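(* Let $n\ge 3$ be an integer and let $K\subset\mathbb{R}^n$ be an origin-symmetric star body whose radial function $\rho_K:S^{n-1}\to(0,\infty)$ is $C^\infty$. For $\xi\in S^{n-1}$ and $t\in\mathbb{R}$ let $A_\xi(t)=\mathrm{Vol}_{n-1}\bigl(K\cap(t\xi+\xi^\perp)\bigr)$, let $A_\xi^{(j)}$ denote the $j$-th derivative of $t\mapsto A_\xi(t)$, and let $R$ denote the spherical Radon transform on $S^{n-1}$. Then the following identities of functions on $S^{n-1}$ hold. If $n$ is even, then $$(-1)^{\frac{n-2}{2}}\,2^n\,\pi^{n-2}\,\rho_K = R\left(\xi\mapsto A_\xi^{(n-2)}(0)\right).$$ If $n$ is odd, then $$\frac{(-1)^{\frac{n-1}{2}}(2\pi)^{n-1}}{(n-2)!}\,\rho_K = R\left(\xi\mapsto \int_0^\infty t^{-n+1}\Bigl(A_\xi(t)-\sum_{k=0}^{\frac{n-3}{2}}A_\xi^{(2k)}(0)\,\frac{t^{2k}}{(2k)!}\Bigr)\,dt\right).$$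
   Context: $\mathbb{R}^n$ carries its standard scalar product $\langle\cdot,\cdot\rangle$ and Euclidean norm, $S^{n-1}$ is the Euclidean unit sphere, and $\xi^\perp=\{x\in\mathbb{R}^n:\langle x,\xi\rangle=0\}$. $\mathrm{Vol}_{n-1}$ is $(n-1)$-dimensional Lebesgue measure on affine hyperplanes. A star body $K\subset\mathbb{R}^n$ is a compact set, star-shaped with respect to the origin and with the origin in its interior, whose radial function $\rho_K(x)=\sup\{\lambda>0:\lambda x\in K\}$, $x\in S^{n-1}$, is (positive and) continuous; thus $K=\{rx: x\in S^{n-1},\,0\le r\le\rho_K(x)\}$. It is origin-symmetric if $K=-K$. The spherical Radon transform $R$ acts on continuous functions $f$ on $S^{n-1}$ by $$Rf(\xi)=\int_{S^{n-1}\cap\xi^\perp}f(u)\,d\sigma_{n-2}(u),\qquad \xi\in S^{n-1},$$ where $\sigma_{n-2}$ is the rotation-invariant (Haar) measure on the great subsphere $S^{n-1}\cap\xi^\perp$ with total mass $s_{n-2}$, the (unnormalized) $(n-2)$-dimensional surface measure of the unit sphere $S^{n-2}\subset\mathbb{R}^{n-1}$, i.e. $s_{n-2}=2\pi^{(n-1)/2}/\Gamma((n-1)/2)$. *)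

theory Defs
  imports "HOL-Analysis.Analysis"
begin

section \<open>Star bodies\<close>

definition radial_function :: "'a::euclidean_space set \<Rightarrow> 'a \<Rightarrow> real" where
  "radial_function K x = Sup {l. 0 < l \<and> l *\<^sub>R x \<in> K}"

definition star_body :: "'a::euclidean_space set \<Rightarrow> bool" where
  "star_body K \<longleftrightarrow>
     compact K \<and> (\<forall>x\<in>K. closed_segment 0 x \<subseteq> K) \<and> 0 \<in> interior K \<and>
     (\<forall>x\<in>sphere 0 1. 0 < radial_function K x) \<and>
     continuous_on (sphere 0 1) (radial_function K)"

definition origin_symmetric :: "'a::euclidean_space set \<Rightarrow> bool" where
  "origin_symmetric K \<longleftrightarrow> uminus ` K = K"


section \<open>Smooth functions\<close>

text \<open>The following two notions are meant for open sets \<open>U\<close>.\<close>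

primrec Ck_on :: "nat \<Rightarrow> ('a::euclidean_space \<Rightarrow> real) \<Rightarrow> 'a set \<Rightarrow> bool" where
  "Ck_on 0 f U \<longleftrightarrow> continuous_on U f"
| "Ck_on (Suc k) f U \<longleftrightarrow>
     f differentiable_on U \<and> (\<forall>v. Ck_on k (\<lambda>x. frechet_derivative f (at x) v) U)"

definition Cinf_on :: "('a::euclidean_space \<Rightarrow> real) \<Rightarrow> 'a set \<Rightarrow> bool" where
  "Cinf_on f U \<longleftrightarrow> (\<forall>k. Ck_on k f U)"

text \<open>Smoothness on a submanifold \<open>S\<close> of Euclidean space: local existence of smooth extensions.
  Only the values of \<open>f\<close> on \<open>S\<close> matter.\<close>

definition smooth_on_submanifold :: "('a::euclidean_space \<Rightarrow> real) \<Rightarrow> 'a set \<Rightarrow> bool" where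
  "smooth_on_submanifold f S \<longleftrightarrow>
     (\<forall>x\<in>S. \<exists>U g. open U \<and> x \<in> U \<and> Cinf_on g U \<and> (\<forall>y\<in>U \<inter> S. g y = f y))"


section \<open>Hyperplane sections\<close>

definition perp :: "'a::euclidean_space \<Rightarrow> 'a set" where
  "perp \<xi> = {x. x \<bullet> \<xi> = 0}"

definition orthonormal_basis_of :: "'a::euclidean_space set \<Rightarrow> 'a set \<Rightarrow> bool" where
  "orthonormal_basis_of V B \<longleftrightarrow>
     B \<subseteq> V \<and> pairwise orthogonal B \<and> (\<forall>b\<in>B. norm b = 1) \<and> span B = V"

text \<open>Lebesgue measure (on Borel sets) of the affine subspace \<open>a + V\<close>, where \<open>V\<close> is a linear
  subspace: the image of the product measure \<open>\<real>\<^sup>B\<close> under the isometric parametrisation given by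
  an orthonormal basis \<open>B\<close> of \<open>V\<close>, just as \<^const>\<open>lborel\<close> is defined from \<^const>\<open>Basis\<close>.
  It does not depend on the choice of \<open>B\<close>, and the complement of \<open>a + V\<close> is a null set.\<close>

definition affine_lborel :: "'a::euclidean_space \<Rightarrow> 'a set \<Rightarrow> 'a measure" where
  "affine_lborel a V =
     (let B = (SOME B. orthonormal_basis_of V B)
      in distr (\<Pi>\<^sub>M b\<in>B. lborel) borel (\<lambda>c. a + (\<Sum>b\<in>B. c b *\<^sub>R b)))"

definition section_volume :: "'a::euclidean_space set \<Rightarrow> 'a \<Rightarrow> real \<Rightarrow> real" where
  "section_volume K \<xi> t =
     measure (affine_lborel (t *\<^sub>R \<xi>) (perp \<xi>)) (K \<inter> (+) (t *\<^sub>R \<xi>) ` perp \<xi>)"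


section \<open>Spherical Radon transform\<close>

text \<open>For a unit vector \<open>\<xi>\<close>, the orthogonal maps fixing \<open>\<xi>\<close> restrict to exactly the orthogonal
  group of \<open>perp \<xi>\<close>. Since that group acts transitively on the great subsphere, the
  invariant Borel measure of the prescribed total mass exists and is unique.\<close>

definition great_subsphere :: "'a::euclidean_space \<Rightarrow> 'a set" where
  "great_subsphere \<xi> = sphere 0 1 \<inter> perp \<xi>"

definition is_subsphere_measure :: "'a::euclidean_space \<Rightarrow> 'a measure \<Rightarrow> bool" where
  "is_subsphere_measure \<xi> \<mu> \<longleftrightarrow>
     sets \<mu> = sets (restrict_space borel (great_subsphere \<xi>)) \<and>
     (\<forall>T. orthogonal_transformation T \<and> T \<xi> = \<xi> \<longrightarrow> distr \<mu> \<mu> T = \<mu>) \<and>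
     emeasure \<mu> (space \<mu>) =
       ennreal (2 * pi powr ((real DIM('a) - 1) / 2) / Gamma ((real DIM('a) - 1) / 2))"

definition subsphere_measure :: "'a::euclidean_space \<Rightarrow> 'a measure" where
  "subsphere_measure \<xi> = (THE \<mu>. is_subsphere_measure \<xi> \<mu>)"

definition spherical_radon :: "('a::euclidean_space \<Rightarrow> real) \<Rightarrow> 'a \<Rightarrow> real" where
  "spherical_radon f \<xi> = (\<integral>u. f u \<partial>subsphere_measure \<xi>)"

end

(* Idea.  Fix a unit vector theta and compare K with the ball B of radius rho_K(theta).
   Averaging A_xi over xi in theta^perp, with Gaussian weights on theta^perp, turns by Fubini into an
   integral over K of |y|^(-1) w(t/|y|), where y is the projection of x to theta^perp.  The weight used is
   exp(-r^2) - exp(-4 r^2): its two Gaussians are rescalings of each other, and at the homogeneity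
   degree that matters here their contributions to the Taylor coefficient (n even) or to the regularised
   moment (n odd) cancel, so that only the integral of (1_K - 1_B) |y|^(1-n) could still be felt.
   That integral converges because rho_K is Lipschitz near theta, so K and B give the same average.  For the ball
   A_xi does not depend on xi and everything is explicit.  Smoothness of A_xi at 0, locally uniformly
   in xi, comes from a smooth change of the polar angle in the meridian planes through xi. *)

theory Submission
  imports Defs "HOL-Probability.Probability"
begin

section \<open>Translation-invariant measures\<close>

text \<open>The obstacle is the exponent 1 - n. With r = |eta| and xi = eta/r, the expansion of
  A_xi(t/r)/r puts r^(1-n) in front of the coefficient of t^(n-2), and this power only just fails to
  be integrable at 0 in a hyperplane of dimension n - 1. On the body side the same order of t
  produces |y|^(1-n), which only just fails to be integrable along the axis of
  \<open>\<theta>\<close>. The first defect is cured because the difference of the two Gaussians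
  vanishes to second order at 0, the second because the ball is subtracted. The factor 4 is the
  square of the dilation factor 2; any other dilation would cancel in the same way. Gaussians are
  chosen because their one-dimensional marginals are Gaussian again, so the law of the pairing of x
  with eta is explicit on both sides. A law determines its density only almost everywhere in t.
  Hence Taylor coefficients are compared along a sequence of good values of t tending to 0, and
  moments by integration, where null sets do not matter.\<close>

lemma translation_invariant_eq_lborel:
  fixes M :: "'a::euclidean_space measure"
  assumes sf: "sigma_finite_measure M" and sets[measurable_cong]: "sets M = sets borel"
    and inv: "\<And>v. distr M borel ((+) v) = M"
    and ball: "emeasure M (cball 0 1) = emeasure lborel (cball (0::'a) 1)"
  shows "M = lborel"
proof (rule measure_eqI)
  interpret pair_sigma_finite lborel M
    using sf by (simp add: pair_sigma_finite_def sigma_finite_lborel)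
  have sp: "space M = UNIV" using sets_eq_imp_space_eq[OF sets] by simp
  have shift: "(\<integral>\<^sup>+x. F (x + v) \<partial>M) = (\<integral>\<^sup>+x. F x \<partial>M)" if [measurable]: "F \<in> borel_measurable borel" for F v
  proof -
    have "(\<integral>\<^sup>+x. F x \<partial>M) = (\<integral>\<^sup>+x. F x \<partial>distr M borel ((+) v))" by (simp add: inv)
    also have "\<dots> = (\<integral>\<^sup>+x. F (x + v) \<partial>M)"
      by (subst nn_integral_distr) (simp_all add: add.commute)
    finally show ?thesis by simp
  qed
  have shiftL: "(\<integral>\<^sup>+x. F (x + v) \<partial>lborel) = (\<integral>\<^sup>+x. F x \<partial>lborel)" if [measurable]: "F \<in> borel_measurable borel" for F and v::'a
  proof -
    have "(\<integral>\<^sup>+x. F x \<partial>lborel) = (\<integral>\<^sup>+x. F x \<partial>distr lborel borel ((+) v))" by (simp add: lborel_distr_plus)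
    also have "\<dots> = (\<integral>\<^sup>+x. F (x + v) \<partial>lborel)"
      by (subst nn_integral_distr) (simp_all add: add.commute)
    finally show ?thesis by simp
  qed
  have refl: "(\<integral>\<^sup>+x. F (- x) \<partial>lborel) = (\<integral>\<^sup>+x. F (x::'a) \<partial>lborel)" if [measurable]: "F \<in> borel_measurable borel" for F
  proof -
    have e: "lborel = distr lborel borel (\<lambda>x::'a. - x)"
      using lborel_affine[of "-1" "0::'a"] by (simp add: density_1)
    have "(\<integral>\<^sup>+x. F x \<partial>lborel) = (\<integral>\<^sup>+x. F x \<partial>distr lborel borel (\<lambda>x::'a. - x))" using e by simp
    also have "\<dots> = (\<integral>\<^sup>+x. F (- x) \<partial>lborel)"
      by (subst nn_integral_distr) simp_all
    finally show ?thesis by simp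
  qed
  \<comment> \<open>Uniqueness of Haar measure: shifting y by x under \<open>lborel\<close>, then x
    by - y under M, then reflecting and shifting y, exchanges the roles of the two measures. Applied
    below with g the indicator of the unit ball, it expresses M through
    \<open>lborel\<close>.\<close>
  have key: "(\<integral>\<^sup>+x. f x \<partial>M) * (\<integral>\<^sup>+x. g x \<partial>lborel) = (\<integral>\<^sup>+x. g x \<partial>M) * (\<integral>\<^sup>+x. f x \<partial>lborel)"
    if [measurable]: "f \<in> borel_measurable borel" "g \<in> borel_measurable borel" for f g :: "'a \<Rightarrow> ennreal"
  proof -
    have "(\<integral>\<^sup>+x. f x \<partial>M) * (\<integral>\<^sup>+x. g x \<partial>lborel) = (\<integral>\<^sup>+x. \<integral>\<^sup>+y. f x * g y \<partial>lborel \<partial>M)"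
      by (simp add: nn_integral_cmult nn_integral_multc)
    also have "\<dots> = (\<integral>\<^sup>+x. \<integral>\<^sup>+y. f x * g (y + x) \<partial>lborel \<partial>M)"
      by (rule nn_integral_cong, rule shiftL[where F = "\<lambda>y. f _ * g y", symmetric]) simp
    also have "\<dots> = (\<integral>\<^sup>+y. \<integral>\<^sup>+x. f x * g (x + y) \<partial>M \<partial>lborel)"
      by (subst Fubini') (simp_all add: add.commute)
    also have "\<dots> = (\<integral>\<^sup>+y. \<integral>\<^sup>+x. f ((x + y) + - y) * g (x + y) \<partial>M \<partial>lborel)" by simp
    also have "\<dots> = (\<integral>\<^sup>+y. \<integral>\<^sup>+x. f (x + - y) * g x \<partial>M \<partial>lborel)"
      by (rule nn_integral_cong, rule shift[where F = "\<lambda>x. f (x + - _) * g x"]) simp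
    also have "\<dots> = (\<integral>\<^sup>+x. \<integral>\<^sup>+y. f (x + - y) * g x \<partial>lborel \<partial>M)"
      by (subst Fubini') simp_all
    also have "\<dots> = (\<integral>\<^sup>+x. \<integral>\<^sup>+y. f (x + y) * g x \<partial>lborel \<partial>M)"
      by (rule nn_integral_cong, rule refl[where F = "\<lambda>y. f (_ + y) * g _"]) simp
    also have "\<dots> = (\<integral>\<^sup>+x. \<integral>\<^sup>+y. f y * g x \<partial>lborel \<partial>M)"
      by (rule nn_integral_cong)
        (use shiftL[where F = "\<lambda>y. f y * g _"] in \<open>simp add: add.commute\<close>)
    also have "\<dots> = (\<integral>\<^sup>+x. g x \<partial>M) * (\<integral>\<^sup>+x. f x \<partial>lborel)"
      by (simp add: nn_integral_cmult nn_integral_multc mult.commute)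
    finally show ?thesis .
  qed
  fix A assume "A \<in> sets M"
  then have [measurable]: "A \<in> sets borel" by (simp add: sets)
  let ?c = "emeasure lborel (cball (0::'a) 1)"
  have "emeasure M A * ?c = emeasure M (cball 0 1) * emeasure lborel A"
    using key[of "indicator A" "indicator (cball 0 1)"] by (simp add: sets borel_measurable_indicator)
  also have "\<dots> = emeasure lborel A * ?c" by (simp add: ball mult.commute)
  finally have e: "emeasure M A * ?c = emeasure lborel A * ?c" .
  have "?c \<noteq> 0" "?c \<noteq> \<top>"
    using emeasure_cball[of 1 "0::'a"] unit_ball_vol_pos[of "real DIM('a)"] by (auto simp del: unit_ball_vol_pos)
  then show "emeasure M A = emeasure lborel A"
    using e by (metis ennreal_mult_divide_eq)
qed (simp add: sets)

lemma distr_lborel_orthogonal_transformation: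
  fixes T :: "'a::euclidean_space \<Rightarrow> 'a"
  assumes T: "orthogonal_transformation T"
  shows "distr lborel borel T = lborel"
proof -
  obtain T' where T': "orthogonal_transformation T'" and TT': "\<And>x. T (T' x) = x" "\<And>x. T' (T x) = x"
    using orthogonal_transformation_inv[OF T] orthogonal_transformation_bij[OF T]
    by (metis bij_inv_eq_iff)
  have lin: "linear T" using T by (rule orthogonal_transformation_linear)
  have [measurable]: "T \<in> borel_measurable borel" "T' \<in> borel_measurable borel"
    using T T' by (auto intro!: borel_measurable_continuous_onI linear_continuous_on
        simp: linear_conv_bounded_linear[symmetric] orthogonal_transformation_linear)
  have ball: "T -` cball 0 r = cball 0 r" for r
    using orthogonal_transformation_norm[OF T] by auto
  show ?thesis
  proof (rule translation_invariant_eq_lborel)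
    show "distr (distr lborel borel T) borel ((+) v) = distr lborel borel T" for v
    proof -
      have "distr (distr lborel borel T) borel ((+) v) = distr (distr lborel borel ((+) (T' v))) borel T"
        by (simp add: distr_distr comp_def linear_add[OF lin] TT')
      then show ?thesis by (simp add: lborel_distr_plus)
    qed
    show "emeasure (distr lborel borel T) (cball 0 1) = emeasure lborel (cball (0::'a) 1)"
      by (simp add: emeasure_distr ball)
    show "sigma_finite_measure (distr lborel borel T)"
    proof
      show "\<exists>A. countable A \<and> A \<subseteq> sets (distr lborel borel T) \<and> \<Union> A = space (distr lborel borel T)
        \<and> (\<forall>a\<in>A. emeasure (distr lborel borel T) a \<noteq> \<infinity>)"
        by (intro exI[of _ "range (\<lambda>i::nat. cball 0 (real i))"])
          (auto simp: emeasure_distr ball emeasure_cball real_arch_simple)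
    qed
  qed simp
qed

lemma distr_PiM_lborel_translate:
  assumes "finite I"
  shows "distr (PiM I (\<lambda>_. lborel :: real measure)) (PiM I (\<lambda>_. lborel)) (\<lambda>c. \<lambda>i\<in>I. v i + c i) = PiM I (\<lambda>_. lborel)"
proof -
  interpret product_sigma_finite "\<lambda>_::'a. lborel :: real measure" by standard
  show ?thesis
  proof (rule PiM_eqI[OF assms])
    fix A :: "'a \<Rightarrow> real set" assume A: "\<And>i. i \<in> I \<Longrightarrow> A i \<in> sets lborel"
    have pre: "(\<lambda>c. \<lambda>i\<in>I. v i + c i) -` Pi\<^sub>E I A \<inter> space (PiM I (\<lambda>_. lborel)) =
      Pi\<^sub>E I (\<lambda>i. (+) (v i) -` A i)"
      by (auto simp: space_PiM PiE_iff)
    have e: "emeasure lborel ((+) (v i) -` A i) = emeasure lborel (A i)" if "i \<in> I" for i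
    proof -
      have "emeasure lborel (A i) = emeasure (distr lborel borel ((+) (v i))) (A i)"
        by (simp add: lborel_distr_plus)
      also have "\<dots> = emeasure lborel ((+) (v i) -` A i)"
        using A[OF that] by (subst emeasure_distr) simp_all
      finally show ?thesis by simp
    qed
    have "(+) (v i) -` A i \<in> sets lborel" if "i \<in> I" for i
    proof -
      have "(+) (v i) -` A i \<inter> space lborel \<in> sets lborel"
        by (rule measurable_sets[of _ _ borel]) (use A[OF that] in simp_all)
      then show ?thesis by simp
    qed
    then show "emeasure (distr (PiM I (\<lambda>_. lborel)) (PiM I (\<lambda>_. lborel)) (\<lambda>c. \<lambda>i\<in>I. v i + c i)) (Pi\<^sub>E I A) =
      (\<Prod>i\<in>I. emeasure lborel (A i))"
      using assms A by (subst emeasure_distr) (simp_all add: pre emeasure_PiM e)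
  qed simp
qed

text \<open>Makes Lebesgue measure independent of the orthonormal basis. The parametrisation is an
  isometry from the coordinate norm, so the unit ball keeps its volume, and a translation of the
  space is a translation of the coordinates.\<close>

lemma distr_PiM_orthonormal_basis:
  fixes B :: "'a::euclidean_space set"
  assumes B: "orthonormal_basis_of UNIV B" and fin: "finite B"
  shows "distr (PiM B (\<lambda>_. lborel)) borel (\<lambda>c. \<Sum>b\<in>B. c b *\<^sub>R b) = lborel" (is "distr ?P _ ?f = _")
proof -
  have orth: "b \<bullet> b' = (if b = b' then 1 else 0)" if "b \<in> B" "b' \<in> B" for b b'
    using B that unfolding orthonormal_basis_of_def pairwise_def orthogonal_def
    by (auto simp: norm_eq_1)
  have indep: "independent B"
    using B pairwise_orthogonal_independent[of B] unfolding orthonormal_basis_of_def by fastforce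
  have card: "card B = DIM('a)"
    using B indep unfolding orthonormal_basis_of_def by (metis dim_UNIV dim_eq_card_independent dim_span)
  have nrm: "norm (?f c) = sqrt (\<Sum>b\<in>B. (c b)\<^sup>2)" for c
  proof -
    have "(norm (?f c))\<^sup>2 = (\<Sum>b\<in>B. (c b)\<^sup>2)"
      by (simp only: power2_norm_eq_inner)
        (simp add: inner_sum_left inner_sum_right orth fin if_distrib[of "\<lambda>x. _ * x"] sum.If_cases power2_eq_square
          cong: if_cong sum.cong)
    then show ?thesis by (metis norm_ge_zero real_sqrt_unique)
  qed
  have [measurable]: "?f \<in> borel_measurable ?P" by simp
  have ball: "emeasure (distr ?P borel ?f) (cball 0 r) = ennreal (unit_ball_vol (real DIM('a)) * r ^ DIM('a))" if "0 < r" for r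
  proof -
    have "?f -` cball 0 r \<inter> space ?P = {c. sqrt (\<Sum>b\<in>B. (c b)\<^sup>2) \<le> r} \<inter> space ?P"
      by (auto simp: nrm)
    then show ?thesis
      using emeasure_cball_aux[OF fin that] card by (subst emeasure_distr) simp_all
  qed
  show ?thesis
  proof (rule translation_invariant_eq_lborel)
    show "emeasure (distr ?P borel ?f) (cball 0 1) = emeasure lborel (cball (0::'a) 1)"
      by (simp add: ball emeasure_cball)
    show "sigma_finite_measure (distr ?P borel ?f)"
    proof
      \<comment> \<open>The radii are \<open>Suc i\<close> because the volume formula
        \<open>ball\<close> is for positive radii.\<close>
      have "\<exists>i::nat. norm x \<le> real (Suc i)" for x :: 'a
        by (meson linear order_trans real_arch_simple of_nat_le_iff le_SucI order_refl)
      then show "\<exists>A. countable A \<and> A \<subseteq> sets (distr ?P borel ?f) \<and> \<Union> A = space (distr ?P borel ?f)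
        \<and> (\<forall>a\<in>A. emeasure (distr ?P borel ?f) a \<noteq> \<infinity>)"
        by (intro exI[of _ "range (\<lambda>i::nat. cball 0 (real (Suc i)))"]) (auto simp: ball simp del: of_nat_Suc)
    qed
    show "distr (distr ?P borel ?f) borel ((+) v) = distr ?P borel ?f" for v
    proof -
      have "v \<in> span B" using B by (simp add: orthonormal_basis_of_def)
      then obtain w where w: "v = (\<Sum>b\<in>B. w b *\<^sub>R b)"
        using span_finite[OF fin] by auto
      have "distr (distr ?P borel ?f) borel ((+) v) = distr ?P borel (\<lambda>c. v + ?f c)"
        by (simp add: distr_distr comp_def)
      also have "\<dots> = distr ?P borel (\<lambda>c. ?f (\<lambda>i\<in>B. w i + c i))"
        by (simp add: w sum.distrib scaleR_add_left)
      also have "\<dots> = distr (distr ?P ?P (\<lambda>c. \<lambda>i\<in>B. w i + c i)) borel ?f"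
        by (subst distr_distr) (simp_all add: comp_def)
      finally show ?thesis by (simp add: distr_PiM_lborel_translate[OF fin])
    qed
  qed simp
qed

section \<open>Lebesgue measure on hyperplanes\<close>

abbreviation perp_lborel :: "'a::euclidean_space \<Rightarrow> 'a measure" where
  "perp_lborel \<xi> \<equiv> affine_lborel 0 (perp \<xi>)"

definition perp_proj :: "'a::euclidean_space \<Rightarrow> 'a \<Rightarrow> 'a" where
  "perp_proj \<xi> x = x - (x \<bullet> \<xi>) *\<^sub>R \<xi>"

lemma measurable_perp_proj[measurable]: "perp_proj \<xi> \<in> borel_measurable borel"
  unfolding perp_proj_def by simp

lemma perp_proj_in_perp: "norm \<xi> = 1 \<Longrightarrow> perp_proj \<xi> x \<in> perp \<xi>"
  by (simp add: perp_proj_def perp_def inner_diff_left norm_eq_1)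

lemma sets_affine_lborel[simp, measurable_cong]: "sets (affine_lborel a V) = sets borel"
  by (simp add: affine_lborel_def Let_def)

lemma space_affine_lborel[simp]: "space (affine_lborel a V) = UNIV"
  by (simp add: affine_lborel_def Let_def)

text \<open>Exposes the basis behind \<open>SOME\<close> in \<open>affine_lborel\<close>. One basis
  serves every base point a, and adjoining \<open>\<xi>\<close> completes it to an orthonormal basis
  of the whole space, which makes the hyperplane measure a factor of \<open>lborel\<close>.\<close>

lemma perp_lborel_basis:
  fixes \<xi> :: "'a::euclidean_space"
  assumes \<xi>: "norm \<xi> = 1"
  obtains B where "finite B" "card B = DIM('a) - 1" "\<xi> \<notin> B" "B \<subseteq> perp \<xi>"
    "orthonormal_basis_of UNIV (insert \<xi> B)"
    "\<And>a. affine_lborel a (perp \<xi>) = distr (PiM B (\<lambda>_. lborel)) borel (\<lambda>c. a + (\<Sum>b\<in>B. c b *\<^sub>R b))"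
proof -
  define B where "B = (SOME B. orthonormal_basis_of (perp \<xi>) B)"
  have sub: "subspace (perp \<xi>)"
    unfolding perp_def subspace_def by (auto simp: inner_add_left)
  have "\<exists>B. orthonormal_basis_of (perp \<xi>) B"
    using orthonormal_basis_subspace[OF sub] unfolding orthonormal_basis_of_def by metis
  then have B: "orthonormal_basis_of (perp \<xi>) B"
    unfolding B_def by (rule someI_ex)
  have B1: "B \<subseteq> perp \<xi>" and nB: "\<And>b. b \<in> B \<Longrightarrow> norm b = 1" and oB: "pairwise orthogonal B" and sB: "span B = perp \<xi>"
    using B by (auto simp: orthonormal_basis_of_def)
  have \<xi>B: "\<xi> \<notin> B" using B1 \<xi> by (auto simp: perp_def norm_eq_1)
  have o': "pairwise orthogonal (insert \<xi> B)"
    using oB B1 by (auto simp: pairwise_insert perp_def orthogonal_def inner_commute)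
  have indep: "independent (insert \<xi> B)"
    using o' nB \<xi> by (intro pairwise_orthogonal_independent) (auto dest: nB)
  then have fin: "finite B" using finiteI_independent by fastforce
  have "x \<in> span (insert \<xi> B)" for x
  proof -
    have "perp_proj \<xi> x \<in> span (insert \<xi> B)"
      using perp_proj_in_perp[OF \<xi>, of x] sB span_mono[of B "insert \<xi> B"] by blast
    then have "perp_proj \<xi> x + (x \<bullet> \<xi>) *\<^sub>R \<xi> \<in> span (insert \<xi> B)"
      by (rule span_add[OF _ span_scale[OF span_base]]) simp
    then show ?thesis by (simp add: perp_proj_def)
  qed
  then have sp: "span (insert \<xi> B) = UNIV" by auto
  have "card (insert \<xi> B) = DIM('a)"
    using indep sp by (metis dim_UNIV dim_eq_card_independent dim_span)
  then have card: "card B = DIM('a) - 1" using fin \<xi>B by simp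
  show ?thesis
  proof (rule that[OF fin card \<xi>B B1])
    show "orthonormal_basis_of UNIV (insert \<xi> B)"
      using o' nB \<xi> sp by (auto simp: orthonormal_basis_of_def)
  qed (simp add: affine_lborel_def B_def Let_def)
qed

lemma nn_integral_lborel_perp:
  fixes \<xi> :: "'a::euclidean_space"
  assumes \<xi>: "norm \<xi> = 1" and [measurable]: "F \<in> borel_measurable borel"
  shows "(\<integral>\<^sup>+x. F x \<partial>lborel) = (\<integral>\<^sup>+s. \<integral>\<^sup>+y. F (s *\<^sub>R \<xi> + y) \<partial>perp_lborel \<xi> \<partial>lborel)"
proof -
  obtain B where B: "finite B" "\<xi> \<notin> B" "orthonormal_basis_of UNIV (insert \<xi> B)"
    "perp_lborel \<xi> = distr (PiM B (\<lambda>_. lborel)) borel (\<lambda>c. \<Sum>b\<in>B. c b *\<^sub>R b)"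
    by (rule perp_lborel_basis[OF \<xi>]) simp
  interpret product_sigma_finite "\<lambda>_::'a. lborel :: real measure" by standard
  have "(\<integral>\<^sup>+x. F x \<partial>lborel) = (\<integral>\<^sup>+c. F (\<Sum>b\<in>insert \<xi> B. c b *\<^sub>R b) \<partial>PiM (insert \<xi> B) (\<lambda>_. lborel))"
    using B(1) by (subst distr_PiM_orthonormal_basis[OF B(3), symmetric], simp, subst nn_integral_distr) simp_all
  also have "\<dots> = (\<integral>\<^sup>+s. \<integral>\<^sup>+c. F (\<Sum>b\<in>insert \<xi> B. (c(\<xi> := s)) b *\<^sub>R b) \<partial>PiM B (\<lambda>_. lborel) \<partial>lborel)"
    using B by (subst product_nn_integral_insert_rev) simp_all
  also have "\<dots> = (\<integral>\<^sup>+s. \<integral>\<^sup>+c. F (s *\<^sub>R \<xi> + (\<Sum>b\<in>B. c b *\<^sub>R b)) \<partial>PiM B (\<lambda>_. lborel) \<partial>lborel)"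
  proof -
    have "(\<Sum>b\<in>B. (if b = \<xi> then s else c b) *\<^sub>R b) = (\<Sum>b\<in>B. c b *\<^sub>R b)" for s and c :: "'a \<Rightarrow> real"
      using B(2) by (intro sum.cong) auto
    then show ?thesis using B by simp
  qed
  also have "\<dots> = (\<integral>\<^sup>+s. \<integral>\<^sup>+y. F (s *\<^sub>R \<xi> + y) \<partial>perp_lborel \<xi> \<partial>lborel)"
    by (simp add: B(4) nn_integral_distr)
  finally show ?thesis .
qed

lemma AE_perp_lborel:
  assumes "norm \<xi> = 1"
  shows "AE y in perp_lborel \<xi>. y \<in> perp \<xi>"
proof -
  obtain B where B: "finite B" "B \<subseteq> perp \<xi>"
    "perp_lborel \<xi> = distr (PiM B (\<lambda>_. lborel)) borel (\<lambda>c. \<Sum>b\<in>B. c b *\<^sub>R b)"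
    by (rule perp_lborel_basis[OF assms]) simp
  have "(\<Sum>b\<in>B. c b *\<^sub>R b) \<bullet> \<xi> = 0" for c
    using B(2) by (auto simp: inner_sum_left perp_def intro!: sum.neutral)
  moreover have "perp \<xi> \<in> sets borel" unfolding perp_def by measurable
  ultimately show ?thesis
    unfolding B(3) by (subst AE_distr_iff) (auto simp: perp_def)
qed

lemma emeasure_perp_lborel_cball:
  fixes \<xi> :: "'a::euclidean_space"
  assumes "norm \<xi> = 1" "0 \<le> r" "2 \<le> DIM('a)"
  shows "emeasure (perp_lborel \<xi>) (cball 0 r) = ennreal (unit_ball_vol (real (DIM('a) - 1)) * r ^ (DIM('a) - 1))"
proof -
  obtain B where B: "finite B" "\<xi> \<notin> B" "orthonormal_basis_of UNIV (insert \<xi> B)" "card B = DIM('a) - 1"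
    "perp_lborel \<xi> = distr (PiM B (\<lambda>_. lborel)) borel (\<lambda>c. \<Sum>b\<in>B. c b *\<^sub>R b)"
    by (rule perp_lborel_basis[OF assms(1)]) simp
  have orth: "b \<bullet> b' = (if b = b' then 1 else 0)" if "b \<in> B" "b' \<in> B" for b b'
    using B(3) that unfolding orthonormal_basis_of_def pairwise_def orthogonal_def
    by (auto simp: norm_eq_1)
  have nrm: "norm (\<Sum>b\<in>B. c b *\<^sub>R b) = sqrt (\<Sum>b\<in>B. (c b)\<^sup>2)" for c
  proof -
    have "(norm (\<Sum>b\<in>B. c b *\<^sub>R b))\<^sup>2 = (\<Sum>b\<in>B. (c b)\<^sup>2)"
      by (simp only: power2_norm_eq_inner)
        (simp add: inner_sum_left inner_sum_right orth B(1) if_distrib[of "\<lambda>x. _ * x"] sum.If_cases power2_eq_square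
          cong: if_cong sum.cong)
    then show ?thesis by (metis norm_ge_zero real_sqrt_unique)
  qed
  have pos: "emeasure (perp_lborel \<xi>) (cball 0 r) = ennreal (unit_ball_vol (real (DIM('a) - 1)) * r ^ (DIM('a) - 1))" if "0 < r" for r
  proof -
    have "(\<lambda>c. \<Sum>b\<in>B. c b *\<^sub>R b) -` cball 0 r \<inter> space (PiM B (\<lambda>_. lborel)) = {c. sqrt (\<Sum>b\<in>B. (c b)\<^sup>2) \<le> r} \<inter> space (PiM B (\<lambda>_. lborel))"
      by (auto simp: nrm)
    then show ?thesis
      using emeasure_cball_aux[OF B(1) that] B(4) unfolding B(5) by (subst emeasure_distr) simp_all
  qed
  show ?thesis
  proof (cases "r = 0")
    \<comment> \<open>The coordinate formula covers positive radii. Radius 0 is the limit of the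
      radii 1/(i+1), and the limiting power of 0 vanishes because the hyperplane has dimension at
      least 1.\<close>
    case True
    have "emeasure (perp_lborel \<xi>) (cball 0 0) \<le> ennreal (unit_ball_vol (real (DIM('a) - 1)) * e ^ (DIM('a) - 1))" if "0 < e" for e
      unfolding pos[OF that, symmetric] using that by (intro emeasure_mono) auto
    then have a: "eventually (\<lambda>i. emeasure (perp_lborel \<xi>) (cball 0 0) \<le> ennreal (unit_ball_vol (real (DIM('a) - 1)) * (1 / real (Suc i)) ^ (DIM('a) - 1))) sequentially"
      by simp
    have "(\<lambda>i. ennreal (unit_ball_vol (real (DIM('a) - 1)) * (1 / real (Suc i)) ^ (DIM('a) - 1))) \<longlonglongrightarrow> ennreal (unit_ball_vol (real (DIM('a) - 1)) * 0 ^ (DIM('a) - 1))"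
      by (intro tendsto_intros LIMSEQ_Suc[OF lim_1_over_n])
    then have "emeasure (perp_lborel \<xi>) (cball 0 0) \<le> ennreal (unit_ball_vol (real (DIM('a) - 1)) * 0 ^ (DIM('a) - 1))"
      by (rule tendsto_lowerbound[OF _ a]) simp
    then show ?thesis using True assms(3) by (simp add: power_0_left split: if_splits)
  qed (use assms pos in auto)
qed

lemma sigma_finite_perp_lborel:
  fixes \<xi> :: "'a::euclidean_space"
  assumes "norm \<xi> = 1" "2 \<le> DIM('a)"
  shows "sigma_finite_measure (perp_lborel \<xi>)"
proof
  show "\<exists>A. countable A \<and> A \<subseteq> sets (perp_lborel \<xi>) \<and> \<Union> A = space (perp_lborel \<xi>)
    \<and> (\<forall>a\<in>A. emeasure (perp_lborel \<xi>) a \<noteq> \<infinity>)"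
    by (intro exI[of _ "range (\<lambda>i::nat. cball 0 (real i))"])
      (auto simp: emeasure_perp_lborel_cball assms real_arch_simple)
qed

lemma nn_integral_gaussian:
  assumes b: "0 < b"
  shows "(\<integral>\<^sup>+s. ennreal (exp (- b * s\<^sup>2)) \<partial>lborel) = ennreal (sqrt (pi / b))"
proof -
  \<comment> \<open>The standard deviation for which the integrand is a multiple of a normal
    density.\<close>
  define \<sigma> where "\<sigma> = sqrt (1 / (2 * b))"
  have \<sigma>: "0 < \<sigma>" "\<sigma>\<^sup>2 = 1 / (2 * b)" using b by (auto simp: \<sigma>_def)
  have e: "exp (- b * s\<^sup>2) = sqrt (pi / b) * normal_density 0 \<sigma> s" for s
    using b by (simp add: normal_density_def \<sigma> field_simps real_sqrt_divide)
  have "(\<integral>\<^sup>+s. ennreal (normal_density 0 \<sigma> s) \<partial>lborel) = 1"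
    using \<sigma>(1) by (subst nn_integral_eq_integral) (auto simp: normal_density_nonneg)
  then show ?thesis
    using b unfolding e by (simp add: ennreal_mult nn_integral_cmult normal_density_nonneg)
qed

lemma nn_integral_gaussian_perp:
  fixes \<xi> :: "'a::euclidean_space"
  assumes "norm \<xi> = 1" "0 < b"
  shows "(\<integral>\<^sup>+y. ennreal (exp (- b * (norm y)\<^sup>2)) \<partial>perp_lborel \<xi>) = ennreal (sqrt (pi / b) ^ (DIM('a) - 1))"
proof -
  obtain B where B: "finite B" "\<xi> \<notin> B" "orthonormal_basis_of UNIV (insert \<xi> B)" "card B = DIM('a) - 1"
    "perp_lborel \<xi> = distr (PiM B (\<lambda>_. lborel)) borel (\<lambda>c. \<Sum>b\<in>B. c b *\<^sub>R b)"
    by (rule perp_lborel_basis[OF assms(1)]) simp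
  interpret product_sigma_finite "\<lambda>_::'a. lborel :: real measure" by standard
  have orth: "b \<bullet> b' = (if b = b' then 1 else 0)" if "b \<in> B" "b' \<in> B" for b b'
    using B(3) that unfolding orthonormal_basis_of_def pairwise_def orthogonal_def
    by (auto simp: norm_eq_1)
  have nrm: "(norm (\<Sum>b\<in>B. c b *\<^sub>R b))\<^sup>2 = (\<Sum>b\<in>B. (c b)\<^sup>2)" for c
    by (simp only: power2_norm_eq_inner)
      (simp add: inner_sum_left inner_sum_right orth B(1) if_distrib[of "\<lambda>x. _ * x"] sum.If_cases power2_eq_square
          cong: if_cong sum.cong)
  have "(\<integral>\<^sup>+y. ennreal (exp (- b * (norm y)\<^sup>2)) \<partial>perp_lborel \<xi>) =
    (\<integral>\<^sup>+c. (\<Prod>i\<in>B. ennreal (exp (- b * (c i)\<^sup>2))) \<partial>PiM B (\<lambda>_. lborel))"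
    unfolding B(5) by (subst nn_integral_distr)
      (simp_all add: nrm sum_distrib_left exp_sum[OF B(1)] prod_ennreal flip: sum_negf)
  also have "\<dots> = (\<Prod>i\<in>B. (\<integral>\<^sup>+s. ennreal (exp (- b * s\<^sup>2)) \<partial>lborel))"
    using B(1) by (subst product_nn_integral_prod) simp_all
  also have "\<dots> = ennreal (sqrt (pi / b) ^ (DIM('a) - 1))"
    using assms(2) by (simp only: nn_integral_gaussian prod_constant B(4)) (simp add: ennreal_power)
  finally show ?thesis .
qed

text \<open>Thickening the hyperplane to a slab trades the measure that depends on
  \<open>\<xi>\<close> for the fixed measure \<open>lborel\<close>. Rotation invariance, scaling and
  measurability in \<open>\<xi>\<close> are all inherited through this formula.\<close>

lemma nn_integral_perp_slab:
  fixes \<xi> :: "'a::euclidean_space"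
  assumes \<xi>: "norm \<xi> = 1" and [measurable]: "F \<in> borel_measurable borel" and a: "0 \<le> a"
  shows "(\<integral>\<^sup>+x. indicator {0..a} (x \<bullet> \<xi>) * F (perp_proj \<xi> x) \<partial>lborel) = ennreal a * (\<integral>\<^sup>+y. F y \<partial>perp_lborel \<xi>)"
proof -
  have "(\<integral>\<^sup>+x. indicator {0..a} (x \<bullet> \<xi>) * F (perp_proj \<xi> x) \<partial>lborel) =
    (\<integral>\<^sup>+s. \<integral>\<^sup>+y. indicator {0..a} ((s *\<^sub>R \<xi> + y) \<bullet> \<xi>) * F (perp_proj \<xi> (s *\<^sub>R \<xi> + y)) \<partial>perp_lborel \<xi> \<partial>lborel)"
    by (rule nn_integral_lborel_perp[OF \<xi>]) simp
  also have "\<dots> = (\<integral>\<^sup>+s. \<integral>\<^sup>+y. indicator {0..a} s * F y \<partial>perp_lborel \<xi> \<partial>lborel)"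
    using AE_perp_lborel[OF \<xi>] \<xi>
    by (intro nn_integral_cong nn_integral_cong_AE) (auto simp: perp_def inner_add_left norm_eq_1 perp_proj_def)
  also have "\<dots> = ennreal a * (\<integral>\<^sup>+y. F y \<partial>perp_lborel \<xi>)"
    using a by (simp add: nn_integral_cmult nn_integral_multc)
  finally show ?thesis .
qed

text \<open>T preserves the slab and commutes with \<open>perp_proj\<close>, so the invariance of
  \<open>lborel\<close> passes to the hyperplane.\<close>

lemma nn_integral_perp_rotate:
  fixes \<xi> :: "'a::euclidean_space"
  assumes \<xi>: "norm \<xi> = 1" and [measurable]: "F \<in> borel_measurable borel" and T: "orthogonal_transformation T" "T \<xi> = \<xi>"
  shows "(\<integral>\<^sup>+y. F (T y) \<partial>perp_lborel \<xi>) = (\<integral>\<^sup>+y. F y \<partial>perp_lborel \<xi>)"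
proof -
  have lin: "linear T" using T by (simp add: orthogonal_transformation_linear)
  have [measurable]: "T \<in> borel_measurable borel"
    using lin by (auto intro!: borel_measurable_continuous_onI linear_continuous_on
        simp: linear_conv_bounded_linear[symmetric])
  have 1: "T x \<bullet> \<xi> = x \<bullet> \<xi>" for x using T by (metis orthogonal_transformation_def)
  have 2: "perp_proj \<xi> (T x) = T (perp_proj \<xi> x)" for x
    by (simp add: perp_proj_def 1 linear_diff[OF lin] linear_cmul[OF lin] T(2))
  have "(\<integral>\<^sup>+y. F y \<partial>perp_lborel \<xi>) = (\<integral>\<^sup>+x. indicator {0..1} (x \<bullet> \<xi>) * F (perp_proj \<xi> x) \<partial>distr lborel borel T)"
    using nn_integral_perp_slab[OF \<xi>, of F 1] by (simp add: distr_lborel_orthogonal_transformation[OF T(1)])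
  also have "\<dots> = (\<integral>\<^sup>+x. indicator {0..1} (x \<bullet> \<xi>) * F (T (perp_proj \<xi> x)) \<partial>lborel)"
    by (subst nn_integral_distr) (simp_all add: 1 2)
  also have "\<dots> = (\<integral>\<^sup>+y. F (T y) \<partial>perp_lborel \<xi>)"
    using nn_integral_perp_slab[OF \<xi>, of "\<lambda>y. F (T y)" 1] by simp
  finally show ?thesis by simp
qed

text \<open>Dilating the whole space by a gives a^n and stretches the slab of thickness 1 to
  thickness a. Cancelling one factor a leaves the exponent of the hyperplane.\<close>

lemma nn_integral_perp_scale:
  fixes \<xi> :: "'a::euclidean_space"
  assumes \<xi>: "norm \<xi> = 1" and [measurable]: "F \<in> borel_measurable borel" and a: "0 < a" and dim: "2 \<le> DIM('a)"
  shows "ennreal (a ^ (DIM('a) - 1)) * (\<integral>\<^sup>+y. F (a *\<^sub>R y) \<partial>perp_lborel \<xi>) = (\<integral>\<^sup>+y. F y \<partial>perp_lborel \<xi>)"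
proof -
  have "ennreal a * (\<integral>\<^sup>+y. F y \<partial>perp_lborel \<xi>) = (\<integral>\<^sup>+x. indicator {0..a} (x \<bullet> \<xi>) * F (perp_proj \<xi> x) \<partial>lborel)"
    using nn_integral_perp_slab[OF \<xi>, of F a] a by simp
  also have "\<dots> = (\<integral>\<^sup>+x. indicator {0..a} (x \<bullet> \<xi>) * F (perp_proj \<xi> x) \<partial>density (distr lborel borel (\<lambda>x. a *\<^sub>R x)) (\<lambda>_. a ^ DIM('a)))"
    using lborel_affine[of a "0::'a"] a by simp
  also have "\<dots> = ennreal (a ^ DIM('a)) * (\<integral>\<^sup>+x. indicator {0..a} (a *\<^sub>R x \<bullet> \<xi>) * F (perp_proj \<xi> (a *\<^sub>R x)) \<partial>lborel)"
    by (simp add: nn_integral_density nn_integral_distr nn_integral_cmult)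
  also have "\<dots> = ennreal (a ^ DIM('a)) * (\<integral>\<^sup>+x. indicator {0..1} (x \<bullet> \<xi>) * F (a *\<^sub>R perp_proj \<xi> x) \<partial>lborel)"
  proof -
    have "indicator {0..a} (a *\<^sub>R x \<bullet> \<xi>) = (indicator {0..1} (x \<bullet> \<xi>) :: ennreal)" for x
      using a by (auto simp: indicator_def zero_le_mult_iff)
    moreover have "perp_proj \<xi> (a *\<^sub>R x) = a *\<^sub>R perp_proj \<xi> x" for x
      by (simp add: perp_proj_def scaleR_diff_right)
    ultimately show ?thesis by simp
  qed
  also have "\<dots> = ennreal (a ^ DIM('a)) * (\<integral>\<^sup>+y. F (a *\<^sub>R y) \<partial>perp_lborel \<xi>)"
    using nn_integral_perp_slab[OF \<xi>, of "\<lambda>y. F (a *\<^sub>R y)" 1] by simp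
  also have "ennreal (a ^ DIM('a)) = ennreal a * ennreal (a ^ (DIM('a) - 1))"
    using a dim by (subst ennreal_mult[symmetric]) (auto simp flip: power_Suc)
  finally have e: "ennreal a * (\<integral>\<^sup>+y. F y \<partial>perp_lborel \<xi>) =
     ennreal a * (ennreal (a ^ (DIM('a) - 1)) * (\<integral>\<^sup>+y. F (a *\<^sub>R y) \<partial>perp_lborel \<xi>))" by (simp add: mult.assoc)
  have "ennreal a \<noteq> 0" "ennreal a \<noteq> \<top>" using a by auto
  with e show ?thesis by (simp add: ennreal_mult_cancel_left)
qed

lemma section_volume_eq:
  assumes \<xi>: "norm \<xi> = 1" and [measurable]: "K \<in> sets borel"
  shows "section_volume K \<xi> t = measure (perp_lborel \<xi>) {y. t *\<^sub>R \<xi> + y \<in> K}"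
proof -
  obtain B where B: "finite B"
    "\<And>a. affine_lborel a (perp \<xi>) = distr (PiM B (\<lambda>_. lborel)) borel (\<lambda>c. a + (\<Sum>b\<in>B. c b *\<^sub>R b))"
    by (rule perp_lborel_basis[OF \<xi>]) blast
  have e: "affine_lborel (t *\<^sub>R \<xi>) (perp \<xi>) = distr (perp_lborel \<xi>) borel ((+) (t *\<^sub>R \<xi>))"
    unfolding B(2) by (subst distr_distr) (simp_all add: comp_def)
  have im: "(+) (t *\<^sub>R \<xi>) ` perp \<xi> = {x. x - t *\<^sub>R \<xi> \<in> perp \<xi>}"
    by (auto simp: image_iff intro: exI[of _ "_ - _"]) (metis add.commute diff_add_cancel)
  have [measurable]: "perp \<xi> \<in> sets borel" unfolding perp_def by measurable
  have "section_volume K \<xi> t = measure (perp_lborel \<xi>) {y. t *\<^sub>R \<xi> + y \<in> K \<and> y \<in> perp \<xi>}"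
    unfolding section_volume_def e im by (subst measure_distr) (auto simp: vimage_def)
  also have "\<dots> = measure (perp_lborel \<xi>) {y. t *\<^sub>R \<xi> + y \<in> K}"
  proof (rule measure_eq_AE)
    show "AE y in perp_lborel \<xi>. (y \<in> {y. t *\<^sub>R \<xi> + y \<in> K \<and> y \<in> perp \<xi>}) = (y \<in> {y. t *\<^sub>R \<xi> + y \<in> K})"
      using AE_perp_lborel[OF \<xi>] by auto
  qed measurable
  finally show ?thesis .
qed

section \<open>The invariant measure on a great subsphere\<close>

text \<open>Christensen's argument for measures whose balls of equal radius around points of S are
  equally heavy. Integrating the indicator of the pairs with x in F and |x - y| < e in both orders
  gives M(F) times the N-mass of a ball on one side, and at most the N-mass of the e-neighbourhood
  of F times the M-mass of a ball on the other.\<close>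

lemma uniformly_distributed_le:
  fixes M N :: "'a::euclidean_space measure"
  assumes fin: "finite_measure M" "finite_measure N"
    and sets[measurable_cong]: "sets M = sets borel" "sets N = sets borel"
    and S: "compact S" "emeasure M (- S) = 0" "emeasure N (- S) = 0"
    and uniM: "\<And>x y e. x \<in> S \<Longrightarrow> y \<in> S \<Longrightarrow> 0 < e \<Longrightarrow> emeasure M (ball x e) = emeasure M (ball y e)"
    and uniN: "\<And>x y e. x \<in> S \<Longrightarrow> y \<in> S \<Longrightarrow> 0 < e \<Longrightarrow> emeasure N (ball x e) = emeasure N (ball y e)"
    and mass: "emeasure M UNIV = emeasure N UNIV"
    and F: "closed F"
  shows "emeasure M F \<le> emeasure N F"
proof (cases "emeasure M UNIV = 0 \<or> F = {}")
  \<comment> \<open>The empty set is split off because \<open>infdist\<close> to it is 0 by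
    convention, so its neighbourhoods below would be the whole space.\<close>
  case True
  then show ?thesis using emeasure_mono[of F UNIV M] sets by auto
next
  case False
  interpret M: finite_measure M by fact
  interpret N: finite_measure N by fact
  interpret pair_sigma_finite M N
    by (simp add: pair_sigma_finite_def M.sigma_finite_measure_axioms N.sigma_finite_measure_axioms)
  have [measurable]: "S \<in> sets borel" "F \<in> sets borel" using S(1) F by (auto simp: compact_imp_closed)
  have aeM: "AE x in M. x \<in> S" and aeN: "AE x in N. x \<in> S"
    using S(2,3) by (auto intro!: AE_I[of _ _ "- S"] simp: sets)
  from False obtain x0 where x0: "x0 \<in> S"
    using S(2) by (cases "S = {}") auto
  have step: "emeasure M F \<le> emeasure N {y. infdist y F < e}" if e: "0 < e" for e
  proof -
    let ?g = "emeasure M (ball x0 e)" and ?h = "emeasure N (ball x0 e)"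
    have bN: "(\<integral>\<^sup>+y. indicator (ball x e) y \<partial>N) = ?h" if "x \<in> S" for x
      using uniN[OF that x0 e] by (simp only: nn_integral_indicator sets borel_open open_ball)
    have bM: "(\<integral>\<^sup>+x. indicator (ball x e) y \<partial>M) = ?g" if "y \<in> S" for y
    proof -
      have "(\<integral>\<^sup>+x. indicator (ball x e) y \<partial>M) = (\<integral>\<^sup>+x. indicator (ball y e) x \<partial>M)"
        by (intro nn_integral_cong) (auto simp: indicator_def dist_commute)
      then show ?thesis using uniM[OF that x0 e] by (simp add: sets)
    qed
    note nn_integral_indicator[simp del]
    have ind[measurable]: "(\<lambda>(x, y). indicator (ball x e) y :: ennreal) \<in> borel_measurable (M \<Otimes>\<^sub>M N)"
    proof -
      have "(\<lambda>(x::'a, y). indicator (ball x e) y :: ennreal) = (\<lambda>p. if dist (fst p) (snd p) < e then 1 else 0)"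
        by (auto simp: fun_eq_iff)
      then show ?thesis by (simp only:) measurable
    qed
    \<comment> \<open>The same double integral without F: equal total masses force equal masses of
      balls.\<close>
    have "?h * emeasure M UNIV = (\<integral>\<^sup>+x. ?h \<partial>M)" using sets_eq_imp_space_eq[OF sets(1)] by simp
    also have "\<dots> = (\<integral>\<^sup>+x. \<integral>\<^sup>+y. indicator (ball x e) y \<partial>N \<partial>M)"
      using aeM by (intro nn_integral_cong_AE) (auto simp: bN)
    also have "\<dots> = (\<integral>\<^sup>+y. \<integral>\<^sup>+x. indicator (ball x e) y \<partial>M \<partial>N)"
      using Fubini'[of "\<lambda>x y. indicator (ball x e) y :: ennreal"] by simp
    also have "\<dots> = (\<integral>\<^sup>+x. ?g \<partial>N)"
      using aeN by (intro nn_integral_cong_AE) (auto simp: bM)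
    also have "\<dots> = ?g * emeasure M UNIV" using sets_eq_imp_space_eq[OF sets(2)] mass by simp
    finally have gh: "?h = ?g"
      using False M.emeasure_finite[of UNIV] by (metis ennreal_mult_divide_eq infinity_ennreal_def)
    \<comment> \<open>Compactness: if balls of radius e were null, finitely many of them would cover
      S and M would vanish.\<close>
    have g0: "?g \<noteq> 0"
    proof
      assume g: "?g = 0"
      obtain C where C: "C \<subseteq> S" "finite C" "S \<subseteq> (\<Union>x\<in>C. ball x e)"
        by (rule compactE_image[OF S(1), of S "\<lambda>x. ball x e"]) (use e in auto)
      have "emeasure M (\<Union>x\<in>C. ball x e) \<le> (\<Sum>x\<in>C. emeasure M (ball x e))"
        using C(2) by (intro emeasure_subadditive_finite) (auto simp: sets)
      also have "\<dots> = 0" using C(1) uniM[OF _ x0 e] g by (intro sum.neutral) auto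
      finally have "emeasure M S = 0"
        using emeasure_mono[OF C(3), of M] by (simp add: sets borel_open open_UN)
      moreover have "emeasure M UNIV = emeasure M S"
        using aeM by (intro emeasure_eq_AE) (auto simp: sets)
      ultimately show False using False by simp
    qed
    have "emeasure M F * ?g = (\<integral>\<^sup>+x. indicator F x * ?h \<partial>M)"
      by (simp add: nn_integral_multc nn_integral_indicator gh sets)
    also have "\<dots> = (\<integral>\<^sup>+x. \<integral>\<^sup>+y. indicator F x * indicator (ball x e) y \<partial>N \<partial>M)"
      using aeM by (intro nn_integral_cong_AE) (auto simp: bN nn_integral_cmult sets)
    also have "\<dots> = (\<integral>\<^sup>+y. \<integral>\<^sup>+x. indicator F x * indicator (ball x e) y \<partial>M \<partial>N)"
    proof -
      have "(\<lambda>(x, y). indicator F x * indicator (ball x e) y :: ennreal) =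
        (\<lambda>p. indicator F (fst p) * (case p of (x, y) \<Rightarrow> indicator (ball x e) y))" by auto
      then have "(\<lambda>(x, y). indicator F x * indicator (ball x e) y :: ennreal) \<in> borel_measurable (M \<Otimes>\<^sub>M N)"
        using ind by (simp only:) measurable
      then show ?thesis
        using Fubini'[of "\<lambda>x y. indicator F x * indicator (ball x e) y :: ennreal"] by simp
    qed
    also have "\<dots> \<le> (\<integral>\<^sup>+y. indicator {y. infdist y F < e} y * ?g \<partial>N)"
    proof (rule nn_integral_mono_AE)
      have "(\<integral>\<^sup>+x. indicator F x * indicator (ball x e) y \<partial>M) \<le> indicator {y. infdist y F < e} y * ?g" if "y \<in> S" for y
      proof (cases "infdist y F < e")
        case True
        have "(\<integral>\<^sup>+x. indicator F x * indicator (ball x e) y \<partial>M) \<le> (\<integral>\<^sup>+x. indicator (ball x e) y \<partial>M)"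
          by (intro nn_integral_mono) (auto simp: indicator_def)
        then show ?thesis using True bM[OF that] by simp
      next
        case False
        have "indicator F x * indicator (ball x e) y = (0::ennreal)" for x
          using False infdist_le[of x F y] by (auto simp: indicator_def dist_commute)
        then have "(\<integral>\<^sup>+x. indicator F x * indicator (ball x e) y \<partial>M) = 0" by (simp only: nn_integral_const mult_zero_left)
        then show ?thesis by simp
      qed
      then show "AE y in N. (\<integral>\<^sup>+x. indicator F x * indicator (ball x e) y \<partial>M) \<le> indicator {y. infdist y F < e} y * ?g"
        using aeN by auto
    qed
    also have "\<dots> = emeasure N {y. infdist y F < e} * ?g"
    proof -
      have "{y. infdist y F < e} \<in> sets N"
        unfolding sets by (intro borel_open open_Collect_less continuous_intros)
      then show ?thesis by (simp add: nn_integral_multc nn_integral_indicator)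
    qed
    finally have "emeasure M F * ?g \<le> emeasure N {y. infdist y F < e} * ?g" .
    then show ?thesis
      using g0 M.emeasure_finite[of "ball x0 e"]
      by (metis ennreal_mult_le_mult_iff infinity_ennreal_def mult.commute)
  qed
  \<comment> \<open>A closed nonempty set is the intersection of its open neighbourhoods of radius
    1/(i+1), and N is finite, so continuity from above removes e.\<close>
  let ?A = "\<lambda>i::nat. {y. infdist y F < 1 / real (Suc i)}"
  have "(\<lambda>i. emeasure N (?A i)) \<longlonglongrightarrow> emeasure N (\<Inter>i. ?A i)"
  proof (rule Lim_emeasure_decseq)
    show "decseq ?A"
    proof (rule antimonoI)
      fix i j :: nat assume "i \<le> j"
      then have "1 / real (Suc j) \<le> 1 / real (Suc i)" by (simp add: frac_le)
      then show "?A j \<subseteq> ?A i" by auto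
    qed
    have "open {y. infdist y F < 1 / real (Suc i)}" for i
      by (intro open_Collect_less continuous_intros)
    then show "range ?A \<subseteq> sets N" by (auto simp: sets simp del: of_nat_Suc)
  qed simp
  moreover have "(\<Inter>i. ?A i) = F"
  proof
    have "y \<in> F" if "\<forall>i. infdist y F < 1 / real (Suc i)" for y
    proof -
      have "infdist y F \<le> 0"
      proof (rule ccontr)
        assume "\<not> infdist y F \<le> 0"
        then obtain i where "1 / real (Suc i) < infdist y F"
          using nat_approx_posE[of "infdist y F"] by (metis not_le)
        with that[rule_format, of i] show False by linarith
      qed
      then have "infdist y F = 0" using infdist_nonneg[of y F] by simp
      then show ?thesis using F False in_closed_iff_infdist_zero by auto
    qed
    then show "(\<Inter>i. ?A i) \<subseteq> F" by auto
    show "F \<subseteq> (\<Inter>i. ?A i)" by auto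
  qed
  ultimately have "(\<lambda>i. emeasure N (?A i)) \<longlonglongrightarrow> emeasure N F" by simp
  moreover have "emeasure M F \<le> emeasure N (?A i)" for i
    by (rule step) simp
  ultimately show ?thesis
    by (intro LIMSEQ_le_const[where X = "\<lambda>i. emeasure N (?A i)"]) blast+
qed

lemma uniformly_distributed_unique:
  fixes M N :: "'a::euclidean_space measure"
  assumes fin: "finite_measure M" "finite_measure N"
    and sets: "sets M = sets borel" "sets N = sets borel"
    and S: "compact S" "emeasure M (- S) = 0" "emeasure N (- S) = 0"
    and uniM: "\<And>x y e. x \<in> S \<Longrightarrow> y \<in> S \<Longrightarrow> 0 < e \<Longrightarrow> emeasure M (ball x e) = emeasure M (ball y e)"
    and uniN: "\<And>x y e. x \<in> S \<Longrightarrow> y \<in> S \<Longrightarrow> 0 < e \<Longrightarrow> emeasure N (ball x e) = emeasure N (ball y e)"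
    and mass: "emeasure M UNIV = emeasure N UNIV"
  shows "M = N"
proof (rule measure_eqI_generator_eq[where E = "Collect closed" and A = "\<lambda>_. UNIV" and \<Omega> = UNIV])
  show "emeasure M F = emeasure N F" if "F \<in> Collect closed" for F
    using uniformly_distributed_le[OF fin sets S uniM uniN mass, of F]
      uniformly_distributed_le[OF fin(2,1) sets(2,1) S(1,3,2) uniN uniM mass[symmetric], of F] that
    by (intro antisym) simp_all
  show "sets M = sigma_sets UNIV (Collect closed)" "sets N = sigma_sets UNIV (Collect closed)"
    unfolding sets by (simp_all add: borel_eq_closed)
  show "emeasure M UNIV \<noteq> \<infinity>" for i :: nat
    using fin(1) finite_measure.emeasure_finite by (metis infinity_ennreal_def)
qed (auto intro!: Int_stableI closed_Int)

lemma compact_great_subsphere: "compact (great_subsphere \<xi>)"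
proof -
  have "perp \<xi> = {x. \<xi> \<bullet> x = 0}" by (auto simp: perp_def inner_commute)
  then have "closed (perp \<xi>)" by (simp add: closed_hyperplane)
  then show ?thesis
    unfolding great_subsphere_def by (intro compact_Int_closed) auto
qed

lemma great_subsphere_transitive:
  fixes \<xi> :: "'a::euclidean_space"
  assumes "u \<in> great_subsphere \<xi>" "v \<in> great_subsphere \<xi>"
  obtains T where "orthogonal_transformation T" "T \<xi> = \<xi>" "T u = v"
proof -
  \<comment> \<open>T is the reflection in the hyperplane orthogonal to u - v. Since w is orthogonal
    to \<open>\<xi>\<close>, it fixes \<open>\<xi>\<close>. For u = v the division by 0 makes T the
    identity.\<close>
  define w where "w = u - v"
  define T where "T x = x - (2 * (x \<bullet> w) / (w \<bullet> w)) *\<^sub>R w" for x :: 'a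
  have nu: "u \<bullet> u = 1" "v \<bullet> v = 1" "u \<bullet> \<xi> = 0" "v \<bullet> \<xi> = 0"
    using assms by (auto simp: great_subsphere_def perp_def norm_eq_1)
  have uw: "2 * (u \<bullet> w) = w \<bullet> w"
    by (simp add: w_def inner_diff_left inner_diff_right nu inner_commute)
  have "linear T"
    by (rule linearI) (auto simp: T_def inner_add_left algebra_simps add_divide_distrib)
  moreover have "T x \<bullet> T y = x \<bullet> y" for x y
    by (cases "w \<bullet> w = 0")
      (auto simp: T_def inner_diff_left inner_diff_right inner_commute field_simps simp del: inner_eq_zero_iff)
  ultimately have "orthogonal_transformation T" by (simp add: orthogonal_transformation_def)
  moreover have "T \<xi> = \<xi>" using nu by (simp add: T_def w_def inner_diff_right inner_commute)
  moreover have "T u = v"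
    by (cases "w = 0") (auto simp: T_def uw, simp_all add: w_def)
  ultimately show ?thesis using that by blast
qed

text \<open>Invariance together with transitivity of the rotations fixing \<open>\<xi>\<close> makes
  all balls centred on the subsphere equally heavy, so the measure is uniformly distributed. Both
  measures are pushed forward to \<open>borel\<close> on the whole space, where the uniqueness
  result for such measures is stated.\<close>

lemma is_subsphere_measure_unique:
  fixes \<xi> :: "'a::euclidean_space"
  assumes "is_subsphere_measure \<xi> \<mu>" "is_subsphere_measure \<xi> \<nu>"
  shows "\<mu> = \<nu>"
proof -
  let ?S = "great_subsphere \<xi>"
  have [measurable]: "?S \<in> sets borel" using compact_great_subsphere compact_imp_closed borel_closed by blast
  have ext: "finite_measure (distr \<mu> borel (\<lambda>x. x))" "emeasure (distr \<mu> borel (\<lambda>x. x)) (- ?S) = 0"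
    "\<And>x y e. x \<in> ?S \<Longrightarrow> y \<in> ?S \<Longrightarrow> 0 < e \<Longrightarrow> emeasure (distr \<mu> borel (\<lambda>x. x)) (ball x e) = emeasure (distr \<mu> borel (\<lambda>x. x)) (ball y e)"
    "emeasure (distr \<mu> borel (\<lambda>x. x)) UNIV = ennreal (2 * pi powr ((real DIM('a) - 1) / 2) / Gamma ((real DIM('a) - 1) / 2))"
    "\<And>A. A \<in> sets \<mu> \<Longrightarrow> emeasure \<mu> A = emeasure (distr \<mu> borel (\<lambda>x. x)) A"
    if \<mu>: "is_subsphere_measure \<xi> \<mu>" for \<mu>
  proof -
    have s[measurable_cong]: "sets \<mu> = sets (restrict_space borel ?S)" and
      inv: "\<And>T. orthogonal_transformation T \<Longrightarrow> T \<xi> = \<xi> \<Longrightarrow> distr \<mu> \<mu> T = \<mu>" and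
      mass: "emeasure \<mu> (space \<mu>) = ennreal (2 * pi powr ((real DIM('a) - 1) / 2) / Gamma ((real DIM('a) - 1) / 2))"
      using \<mu> by (auto simp: is_subsphere_measure_def)
    have sp: "space \<mu> = ?S" using sets_eq_imp_space_eq[OF s] by (simp add: space_restrict_space)
    have m[measurable]: "(\<lambda>x. x) \<in> measurable \<mu> borel"
      unfolding measurable_cong_sets[OF s refl] by (rule measurable_restrict_space1) simp
    have sA: "A \<inter> ?S \<in> sets \<mu>" if "A \<in> sets borel" for A
      using that by (auto simp: s sets_restrict_space)
    have em: "emeasure (distr \<mu> borel (\<lambda>x. x)) A = emeasure \<mu> (A \<inter> ?S)" if "A \<in> sets borel" for A
      using that by (subst emeasure_distr[OF m]) (auto simp: sp)
    show "finite_measure (distr \<mu> borel (\<lambda>x. x))"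
      by (rule finite_measureI) (use mass in \<open>simp add: em sp\<close>)
    show "emeasure (distr \<mu> borel (\<lambda>x. x)) (- ?S) = 0" by (simp add: em)
    show "emeasure (distr \<mu> borel (\<lambda>x. x)) UNIV = ennreal (2 * pi powr ((real DIM('a) - 1) / 2) / Gamma ((real DIM('a) - 1) / 2))"
      using mass by (simp add: em sp)
    show "emeasure \<mu> A = emeasure (distr \<mu> borel (\<lambda>x. x)) A" if "A \<in> sets \<mu>" for A
    proof -
      have "A \<in> sets borel" "A \<subseteq> ?S" using that by (auto simp: s sets_restrict_space)
      then show ?thesis by (simp add: em Int_absorb2)
    qed
    fix x y e assume xy: "x \<in> ?S" "y \<in> ?S"
    obtain T where T: "orthogonal_transformation T" "T \<xi> = \<xi>" "T x = y"
      using great_subsphere_transitive[OF xy] by blast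
    have TS: "T z \<in> ?S \<longleftrightarrow> z \<in> ?S" for z
      using T(1,2) unfolding great_subsphere_def perp_def
      by (auto simp: orthogonal_transformation_norm) (metis orthogonal_transformation_def)+
    have Tb: "T z \<in> ball y e \<longleftrightarrow> z \<in> ball x e" for z
      using T(1,3) by (auto simp: orthogonal_transformation_isometry)
    have TM: "T \<in> measurable \<mu> \<mu>"
    proof -
      have "T \<in> borel_measurable borel"
        using T(1) by (auto intro!: borel_measurable_continuous_onI linear_continuous_on
          simp: linear_conv_bounded_linear[symmetric] orthogonal_transformation_linear)
      then show ?thesis
        unfolding measurable_cong_sets[OF s s]
        by (intro measurable_restrict_space2 measurable_restrict_space1) (auto simp: space_restrict_space TS)
    qed
    have "emeasure \<mu> (ball y e \<inter> ?S) = emeasure (distr \<mu> \<mu> T) (ball y e \<inter> ?S)" using inv[OF T(1,2)] by simp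
    also have "\<dots> = emeasure \<mu> (T -` (ball y e \<inter> ?S) \<inter> ?S)"
      by (subst emeasure_distr[OF TM]) (auto simp: sp intro: sA)
    also have "T -` (ball y e \<inter> ?S) \<inter> ?S = ball x e \<inter> ?S" using TS Tb by blast
    finally show "emeasure (distr \<mu> borel (\<lambda>x. x)) (ball x e) = emeasure (distr \<mu> borel (\<lambda>x. x)) (ball y e)"
      by (simp add: em)
  qed
  have eq: "distr \<mu> borel (\<lambda>x. x) = distr \<nu> borel (\<lambda>x. x)"
    by (rule uniformly_distributed_unique[OF ext(1)[OF assms(1)] ext(1)[OF assms(2)] _ _ compact_great_subsphere
          ext(2)[OF assms(1)] ext(2)[OF assms(2)]])
      (rule sets_distr, rule sets_distr, erule (2) ext(3)[OF assms(1)], erule (2) ext(3)[OF assms(2)],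
        simp only: ext(4)[OF assms(1)] ext(4)[OF assms(2)])
  have s: "sets \<mu> = sets \<nu>" using assms by (simp add: is_subsphere_measure_def)
  show ?thesis
    by (rule measure_eqI[OF s]) (use ext(5)[OF assms(1)] ext(5)[OF assms(2)] eq s in auto)
qed

lemma subsphere_measure_eqI: "is_subsphere_measure \<xi> \<mu> \<Longrightarrow> subsphere_measure \<xi> = \<mu>"
  unfolding subsphere_measure_def using is_subsphere_measure_unique by blast

definition subsphere_mass :: "'a::euclidean_space itself \<Rightarrow> real" where
  "subsphere_mass _ = 2 * pi powr ((real DIM('a) - 1) / 2) / Gamma ((real DIM('a) - 1) / 2)"

lemma subsphere_mass_pos: "2 \<le> DIM('a) \<Longrightarrow> 0 < subsphere_mass TYPE('a::euclidean_space)"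
  unfolding subsphere_mass_def by (intro divide_pos_pos Gamma_real_pos) auto

lemma AE_perp_lborel_nonzero:
  fixes \<theta> :: "'a::euclidean_space"
  assumes "norm \<theta> = 1" "2 \<le> DIM('a)"
  shows "AE y in perp_lborel \<theta>. y \<noteq> 0"
proof (rule AE_I[of _ _ "{0}"])
  show "emeasure (perp_lborel \<theta>) {0} = 0"
    using emeasure_perp_lborel_cball[of \<theta> 0] assms by (simp add: power_0_left)
qed auto

lemma measurable_sgn[measurable]: "(sgn :: 'a::euclidean_space \<Rightarrow> 'a) \<in> borel_measurable borel"
  unfolding sgn_div_norm by measurable

lemma measurable_sgn_sphere:
  fixes F :: "'a::euclidean_space \<Rightarrow> real"
  assumes F: "F \<in> borel_measurable (restrict_space borel (sphere 0 1))"
  shows "(\<lambda>y. F (sgn y)) \<in> borel_measurable borel"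
proof -
  \<comment> \<open>\<open>sgn\<close> takes values in the sphere except for
    \<open>sgn 0 = 0\<close>. Extending F by one constant off the sphere therefore changes nothing
    after composition with \<open>sgn\<close>.\<close>
  define F' where "F' = (\<lambda>x. if x \<in> sphere 0 1 then F x else F 0)"
  have [measurable]: "sphere (0::'a) 1 \<in> sets borel" by (simp add: borel_closed)
  have [measurable]: "F' \<in> borel_measurable borel"
    unfolding F'_def by (rule measurable_If_restrict_space_iff[THEN iffD2]) (use F in \<open>simp_all add: sphere_def\<close>)
  have "F (sgn y) = F' (sgn y)" for y
    by (auto simp: F'_def norm_sgn split: if_splits)
  then show ?thesis by simp
qed

text \<open>By uniqueness, any radial weight of finite positive mass on the hyperplane induces the invariant
  measure; this replaces polar coordinates.\<close>

lemma spherical_radon_eq_weighted: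
  fixes \<theta> :: "'a::euclidean_space"
  assumes \<theta>: "norm \<theta> = 1" and dim: "2 \<le> DIM('a)"
    and v[measurable]: "v \<in> borel_measurable borel" and v0: "\<And>r. 0 \<le> v r"
    and Z: "(\<integral>\<^sup>+y. ennreal (v (norm y)) \<partial>perp_lborel \<theta>) = ennreal z" "0 < z"
    and F[measurable]: "F \<in> borel_measurable (restrict_space borel (sphere 0 1))"
  shows "spherical_radon F \<theta> = subsphere_mass TYPE('a) / z * (\<integral>y. v (norm y) * F (sgn y) \<partial>perp_lborel \<theta>)"
proof -
  let ?S = "great_subsphere \<theta>"
  define c where "c = subsphere_mass TYPE('a) / z"
  have c: "0 \<le> c" "c * z = subsphere_mass TYPE('a)" using Z subsphere_mass_pos[OF dim] by (auto simp: c_def)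
  define W where "W y = ennreal (c * v (norm y))" for y :: 'a
  have [measurable]: "W \<in> borel_measurable borel" unfolding W_def by simp
  have [measurable]: "?S \<in> sets borel" using compact_great_subsphere compact_imp_closed borel_closed by blast
  have [measurable]: "perp \<theta> \<in> sets borel" unfolding perp_def by measurable
  have aeP: "AE y in perp_lborel \<theta>. y \<in> perp \<theta> \<and> y \<noteq> 0"
    using AE_perp_lborel[OF \<theta>] AE_perp_lborel_nonzero[OF \<theta> dim] by eventually_elim simp
  have sgnS: "sgn y \<in> ?S" if "y \<in> perp \<theta>" "y \<noteq> 0" for y
    using that by (auto simp: great_subsphere_def norm_sgn perp_def sgn_div_norm)
  have "\<exists>u0. u0 \<in> ?S"
  proof -
    \<comment> \<open>If the hyperplane contained only 0, the two almost-everywhere statements in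
      \<open>aeP\<close> would make its measure zero, against the positive volume of its unit
      ball.\<close>
    have "\<exists>y. y \<in> perp \<theta> \<and> y \<noteq> 0"
    proof (rule ccontr)
      assume no: "\<not> ?thesis"
      have "AE y in perp_lborel \<theta>. False"
        using aeP by eventually_elim (use no in blast)
      then have "emeasure (perp_lborel \<theta>) UNIV = 0" by (simp add: AE_iff_measurable[OF _ refl] )
      then have "emeasure (perp_lborel \<theta>) (cball 0 1) = 0"
        using emeasure_mono[of "cball 0 1" UNIV "perp_lborel \<theta>"] by simp
      then show False
        using emeasure_perp_lborel_cball[OF \<theta>, of 1] dim unit_ball_vol_pos[of "real (DIM('a) - 1)"]
        by (simp del: unit_ball_vol_pos)
    qed
    then show ?thesis using sgnS by blast
  qed
  then obtain u0 where u0: "u0 \<in> ?S" by blast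
  \<comment> \<open>\<open>sgn y\<close> is corrected to \<open>u0\<close> on a null set, so that g
    maps every point into the subsphere and can serve as a map into the restricted measurable
    space.\<close>
  define g where "g y = (if y \<in> perp \<theta> \<and> y \<noteq> 0 then sgn y else u0)" for y
  have [measurable]: "g \<in> borel_measurable borel" unfolding g_def sgn_div_norm by measurable
  have gS: "g y \<in> ?S" for y using sgnS u0 by (auto simp: g_def)
  have g_sgn: "AE y in perp_lborel \<theta>. g y = sgn y" using aeP by eventually_elim (simp add: g_def)
  define \<sigma> where "\<sigma> = distr (density (perp_lborel \<theta>) W) (restrict_space borel ?S) g"
  have gm[measurable]: "g \<in> measurable (density (perp_lborel \<theta>) W) (restrict_space borel ?S)"
    by (intro measurable_restrict_space2) (auto simp: gS)
  have s\<sigma>: "sets \<sigma> = sets (restrict_space borel ?S)" by (simp add: \<sigma>_def)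
  have sp\<sigma>: "space \<sigma> = ?S" by (simp add: \<sigma>_def space_restrict_space)
  have em: "emeasure \<sigma> A = (\<integral>\<^sup>+y. W y * indicator A (g y) \<partial>perp_lborel \<theta>)" if A: "A \<in> sets \<sigma>" for A
  proof -
    have [measurable]: "A \<in> sets borel" using A by (auto simp: s\<sigma> sets_restrict_space)
    have "emeasure \<sigma> A = emeasure (density (perp_lborel \<theta>) W) (g -` A)"
      unfolding \<sigma>_def using A s\<sigma> by (subst emeasure_distr[OF gm]) auto
    also have "\<dots> = (\<integral>\<^sup>+y. W y * indicator (g -` A) y \<partial>perp_lborel \<theta>)"
      by (subst emeasure_density) (auto simp: measurable_sets_borel[of g borel A])
    finally show ?thesis by (simp add: indicator_def)
  qed
  have sub: "is_subsphere_measure \<theta> \<sigma>"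
    unfolding is_subsphere_measure_def
  proof (intro conjI allI impI; (elim conjE)?)
    show "sets \<sigma> = sets (restrict_space borel ?S)" by fact
    have "emeasure \<sigma> (space \<sigma>) = (\<integral>\<^sup>+y. W y \<partial>perp_lborel \<theta>)"
      by (subst em[OF sets.top]) (auto simp: sp\<sigma> gS)
    also have "\<dots> = ennreal (c * z)"
      using c(1) v0 Z by (simp add: W_def ennreal_mult nn_integral_cmult del: c(2))
    finally show "emeasure \<sigma> (space \<sigma>) = ennreal (2 * pi powr ((real DIM('a) - 1) / 2) / Gamma ((real DIM('a) - 1) / 2))"
      using c(2) by (simp add: subsphere_mass_def)
    fix T assume T: "orthogonal_transformation T" "T \<theta> = \<theta>"
    have lin: "linear T" using T by (simp add: orthogonal_transformation_linear)
    have TB[measurable]: "T \<in> borel_measurable borel"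
      using lin by (auto intro!: borel_measurable_continuous_onI linear_continuous_on
          simp: linear_conv_bounded_linear[symmetric])
    have nT: "norm (T y) = norm y" for y using T by (simp add: orthogonal_transformation_norm)
    have pT: "T y \<in> perp \<theta> \<longleftrightarrow> y \<in> perp \<theta>" for y
      using T unfolding perp_def by (metis mem_Collect_eq orthogonal_transformation_def)
    have TS: "T y \<in> ?S \<longleftrightarrow> y \<in> ?S" for y by (simp add: great_subsphere_def nT pT)
    have TM: "T \<in> measurable \<sigma> \<sigma>"
      unfolding measurable_cong_sets[OF s\<sigma> s\<sigma>]
      by (intro measurable_restrict_space2 measurable_restrict_space1) (auto simp: space_restrict_space TS)
    have gT: "AE y in perp_lborel \<theta>. T (g y) = g (T y)"
      using aeP
    proof eventually_elim
      case (elim y)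
      then have "T y \<noteq> 0" by (metis nT norm_eq_zero)
      then show ?case using elim by (simp add: g_def pT sgn_div_norm nT linear_cmul[OF lin])
    qed
    show "distr \<sigma> \<sigma> T = \<sigma>"
    proof (rule measure_eqI)
      fix A assume "A \<in> sets (distr \<sigma> \<sigma> T)"
      then have A: "A \<in> sets \<sigma>" by simp
      then have [measurable]: "A \<in> sets borel" by (auto simp: s\<sigma> sets_restrict_space)
      have "emeasure (distr \<sigma> \<sigma> T) A = emeasure \<sigma> (T -` A \<inter> space \<sigma>)"
        by (rule emeasure_distr[OF TM A])
      also have "\<dots> = (\<integral>\<^sup>+y. W y * indicator (T -` A \<inter> space \<sigma>) (g y) \<partial>perp_lborel \<theta>)"
        by (rule em[OF measurable_sets[OF TM A]])
      also have "\<dots> = (\<integral>\<^sup>+y. W (T y) * indicator A (g (T y)) \<partial>perp_lborel \<theta>)"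
        using gT by (intro nn_integral_cong_AE) (auto simp: W_def nT sp\<sigma> gS indicator_def)
      also have "\<dots> = (\<integral>\<^sup>+y. W y * indicator A (g y) \<partial>perp_lborel \<theta>)"
        by (rule nn_integral_perp_rotate[OF \<theta> _ T, of "\<lambda>y. W y * indicator A (g y)"]) simp
      also have "\<dots> = emeasure \<sigma> A" by (simp add: em[OF A])
      finally show "emeasure (distr \<sigma> \<sigma> T) A = emeasure \<sigma> A" .
    qed simp
  qed
  have FS: "F \<in> borel_measurable (restrict_space borel ?S)"
    by (rule measurable_restrict_mono[OF F]) (auto simp: great_subsphere_def)
  have [measurable]: "(\<lambda>y. F (g y)) \<in> borel_measurable borel"
    by (rule measurable_compose[OF _ FS]) (intro measurable_restrict_space2, auto simp: gS)
  have "spherical_radon F \<theta> = (\<integral>u. F u \<partial>\<sigma>)"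
    unfolding spherical_radon_def by (simp add: subsphere_measure_eqI[OF sub])
  also have "\<dots> = (\<integral>y. F (g y) \<partial>density (perp_lborel \<theta>) W)"
    unfolding \<sigma>_def by (rule integral_distr[OF gm FS])
  also have "\<dots> = (\<integral>y. c * v (norm y) * F (g y) \<partial>perp_lborel \<theta>)"
    unfolding W_def using c v0 by (subst integral_density) auto
  also have "\<dots> = (\<integral>y. c * (v (norm y) * F (g y)) \<partial>perp_lborel \<theta>)" by (simp add: mult.assoc)
  also have "\<dots> = c * (\<integral>y. v (norm y) * F (g y) \<partial>perp_lborel \<theta>)" by simp
  also have "(\<integral>y. v (norm y) * F (g y) \<partial>perp_lborel \<theta>) = (\<integral>y. v (norm y) * F (sgn y) \<partial>perp_lborel \<theta>)"
  proof (rule integral_cong_AE)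
    note measurable_sgn_sphere[OF F, measurable]
    show "(\<lambda>y. v (norm y) * F (sgn y)) \<in> borel_measurable (perp_lborel \<theta>)" by simp
  qed (use g_sgn in \<open>auto\<close>)
  finally show ?thesis by (simp add: c_def)
qed

section \<open>Smooth functions of one variable depending on a parameter\<close>

text \<open>Differentiation is in s alone; the parameter enters through joint continuity of every
  derivative on W. With a compact parameter space this is enough for bounds uniform in the
  parameter.\<close>

primrec param_Ck :: "nat \<Rightarrow> (real \<times> 'p::metric_space) set \<Rightarrow> (real \<Rightarrow> 'p \<Rightarrow> real) \<Rightarrow> bool" where
  "param_Ck 0 W f \<longleftrightarrow> continuous_on W (\<lambda>(s, p). f s p)"
| "param_Ck (Suc k) W f \<longleftrightarrow> continuous_on W (\<lambda>(s, p). f s p) \<and>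
     (\<exists>f'. (\<forall>s p. (s, p) \<in> W \<longrightarrow> ((\<lambda>s. f s p) has_real_derivative f' s p) (at s)) \<and> param_Ck k W f')"

lemma param_Ck_continuous: "param_Ck k W f \<Longrightarrow> continuous_on W (\<lambda>(s, p). f s p)"
  by (cases k) auto

lemma param_Ck_SucD: "param_Ck (Suc k) W f \<Longrightarrow> param_Ck k W f"
  by (induction k arbitrary: f) auto

lemma param_Ck_subset: "param_Ck k W f \<Longrightarrow> V \<subseteq> W \<Longrightarrow> param_Ck k V f"
proof (induction k arbitrary: f)
  case (Suc k)
  then show ?case by simp (meson continuous_on_subset subsetD)
qed (auto intro: continuous_on_subset)

lemma param_Ck_param:
  assumes "continuous_on W (\<lambda>(s, p). g p)"
  shows "param_Ck k W (\<lambda>s p. g p)"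
proof -
  have z: "param_Ck k W (\<lambda>s p. 0)" for k
  proof (induction k)
    case (Suc k)
    then show ?case by (simp add: case_prod_unfold) (rule exI[of _ "\<lambda>s p. 0"], simp)
  qed (simp add: case_prod_unfold)
  show ?thesis
  proof (cases k)
    case (Suc k)
    then show ?thesis using assms z[of k] by simp (rule exI[of _ "\<lambda>s p. 0"], simp)
  qed (use assms in simp)
qed

lemma param_Ck_const: "param_Ck k W (\<lambda>s p. c)"
  by (rule param_Ck_param) (simp add: case_prod_unfold)

lemma param_Ck_add:
  "param_Ck k W f \<Longrightarrow> param_Ck k W g \<Longrightarrow> param_Ck k W (\<lambda>s p. f s p + g s p)"
proof (induction k arbitrary: f g)
  case 0
  then show ?case by (auto simp: case_prod_unfold intro!: continuous_intros)
next
  case (Suc k)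
  then obtain f' g' where *: "\<And>s p. (s, p) \<in> W \<Longrightarrow> ((\<lambda>s. f s p) has_real_derivative f' s p) (at s)" "param_Ck k W f'"
    "\<And>s p. (s, p) \<in> W \<Longrightarrow> ((\<lambda>s. g s p) has_real_derivative g' s p) (at s)" "param_Ck k W g'" by auto
  show ?case using Suc.prems * Suc.IH[of f' g']
    by (auto simp: case_prod_unfold intro!: continuous_intros exI[of _ "\<lambda>s p. f' s p + g' s p"] DERIV_add)
qed

lemma param_Ck_mult:
  "param_Ck k W f \<Longrightarrow> param_Ck k W g \<Longrightarrow> param_Ck k W (\<lambda>s p. f s p * g s p)"
proof (induction k arbitrary: f g)
  case 0
  then show ?case by (auto simp: case_prod_unfold intro!: continuous_intros)
next
  case (Suc k)
  then obtain f' g' where *: "\<And>s p. (s, p) \<in> W \<Longrightarrow> ((\<lambda>s. f s p) has_real_derivative f' s p) (at s)" "param_Ck k W f'"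
    "\<And>s p. (s, p) \<in> W \<Longrightarrow> ((\<lambda>s. g s p) has_real_derivative g' s p) (at s)" "param_Ck k W g'" by auto
  have "param_Ck k W (\<lambda>s p. f' s p * g s p + g' s p * f s p)"
    using Suc.prems[THEN param_Ck_SucD] * by (intro param_Ck_add Suc.IH)
  then show ?case using Suc.prems *
    by (auto simp: case_prod_unfold intro!: continuous_intros exI[of _ "\<lambda>s p. f' s p * g s p + g' s p * f s p"] DERIV_mult)
qed

lemma param_Ck_power: "param_Ck k W f \<Longrightarrow> param_Ck k W (\<lambda>s p. f s p ^ j)"
  by (induction j) (auto intro: param_Ck_const param_Ck_mult)

lemma param_Ck_sum: "finite I \<Longrightarrow> (\<And>i. i \<in> I \<Longrightarrow> param_Ck k W (f i)) \<Longrightarrow> param_Ck k W (\<lambda>s p. \<Sum>i\<in>I. f i s p)"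
  by (induction I rule: finite_induct) (auto intro: param_Ck_const param_Ck_add)

lemma param_Ck_inverse:
  "param_Ck k W f \<Longrightarrow> (\<And>s p. (s, p) \<in> W \<Longrightarrow> f s p \<noteq> 0) \<Longrightarrow> param_Ck k W (\<lambda>s p. inverse (f s p))"
proof (induction k)
  case 0
  then show ?case by (auto simp: case_prod_unfold intro!: continuous_intros)
next
  case (Suc k)
  then obtain f' where *: "\<And>s p. (s, p) \<in> W \<Longrightarrow> ((\<lambda>s. f s p) has_real_derivative f' s p) (at s)" "param_Ck k W f'"
    by auto
  have "param_Ck k W (\<lambda>s p. inverse (f s p))" using Suc param_Ck_SucD by blast
  then have "param_Ck k W (\<lambda>s p. -1 * ((inverse (f s p) * f' s p) * inverse (f s p)))"
    using * by (intro param_Ck_mult param_Ck_const)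
  then have p: "param_Ck k W (\<lambda>s p. - (inverse (f s p) * f' s p * inverse (f s p)))" by simp
  show ?case using Suc.prems * p
    by (auto simp: case_prod_unfold intro!: continuous_intros exI[of _ "\<lambda>s p. - (inverse (f s p) * f' s p * inverse (f s p))"] DERIV_inverse')
qed

lemma param_Ck_sin: "param_Ck k W (\<lambda>s p. sin (s + a))"
proof (induction k arbitrary: a)
  case 0
  then show ?case by (auto simp: case_prod_unfold intro!: continuous_intros)
next
  case (Suc k)
  have "((\<lambda>s. sin (s + a)) has_real_derivative sin (s + (a + pi / 2))) (at s)" for s
    by (auto intro!: derivative_eq_intros) (simp add: sin_add flip: add.assoc)
  then show ?case using Suc[of "a + pi / 2"]
    by (auto simp: case_prod_unfold intro!: continuous_intros exI[of _ "\<lambda>s p. sin (s + (a + pi / 2))"])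
qed

lemma param_Ck_sin_cos: "param_Ck k W (\<lambda>s p. sin s)" "param_Ck k W (\<lambda>s p. cos s)"
  using param_Ck_sin[of k W 0] param_Ck_sin[of k W "pi / 2"] by (simp_all add: sin_add)

lemma param_Ck_cong:
  assumes op: "\<And>p. open {s. (s, p) \<in> W}"
    and eq: "\<And>s p. (s, p) \<in> W \<Longrightarrow> f s p = g s p" and f: "param_Ck k W f"
  shows "param_Ck k W g"
proof -
  have c: "continuous_on W (\<lambda>(s, p). g s p) \<longleftrightarrow> continuous_on W (\<lambda>(s, p). f s p)"
    by (rule continuous_on_cong) (auto simp: eq)
  show ?thesis
  proof (cases k)
    case (Suc j)
    then obtain f' where f': "\<And>s p. (s, p) \<in> W \<Longrightarrow> ((\<lambda>s. f s p) has_real_derivative f' s p) (at s)" "param_Ck j W f'"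
      using f by auto
    have "((\<lambda>s. g s p) has_real_derivative f' s p) (at s)" if "(s, p) \<in> W" for s p
      by (rule has_field_derivative_transform_within_open[OF f'(1)[OF that] op[of p]]) (auto simp: that eq)
    then show ?thesis using f Suc f'(2) c by auto
  qed (use f c in auto)
qed

text \<open>The derivatives supplied by different neighbourhoods are glued by replacing each of them
  with \<open>deriv\<close>. Openness of the slices in s makes the transfer legitimate.\<close>

lemma param_Ck_local:
  assumes op: "\<And>p. open {s. (s, p) \<in> W}"
    and loc: "\<And>w. w \<in> W \<Longrightarrow> \<exists>N. open N \<and> w \<in> N \<and> param_Ck k (W \<inter> N) f"
  shows "param_Ck k W f"
  using loc
proof (induction k arbitrary: f)
  case 0
  have "continuous (at w within W) (\<lambda>(s, p). f s p)" if w: "w \<in> W" for w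
  proof -
    obtain N where N: "open N" "w \<in> N" "continuous_on (W \<inter> N) (\<lambda>(s, p). f s p)"
      using 0[OF w] by auto
    then have "continuous (at w within (W \<inter> N)) (\<lambda>(s, p). f s p)"
      using w by (simp add: continuous_on_eq_continuous_within)
    moreover have "at w within (W \<inter> N) = at w within W"
      by (rule at_within_nhd[OF N(2,1)]) auto
    ultimately show ?thesis by simp
  qed
  then show ?case by (simp add: continuous_on_eq_continuous_within)
next
  case (Suc k)
  have "\<And>w. w \<in> W \<Longrightarrow> \<exists>N. open N \<and> w \<in> N \<and> param_Ck k (W \<inter> N) f"
    using Suc.prems param_Ck_SucD by blast
  then have c: "continuous_on W (\<lambda>(s, p). f s p)"
    using Suc.IH param_Ck_continuous by blast
  define f' where "f' s p = deriv (\<lambda>s. f s p) s" for s p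
  have d: "((\<lambda>s. f s p) has_real_derivative f' s p) (at s)" if sp: "(s, p) \<in> W" for s p
  proof -
    obtain N where N: "open N" "(s, p) \<in> N" "param_Ck (Suc k) (W \<inter> N) f"
      using Suc.prems[OF sp] by blast
    then have "\<exists>d. ((\<lambda>s. f s p) has_real_derivative d) (at s)" using sp by auto
    then show ?thesis unfolding f'_def using DERIV_imp_deriv by blast
  qed
  have "param_Ck k W f'"
  proof (rule Suc.IH)
    fix w assume w: "w \<in> W"
    obtain N where N: "open N" "w \<in> N" "param_Ck (Suc k) (W \<inter> N) f"
      using Suc.prems[OF w] by blast
    then obtain g where g: "\<And>s p. (s, p) \<in> W \<inter> N \<Longrightarrow> ((\<lambda>s. f s p) has_real_derivative g s p) (at s)" "param_Ck k (W \<inter> N) g"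
      by auto
    have "param_Ck k (W \<inter> N) f'"
    proof (rule param_Ck_cong[OF _ _ g(2)])
      show "g s p = f' s p" if "(s, p) \<in> W \<inter> N" for s p
        unfolding f'_def using DERIV_imp_deriv[OF g(1)[OF that]] by simp
      have "open {s. (s, p) \<in> N}" for p
      proof -
        have "continuous_on UNIV (\<lambda>s::real. (s, p))" by (intro continuous_intros)
        from open_vimage[OF N(1) this] show ?thesis by (simp add: vimage_def)
      qed
      then show "open {s. (s, p) \<in> W \<inter> N}" for p using op[of p] by (simp add: Collect_conj_eq open_Int)
    qed
    then show "\<exists>N. open N \<and> w \<in> N \<and> param_Ck k (W \<inter> N) f'" using N by blast
  qed
  then show ?case using c d by auto
qed

section \<open>Great circles and smooth functions on the sphere\<close>

definition arc :: "real \<Rightarrow> 'a \<times> 'a \<Rightarrow> 'a::euclidean_space" where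
  "arc s p = cos s *\<^sub>R fst p + sin s *\<^sub>R snd p"

text \<open>In use the pair is (omega, \<open>\<xi>\<close>), with \<open>\<xi>\<close> the normal
  of the section and omega a direction in its hyperplane. Then the variable s of \<open>arc\<close>
  is the elevation above that hyperplane. Compactness of the set of pairs is the source of all
  bounds uniform in \<open>\<xi>\<close>.\<close>

definition orthonormal_pairs :: "('a::euclidean_space \<times> 'a) set" where
  "orthonormal_pairs = {p. norm (fst p) = 1 \<and> norm (snd p) = 1 \<and> fst p \<bullet> snd p = 0}"

lemma compact_orthonormal_pairs: "compact (orthonormal_pairs :: ('a::euclidean_space \<times> 'a) set)"
proof -
  have "orthonormal_pairs = (sphere 0 1 \<times> sphere 0 1) \<inter> {p::'a \<times> 'a. fst p \<bullet> snd p = 0}"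
    by (auto simp: orthonormal_pairs_def)
  moreover have "closed {p::'a \<times> 'a. fst p \<bullet> snd p = 0}"
    by (intro closed_Collect_eq continuous_intros)
  ultimately show ?thesis by (metis compact_Int_closed compact_Times compact_sphere)
qed

lemma norm_arc: "p \<in> orthonormal_pairs \<Longrightarrow> norm (arc s p) = 1"
proof -
  assume "p \<in> orthonormal_pairs"
  then have *: "fst p \<bullet> fst p = 1" "snd p \<bullet> snd p = 1" "fst p \<bullet> snd p = 0" "snd p \<bullet> fst p = 0"
    by (auto simp: orthonormal_pairs_def norm_eq_1 inner_commute)
  have "arc s p \<bullet> arc s p = (cos s)\<^sup>2 + (sin s)\<^sup>2"
    by (simp add: arc_def inner_add_left inner_add_right * power2_eq_square)
  then show ?thesis by (simp add: norm_eq_1)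
qed

lemma param_Ck_compose_arc:
  assumes U: "open U" and g: "Ck_on k g U" and W: "\<And>s p. (s, p) \<in> W \<Longrightarrow> arc s p \<in> U"
  shows "param_Ck k W (\<lambda>s p. g (arc s p))"
  using g
proof (induction k arbitrary: g)
  case 0
  have "continuous_on W (\<lambda>w. arc (fst w) (snd w))" unfolding arc_def by (intro continuous_intros)
  then show ?case using 0 W
    by (auto simp: case_prod_unfold intro!: continuous_on_compose2[of U g])
next
  case (Suc k)
  have diff: "g differentiable_on U" and ck: "\<And>v. Ck_on k (\<lambda>x. frechet_derivative g (at x) v) U"
    using Suc.prems by auto
  have "continuous_on W (\<lambda>w. arc (fst w) (snd w))" unfolding arc_def by (intro continuous_intros)
  then have c: "continuous_on W (\<lambda>(s, p). g (arc s p))" using W differentiable_imp_continuous_on[OF diff]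
    by (auto simp: case_prod_unfold intro!: continuous_on_compose2[of U g])
  define v where "v s p = cos s *\<^sub>R snd p + (- sin s) *\<^sub>R fst p" for s and p :: "'a \<times> 'a"
  \<comment> \<open>The derivative along the moving vector \<open>v s p\<close> is expanded in
    \<open>Basis\<close>, because \<open>Ck_on\<close> controls \<open>frechet_derivative\<close>
    only in fixed directions.\<close>
  define g' where "g' s p = (\<Sum>b\<in>Basis. (v s p \<bullet> b) * frechet_derivative g (at (arc s p)) b)" for s p
  have "((\<lambda>s. g (arc s p)) has_real_derivative g' s p) (at s)" if sp: "(s, p) \<in> W" for s p
  proof -
    let ?D = "frechet_derivative g (at (arc s p))"
    have "g differentiable at (arc s p)" using diff W[OF sp] U
      by (simp add: differentiable_on_eq_differentiable_at)
    then have D: "(g has_derivative ?D) (at (arc s p))" by (simp add: frechet_derivative_works)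
    have a: "((\<lambda>s. arc s p) has_vector_derivative v s p) (at s)"
      unfolding arc_def v_def by (auto intro!: derivative_eq_intros simp: has_vector_derivative_def algebra_simps)
    have "((\<lambda>s. g (arc s p)) has_vector_derivative ?D (v s p)) (at s)"
      using vector_derivative_diff_chain_within[OF a has_derivative_at_withinI[OF D]] by (simp add: comp_def)
    moreover have "?D (v s p) = g' s p"
    proof -
      have lin: "linear ?D" using D has_derivative_linear by blast
      have "?D (v s p) = ?D (\<Sum>b\<in>Basis. (v s p \<bullet> b) *\<^sub>R b)" by (simp add: euclidean_representation)
      also have "\<dots> = g' s p" by (simp add: linear_sum[OF lin] linear_cmul[OF lin] g'_def)
      finally show ?thesis .
    qed
    ultimately show ?thesis by (simp add: has_real_derivative_iff_has_vector_derivative)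
  qed
  moreover have "param_Ck k W g'"
  proof -
    have "param_Ck k W (\<lambda>s p. (v s p \<bullet> b) * frechet_derivative g (at (arc s p)) b)" for b
    proof (rule param_Ck_mult)
      have e: "v s p \<bullet> b = cos s * (snd p \<bullet> b) + (-1 * sin s) * (fst p \<bullet> b)" for s p
        by (simp add: v_def inner_diff_left)
      show "param_Ck k W (\<lambda>s p. v s p \<bullet> b)"
        unfolding e by (intro param_Ck_add param_Ck_mult param_Ck_sin_cos param_Ck_const param_Ck_param)
          (auto simp: case_prod_unfold intro!: continuous_intros)
    qed (rule Suc.IH[OF ck])
    then show ?thesis unfolding g'_def by (intro param_Ck_sum) auto
  qed
  ultimately show ?case using c by auto
qed

lemma param_Ck_smooth_sphere:
  fixes f :: "'a::euclidean_space \<Rightarrow> real"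
  assumes "smooth_on_submanifold f (sphere 0 1)"
  shows "param_Ck k (UNIV \<times> orthonormal_pairs) (\<lambda>s p. f (arc s p))"
proof (rule param_Ck_local)
  let ?W = "UNIV \<times> (orthonormal_pairs :: ('a \<times> 'a) set)"
  have opW: "open {s. (s, p) \<in> ?W}" for p by (cases "p \<in> orthonormal_pairs") auto
  then show "open {s. (s, p) \<in> ?W}" for p .
  fix w :: "real \<times> 'a \<times> 'a" assume w: "w \<in> ?W"
  have "arc (fst w) (snd w) \<in> sphere 0 1" using w norm_arc by auto
  then obtain U g where U: "open U" "arc (fst w) (snd w) \<in> U" "Cinf_on g U" "\<And>y. y \<in> U \<inter> sphere 0 1 \<Longrightarrow> g y = f y"
    using assms[unfolded smooth_on_submanifold_def, THEN bspec, of "arc (fst w) (snd w)"] by blast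
  define N where "N = (\<lambda>w. arc (fst w) (snd w)) -` U"
  have "continuous_on UNIV (\<lambda>w::real \<times> 'a \<times> 'a. arc (fst w) (snd w))" unfolding arc_def by (intro continuous_intros)
  then have N: "open N" "w \<in> N" unfolding N_def using U by (auto intro: open_vimage)
  have "param_Ck k (?W \<inter> N) (\<lambda>s p. g (arc s p))"
    using U(3) by (intro param_Ck_compose_arc[OF U(1)]) (auto simp: Cinf_on_def N_def)
  then have "param_Ck k (?W \<inter> N) (\<lambda>s p. f (arc s p))"
  proof (rule param_Ck_cong[rotated 2])
    have "open {s. (s, p) \<in> N}" for p
    proof -
      have "continuous_on UNIV (\<lambda>s::real. (s, p))" by (intro continuous_intros)
      from open_vimage[OF N(1) this] show ?thesis by (simp add: vimage_def)
    qed
    then show "open {s. (s, p) \<in> ?W \<inter> N}" for p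
      using open_Int[OF opW[of p], of "{s. (s, p) \<in> N}"] by (simp only: Int_iff Collect_conj_eq)
    show "g (arc s p) = f (arc s p)" if "(s, p) \<in> ?W \<inter> N" for s p
      using that by (intro U(4)) (simp add: N_def norm_arc)
  qed
  then show "\<exists>N. open N \<and> w \<in> N \<and> param_Ck k (?W \<inter> N) (\<lambda>s p. f (arc s p))" using N by blast
qed

section \<open>Derivatives and inverse functions depending on a parameter\<close>

lemma param_Ck_derivative:
  assumes op: "\<And>p. open {s. (s, p) \<in> W}" and f: "\<And>k. param_Ck k W f"
  obtains f' where "\<And>s p. (s, p) \<in> W \<Longrightarrow> ((\<lambda>s. f s p) has_real_derivative f' s p) (at s)"
    "\<And>k. param_Ck k W f'"
proof -
  \<comment> \<open>Each order k brings its own witness for the derivative. \<open>deriv\<close> is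
    one function that agrees with all of them on W.\<close>
  define f' where "f' s p = deriv (\<lambda>s. f s p) s" for s p
  have d: "((\<lambda>s. f s p) has_real_derivative f' s p) (at s)" if "(s, p) \<in> W" for s p
  proof -
    obtain g where "((\<lambda>s. f s p) has_real_derivative g s p) (at s)" using f[of "Suc 0"] \<open>(s, p) \<in> W\<close> by (auto simp del: split_paired_All)
    then show ?thesis unfolding f'_def using DERIV_imp_deriv by fastforce
  qed
  have "param_Ck k W f'" for k
  proof -
    obtain g where g: "\<And>s p. (s, p) \<in> W \<Longrightarrow> ((\<lambda>s. f s p) has_real_derivative g s p) (at s)" "param_Ck k W g"
      using f[of "Suc k"] by auto
    show ?thesis
      by (rule param_Ck_cong[OF op _ g(2)]) (use d g(1) DERIV_unique in blast)
  qed
  then show ?thesis using that d by blast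
qed

text \<open>An inverse function theorem with an interval of definition common to all parameters: the
  slope of \<open>\<Phi>\<close> is at least e throughout. The function \<open>F k\<close> is the
  k-th derivative in t of H after the change of variable s = \<open>\<phi> t p\<close>, and its
  continuity reaches the closed interval so that it is bounded there.\<close>

lemma param_inverse_function:
  fixes \<Phi> \<Phi>' H :: "real \<Rightarrow> 'p::euclidean_space \<Rightarrow> real"
  assumes P: "compact P" and \<delta>: "0 < \<delta>" and e: "0 < e"
    and dPhi: "\<And>s p. \<bar>s\<bar> < \<delta> \<Longrightarrow> p \<in> P \<Longrightarrow> ((\<lambda>s. \<Phi> s p) has_real_derivative \<Phi>' s p) (at s)"
    and ge: "\<And>s p. \<bar>s\<bar> < \<delta> \<Longrightarrow> p \<in> P \<Longrightarrow> e \<le> \<Phi>' s p"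
    and zero: "\<And>p. p \<in> P \<Longrightarrow> \<Phi> 0 p = 0"
    and smPhi: "\<And>k. param_Ck k ({-\<delta><..<\<delta>} \<times> P) \<Phi>"
    and smPhi': "\<And>k. param_Ck k ({-\<delta><..<\<delta>} \<times> P) \<Phi>'"
    and smH: "\<And>k. param_Ck k ({-\<delta><..<\<delta>} \<times> P) H"
    and a: "0 < a" "a < \<delta>"
  obtains \<phi> F t0 where "0 < t0"
    "\<And>t p. \<bar>t\<bar> \<le> t0 \<Longrightarrow> p \<in> P \<Longrightarrow> \<bar>\<phi> t p\<bar> \<le> a \<and> \<Phi> (\<phi> t p) p = t"
    "\<And>s s' p. \<bar>s\<bar> \<le> a \<Longrightarrow> \<bar>s'\<bar> \<le> a \<Longrightarrow> p \<in> P \<Longrightarrow> \<Phi> s p \<le> \<Phi> s' p \<longleftrightarrow> s \<le> s'"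
    "\<And>t p. F 0 t p = H (\<phi> t p) p"
    "\<And>k. continuous_on ({-t0..t0} \<times> P) (\<lambda>(t, p). F k t p)"
    "\<And>k t p. \<bar>t\<bar> < t0 \<Longrightarrow> p \<in> P \<Longrightarrow> ((\<lambda>t. F k t p) has_real_derivative F (Suc k) t p) (at t)"
proof -
  let ?W = "{-\<delta><..<\<delta>} \<times> P"
  have opW: "open {s. (s, p) \<in> ?W}" for p
  proof (cases "p \<in> P")
    case True
    then have "{s. (s, p) \<in> ?W} = {-\<delta><..<\<delta>}" by auto
    then show ?thesis by simp
  qed simp
  have grow: "\<Phi> s' p - \<Phi> s p \<ge> e * (s' - s)" if "s \<le> s'" "\<bar>s\<bar> \<le> a" "\<bar>s'\<bar> \<le> a" "p \<in> P" for s s' p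
  proof (cases "s = s'")
    case False
    then have "s < s'" using that by simp
    then obtain z where z: "s < z" "z < s'" "\<Phi> s' p - \<Phi> s p = (s' - s) * \<Phi>' z p"
    proof -
      have "((\<lambda>s. \<Phi> s p) has_real_derivative \<Phi>' x p) (at x)" if "s \<le> x" "x \<le> s'" for x
        using that \<open>\<bar>s\<bar> \<le> a\<close> \<open>\<bar>s'\<bar> \<le> a\<close> a \<open>p \<in> P\<close> by (intro dPhi) auto
      from MVT2[OF \<open>s < s'\<close> this] show ?thesis using that by blast
    qed
    moreover have "e \<le> \<Phi>' z p" using z that a by (intro ge) auto
    ultimately show ?thesis using \<open>s < s'\<close> by (simp add: mult.commute mult_left_mono)
  qed simp
  have mono: "\<Phi> s p \<le> \<Phi> s' p \<longleftrightarrow> s \<le> s'" if "\<bar>s\<bar> \<le> a" "\<bar>s'\<bar> \<le> a" "p \<in> P" for s s' p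
  proof (cases "s \<le> s'")
    case True
    moreover have "0 \<le> e * (s' - s)" using True e by simp
    ultimately show ?thesis using grow[OF True that] by simp
  next
    case False
    moreover have "0 < e * (s - s')" using False e by simp
    ultimately show ?thesis using grow[of s' s p] that by auto
  qed
  \<comment> \<open>With slope at least e and value 0 at 0, \<open>\<Phi>\<close> reaches beyond e a
    in absolute value at a and - a.\<close>
  define t0 where "t0 = e * a"
  have t0: "0 < t0" using e a by (simp add: t0_def)
  have ex: "\<exists>s. \<bar>s\<bar> \<le> a \<and> \<Phi> s p = t" if "\<bar>t\<bar> \<le> t0" "p \<in> P" for t p
  proof -
    have "continuous_on {-a..a} (\<lambda>s. \<Phi> s p)"
      by (rule DERIV_continuous_on, rule has_field_derivative_at_within, rule dPhi) (use a that in auto)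
    moreover have "\<Phi> (-a) p \<le> t" "t \<le> \<Phi> a p"
      using grow[of "-a" 0 p] grow[of 0 a p] zero[OF that(2)] that a by (auto simp: t0_def)
    ultimately obtain s where "-a \<le> s" "s \<le> a" "\<Phi> s p = t"
      using IVT'[of "\<lambda>s. \<Phi> s p" "-a" t a] a(1) by (metis less_eq_real_def neg_le_0_iff_le order_trans)
    then show ?thesis by (intro exI[of _ s]) (simp add: abs_le_iff)
  qed
  define \<phi> where "\<phi> t p = (SOME s. \<bar>s\<bar> \<le> a \<and> \<Phi> s p = t)" for t p
  have \<phi>: "\<bar>\<phi> t p\<bar> \<le> a \<and> \<Phi> (\<phi> t p) p = t" if "\<bar>t\<bar> \<le> t0" "p \<in> P" for t p
    unfolding \<phi>_def by (rule someI_ex[OF ex[OF that]])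
  have \<phi>_eq: "\<phi> t p = s" if "\<bar>t\<bar> \<le> t0" "p \<in> P" "\<bar>s\<bar> \<le> a" "\<Phi> s p = t" for t p s
    using \<phi>[OF that(1,2)] mono[of "\<phi> t p" s p] mono[of s "\<phi> t p" p] that by auto
  have cont\<phi>: "continuous_on ({-t0..t0} \<times> P) (\<lambda>w. \<phi> (fst w) (snd w))"
  \<comment> \<open>The graph of \<open>\<phi>\<close> is the zero set of the continuous function
    \<open>\<Phi>\<close> minus t on a closed set, and the target interval is compact.\<close>
  proof (rule continuous_from_closed_graph[where T = "{-a..a}"])
    let ?C = "({-t0..t0} \<times> P) \<times> {-a..a}"
    have cl: "closed ?C" using P by (intro closed_Times) (auto simp: compact_imp_closed)
    have "continuous_on ?C (\<lambda>x. (\<lambda>(s, p). \<Phi> s p) (snd x, snd (fst x)))"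
      by (rule continuous_on_compose2[OF param_Ck_continuous[OF smPhi]])
        (use a in \<open>auto intro!: continuous_intros\<close>)
    then have "continuous_on ?C (\<lambda>x. \<Phi> (snd x) (snd (fst x)) - fst (fst x))"
      by (auto intro!: continuous_intros)
    from continuous_closed_preimage_constant[OF this cl, of 0]
    have "closed {x \<in> ?C. \<Phi> (snd x) (snd (fst x)) - fst (fst x) = 0}" .
    also have "{x \<in> ?C. \<Phi> (snd x) (snd (fst x)) - fst (fst x) = 0} = (\<lambda>w. (w, \<phi> (fst w) (snd w))) ` ({-t0..t0} \<times> P)"
    proof (intro set_eqI iffI)
      fix x assume "x \<in> {x \<in> ?C. \<Phi> (snd x) (snd (fst x)) - fst (fst x) = 0}"
      then have *: "fst x \<in> {-t0..t0} \<times> P" "\<bar>snd x\<bar> \<le> a" "\<Phi> (snd x) (snd (fst x)) = fst (fst x)" by auto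
      then have "\<phi> (fst (fst x)) (snd (fst x)) = snd x" by (intro \<phi>_eq) auto
      then show "x \<in> (\<lambda>w. (w, \<phi> (fst w) (snd w))) ` ({-t0..t0} \<times> P)"
        using *(1) by (intro image_eqI[of _ _ "fst x"]) (auto simp: prod_eq_iff)
    next
      fix x assume "x \<in> (\<lambda>w. (w, \<phi> (fst w) (snd w))) ` ({-t0..t0} \<times> P)"
      then show "x \<in> {x \<in> ?C. \<Phi> (snd x) (snd (fst x)) - fst (fst x) = 0}"
        using \<phi> by (fastforce simp: abs_le_iff)
    qed
    finally show "closed ((\<lambda>w. (w, \<phi> (fst w) (snd w))) ` ({-t0..t0} \<times> P))" .
    show "(\<lambda>w. \<phi> (fst w) (snd w)) \<in> {-t0..t0} \<times> P \<rightarrow> {-a..a}" using \<phi> by (fastforce simp: abs_le_iff)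
  qed simp
  have d\<phi>: "((\<lambda>t. \<phi> t p) has_real_derivative inverse (\<Phi>' (\<phi> t p) p)) (at t)" if t: "\<bar>t\<bar> < t0" and p: "p \<in> P" for t p
  proof (rule DERIV_inverse_function[where a = "-t0" and b = t0])
    have b: "\<bar>\<phi> t p\<bar> < \<delta>" using \<phi>[of t p] t p a by fastforce
    show "((\<lambda>s. \<Phi> s p) has_real_derivative \<Phi>' (\<phi> t p) p) (at (\<phi> t p))" by (rule dPhi[OF b p])
    show "\<Phi>' (\<phi> t p) p \<noteq> 0" using ge[OF b p] e by simp
    show "- t0 < t" "t < t0" using t by auto
    show "\<Phi> (\<phi> y p) p = y" if "- t0 < y" "y < t0" for y using \<phi>[of y p] that p by auto
    have "continuous_on {-t0..t0} (\<lambda>t. (\<lambda>w. \<phi> (fst w) (snd w)) (t, p))"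
      by (rule continuous_on_compose2[OF cont\<phi>]) (use p in \<open>auto intro!: continuous_intros\<close>)
    then have "continuous_on {-t0..t0} (\<lambda>t. \<phi> t p)" by simp
    then have "continuous_on {-t0<..<t0} (\<lambda>t. \<phi> t p)" by (rule continuous_on_subset) auto
    then show "isCont (\<lambda>t. \<phi> t p) t" using t by (simp add: continuous_on_eq_continuous_at abs_less_iff)
  qed
  \<comment> \<open>Differentiating in t = \<open>\<Phi>\<close> means differentiating in s and
    dividing by \<open>\<Phi>'\<close>. Iterating this operator on H gives functions of s whose
    composition with \<open>\<phi>\<close> are the successive derivatives in t.\<close>
  have "\<exists>Hs. \<forall>k. (\<forall>j. param_Ck j ?W (Hs k)) \<and> (k = 0 \<longrightarrow> Hs k = H) \<and>
    (\<forall>s p. (s, p) \<in> ?W \<longrightarrow> ((\<lambda>s. Hs k s p) has_real_derivative Hs (Suc k) s p * \<Phi>' s p) (at s))"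
  proof -
    have "\<exists>Hs. \<forall>k. ((\<forall>j. param_Ck j ?W (Hs k)) \<and> (k = 0 \<longrightarrow> Hs k = H)) \<and>
      (\<forall>s p. (s, p) \<in> ?W \<longrightarrow> ((\<lambda>s. Hs k s p) has_real_derivative Hs (Suc k) s p * \<Phi>' s p) (at s))"
    proof (rule dependent_nat_choice[where P = "\<lambda>k g. (\<forall>j. param_Ck j ?W g) \<and> (k = 0 \<longrightarrow> g = H)"
          and Q = "\<lambda>k g g'. \<forall>s p. (s, p) \<in> ?W \<longrightarrow> ((\<lambda>s. g s p) has_real_derivative g' s p * \<Phi>' s p) (at s)"])
      show "\<exists>x. (\<forall>j. param_Ck j ?W x) \<and> (0 = (0::nat) \<longrightarrow> x = H)" using smH by blast
      fix g and k :: nat assume "(\<forall>j. param_Ck j ?W g) \<and> (k = 0 \<longrightarrow> g = H)"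
      then obtain g' where g': "\<And>s p. (s, p) \<in> ?W \<Longrightarrow> ((\<lambda>s. g s p) has_real_derivative g' s p) (at s)"
        "\<And>k. param_Ck k ?W g'"
        using param_Ck_derivative[OF opW, of g] by blast
      have nz: "\<Phi>' s p \<noteq> 0" if "(s, p) \<in> ?W" for s p using ge[of s p] that e by fastforce
      show "\<exists>y. ((\<forall>j. param_Ck j ?W y) \<and> (Suc k = 0 \<longrightarrow> y = H)) \<and>
        (\<forall>s p. (s, p) \<in> ?W \<longrightarrow> ((\<lambda>s. g s p) has_real_derivative y s p * \<Phi>' s p) (at s))"
      proof (intro exI[of _ "\<lambda>s p. g' s p * inverse (\<Phi>' s p)"] conjI allI impI)
        show "param_Ck j ?W (\<lambda>s p. g' s p * inverse (\<Phi>' s p))" for j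
          by (intro param_Ck_mult param_Ck_inverse g' smPhi' nz)
        show "((\<lambda>s. g s p) has_real_derivative g' s p * inverse (\<Phi>' s p) * \<Phi>' s p) (at s)" if "(s, p) \<in> ?W" for s p
          using g'(1)[OF that] nz[OF that] by (simp add: mult.assoc left_inverse)
      qed simp
    qed
    then show ?thesis by blast
  qed
  then obtain Hs where Hs: "\<And>k j. param_Ck j ?W (Hs k)" "Hs 0 = H"
    "\<And>k s p. (s, p) \<in> ?W \<Longrightarrow> ((\<lambda>s. Hs k s p) has_real_derivative Hs (Suc k) s p * \<Phi>' s p) (at s)" by metis
  show ?thesis
  proof (rule that[OF t0 \<phi> mono, of "\<lambda>k t p. Hs k (\<phi> t p) p"])
    show "Hs 0 (\<phi> t p) p = H (\<phi> t p) p" for t p by (simp add: Hs)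
    show "continuous_on ({-t0..t0} \<times> P) (\<lambda>(t, p). Hs k (\<phi> t p) p)" for k
    proof -
      have "continuous_on ({-t0..t0} \<times> P) (\<lambda>w. (\<lambda>(s, p). Hs k s p) (\<phi> (fst w) (snd w), snd w))"
        by (rule continuous_on_compose2[OF param_Ck_continuous[OF Hs(1)]])
          (use \<phi> a in \<open>fastforce intro!: continuous_intros cont\<phi> simp: abs_le_iff\<close>)+
      then show ?thesis by (simp add: case_prod_unfold)
    qed
    fix k t p assume t: "\<bar>t\<bar> < t0" and p: "p \<in> P"
    have b: "\<bar>\<phi> t p\<bar> < \<delta>" using \<phi>[of t p] t p a by fastforce
    have "((\<lambda>t. Hs k (\<phi> t p) p) has_real_derivative (Hs (Suc k) (\<phi> t p) p * \<Phi>' (\<phi> t p) p) * inverse (\<Phi>' (\<phi> t p) p)) (at t)"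
      by (rule DERIV_chain2[OF Hs(3) d\<phi>[OF t p]]) (use b p in auto)
    moreover have "\<Phi>' (\<phi> t p) p \<noteq> 0" using ge[OF b p] e by simp
    ultimately show "((\<lambda>t. Hs k (\<phi> t p) p) has_real_derivative Hs (Suc k) (\<phi> t p) p) (at t)"
      by (simp add: mult.assoc right_inverse)
  qed
qed

text \<open>In the half plane spanned by \<open>snd p\<close> and the ray of \<open>fst p\<close>,
  the boundary point at elevation s has height q sin s and distance q cos s from the axis. At s = 0
  the height has derivative q > 0, so near the hyperplane the height t can replace s as parameter,
  and the section has radius q cos s at s = \<open>\<phi> t p\<close>. The power m is stored in F
  because the volume involves the radius only through it.\<close>

lemma star_section_smooth_radius:
  fixes \<rho> :: "'a::euclidean_space \<Rightarrow> real"
  assumes sm: "\<And>k. param_Ck k (UNIV \<times> orthonormal_pairs) (\<lambda>s p. \<rho> (arc s p))"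
    and c0: "0 < c0" "\<And>u. norm u = 1 \<Longrightarrow> c0 \<le> \<rho> u" and m: "1 \<le> m"
  obtains F t0 where "0 < t0"
    "\<And>k. continuous_on ({-t0..t0} \<times> orthonormal_pairs) (\<lambda>(t, p). F k t p)"
    "\<And>k t p. \<bar>t\<bar> < t0 \<Longrightarrow> p \<in> orthonormal_pairs \<Longrightarrow> ((\<lambda>t. F k t p) has_real_derivative F (Suc k) t p) (at t)"
    "\<And>t r p. \<bar>t\<bar> \<le> t0 \<Longrightarrow> p \<in> orthonormal_pairs \<Longrightarrow> 0 < r \<Longrightarrow>
      norm (t *\<^sub>R snd p + r *\<^sub>R fst p) \<le> \<rho> (sgn (t *\<^sub>R snd p + r *\<^sub>R fst p)) \<longleftrightarrow> r ^ m \<le> F 0 t p"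
    "\<And>t p. \<bar>t\<bar> \<le> t0 \<Longrightarrow> p \<in> orthonormal_pairs \<Longrightarrow> 0 \<le> F 0 t p"
proof -
  let ?P = "orthonormal_pairs :: ('a \<times> 'a) set"
  define q where "q s p = \<rho> (arc s p)" for s p
  define \<Phi> where "\<Phi> s p = q s p * sin s" for s p
  define H where "H s p = (q s p * cos s) ^ m" for s p
  have q0: "c0 \<le> q s p" if "p \<in> ?P" for s p unfolding q_def using c0(2) norm_arc[OF that] by blast
  have smq: "param_Ck k (UNIV \<times> ?P) q" for k using sm[of k] by (simp add: q_def[abs_def])
  have smPhi: "param_Ck k (UNIV \<times> ?P) \<Phi>" for k
    unfolding \<Phi>_def[abs_def] by (intro param_Ck_mult smq param_Ck_sin_cos)
  have smH: "param_Ck k (UNIV \<times> ?P) H" for k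
    unfolding H_def[abs_def] by (intro param_Ck_power param_Ck_mult smq param_Ck_sin_cos)
  have opU: "open {s::real. (s, p) \<in> UNIV \<times> ?P}" for p by (cases "p \<in> ?P") auto
  obtain q' where q': "\<And>s p. (s, p) \<in> UNIV \<times> ?P \<Longrightarrow> ((\<lambda>s. q s p) has_real_derivative q' s p) (at s)"
    "\<And>k. param_Ck k (UNIV \<times> ?P) q'"
    using param_Ck_derivative[OF opU smq] by blast
  define \<Phi>' where "\<Phi>' s p = q' s p * sin s + cos s * q s p" for s p
  have smPhi': "param_Ck k (UNIV \<times> ?P) \<Phi>'" for k
    unfolding \<Phi>'_def[abs_def] by (intro param_Ck_add param_Ck_mult smq q' param_Ck_sin_cos)
  have dPhi: "((\<lambda>s. \<Phi> s p) has_real_derivative \<Phi>' s p) (at s)" if "p \<in> ?P" for s p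
    unfolding \<Phi>_def[abs_def] \<Phi>'_def by (rule DERIV_mult) (use that in \<open>auto intro!: q' DERIV_sin\<close>)
  have "compact ({-1..1::real} \<times> ?P)" by (intro compact_Times compact_orthonormal_pairs) auto
  moreover have "continuous_on ({-1..1} \<times> ?P) (\<lambda>(s, p). \<Phi>' s p)"
    by (rule continuous_on_subset[OF param_Ck_continuous[OF smPhi']]) auto
  ultimately have "uniformly_continuous_on ({-1..1} \<times> ?P) (\<lambda>(s, p). \<Phi>' s p)"
    by (rule compact_uniformly_continuous[rotated])
  then obtain d where d: "0 < d" "\<And>x x'. x \<in> {-1..1} \<times> ?P \<Longrightarrow> x' \<in> {-1..1} \<times> ?P \<Longrightarrow> dist x' x < d \<Longrightarrow>
      dist ((\<lambda>(s, p). \<Phi>' s p) x') ((\<lambda>(s, p). \<Phi>' s p) x) < c0 / 2"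
    unfolding uniformly_continuous_on_def using c0(1) by (metis half_gt_zero)
  \<comment> \<open>Within distance d the derivative \<open>\<Phi>'\<close> moves by less than c0/2
    from its value \<open>q 0 p\<close>, which is at least c0.\<close>
  define \<delta> where "\<delta> = min (d / 2) 1"
  define a where "a = \<delta> / 2"
  have \<delta>: "0 < \<delta>" "\<delta> \<le> 1" "\<delta> < d" using d(1) by (auto simp: \<delta>_def)
  have a: "0 < a" "a < \<delta>" "a < pi / 2" using \<delta> pi_gt3 by (auto simp: a_def)
  have ge: "c0 / 2 \<le> \<Phi>' s p" if "\<bar>s\<bar> < \<delta>" "p \<in> ?P" for s p
  proof -
    have "dist ((\<lambda>(s, p). \<Phi>' s p) (s, p)) ((\<lambda>(s, p). \<Phi>' s p) (0, p)) < c0 / 2"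
      by (rule d(2)) (use that \<delta> in \<open>auto simp: dist_Pair_Pair\<close>)
    moreover have "\<Phi>' 0 p = q 0 p" by (simp add: \<Phi>'_def)
    ultimately show ?thesis using q0[OF that(2), of 0] unfolding dist_real_def abs_less_iff by (simp add: field_simps)
  qed
  obtain \<phi> F t1 where F: "0 < t1"
    "\<And>t p. \<bar>t\<bar> \<le> t1 \<Longrightarrow> p \<in> ?P \<Longrightarrow> \<bar>\<phi> t p\<bar> \<le> a \<and> \<Phi> (\<phi> t p) p = t"
    "\<And>s s' p. \<bar>s\<bar> \<le> a \<Longrightarrow> \<bar>s'\<bar> \<le> a \<Longrightarrow> p \<in> ?P \<Longrightarrow> \<Phi> s p \<le> \<Phi> s' p \<longleftrightarrow> s \<le> s'"
    "\<And>t p. F 0 t p = H (\<phi> t p) p"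
    "\<And>k. continuous_on ({-t1..t1} \<times> ?P) (\<lambda>(t, p). F k t p)"
    "\<And>k t p. \<bar>t\<bar> < t1 \<Longrightarrow> p \<in> ?P \<Longrightarrow> ((\<lambda>t. F k t p) has_real_derivative F (Suc k) t p) (at t)"
  proof -
    have sub: "{-\<delta><..<\<delta>} \<times> ?P \<subseteq> UNIV \<times> ?P" by auto
    have h: "0 < c0 / 2" using c0 by simp
    have z: "\<Phi> 0 p = 0" for p by (simp add: \<Phi>_def)
    show ?thesis
      by (rule param_inverse_function[OF compact_orthonormal_pairs \<delta>(1) h dPhi ge z param_Ck_subset[OF smPhi sub]
            param_Ck_subset[OF smPhi' sub] param_Ck_subset[OF smH sub] a(1,2)])
        (assumption+, rule that)
  qed
  \<comment> \<open>The second bound disposes of elevations outside [-a, a]: the boundary point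
    there has height at least c0 sin a in absolute value as long as the elevation stays below
    pi/2.\<close>
  define t0 where "t0 = min t1 (c0 * sin a)"
  have sina: "0 < sin a" using a by (intro sin_gt_zero) auto
  have t0: "0 < t0" "t0 \<le> t1" "t0 \<le> c0 * sin a" using F(1) c0(1) sina by (auto simp: t0_def)
  have R: "0 < q (\<phi> t p) p * cos (\<phi> t p)" if "\<bar>t\<bar> \<le> t0" "p \<in> ?P" for t p
  proof -
    have "\<bar>\<phi> t p\<bar> < pi / 2" using F(2)[of t p] that t0 a by fastforce
    then have "0 < cos (\<phi> t p)" by (intro cos_gt_zero_pi) auto
    then show ?thesis using q0[OF that(2), of "\<phi> t p"] c0(1) by simp
  qed
  have main: "norm (t *\<^sub>R snd p + r *\<^sub>R fst p) \<le> \<rho> (sgn (t *\<^sub>R snd p + r *\<^sub>R fst p)) \<longleftrightarrow> r \<le> q (\<phi> t p) p * cos (\<phi> t p)"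
    if t: "\<bar>t\<bar> \<le> t0" and p: "p \<in> ?P" and r: "0 < r" for t r p
  proof -
    \<comment> \<open>Polar coordinates in the half plane: the point has norm l and elevation
      \<open>\<psi>\<close>. Membership reads l \<le> q at \<open>\<psi>\<close>, while the claim
      concerns q at \<open>\<phi> t p\<close>; the two are linked by comparing the angles through
      their tangents.\<close>
    define \<psi> where "\<psi> = arctan (t / r)"
    define l where "l = sqrt (r\<^sup>2 + t\<^sup>2)"
    have \<psi>: "- (pi / 2) < \<psi>" "\<psi> < pi / 2" using arctan_bounded[of "t / r"] by (auto simp: \<psi>_def)
    have l: "0 < l" "l\<^sup>2 = r\<^sup>2 + t\<^sup>2" using r by (auto simp: l_def add_pos_nonneg)
    have "sqrt (1 + (t / r)\<^sup>2) = l / r"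
      using r l by (intro real_sqrt_unique) (auto simp: power_divide field_simps)
    then have cs: "cos \<psi> = r / l" "sin \<psi> = t / l"
      using r l(1) by (auto simp: \<psi>_def cos_arctan sin_arctan)
    have x: "t *\<^sub>R snd p + r *\<^sub>R fst p = l *\<^sub>R arc \<psi> p"
      using l(1) by (simp add: arc_def cs scaleR_add_right add.commute)
    have nx: "norm (t *\<^sub>R snd p + r *\<^sub>R fst p) = l" unfolding x using l(1) norm_arc[OF p] by simp
    have sx: "sgn (t *\<^sub>R snd p + r *\<^sub>R fst p) = arc \<psi> p"
      unfolding x using l(1) norm_arc[OF p, of \<psi>] by (simp add: sgn_div_norm)
    have lhs: "norm (t *\<^sub>R snd p + r *\<^sub>R fst p) \<le> \<rho> (sgn (t *\<^sub>R snd p + r *\<^sub>R fst p)) \<longleftrightarrow> l \<le> q \<psi> p"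
      by (simp add: nx sx q_def)
    let ?f = "\<phi> t p"
    have f: "\<bar>?f\<bar> \<le> a" "q ?f p * sin ?f = t" using F(2)[of t p] t t0 p by (auto simp: \<Phi>_def)
    note Rp = R[OF t p]
    have tan\<psi>: "tan \<psi> = t / r" by (simp add: \<psi>_def tan_arctan)
    have cosf: "0 < cos ?f" using f a by (intro cos_gt_zero_pi) auto
    have tanf: "tan ?f = t / (q ?f p * cos ?f)"
    proof -
      have "q ?f p \<noteq> 0" using q0[OF p, of ?f] c0 by auto
      then have "t / (q ?f p * cos ?f) = sin ?f / cos ?f" by (subst f(2)[symmetric]) simp
      then show ?thesis by (simp add: tan_def)
    qed
    have tanle: "?f \<le> \<psi> \<longleftrightarrow> tan ?f \<le> tan \<psi>" "\<psi> \<le> ?f \<longleftrightarrow> tan \<psi> \<le> tan ?f"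
      using tan_mono_le_eq[of ?f \<psi>] tan_mono_le_eq[of \<psi> ?f] f(1) a \<psi> by auto
    have q\<psi>: "c0 \<le> q \<psi> p" using q0[OF p] by simp
    \<comment> \<open>Multiplication by sin \<open>\<psi>\<close> turns the comparison of lengths
      into one of heights; it preserves, reverses or loses the inequality according to the sign of
      t.\<close>
    consider "t = 0" | "0 < t" | "t < 0" by linarith
    then have "l \<le> q \<psi> p \<longleftrightarrow> r \<le> q ?f p * cos ?f"
    proof cases
      case 1
      then have "?f = 0" using f(2) q0[OF p, of ?f] c0(1) f(1) a sin_gt_zero[of ?f] sin_gt_zero[of "- ?f"]
        by (auto simp: abs_le_iff not_less) (smt (verit) sin_gt_zero pi_gt_zero sin_minus)
      moreover have "\<psi> = 0" "l = r" using 1 r by (auto simp: \<psi>_def l_def)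
      ultimately show ?thesis by simp
    next
      case 2
      have "l \<le> q \<psi> p \<longleftrightarrow> t \<le> \<Phi> \<psi> p"
      proof -
        have "t \<le> \<Phi> \<psi> p \<longleftrightarrow> l * sin \<psi> \<le> q \<psi> p * sin \<psi>" using l(1) by (simp add: \<Phi>_def cs)
        also have "\<dots> \<longleftrightarrow> l \<le> q \<psi> p" using 2 l(1) by (intro mult_le_cancel_right_pos) (simp add: cs)
        finally show ?thesis by simp
      qed
      also have "\<dots> \<longleftrightarrow> ?f \<le> \<psi>"
      proof (cases "\<psi> \<le> a")
        case True
        have "0 < \<psi>" using 2 r by (simp add: \<psi>_def)
        then show ?thesis using F(3)[of ?f \<psi> p] f(1) True p F(2)[of t p] t t0 by auto
      next
        case False
        have "sin a \<le> sin \<psi>" using False a \<psi> by (subst sin_mono_le_eq) auto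
        then have "c0 * sin a \<le> q \<psi> p * sin \<psi>" using q\<psi> c0 sina by (intro mult_mono) auto
        then show ?thesis using False f(1) t t0 by (auto simp: \<Phi>_def)
      qed
      also have "\<dots> \<longleftrightarrow> t / (q ?f p * cos ?f) \<le> t / r" by (simp only: tanle tan\<psi> tanf)
      also have "\<dots> \<longleftrightarrow> r \<le> q ?f p * cos ?f"
        using 2 r Rp by (simp only: divide_le_eq_1 divide_le_cancel divide_inverse mult_le_cancel_left_pos inverse_le_iff_le)
      finally show ?thesis .
    next
      case 3
      have "l \<le> q \<psi> p \<longleftrightarrow> \<Phi> \<psi> p \<le> t"
      proof -
        have "\<Phi> \<psi> p \<le> t \<longleftrightarrow> q \<psi> p * sin \<psi> \<le> l * sin \<psi>" using l(1) by (simp add: \<Phi>_def cs)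
        also have "\<dots> \<longleftrightarrow> l \<le> q \<psi> p" using 3 l(1) by (intro mult_le_cancel_right_neg) (simp add: cs divide_neg_pos)
        finally show ?thesis by simp
      qed
      also have "\<dots> \<longleftrightarrow> \<psi> \<le> ?f"
      proof (cases "- a \<le> \<psi>")
        case True
        have "\<psi> < 0" using 3 r by (simp add: \<psi>_def divide_neg_pos)
        then show ?thesis using F(3)[of \<psi> ?f p] f(1) True p F(2)[of t p] t t0 by auto
      next
        case False
        have "sin a \<le> sin (- \<psi>)" using False a \<psi> by (subst sin_mono_le_eq) auto
        then have "c0 * sin a \<le> q \<psi> p * sin (- \<psi>)" using q\<psi> c0 sina by (intro mult_mono) auto
        then show ?thesis using False f(1) t t0 by (auto simp: \<Phi>_def)
      qed
      also have "\<dots> \<longleftrightarrow> t / r \<le> t / (q ?f p * cos ?f)" by (simp only: tanle tan\<psi> tanf)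
      also have "\<dots> \<longleftrightarrow> r \<le> q ?f p * cos ?f"
        using 3 r Rp by (simp only: divide_inverse mult_le_cancel_left_neg inverse_le_iff_le)
      finally show ?thesis .
    qed
    then show ?thesis using lhs by simp
  qed
  show ?thesis
  proof (rule that[OF t0(1)])
    show "continuous_on ({-t0..t0} \<times> ?P) (\<lambda>(t, p). F k t p)" for k
      by (rule continuous_on_subset[OF F(5)]) (use t0 in auto)
    show "((\<lambda>t. F k t p) has_real_derivative F (Suc k) t p) (at t)" if "\<bar>t\<bar> < t0" "p \<in> ?P" for k t p
      using that t0 by (intro F(6)) auto
    show "norm (t *\<^sub>R snd p + r *\<^sub>R fst p) \<le> \<rho> (sgn (t *\<^sub>R snd p + r *\<^sub>R fst p)) \<longleftrightarrow> r ^ m \<le> F 0 t p"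
      if "\<bar>t\<bar> \<le> t0" "p \<in> ?P" "0 < r" for t r p
      using main[OF that] R[OF that(1,2)] that(3) m by (simp add: F(4) H_def)
    show "0 \<le> F 0 t p" if "\<bar>t\<bar> \<le> t0" "p \<in> ?P" for t p
      using R[OF that] by (simp add: F(4) H_def)
  qed
qed

section \<open>Star bodies and their sections\<close>

lemma star_body_mem_iff:
  assumes K: "star_body K" and x: "x \<noteq> 0"
  shows "x \<in> K \<longleftrightarrow> norm x \<le> radial_function K (sgn x)"
proof -
  define u where "u = sgn x"
  define L where "L = {l. 0 < l \<and> l *\<^sub>R u \<in> K}"
  have u: "norm u = 1" "norm x *\<^sub>R u = x" using x by (auto simp: u_def norm_sgn sgn_div_norm)
  have cK: "compact K" and seg: "\<And>y. y \<in> K \<Longrightarrow> closed_segment 0 y \<subseteq> K" and pos: "0 < radial_function K u"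
    using K u by (auto simp: star_body_def)
  have \<rho>: "radial_function K u = Sup L" by (simp add: radial_function_def L_def)
  obtain b where b: "\<And>y. y \<in> K \<Longrightarrow> norm y \<le> b" using cK compact_imp_bounded bounded_iff by metis
  have bdd: "bdd_above L" using b u by (intro bdd_aboveI[of _ b]) (fastforce simp: L_def)
  have ne: "L \<noteq> {}"
  proof -
    obtain e where e: "0 < e" "cball 0 e \<subseteq> K" using K by (auto simp: star_body_def mem_interior_cball)
    then have "e *\<^sub>R u \<in> K" using u by (intro subsetD[OF e(2)]) simp
    then have "e \<in> L" using e u by (simp add: L_def)
    then show ?thesis by auto
  qed
  have att: "Sup L *\<^sub>R u \<in> K"
  proof -
    have "Sup L \<in> closure L" using closure_contains_Sup[OF ne bdd] .
    moreover have "closed ((\<lambda>l. l *\<^sub>R u) -` K)"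
      by (intro closed_vimage compact_imp_closed cK continuous_intros)
    moreover have "L \<subseteq> (\<lambda>l. l *\<^sub>R u) -` K" by (auto simp: L_def)
    ultimately show ?thesis using closure_minimal by blast
  qed
  show ?thesis
  proof
    assume "x \<in> K"
    then have "norm x \<in> L" using u x by (simp add: L_def)
    then show "norm x \<le> radial_function K (sgn x)" using cSup_upper[OF _ bdd] \<rho> by (simp add: u_def)
  next
    assume le: "norm x \<le> radial_function K (sgn x)"
    have "x = (norm x / Sup L) *\<^sub>R (Sup L *\<^sub>R u)" using pos u by (simp add: \<rho>)
    moreover have "0 \<le> norm x / Sup L" "norm x / Sup L \<le> 1" using le pos by (simp_all add: \<rho>[symmetric] flip: u_def)
    ultimately have "x \<in> closed_segment 0 (Sup L *\<^sub>R u)" by (auto simp: in_segment intro!: exI[of _ "norm x / Sup L"])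
    then show "x \<in> K" using seg[OF att] by auto
  qed
qed

lemma star_body_zero_mem: "star_body K \<Longrightarrow> 0 \<in> K"
  using interior_subset by (auto simp: star_body_def)

lemma star_body_borel: "star_body K \<Longrightarrow> K \<in> sets borel"
  by (simp add: star_body_def compact_imp_closed borel_closed)

lemma star_body_bounded:
  assumes "star_body K"
  obtains R where "0 < R" "K \<subseteq> cball 0 R"
proof -
  have "bounded K" using assms by (simp add: star_body_def compact_imp_bounded)
  then obtain R where "0 < R" "\<And>x. x \<in> K \<Longrightarrow> norm x \<le> R" by (auto simp: bounded_pos)
  then show ?thesis using that by force
qed

lemma star_body_radial_lower:
  assumes "star_body (K :: 'a::euclidean_space set)"
  obtains c where "0 < c" "\<And>u. norm u = 1 \<Longrightarrow> c \<le> radial_function K u"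
proof -
  have "continuous_on (sphere 0 1) (radial_function K)" using assms by (simp add: star_body_def)
  moreover have "sphere (0::'a) 1 \<noteq> {}" by simp
  ultimately obtain v where v: "v \<in> sphere 0 1" "\<And>u. u \<in> sphere 0 1 \<Longrightarrow> radial_function K v \<le> radial_function K u"
    using continuous_attains_inf[of "sphere (0::'a) 1" "radial_function K"] compact_sphere by blast
  have "0 < radial_function K v" using assms v by (simp add: star_body_def)
  then show ?thesis using that v by force
qed

section \<open>Volume of star-shaped sets in a hyperplane\<close>

lemma nn_integral_rescaling_weight:
  assumes r: "0 < r" and m: "1 \<le> m"
  shows "(\<integral>\<^sup>+a. ennreal (indicator {r..} a * (real m * r ^ m * inverse a ^ Suc m)) \<partial>lborel) = 1"
proof -
  have "(\<integral>\<^sup>+a. ennreal (real m * r ^ m * inverse a ^ Suc m) * indicator {r..} a \<partial>lborel) = ennreal (0 - (- (r ^ m * inverse r ^ m)))"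
  proof (rule nn_integral_FTC_atLeast[where F = "\<lambda>a. - (r ^ m * inverse a ^ m)"])
    show "((\<lambda>a. - (r ^ m * inverse a ^ m)) has_real_derivative real m * r ^ m * inverse a ^ Suc m) (at a)" if "r \<le> a" for a
    proof -
      have "a \<noteq> 0" using that r by auto
      then have "((\<lambda>a. - (r ^ m * inverse a ^ m)) has_real_derivative - (r ^ m * (real m * inverse a ^ (m - 1) * - (inverse a * 1 * inverse a)))) (at a)"
        by (auto intro!: derivative_eq_intros)
      moreover have "inverse a ^ Suc m = inverse a ^ (m - 1) * inverse a * inverse a" using m by (cases m) auto
      ultimately show ?thesis by (simp add: mult_ac del: power_Suc)
    qed
    have "((\<lambda>a. - (r ^ m * inverse a ^ m)) \<longlongrightarrow> - (r ^ m * 0 ^ m)) at_top"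
      by (intro tendsto_minus tendsto_mult tendsto_const tendsto_power tendsto_inverse_0_at_top filterlim_ident)
    then show "((\<lambda>a. - (r ^ m * inverse a ^ m)) \<longlongrightarrow> 0) at_top" using m by (simp add: power_0_left split: if_splits)
  qed (use r in auto)
  moreover have "r ^ m * inverse r ^ m = 1" using r by (simp flip: power_mult_distrib)
  ultimately show ?thesis by (simp add: mult.commute ennreal_indicator[symmetric] ennreal_mult'[symmetric] del: ennreal_indicator)
qed

lemma nn_integral_power_interval:
  assumes c: "0 \<le> c" and m: "1 \<le> m"
  shows "(\<integral>\<^sup>+a. ennreal (indicator {0..c} a * (real m * a ^ (m - 1))) \<partial>lborel) = ennreal (c ^ m)"
proof -
  have "(\<integral>\<^sup>+a. ennreal (real m * a ^ (m - 1)) * indicator {0..c} a \<partial>lborel) = ennreal (c ^ m - 0 ^ m)"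
    by (rule nn_integral_FTC_Icc[where F = "\<lambda>a. a ^ m"]) (use c in \<open>auto intro!: derivative_eq_intros\<close>)
  then show ?thesis using m by (simp add: mult.commute power_0_left ennreal_indicator[symmetric] ennreal_mult'[symmetric] del: ennreal_indicator)
qed

text \<open>Insert the identity \<open>\<integral> m |y|\<^sup>m a\<^sup>-\<^sup>m\<^sup>-\<^sup>1 da = 1\<close> over \<open>a \<ge> |y|\<close>, swap the integrals and rescale \<open>y = a z\<close>.\<close>

lemma emeasure_perp_star_set:
  fixes \<xi> :: "'a::euclidean_space"
  assumes \<xi>: "norm \<xi> = 1" and dim: "2 \<le> DIM('a)" and [measurable]: "G \<in> borel_measurable borel"
    and G0: "\<And>y. 0 \<le> G y" and hom: "\<And>a y. 0 < a \<Longrightarrow> G (a *\<^sub>R y) = G y"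
  shows "emeasure (perp_lborel \<xi>) {y. norm y ^ (DIM('a) - 1) \<le> G y} =
    (\<integral>\<^sup>+y. ennreal (indicator (cball 0 1) y * G y) \<partial>perp_lborel \<xi>)"
proof -
  define m where "m = DIM('a) - 1"
  have m: "1 \<le> m" using dim by (simp add: m_def)
  interpret sigma_finite_measure "perp_lborel \<xi>" using sigma_finite_perp_lborel[OF \<xi> dim] .
  interpret pair_sigma_finite "perp_lborel \<xi>" lborel by (simp add: pair_sigma_finite_def sigma_finite_measure_axioms sigma_finite_lborel)
  define w where "w y a = indicator {0<..} a * indicator {..a} (norm y) * (real m * norm y ^ m * inverse a ^ Suc m)" for y :: 'a and a :: real
  have w: "(\<integral>\<^sup>+a. ennreal (w y a) \<partial>lborel) = 1" if "y \<noteq> 0" for y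
  proof -
    have "w y a = indicator {norm y..} a * (real m * norm y ^ m * inverse a ^ Suc m)" for a
      using that by (auto simp: w_def indicator_def) (smt (verit) norm_ge_zero norm_eq_zero)
    then show ?thesis using nn_integral_rescaling_weight[of "norm y" m] that m by simp
  qed
  have w_if: "w y a = (if 0 < a \<and> norm y \<le> a then real m * norm y ^ m * inverse a ^ Suc m else 0)" for y a
    by (simp add: w_def indicator_def)
  have wm[measurable]: "(\<lambda>x. w (fst x) (snd x)) \<in> borel_measurable (borel \<Otimes>\<^sub>M borel)"
    unfolding w_if by measurable
  have wy[measurable]: "(\<lambda>y. w y a) \<in> borel_measurable borel" for a
    unfolding w_if by measurable
  have wa[measurable]: "w y \<in> borel_measurable borel" for y
    unfolding w_if[abs_def] by measurable
  define Q where "Q y = (if norm y ^ m \<le> G y then 1 else 0::ennreal)" for y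
  have [measurable]: "Q \<in> borel_measurable borel" unfolding Q_def by measurable
  have "emeasure (perp_lborel \<xi>) {y. norm y ^ m \<le> G y} = (\<integral>\<^sup>+y. Q y \<partial>perp_lborel \<xi>)"
  proof -
    have "Q = indicator {y. norm y ^ m \<le> G y}" by (auto simp: Q_def fun_eq_iff)
    then show ?thesis by simp
  qed
  also have "\<dots> = (\<integral>\<^sup>+y. \<integral>\<^sup>+a. Q y * ennreal (w y a) \<partial>lborel \<partial>perp_lborel \<xi>)"
    using AE_perp_lborel_nonzero[OF \<xi> dim] by (intro nn_integral_cong_AE) (auto simp: nn_integral_cmult w)
  also have "\<dots> = (\<integral>\<^sup>+a. \<integral>\<^sup>+y. Q y * ennreal (w y a) \<partial>perp_lborel \<xi> \<partial>lborel)"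
    using Fubini'[of "\<lambda>y a. Q y * ennreal (w y a)"] by (simp add: case_prod_unfold)
  also have "\<dots> = (\<integral>\<^sup>+a. \<integral>\<^sup>+z. ennreal (indicator (cball 0 1) z * norm z ^ m) *
      ennreal (if 0 < a \<and> a ^ m * norm z ^ m \<le> G z then real m * a ^ (m - 1) else 0) \<partial>perp_lborel \<xi> \<partial>lborel)"
  proof (rule nn_integral_cong)
    fix a :: real
    show "(\<integral>\<^sup>+y. Q y * ennreal (w y a) \<partial>perp_lborel \<xi>) = (\<integral>\<^sup>+z. ennreal (indicator (cball 0 1) z * norm z ^ m) *
      ennreal (if 0 < a \<and> a ^ m * norm z ^ m \<le> G z then real m * a ^ (m - 1) else 0) \<partial>perp_lborel \<xi>)"
    proof (cases "0 < a")
      case True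
      have "(\<integral>\<^sup>+y. Q y * ennreal (w y a) \<partial>perp_lborel \<xi>) = ennreal (a ^ m) * (\<integral>\<^sup>+z. Q (a *\<^sub>R z) * ennreal (w (a *\<^sub>R z) a) \<partial>perp_lborel \<xi>)"
        using nn_integral_perp_scale[OF \<xi> _ True dim, of "\<lambda>y. Q y * ennreal (w y a)"] by (simp add: m_def)
      also have "\<dots> = (\<integral>\<^sup>+z. ennreal (a ^ m) * (Q (a *\<^sub>R z) * ennreal (w (a *\<^sub>R z) a)) \<partial>perp_lborel \<xi>)"
        by (subst nn_integral_cmult) simp_all
      also have "\<dots> = (\<integral>\<^sup>+z. ennreal (indicator (cball 0 1) z * norm z ^ m) *
        ennreal (if 0 < a \<and> a ^ m * norm z ^ m \<le> G z then real m * a ^ (m - 1) else 0) \<partial>perp_lborel \<xi>)"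
      proof (rule nn_integral_cong)
        fix z :: 'a
        have e: "a ^ m * (real m * (a * norm z) ^ m * inverse a ^ Suc m) = norm z ^ m * (real m * a ^ (m - 1))"
        proof -
          have 1: "a ^ m * inverse a ^ m = 1" using True by (simp flip: power_mult_distrib)
          have 2: "a ^ m * inverse a = a ^ (m - 1)" using True m by (cases m) auto
          have "a ^ m * (real m * (a * norm z) ^ m * inverse a ^ Suc m) = real m * norm z ^ m * (a ^ m * inverse a ^ m) * (a ^ m * inverse a)"
            by (simp only: power_mult_distrib power_Suc mult_ac)
          then show ?thesis by (simp only: 1 2 mult_1_right) (simp only: mult_ac)
        qed
        have "norm z \<le> 1 \<longleftrightarrow> norm (a *\<^sub>R z) \<le> a" using True by simp
        then show "ennreal (a ^ m) * (Q (a *\<^sub>R z) * ennreal (w (a *\<^sub>R z) a)) = ennreal (indicator (cball 0 1) z * norm z ^ m) *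
          ennreal (if 0 < a \<and> a ^ m * norm z ^ m \<le> G z then real m * a ^ (m - 1) else 0)"
          using True e by (auto simp: Q_def w_def hom indicator_def power_mult_distrib ennreal_mult'[symmetric] simp del: power_Suc)
      qed
      finally show ?thesis .
    qed (simp add: w_def)
  qed
  also have "\<dots> = (\<integral>\<^sup>+z. \<integral>\<^sup>+a. ennreal (indicator (cball 0 1) z * norm z ^ m) *
      ennreal (if 0 < a \<and> a ^ m * norm z ^ m \<le> G z then real m * a ^ (m - 1) else 0) \<partial>lborel \<partial>perp_lborel \<xi>)"
    by (rule Fubini') (simp only: indicator_def mem_cball_0 case_prod_unfold, measurable)
  also have "\<dots> = (\<integral>\<^sup>+z. ennreal (indicator (cball 0 1) z * G z) \<partial>perp_lborel \<xi>)"
  proof (rule nn_integral_cong_AE)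
    show "AE z in perp_lborel \<xi>. (\<integral>\<^sup>+a. ennreal (indicator (cball 0 1) z * norm z ^ m) *
      ennreal (if 0 < a \<and> a ^ m * norm z ^ m \<le> G z then real m * a ^ (m - 1) else 0) \<partial>lborel) = ennreal (indicator (cball 0 1) z * G z)"
      using AE_perp_lborel_nonzero[OF \<xi> dim]
    proof eventually_elim
      case (elim z)
      \<comment> \<open>The end point of the interval of admissible scales a, chosen so that c^m
        |z|^m = G z; the integral of m a^(m-1) up to c is then exactly c^m.\<close>
      define c where "c = root m (G z) / norm z"
      have c: "0 \<le> c" "c ^ m * norm z ^ m = G z"
        using m G0[of z] elim by (auto simp: c_def power_divide real_root_ge_zero)
      have "a ^ m * norm z ^ m \<le> G z \<longleftrightarrow> a \<le> c" if "0 < a" for a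
        unfolding c(2)[symmetric] using elim that m c(1) by simp
      then have "(\<integral>\<^sup>+a. ennreal (if 0 < a \<and> a ^ m * norm z ^ m \<le> G z then real m * a ^ (m - 1) else 0) \<partial>lborel)
        = (\<integral>\<^sup>+a. ennreal (indicator {0..c} a * (real m * a ^ (m - 1))) \<partial>lborel)"
        by (intro nn_integral_cong_AE AE_I[of _ _ "{0}"]) (auto simp: indicator_def)
      also have "\<dots> = ennreal (c ^ m)" by (rule nn_integral_power_interval[OF c(1) m])
      finally show ?case
        using c(1) by (subst nn_integral_cmult) (simp_all add: ennreal_mult'[symmetric] mult.assoc c(2)[symmetric] mult.commute)
    qed
  qed
  finally show ?thesis by (simp add: m_def)
qed

section \<open>Derivatives of the section volume, uniformly in the normal\<close>

lemma DERIV_from_quadratic_bound: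
  fixes f :: "real \<Rightarrow> real"
  assumes d: "0 < d" and b: "\<And>s. \<bar>s - t\<bar> < d \<Longrightarrow> \<bar>f s - f t - (s - t) * D\<bar> \<le> C * (s - t)\<^sup>2"
  shows "(f has_real_derivative D) (at t)"
  unfolding has_field_derivative_iff
proof (rule LIM_zero_cancel, rule Lim_null_comparison[where g = "\<lambda>s. C * \<bar>s - t\<bar>"])
  have "eventually (\<lambda>s. s \<noteq> t \<and> \<bar>s - t\<bar> < d) (at t)"
    using d by (auto simp: eventually_at dist_real_def intro!: exI[of _ d])
  then show "eventually (\<lambda>s. norm ((f s - f t) / (s - t) - D) \<le> C * \<bar>s - t\<bar>) (at t)"
  proof eventually_elim
    case (elim s)
    then have "(f s - f t) / (s - t) - D = (f s - f t - (s - t) * D) / (s - t)" by (simp add: field_simps)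
    then have "\<bar>(f s - f t) / (s - t) - D\<bar> \<le> C * (s - t)\<^sup>2 / \<bar>s - t\<bar>"
      using b[of s] elim by (simp add: abs_divide divide_right_mono)
    also have "\<dots> = C * \<bar>s - t\<bar>" using elim by (simp add: power2_eq_square abs_if field_simps)
    finally show ?case by simp
  qed
  have "((\<lambda>s. C * \<bar>s - t\<bar>) \<longlongrightarrow> C * \<bar>t - t\<bar>) (at t)" by (intro tendsto_intros)
  then show "((\<lambda>s. C * \<bar>s - t\<bar>) \<longlongrightarrow> 0) (at t)" by simp
qed

lemma iterated_deriv_eq:
  fixes f :: "real \<Rightarrow> real"
  assumes f: "\<And>t. \<bar>t\<bar> < d \<Longrightarrow> f t = V 0 t"
    and V: "\<And>k t. \<bar>t\<bar> < d \<Longrightarrow> (V k has_real_derivative V (Suc k) t) (at t)"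
    and t: "\<bar>t\<bar> < d"
  shows "(deriv ^^ k) f t = V k t"
  using t
proof (induction k arbitrary: t)
  case (Suc k)
  have "((deriv ^^ k) f has_real_derivative V (Suc k) t) (at t)"
  proof (rule has_field_derivative_transform_within_open[OF V[OF Suc.prems], of "{-d<..<d}"])
    show "V k s = (deriv ^^ k) f s" if "s \<in> {-d<..<d}" for s using Suc.IH[of s] that by auto
  qed (use Suc.prems in auto)
  then show ?case by (simp add: DERIV_imp_deriv)
qed (use f in simp)

lemma compact_interval_orthonormal_pairs_bound:
  fixes F :: "nat \<Rightarrow> real \<Rightarrow> 'a::euclidean_space \<times> 'a \<Rightarrow> real"
  assumes "continuous_on ({-t0..t0} \<times> orthonormal_pairs) (\<lambda>(t, p). F k t p)"
  shows "\<exists>C\<ge>0. \<forall>t p. \<bar>t\<bar> \<le> t0 \<longrightarrow> p \<in> orthonormal_pairs \<longrightarrow> \<bar>F k t p\<bar> \<le> C"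
proof -
  have "compact ({-t0..t0} \<times> (orthonormal_pairs :: ('a \<times> 'a) set))"
    by (intro compact_Times compact_orthonormal_pairs) auto
  then have "bounded ((\<lambda>(t, p). F k t p) ` ({-t0..t0} \<times> orthonormal_pairs))"
    using assms compact_continuous_image compact_imp_bounded by blast
  then obtain C where C: "0 < C" "\<forall>x\<in>(\<lambda>(t, p). F k t p) ` ({-t0..t0} \<times> orthonormal_pairs). norm x \<le> C"
    unfolding bounded_pos by blast
  have "\<bar>F k t p\<bar> \<le> C" if "\<bar>t\<bar> \<le> t0" "p \<in> orthonormal_pairs" for t p
    using C(2)[rule_format, of "F k t p"] that by (force simp: abs_le_iff)
  then show ?thesis using C(1) by (intro exI[of _ C]) auto
qed

text \<open>The volume is the integral of the m-th power of the section radius over the unit ball of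
  the hyperplane. The domain no longer moves with t, so derivatives pass to the integrand, and their
  bounds are independent of \<open>\<xi>\<close> because orthonormal pairs form a compact
  set.\<close>

lemma section_volume_derivatives:
  fixes K :: "'a::euclidean_space set"
  assumes K: "star_body K" and sm: "smooth_on_submanifold (radial_function K) (sphere 0 1)" and dim: "2 \<le> DIM('a)"
  obtains V t0 where "0 < t0"
    "\<And>\<xi> t. norm \<xi> = 1 \<Longrightarrow> \<bar>t\<bar> < t0 \<Longrightarrow> section_volume K \<xi> t = V 0 t \<xi>"
    "\<And>k t \<xi>. norm \<xi> = 1 \<Longrightarrow> \<bar>t\<bar> < t0 \<Longrightarrow> ((\<lambda>t. V k t \<xi>) has_real_derivative V (Suc k) t \<xi>) (at t)"
    "\<And>k. \<exists>C\<ge>0. \<forall>t \<xi>. norm \<xi> = 1 \<longrightarrow> \<bar>t\<bar> < t0 \<longrightarrow> \<bar>V k t \<xi>\<bar> \<le> C"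
proof -
  define m where "m = DIM('a) - 1"
  have m: "1 \<le> m" using dim by (simp add: m_def)
  let ?P = "orthonormal_pairs :: ('a \<times> 'a) set"
  obtain c0 where c0: "0 < c0" "\<And>u. norm u = 1 \<Longrightarrow> c0 \<le> radial_function K u"
    using star_body_radial_lower[OF K] by blast
  obtain F t0 where t0: "0 < t0"
    and Fc: "\<And>k. continuous_on ({-t0..t0} \<times> ?P) (\<lambda>(t, p). F k t p)"
    and Fd: "\<And>k t p. \<bar>t\<bar> < t0 \<Longrightarrow> p \<in> ?P \<Longrightarrow> ((\<lambda>t. F k t p) has_real_derivative F (Suc k) t p) (at t)"
    and FK: "\<And>t r p. \<bar>t\<bar> \<le> t0 \<Longrightarrow> p \<in> ?P \<Longrightarrow> 0 < r \<Longrightarrow>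
      norm (t *\<^sub>R snd p + r *\<^sub>R fst p) \<le> radial_function K (sgn (t *\<^sub>R snd p + r *\<^sub>R fst p)) \<longleftrightarrow> r ^ m \<le> F 0 t p"
    and F0: "\<And>t p. \<bar>t\<bar> \<le> t0 \<Longrightarrow> p \<in> ?P \<Longrightarrow> 0 \<le> F 0 t p"
    by (rule star_section_smooth_radius[OF param_Ck_smooth_sphere[OF sm] c0 m]) (assumption+, rule that)
  have bd: "\<exists>C\<ge>0. \<forall>t p. \<bar>t\<bar> \<le> t0 \<longrightarrow> p \<in> ?P \<longrightarrow> \<bar>F k t p\<bar> \<le> C" for k
    by (rule compact_interval_orthonormal_pairs_bound[OF Fc])
  define vol where "vol = unit_ball_vol (real m)"
  have vol: "0 \<le> vol" by (simp add: vol_def)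
  \<comment> \<open>The indicator confines \<open>F k\<close> to orthonormal pairs, where it is
    known to be continuous, and so yields a measurable function on the whole space. It equals 1
    almost everywhere on the hyperplane.\<close>
  define Fb where "Fb k t \<xi> y = indicator (great_subsphere \<xi>) (sgn y) * F k t (sgn y, \<xi>)" for k t and \<xi> y :: 'a
  define g where "g k t \<xi> y = indicator (cball 0 1) y * Fb k t \<xi> y" for k t and \<xi> y :: 'a
  have Pin: "(\<omega>, \<xi>) \<in> ?P" if "norm \<xi> = 1" "\<omega> \<in> great_subsphere \<xi>" for \<omega> \<xi> :: 'a
    using that by (simp add: orthonormal_pairs_def great_subsphere_def perp_def)
  have Fbm[measurable]: "Fb k t \<xi> \<in> borel_measurable borel" if t: "\<bar>t\<bar> \<le> t0" and \<xi>: "norm \<xi> = 1" for k t \<xi>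
  proof -
    have "continuous_on (great_subsphere \<xi>) (\<lambda>\<omega>. (\<lambda>(t, p). F k t p) (t, (\<omega>, \<xi>)))"
      by (rule continuous_on_compose2[OF Fc[of k]]) (use t Pin[OF \<xi>] in \<open>auto intro!: continuous_intros\<close>)
    then have "continuous_on (great_subsphere \<xi>) (\<lambda>\<omega>. F k t (\<omega>, \<xi>))" by simp
    then have "(\<lambda>\<omega>. indicator (great_subsphere \<xi>) \<omega> *\<^sub>R F k t (\<omega>, \<xi>)) \<in> borel_measurable borel"
      using compact_great_subsphere[of \<xi>] by (intro borel_measurable_continuous_on_indicator) (auto simp: compact_imp_closed)
    from measurable_compose[OF measurable_sgn this] show ?thesis by (simp add: Fb_def[abs_def])
  qed
  have gm[measurable]: "g k t \<xi> \<in> borel_measurable borel" if "\<bar>t\<bar> \<le> t0" "norm \<xi> = 1" for k t \<xi>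
    unfolding g_def[abs_def] by (intro borel_measurable_times borel_measurable_indicator Fbm that) simp
  have cb: "emeasure (perp_lborel \<xi>) (cball 0 1) = ennreal vol" if "norm \<xi> = 1" for \<xi> :: 'a
    using emeasure_perp_lborel_cball[OF that _ dim, of 1] by (simp add: vol_def m_def)
  have int_const: "integrable (perp_lborel \<xi>) (\<lambda>y. indicator (cball 0 1) y * C)" "(\<integral>y. indicator (cball 0 1) y * C \<partial>perp_lborel \<xi>) = vol * C"
    if "norm \<xi> = 1" for \<xi> :: 'a and C :: real
    using cb[OF that] vol by (auto intro!: integrable_real_mult_indicator simp: measure_def)
  have gb: "\<bar>g k t \<xi> y\<bar> \<le> indicator (cball 0 1) y * C"
    if "\<forall>t p. \<bar>t\<bar> \<le> t0 \<longrightarrow> p \<in> ?P \<longrightarrow> \<bar>F k t p\<bar> \<le> C" "0 \<le> C" "\<bar>t\<bar> \<le> t0" "norm \<xi> = 1" for k t \<xi> y C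
    using that Pin[OF that(4), of "sgn y"] by (auto simp: g_def Fb_def indicator_def)
  have int_g: "integrable (perp_lborel \<xi>) (g k t \<xi>)" if "\<bar>t\<bar> \<le> t0" "norm \<xi> = 1" for k t \<xi>
  proof -
    obtain C where C: "0 \<le> C" "\<forall>t p. \<bar>t\<bar> \<le> t0 \<longrightarrow> p \<in> ?P \<longrightarrow> \<bar>F k t p\<bar> \<le> C" using bd[of k] by blast
    show ?thesis
      by (rule Bochner_Integration.integrable_bound[OF int_const(1)[OF that(2), of C]])
        (use gm[OF that, of k] gb[OF C(2,1) that] C in \<open>auto simp: abs_mult\<close>)
  qed
  define V where "V k t \<xi> = (\<integral>y. g k t \<xi> y \<partial>perp_lborel \<xi>)" for k t and \<xi> :: 'a
  have Vb: "\<exists>C\<ge>0. \<forall>t \<xi>. norm \<xi> = 1 \<longrightarrow> \<bar>t\<bar> < t0 \<longrightarrow> \<bar>V k t \<xi>\<bar> \<le> C" for k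
  proof -
    obtain C where C: "0 \<le> C" "\<forall>t p. \<bar>t\<bar> \<le> t0 \<longrightarrow> p \<in> ?P \<longrightarrow> \<bar>F k t p\<bar> \<le> C" using bd[of k] by blast
    have "\<bar>V k t \<xi>\<bar> \<le> vol * C" if "norm \<xi> = 1" "\<bar>t\<bar> < t0" for t \<xi>
    proof -
      have t: "\<bar>t\<bar> \<le> t0" using that by simp
      have "norm (V k t \<xi>) \<le> (\<integral>y. indicator (cball 0 1) y * C \<partial>perp_lborel \<xi>)"
        unfolding V_def
        by (rule Bochner_Integration.integral_norm_bound_integral[OF int_g[OF t that(1)] int_const(1)[OF that(1)]])
          (use gb[OF C(2,1) t that(1)] in auto)
      then show ?thesis by (simp only: int_const(2)[OF that(1)] real_norm_def)
    qed
    then show ?thesis using vol C(1) by (intro exI[of _ "vol * C"]) auto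
  qed
  have Vd: "((\<lambda>t. V k t \<xi>) has_real_derivative V (Suc k) t \<xi>) (at t)" if \<xi>: "norm \<xi> = 1" and t: "\<bar>t\<bar> < t0" for k t \<xi>
  proof -
    obtain C where C: "0 \<le> C" "\<forall>t p. \<bar>t\<bar> \<le> t0 \<longrightarrow> p \<in> ?P \<longrightarrow> \<bar>F (Suc (Suc k)) t p\<bar> \<le> C" using bd by blast
    \<comment> \<open>A quadratic error with a constant uniform in p survives integration over the
      unit ball; this replaces a theorem on differentiation under the integral.\<close>
    have Fq: "\<bar>F k s p - F k t p - (s - t) * F (Suc k) t p\<bar> \<le> C * (s - t)\<^sup>2" if "\<bar>s - t\<bar> < t0 - \<bar>t\<bar>" "p \<in> ?P" for s p
    proof (cases "s = t")
      case False
      have s: "\<bar>s\<bar> < t0" using that by linarith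
      define a b where "a = min s t" and "b = max s t"
      have ab: "\<bar>z\<bar> < t0" if "a \<le> z" "z \<le> b" for z using that s t by (auto simp: a_def b_def min_def max_def split: if_splits)
      have "\<exists>z. (if s < t then s < z \<and> z < t else t < z \<and> z < s) \<and>
        F k s p = (\<Sum>i<2. F (k + i) t p / fact i * (s - t) ^ i) + F (k + 2) z p / fact 2 * (s - t) ^ 2"
        by (rule Taylor[where diff = "\<lambda>i t. F (k + i) t p" and a = a and b = b])
          (use False ab that in \<open>auto simp: a_def b_def intro!: Fd\<close>)
      then obtain z where z0: "if s < t then s < z \<and> z < t else t < z \<and> z < s"
        and z1: "F k s p = (\<Sum>i<2. F (k + i) t p / fact i * (s - t) ^ i) + F (k + 2) z p / fact 2 * (s - t) ^ 2" by blast
      have z: "\<bar>z\<bar> < t0" "F k s p = (\<Sum>i<2. F (k + i) t p / fact i * (s - t) ^ i) + F (k + 2) z p / fact 2 * (s - t) ^ 2"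
        using s t z0 z1 by (auto split: if_splits)
      have "F k s p - F k t p - (s - t) * F (Suc k) t p = F (Suc (Suc k)) z p / 2 * (s - t)\<^sup>2"
        unfolding z(2) by (simp add: numeral_2_eq_2 mult.commute)
      moreover have "\<bar>F (Suc (Suc k)) z p / 2 * (s - t)\<^sup>2\<bar> \<le> C * (s - t)\<^sup>2"
        unfolding abs_mult
        using C(2)[rule_format, of z p] z(1) that(2) C(1) by (intro mult_mono) auto
      ultimately show ?thesis by simp
    qed simp
    show ?thesis
    proof (rule DERIV_from_quadratic_bound[of "t0 - \<bar>t\<bar>" t _ _ "vol * C"])
      fix s assume s: "\<bar>s - t\<bar> < t0 - \<bar>t\<bar>"
      have s': "\<bar>s\<bar> \<le> t0" "\<bar>t\<bar> \<le> t0" using s t by linarith+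
      have i: "integrable (perp_lborel \<xi>) (\<lambda>y. g k s \<xi> y - g k t \<xi> y - (s - t) * g (Suc k) t \<xi> y)"
        using int_g[OF s'(1) \<xi>] int_g[OF s'(2) \<xi>] by simp
      have "V k s \<xi> - V k t \<xi> - (s - t) * V (Suc k) t \<xi> = (\<integral>y. g k s \<xi> y - g k t \<xi> y - (s - t) * g (Suc k) t \<xi> y \<partial>perp_lborel \<xi>)"
        using int_g[OF s'(1) \<xi>] int_g[OF s'(2) \<xi>] by (simp add: V_def)
      moreover have "norm (\<integral>y. g k s \<xi> y - g k t \<xi> y - (s - t) * g (Suc k) t \<xi> y \<partial>perp_lborel \<xi>)
        \<le> (\<integral>y. indicator (cball 0 1) y * (C * (s - t)\<^sup>2) \<partial>perp_lborel \<xi>)"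
      proof (rule Bochner_Integration.integral_norm_bound_integral[OF i int_const(1)[OF \<xi>]])
        show "norm (g k s \<xi> y - g k t \<xi> y - (s - t) * g (Suc k) t \<xi> y) \<le> indicator (cball 0 1) y * (C * (s - t)\<^sup>2)" for y
          using Fq[OF s Pin[OF \<xi>, of "sgn y"]] C(1) by (auto simp: g_def Fb_def indicator_def)
      qed
      ultimately show "\<bar>V k s \<xi> - V k t \<xi> - (s - t) * V (Suc k) t \<xi>\<bar> \<le> vol * C * (s - t)\<^sup>2"
        by (simp only: int_const(2)[OF \<xi>] real_norm_def mult.assoc)
    qed (use t in simp)
  qed
  have VK: "section_volume K \<xi> t = V 0 t \<xi>" if \<xi>: "norm \<xi> = 1" and t: "\<bar>t\<bar> < t0" for \<xi> t
  proof -
    have t': "\<bar>t\<bar> \<le> t0" using t by simp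
    have [measurable]: "K \<in> sets borel" using star_body_borel[OF K] .
    have Fb0: "0 \<le> Fb 0 t \<xi> y" for y using F0[OF t' Pin[OF \<xi>, of "sgn y"]] by (auto simp: Fb_def indicator_def)
    have Fbh: "Fb 0 t \<xi> (a *\<^sub>R y) = Fb 0 t \<xi> y" if "0 < a" for a y using that by (simp add: Fb_def sgn_scaleR)
    have "emeasure (perp_lborel \<xi>) {y. t *\<^sub>R \<xi> + y \<in> K} = emeasure (perp_lborel \<xi>) {y. norm y ^ (DIM('a) - 1) \<le> Fb 0 t \<xi> y}"
    proof (rule emeasure_eq_AE)
      show "AE y in perp_lborel \<xi>. (y \<in> {y. t *\<^sub>R \<xi> + y \<in> K}) = (y \<in> {y. norm y ^ (DIM('a) - 1) \<le> Fb 0 t \<xi> y})"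
        using AE_perp_lborel[OF \<xi>] AE_perp_lborel_nonzero[OF \<xi> dim]
      proof eventually_elim
        case (elim y)
        have S: "sgn y \<in> great_subsphere \<xi>" using elim by (auto simp: great_subsphere_def norm_sgn perp_def sgn_div_norm)
        have y: "norm y *\<^sub>R sgn y = y" using elim by (simp add: sgn_div_norm)
        have nz: "t *\<^sub>R \<xi> + y \<noteq> 0"
        proof
          assume "t *\<^sub>R \<xi> + y = 0"
          then have "(t *\<^sub>R \<xi> + y) \<bullet> y = 0" by simp
          moreover have "\<xi> \<bullet> y = 0" using elim by (simp add: perp_def inner_commute)
          ultimately show False using elim by (simp only: inner_add_left inner_scaleR_left) simp
        qed
        have "t *\<^sub>R \<xi> + y \<in> K \<longleftrightarrow> norm (t *\<^sub>R \<xi> + y) \<le> radial_function K (sgn (t *\<^sub>R \<xi> + y))"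
          by (rule star_body_mem_iff[OF K nz])
        also have "\<dots> \<longleftrightarrow> norm y ^ m \<le> F 0 t (sgn y, \<xi>)"
          using FK[OF t' Pin[OF \<xi> S], of "norm y"] elim y by simp
        finally show ?case using S by (simp add: Fb_def m_def)
      qed
    qed (use Fbm[OF t' \<xi>] in measurable)
    also have "\<dots> = (\<integral>\<^sup>+y. ennreal (g 0 t \<xi> y) \<partial>perp_lborel \<xi>)"
      unfolding g_def by (rule emeasure_perp_star_set[OF \<xi> dim Fbm[OF t' \<xi>] Fb0 Fbh])
    also have "\<dots> = ennreal (V 0 t \<xi>)"
      unfolding V_def using Fb0 by (intro nn_integral_eq_integral int_g t' \<xi>) (auto simp: g_def)
    finally have "emeasure (perp_lborel \<xi>) {y. t *\<^sub>R \<xi> + y \<in> K} = ennreal (V 0 t \<xi>)" .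
    moreover have "0 \<le> V 0 t \<xi>" unfolding V_def using Fb0 by (intro integral_nonneg_AE) (auto simp: g_def)
    ultimately show ?thesis by (simp add: section_volume_eq[OF \<xi>] measure_def)
  qed
  show ?thesis by (rule that[OF t0 VK Vd Vb])
qed

section \<open>Taylor bounds for sections and measurability in the normal\<close>

abbreviation section_deriv0 :: "'a::euclidean_space set \<Rightarrow> 'a \<Rightarrow> nat \<Rightarrow> real" where
  "section_deriv0 K \<xi> k \<equiv> (deriv ^^ k) (section_volume K \<xi>) 0"

lemma section_volume_nonneg: "0 \<le> section_volume K \<xi> t"
  by (simp add: section_volume_def)

lemma section_volume_bound:
  fixes K :: "'a::euclidean_space set"
  assumes K: "star_body K" and dim: "2 \<le> DIM('a)"
  obtains M where "0 < M" "\<And>\<xi> t. norm \<xi> = 1 \<Longrightarrow> section_volume K \<xi> t \<le> M"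
    "\<And>\<xi> t. norm \<xi> = 1 \<Longrightarrow> M < \<bar>t\<bar> \<Longrightarrow> section_volume K \<xi> t = 0"
proof -
  obtain R where R: "0 < R" "K \<subseteq> cball 0 R" using star_body_bounded[OF K] .
  define M where "M = max R (unit_ball_vol (real (DIM('a) - 1)) * R ^ (DIM('a) - 1))"
  have [measurable]: "K \<in> sets borel" using star_body_borel[OF K] .
  have orth: "norm (t *\<^sub>R \<xi> + y) = sqrt (t\<^sup>2 + (norm y)\<^sup>2)" if "norm \<xi> = 1" "y \<in> perp \<xi>" for t and \<xi> y :: 'a
  proof -
    have "(norm (t *\<^sub>R \<xi> + y))\<^sup>2 = t\<^sup>2 + (norm y)\<^sup>2"
      using that by (simp only: power2_norm_eq_inner)
        (simp add: inner_add_left inner_add_right perp_def inner_commute norm_eq_1 power2_eq_square)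
    then show ?thesis by (metis norm_ge_zero real_sqrt_unique)
  qed
  have 1: "section_volume K \<xi> t \<le> M" if \<xi>: "norm \<xi> = 1" for \<xi> t
  proof -
    have "emeasure (perp_lborel \<xi>) {y. t *\<^sub>R \<xi> + y \<in> K} \<le> emeasure (perp_lborel \<xi>) (cball 0 R)"
    proof (rule emeasure_mono_AE)
      show "AE y in perp_lborel \<xi>. y \<in> {y. t *\<^sub>R \<xi> + y \<in> K} \<longrightarrow> y \<in> cball 0 R"
        using AE_perp_lborel[OF \<xi>]
      proof eventually_elim
        case (elim y)
        have "norm y \<le> norm (t *\<^sub>R \<xi> + y)" unfolding orth[OF \<xi> elim] by (rule real_le_rsqrt) simp
        then show ?case using R(2) by (auto intro: order_trans)
      qed
    qed simp
    also have "\<dots> \<le> ennreal M" using R dim by (subst emeasure_perp_lborel_cball[OF \<xi>]) (auto simp: M_def intro!: ennreal_leI)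
    finally show ?thesis
      unfolding section_volume_eq[OF \<xi> star_body_borel[OF K]] measure_def using R(1) by (intro enn2real_leI) (auto simp: M_def)
  qed
  have 2: "section_volume K \<xi> t = 0" if \<xi>: "norm \<xi> = 1" and t: "M < \<bar>t\<bar>" for \<xi> t
  proof -
    have "emeasure (perp_lborel \<xi>) {y. t *\<^sub>R \<xi> + y \<in> K} = emeasure (perp_lborel \<xi>) {}"
    proof (rule emeasure_eq_AE)
      show "AE y in perp_lborel \<xi>. (y \<in> {y. t *\<^sub>R \<xi> + y \<in> K}) = (y \<in> {})"
        using AE_perp_lborel[OF \<xi>]
      proof eventually_elim
        case (elim y)
        have "\<bar>t\<bar> \<le> norm (t *\<^sub>R \<xi> + y)" unfolding orth[OF \<xi> elim] by (rule real_le_rsqrt) simp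
        then have "R < norm (t *\<^sub>R \<xi> + y)" using t by (simp add: M_def)
        then show ?case using R(2) by auto
      qed
    qed measurable
    then show ?thesis unfolding section_volume_eq[OF \<xi> star_body_borel[OF K]] measure_def by simp
  qed
  show ?thesis by (rule that[OF _ 1 2]) (use R in \<open>auto simp: M_def\<close>)
qed

text \<open>The bound has to hold for all t, since later the argument is t/|eta| with eta close to
  0. Away from 0 it is crude: the volume is bounded and each monomial has degree below N, so
  everything is dominated by |t|^N.\<close>

lemma section_volume_taylor:
  fixes K :: "'a::euclidean_space set"
  assumes K: "star_body K" and sm: "smooth_on_submanifold (radial_function K) (sphere 0 1)" and dim: "2 \<le> DIM('a)"
  shows "\<exists>C\<ge>0. \<forall>\<xi> t. norm \<xi> = 1 \<longrightarrow>
      \<bar>section_volume K \<xi> t - (\<Sum>k<N. section_deriv0 K \<xi> k / fact k * t ^ k)\<bar> \<le> C * \<bar>t\<bar> ^ N"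
    and "\<exists>D\<ge>0. \<forall>\<xi>. norm \<xi> = 1 \<longrightarrow> \<bar>section_deriv0 K \<xi> k\<bar> \<le> D"
proof -
  obtain V t0 where t0: "0 < t0"
    and VK: "\<And>\<xi> t. norm \<xi> = 1 \<Longrightarrow> \<bar>t\<bar> < t0 \<Longrightarrow> section_volume K \<xi> t = V 0 t \<xi>"
    and Vd: "\<And>k t \<xi>. norm \<xi> = 1 \<Longrightarrow> \<bar>t\<bar> < t0 \<Longrightarrow> ((\<lambda>t. V k t \<xi>) has_real_derivative V (Suc k) t \<xi>) (at t)"
    and Vb: "\<And>k. \<exists>C\<ge>0. \<forall>t \<xi>. norm \<xi> = 1 \<longrightarrow> \<bar>t\<bar> < t0 \<longrightarrow> \<bar>V k t \<xi>\<bar> \<le> C"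
    by (rule section_volume_derivatives[OF K sm dim]) (rule that)
  have dV: "section_deriv0 K \<xi> k = V k 0 \<xi>" if "norm \<xi> = 1" for \<xi> k
    using iterated_deriv_eq[where f = "section_volume K \<xi>" and V = "\<lambda>k t. V k t \<xi>" and d = t0] VK Vd that t0 by simp
  show D: "\<exists>D\<ge>0. \<forall>\<xi>. norm \<xi> = 1 \<longrightarrow> \<bar>section_deriv0 K \<xi> k\<bar> \<le> D" for k
    using Vb[of k] t0 by (auto simp: dV)
  then obtain D where D: "\<And>k. 0 \<le> D k" "\<And>k \<xi>. norm \<xi> = 1 \<Longrightarrow> \<bar>section_deriv0 K \<xi> k\<bar> \<le> D k" by metis
  obtain C1 where C1: "0 \<le> C1" "\<And>t \<xi>. norm \<xi> = 1 \<Longrightarrow> \<bar>t\<bar> < t0 \<Longrightarrow> \<bar>V N t \<xi>\<bar> \<le> C1" using Vb[of N] by blast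
  obtain M where M: "0 < M" "\<And>\<xi> t. norm \<xi> = 1 \<Longrightarrow> section_volume K \<xi> t \<le> M"
    by (rule section_volume_bound[OF K dim]) (rule that)
  \<comment> \<open>For |t| at least t0, the constant M is at most (M/t0^N) |t|^N, and |t|^k is at
    most t0^(k-N) |t|^N.\<close>
  define C2 where "C2 = M / t0 ^ N + (\<Sum>k<N. D k * (1 / t0) ^ (N - k))"
  have C2: "0 \<le> C2" unfolding C2_def using M(1) t0 D(1) by (intro add_nonneg_nonneg sum_nonneg) auto
  have near: "\<bar>section_volume K \<xi> t - (\<Sum>k<N. section_deriv0 K \<xi> k / fact k * t ^ k)\<bar> \<le> C1 * \<bar>t\<bar> ^ N"
    if \<xi>: "norm \<xi> = 1" and t: "\<bar>t\<bar> < t0" for \<xi> t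
  proof (cases "N = 0 \<or> t = 0")
    case True
    then show ?thesis
    proof
      assume "N = 0" then show ?thesis using C1(2)[OF \<xi> t] VK[OF \<xi> t] by simp
    next
      assume t: "t = 0"
      show ?thesis
      proof (cases N)
        case 0 then show ?thesis using C1(2)[OF \<xi>, of 0] VK[OF \<xi>, of 0] t0 t by simp
      next
        case (Suc j) then show ?thesis using t by (simp add: lessThan_Suc_eq_insert_0 sum.reindex zero_notin_Suc_image power_0_left)
      qed
    qed
  next
    case False
    have ab: "\<bar>z\<bar> < t0" if "min 0 t \<le> z" "z \<le> max 0 t" for z using that t by (auto simp: min_def max_def split: if_splits)
    have "\<exists>z. (if t < 0 then t < z \<and> z < 0 else 0 < z \<and> z < t) \<and>
      V 0 t \<xi> = (\<Sum>i<N. V i 0 \<xi> / fact i * (t - 0) ^ i) + V N z \<xi> / fact N * (t - 0) ^ N"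
      by (rule Taylor[where diff = "\<lambda>i t. V i t \<xi>" and a = "min 0 t" and b = "max 0 t"])
        (use False ab in \<open>auto intro!: Vd[OF \<xi>]\<close>)
    then obtain z where z0: "if t < 0 then t < z \<and> z < 0 else 0 < z \<and> z < t"
      and z1: "V 0 t \<xi> = (\<Sum>i<N. V i 0 \<xi> / fact i * (t - 0) ^ i) + V N z \<xi> / fact N * (t - 0) ^ N" by blast
    have z: "\<bar>z\<bar> < t0" "V 0 t \<xi> = (\<Sum>i<N. V i 0 \<xi> / fact i * t ^ i) + V N z \<xi> / fact N * t ^ N"
      using z0 z1 t by (auto split: if_splits)
    have "\<bar>V N z \<xi> / fact N\<bar> \<le> C1"
    proof -
      have "\<bar>V N z \<xi>\<bar> / fact N \<le> C1 / 1"
        using C1(2)[OF \<xi> z(1)] C1(1) by (intro frac_le) (auto simp: fact_ge_1)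
      then show ?thesis by (simp add: abs_divide)
    qed
    then show ?thesis unfolding VK[OF \<xi> t] z(2)
      by (simp add: dV[OF \<xi>] abs_mult power_abs mult_right_mono del: times_divide_eq_left)
  qed
  have far: "\<bar>section_volume K \<xi> t - (\<Sum>k<N. section_deriv0 K \<xi> k / fact k * t ^ k)\<bar> \<le> C2 * \<bar>t\<bar> ^ N"
    if \<xi>: "norm \<xi> = 1" and t: "t0 \<le> \<bar>t\<bar>" for \<xi> t
  proof -
    have "\<bar>section_volume K \<xi> t\<bar> \<le> M / t0 ^ N * \<bar>t\<bar> ^ N"
    proof -
      have "M * t0 ^ N \<le> M * \<bar>t\<bar> ^ N" using M(1) t t0 by (intro mult_left_mono power_mono) auto
      then have "M \<le> M / t0 ^ N * \<bar>t\<bar> ^ N" using t0 by (simp add: field_simps)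
      then show ?thesis using M(2)[OF \<xi>, of t] section_volume_nonneg[of K \<xi> t] by simp
    qed
    moreover have "\<bar>\<Sum>k<N. section_deriv0 K \<xi> k / fact k * t ^ k\<bar> \<le> (\<Sum>k<N. D k * (1 / t0) ^ (N - k) * \<bar>t\<bar> ^ N)"
    proof (rule order_trans[OF sum_abs sum_mono])
      fix k assume "k \<in> {..<N}"
      then have k: "k < N" by simp
      have 1: "1 \<le> (\<bar>t\<bar> / t0) ^ (N - k)" using t t0 by (intro one_le_power) simp
      have "\<bar>t\<bar> ^ k * 1 \<le> \<bar>t\<bar> ^ k * (\<bar>t\<bar> / t0) ^ (N - k)" by (rule mult_left_mono[OF 1]) simp
      also have "\<dots> = (1 / t0) ^ (N - k) * \<bar>t\<bar> ^ N"
        using k by (simp add: power_divide flip: power_add)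
      finally have 2: "\<bar>t\<bar> ^ k \<le> (1 / t0) ^ (N - k) * \<bar>t\<bar> ^ N" by simp
      have "\<bar>section_deriv0 K \<xi> k\<bar> / fact k \<le> D k / 1"
        using D(2)[OF \<xi>] D(1) by (intro frac_le) (auto simp: fact_ge_1)
      then have "\<bar>section_deriv0 K \<xi> k\<bar> / fact k * \<bar>t\<bar> ^ k \<le> D k * ((1 / t0) ^ (N - k) * \<bar>t\<bar> ^ N)"
        using 2 D(1) by (intro mult_mono) auto
      then show "\<bar>section_deriv0 K \<xi> k / fact k * t ^ k\<bar> \<le> D k * (1 / t0) ^ (N - k) * \<bar>t\<bar> ^ N"
        by (simp add: abs_mult abs_divide power_abs mult.assoc)
    qed
    ultimately show ?thesis by (simp add: C2_def distrib_right sum_distrib_right)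
  qed
  show "\<exists>C\<ge>0. \<forall>\<xi> t. norm \<xi> = 1 \<longrightarrow>
      \<bar>section_volume K \<xi> t - (\<Sum>k<N. section_deriv0 K \<xi> k / fact k * t ^ k)\<bar> \<le> C * \<bar>t\<bar> ^ N"
  proof (intro exI[of _ "max C1 C2"] conjI allI impI)
    fix \<xi> :: 'a and t :: real assume \<xi>: "norm \<xi> = 1"
    have "C1 * \<bar>t\<bar> ^ N \<le> max C1 C2 * \<bar>t\<bar> ^ N" "C2 * \<bar>t\<bar> ^ N \<le> max C1 C2 * \<bar>t\<bar> ^ N"
      by (auto intro!: mult_right_mono)
    then show "\<bar>section_volume K \<xi> t - (\<Sum>k<N. section_deriv0 K \<xi> k / fact k * t ^ k)\<bar> \<le> max C1 C2 * \<bar>t\<bar> ^ N"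
      using near[OF \<xi>, of t] far[OF \<xi>, of t] by (cases "\<bar>t\<bar> < t0") auto
  qed (use C1 in simp)
qed

lemma pred_mem_cball[measurable (raw)]:
  "f \<in> borel_measurable M \<Longrightarrow> Measurable.pred M (\<lambda>x. f x \<in> cball (0::'a::euclidean_space) r)"
  by simp

lemma ennreal_section_volume:
  fixes K :: "'a::euclidean_space set"
  assumes \<xi>: "norm \<xi> = 1" and K[measurable]: "K \<in> sets borel" and b: "bounded K" and dim: "2 \<le> DIM('a)"
  shows "ennreal (section_volume K \<xi> t) = (\<integral>\<^sup>+y. indicator K (t *\<^sub>R \<xi> + y) \<partial>perp_lborel \<xi>)"
proof -
  obtain R where R: "0 < R" "\<And>x. x \<in> K \<Longrightarrow> norm x \<le> R" using b by (auto simp: bounded_pos)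
  have "emeasure (perp_lborel \<xi>) {y. t *\<^sub>R \<xi> + y \<in> K} \<le> emeasure (perp_lborel \<xi>) (cball 0 (R + \<bar>t\<bar>))"
  proof (rule emeasure_mono)
    show "{y. t *\<^sub>R \<xi> + y \<in> K} \<subseteq> cball 0 (R + \<bar>t\<bar>)"
    proof
      fix y assume "y \<in> {y. t *\<^sub>R \<xi> + y \<in> K}"
      then have "norm (t *\<^sub>R \<xi> + y) \<le> R" using R by simp
      moreover have "norm y \<le> norm (t *\<^sub>R \<xi> + y) + norm (t *\<^sub>R \<xi>)" by (metis add_diff_cancel_left' norm_triangle_ineq4)
      ultimately show "y \<in> cball 0 (R + \<bar>t\<bar>)" using \<xi> by simp
    qed
  qed simp
  also have "\<dots> < \<top>" using R by (subst emeasure_perp_lborel_cball[OF \<xi> _ dim]) auto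
  finally have "emeasure (perp_lborel \<xi>) {y. t *\<^sub>R \<xi> + y \<in> K} = ennreal (section_volume K \<xi> t)"
    by (simp add: section_volume_eq[OF \<xi> K] measure_def)
  then have "ennreal (section_volume K \<xi> t) = (\<integral>\<^sup>+y. indicator {y. t *\<^sub>R \<xi> + y \<in> K} y \<partial>perp_lborel \<xi>)"
    by simp
  also have "\<dots> = (\<integral>\<^sup>+y. indicator K (t *\<^sub>R \<xi> + y) \<partial>perp_lborel \<xi>)"
    by (intro nn_integral_cong) (auto simp: indicator_def)
  finally show ?thesis .
qed

text \<open>The measure \<open>perp_lborel \<xi>\<close> varies with \<open>\<xi>\<close>, so joint
  measurability is not immediate. The slab formula rewrites the volume as an integral of a jointly
  measurable function against \<open>lborel\<close>.\<close>

lemma measurable_section_volume_sgn: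
  fixes K :: "'a::euclidean_space set"
  assumes K[measurable]: "K \<in> sets borel" and b: "bounded K" and dim: "2 \<le> DIM('a)"
    and f[measurable]: "f \<in> borel_measurable M" and g[measurable]: "g \<in> borel_measurable M"
  shows "(\<lambda>x. section_volume K (sgn (f x :: 'a)) (g x)) \<in> borel_measurable M"
proof -
  define G where "G \<xi> t = (\<integral>\<^sup>+x. indicator {0..1} (x \<bullet> \<xi>) * indicator K (t *\<^sub>R \<xi> + perp_proj \<xi> x) \<partial>lborel)" for \<xi> :: 'a and t :: real
  have [measurable]: "(\<lambda>p. G (fst p) (snd p)) \<in> borel_measurable (borel \<Otimes>\<^sub>M borel)"
    unfolding G_def perp_proj_def by measurable
  have eq: "section_volume K \<xi> t = enn2real (G \<xi> t)" if "norm \<xi> = 1" for \<xi> t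
  proof -
    have "G \<xi> t = ennreal (section_volume K \<xi> t)"
      unfolding G_def ennreal_section_volume[OF that K b dim]
      using nn_integral_perp_slab[OF that, of "\<lambda>y. indicator K (t *\<^sub>R \<xi> + y)" 1] by simp
    then show ?thesis by (simp add: section_volume_nonneg)
  qed
  \<comment> \<open>At \<open>f x = 0\<close> the normal becomes \<open>sgn 0 = 0\<close>; the
    meaningless volume there is at least constant in t.\<close>
  have z: "section_volume K 0 t = section_volume K 0 0" for t
    by (simp add: section_volume_def)
  have "(\<lambda>x. section_volume K (sgn (f x)) (g x)) = (\<lambda>x. if f x = 0 then section_volume K 0 0 else enn2real (G (sgn (f x)) (g x)))"
    using eq z by (auto simp: fun_eq_iff norm_sgn)
  moreover have "(\<lambda>x. if f x = 0 then section_volume K 0 0 else enn2real (G (sgn (f x)) (g x))) \<in> borel_measurable M"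
  proof -
    have "(\<lambda>x. G (sgn (f x)) (g x)) \<in> borel_measurable M"
      by (rule measurable_compose[of "\<lambda>x. (sgn (f x), g x)" M "borel \<Otimes>\<^sub>M borel" "\<lambda>p. G (fst p) (snd p)", simplified]) measurable
    then show ?thesis by measurable
  qed
  ultimately show ?thesis by simp
qed

text \<open>By Taylor's bound the k-th derivative is the limit along e = 1/(i+1) of k!/e^k times the
  volume minus its Taylor polynomial of lower degree; this is measurable by induction on k.\<close>

lemma measurable_section_deriv0:
  fixes K :: "'a::euclidean_space set"
  assumes K: "star_body K" and sm: "smooth_on_submanifold (radial_function K) (sphere 0 1)" and dim: "2 \<le> DIM('a)"
  shows "(\<lambda>\<xi>. section_deriv0 K \<xi> k) \<in> borel_measurable (restrict_space borel (sphere 0 1))"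
proof (induction k rule: less_induct)
  case (less k)
  have bK: "K \<in> sets borel" "bounded K" using star_body_borel[OF K] K by (auto simp: star_body_def compact_imp_bounded)
  obtain C where C: "0 \<le> C" "\<And>\<xi> t. norm \<xi> = 1 \<Longrightarrow>
      \<bar>section_volume K \<xi> t - (\<Sum>j<Suc k. section_deriv0 K \<xi> j / fact j * t ^ j)\<bar> \<le> C * \<bar>t\<bar> ^ Suc k"
    using section_volume_taylor(1)[OF K sm dim, of "Suc k"] by blast
  define e where "e i = 1 / real (Suc i)" for i
  have e: "0 < e i" "e \<longlonglongrightarrow> 0" for i unfolding e_def using LIMSEQ_Suc[OF lim_1_over_n] by auto
  define a where "a i \<xi> = fact k / e i ^ k * (section_volume K (sgn \<xi>) (e i) - (\<Sum>j<k. section_deriv0 K \<xi> j / fact j * e i ^ j))" for i \<xi>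
  have lim: "(\<lambda>i. a i \<xi>) \<longlonglongrightarrow> section_deriv0 K \<xi> k" if \<xi>: "norm \<xi> = 1" for \<xi>
  proof (rule LIM_zero_cancel, rule Lim_null_comparison[where g = "\<lambda>i. fact k * C * e i"])
    have s: "sgn \<xi> = \<xi>" using \<xi> by (simp add: sgn_div_norm)
    have "norm (a i \<xi> - section_deriv0 K \<xi> k) \<le> fact k * C * e i" for i
    proof -
      have "a i \<xi> - section_deriv0 K \<xi> k = fact k / e i ^ k * (section_volume K \<xi> (e i) - (\<Sum>j<Suc k. section_deriv0 K \<xi> j / fact j * e i ^ j))"
        using e(1)[of i] by (simp add: a_def s field_simps)
      also have "\<bar>\<dots>\<bar> \<le> fact k / e i ^ k * (C * \<bar>e i\<bar> ^ Suc k)"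
        unfolding abs_mult using C(2)[OF \<xi>, of "e i"] e(1)[of i] by (intro mult_mono) auto
      also have "\<dots> = fact k * C * e i" using e(1)[of i] by simp
      finally show ?thesis by simp
    qed
    then show "\<forall>\<^sub>F i in sequentially. norm (a i \<xi> - section_deriv0 K \<xi> k) \<le> fact k * C * e i" by simp
    show "(\<lambda>i. fact k * C * e i) \<longlonglongrightarrow> 0" using tendsto_mult_right_zero[OF e(2)] by simp
  qed
  show ?case
  proof (rule borel_measurable_LIMSEQ_real)
    show "(\<lambda>i. a i \<xi>) \<longlonglongrightarrow> section_deriv0 K \<xi> k" if "\<xi> \<in> space (restrict_space borel (sphere 0 1))" for \<xi>
      using that by (intro lim) (simp add: space_restrict_space)
    show "a i \<in> borel_measurable (restrict_space borel (sphere 0 1))" for i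
    proof -
      have "(\<lambda>\<xi>. section_volume K (sgn \<xi>) (e i)) \<in> borel_measurable (restrict_space borel (sphere 0 1))"
        by (intro measurable_section_volume_sgn[OF bK dim] measurable_restrict_space1) simp_all
      then show ?thesis unfolding a_def[abs_def]
        by (intro borel_measurable_times borel_measurable_diff borel_measurable_sum borel_measurable_divide less) auto
    qed
  qed
qed

lemma measurable_section_deriv0_sgn:
  fixes K :: "'a::euclidean_space set"
  assumes "star_body K" "smooth_on_submanifold (radial_function K) (sphere 0 1)" "2 \<le> DIM('a)"
  shows "(\<lambda>y. section_deriv0 K (sgn y) k) \<in> borel_measurable borel"
  by (rule measurable_sgn_sphere[OF measurable_section_deriv0[OF assms]])

section \<open>Gaussian averages over a hyperplane\<close>

lemma norm_add_perp:
  assumes "norm \<xi> = 1" "y \<in> perp \<xi>"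
  shows "(norm (s *\<^sub>R \<xi> + y))\<^sup>2 = s\<^sup>2 + (norm y)\<^sup>2"
  using assms by (simp only: power2_norm_eq_inner)
    (simp add: inner_add_left inner_add_right perp_def inner_commute norm_eq_1 power2_eq_square)

text \<open>The marginal is needed inside the hyperplane of \<open>\<theta>\<close>, whereas Fubini
  is available for the whole space. The Gaussian integral over the whole space is therefore split
  twice, along \<open>\<theta>\<close> and along the direction of y; comparing the results cancels
  one factor sqrt(pi/b).\<close>

lemma nn_integral_gaussian_marginal:
  fixes \<theta> :: "'a::euclidean_space"
  assumes \<theta>: "norm \<theta> = 1" and y: "y \<in> perp \<theta>" "y \<noteq> 0" and b: "0 < b" and dim: "2 \<le> DIM('a)"
    and [measurable]: "F \<in> borel_measurable borel"
  shows "(\<integral>\<^sup>+\<eta>. ennreal (exp (- b * (norm \<eta>)\<^sup>2)) * F (\<eta> \<bullet> y) \<partial>perp_lborel \<theta>) =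
    ennreal (sqrt (pi / b) ^ (DIM('a) - 2)) * (\<integral>\<^sup>+s. ennreal (exp (- b * s\<^sup>2)) * F (s * norm y) \<partial>lborel)"
proof -
  let ?I = "\<integral>\<^sup>+x. ennreal (exp (- b * (norm x)\<^sup>2)) * F (x \<bullet> y) \<partial>lborel"
  let ?c = "ennreal (sqrt (pi / b))"
  define u where "u = sgn y"
  have u: "norm u = 1" "u \<bullet> y = norm y" using y by (auto simp: u_def norm_sgn sgn_div_norm power2_norm_eq_inner[symmetric] power2_eq_square)
  have "?I = (\<integral>\<^sup>+s. \<integral>\<^sup>+\<eta>. ennreal (exp (- b * (norm (s *\<^sub>R \<theta> + \<eta>))\<^sup>2)) * F ((s *\<^sub>R \<theta> + \<eta>) \<bullet> y) \<partial>perp_lborel \<theta> \<partial>lborel)"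
    by (rule nn_integral_lborel_perp[OF \<theta>]) simp
  also have "\<dots> = (\<integral>\<^sup>+s. \<integral>\<^sup>+\<eta>. ennreal (exp (- b * s\<^sup>2)) * (ennreal (exp (- b * (norm \<eta>)\<^sup>2)) * F (\<eta> \<bullet> y)) \<partial>perp_lborel \<theta> \<partial>lborel)"
  proof (rule nn_integral_cong, rule nn_integral_cong_AE)
    fix s :: real
    show "AE \<eta> in perp_lborel \<theta>. ennreal (exp (- b * (norm (s *\<^sub>R \<theta> + \<eta>))\<^sup>2)) * F ((s *\<^sub>R \<theta> + \<eta>) \<bullet> y) =
      ennreal (exp (- b * s\<^sup>2)) * (ennreal (exp (- b * (norm \<eta>)\<^sup>2)) * F (\<eta> \<bullet> y))"
      using AE_perp_lborel[OF \<theta>]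
    proof eventually_elim
      case (elim \<eta>)
      have e: "(s *\<^sub>R \<theta> + \<eta>) \<bullet> y = \<eta> \<bullet> y" using y(1) inner_commute[of y \<theta>] by (simp only: inner_add_left inner_scaleR_left perp_def) simp
      have "exp (- b * (norm (s *\<^sub>R \<theta> + \<eta>))\<^sup>2) = exp (- b * s\<^sup>2) * exp (- b * (norm \<eta>)\<^sup>2)"
        unfolding norm_add_perp[OF \<theta> elim] exp_add[symmetric] by (simp add: algebra_simps)
      then show ?case unfolding e by (simp add: ennreal_mult mult_ac)
    qed
  qed
  also have "\<dots> = ?c * (\<integral>\<^sup>+\<eta>. ennreal (exp (- b * (norm \<eta>)\<^sup>2)) * F (\<eta> \<bullet> y) \<partial>perp_lborel \<theta>)"
    using nn_integral_gaussian[OF b] by (simp add: nn_integral_cmult nn_integral_multc)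
  finally have 1: "?I = \<dots>" .
  have "?I = (\<integral>\<^sup>+s. \<integral>\<^sup>+\<eta>. ennreal (exp (- b * (norm (s *\<^sub>R u + \<eta>))\<^sup>2)) * F ((s *\<^sub>R u + \<eta>) \<bullet> y) \<partial>perp_lborel u \<partial>lborel)"
    by (rule nn_integral_lborel_perp[OF u(1)]) simp
  also have "\<dots> = (\<integral>\<^sup>+s. \<integral>\<^sup>+\<eta>. (ennreal (exp (- b * s\<^sup>2)) * F (s * norm y)) * ennreal (exp (- b * (norm \<eta>)\<^sup>2)) \<partial>perp_lborel u \<partial>lborel)"
  proof (rule nn_integral_cong, rule nn_integral_cong_AE)
    fix s :: real
    show "AE \<eta> in perp_lborel u. ennreal (exp (- b * (norm (s *\<^sub>R u + \<eta>))\<^sup>2)) * F ((s *\<^sub>R u + \<eta>) \<bullet> y) =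
      (ennreal (exp (- b * s\<^sup>2)) * F (s * norm y)) * ennreal (exp (- b * (norm \<eta>)\<^sup>2))"
      using AE_perp_lborel[OF u(1)]
    proof eventually_elim
      case (elim \<eta>)
      have "y = norm y *\<^sub>R u" using y by (simp add: u_def sgn_div_norm)
      then have "\<eta> \<bullet> y = norm y * (\<eta> \<bullet> u)" by (metis inner_scaleR_right)
      then have "\<eta> \<bullet> y = 0" using elim by (simp add: perp_def)
      then have e: "(s *\<^sub>R u + \<eta>) \<bullet> y = s * norm y" by (simp add: inner_add_left u)
      have "exp (- b * (norm (s *\<^sub>R u + \<eta>))\<^sup>2) = exp (- b * s\<^sup>2) * exp (- b * (norm \<eta>)\<^sup>2)"
        unfolding norm_add_perp[OF u(1) elim] exp_add[symmetric] by (simp add: algebra_simps)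
      then show ?case unfolding e by (simp add: ennreal_mult mult_ac)
    qed
  qed
  also have "\<dots> = (\<integral>\<^sup>+s. ennreal (exp (- b * s\<^sup>2)) * F (s * norm y) \<partial>lborel) * ennreal (sqrt (pi / b) ^ (DIM('a) - 1))"
    by (subst nn_integral_cmult) (simp_all only: nn_integral_gaussian_perp[OF u(1) b], simp_all add: nn_integral_multc)
  also have "ennreal (sqrt (pi / b) ^ (DIM('a) - 1)) = ?c * ennreal (sqrt (pi / b) ^ (DIM('a) - 2))"
  proof -
    have "DIM('a) - 1 = Suc (DIM('a) - 2)" using dim by simp
    then show ?thesis using b by (simp only: power_Suc) (simp add: ennreal_mult)
  qed
  finally have "?c * (\<integral>\<^sup>+\<eta>. ennreal (exp (- b * (norm \<eta>)\<^sup>2)) * F (\<eta> \<bullet> y) \<partial>perp_lborel \<theta>) =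
    ?c * (ennreal (sqrt (pi / b) ^ (DIM('a) - 2)) * (\<integral>\<^sup>+s. ennreal (exp (- b * s\<^sup>2)) * F (s * norm y) \<partial>lborel))"
    unfolding 1 by (simp only: mult_ac)
  moreover have "?c \<noteq> 0" "?c \<noteq> \<top>" using b by auto
  ultimately show ?thesis by (simp add: ennreal_mult_cancel_left)
qed

section \<open>Integrability of radial weights on a hyperplane\<close>

lemma integrable_inverse_power_ball:
  fixes \<theta> :: "'a::euclidean_space"
  assumes \<theta>: "norm \<theta> = 1" and dim: "2 \<le> DIM('a)"
  shows "(\<integral>\<^sup>+y. ennreal (indicator (cball 0 1) y * (1 / norm y) ^ (DIM('a) - 2)) \<partial>perp_lborel \<theta>) < \<top>"
proof -
  define k where "k = DIM('a) - 2"
  define vol where "vol = unit_ball_vol (real (Suc k))"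
  have vol: "emeasure (perp_lborel \<theta>) (cball 0 r) = ennreal (vol * r ^ Suc k)" if "0 \<le> r" for r
  proof -
    have "DIM('a) - 1 = Suc k" using dim by (simp add: k_def)
    then show ?thesis using emeasure_perp_lborel_cball[OF \<theta> that dim] by (simp add: vol_def)
  qed
  \<comment> \<open>Dyadic shells: where 2^(-i-1) < |y| \<le> 2^(-i), the integrand is at most
    2^((i+1)k), while the ball of radius 2^(-i) has volume of order 2^(-i(k+1)). The products form a
    geometric series of ratio 1/2.\<close>
  define F where "F i y = ennreal ((2 ^ Suc i) ^ k) * indicator (cball 0 ((1 / 2) ^ i)) y" for i and y :: 'a
  have [measurable]: "F i \<in> borel_measurable borel" for i unfolding F_def[abs_def] by measurable
  have le: "ennreal (indicator (cball 0 1) y * (1 / norm y) ^ k) \<le> (\<Sum>i. F i y)" if "y \<noteq> 0" for y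
  proof (cases "norm y \<le> 1")
    case True
    have "\<exists>i. (1 / 2) ^ Suc i < norm y"
    proof -
      obtain i where "(1 / 2 :: real) ^ i < norm y" using real_arch_pow_inv[of "norm y" "1 / 2"] \<open>y \<noteq> 0\<close> by auto
      moreover have "(1 / 2 :: real) ^ Suc i \<le> (1 / 2) ^ i" by simp
      ultimately show ?thesis by (meson le_less_trans)
    qed
    define i where "i = (LEAST i. (1 / 2) ^ Suc i < norm y)"
    have i: "(1 / 2) ^ Suc i < norm y" unfolding i_def by (rule LeastI_ex) fact
    have "norm y \<le> (1 / 2) ^ i"
    proof (cases i)
      case 0 then show ?thesis using True by simp
    next
      case (Suc j)
      then have "\<not> (1 / 2) ^ Suc j < norm y" using not_less_Least[of j "\<lambda>i. (1 / 2) ^ Suc i < norm y"] by (simp add: i_def)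
      then show ?thesis using Suc by simp
    qed
    moreover have "(1 / norm y) ^ k \<le> (2 ^ Suc i) ^ k"
    proof (rule power_mono)
      have "1 / norm y \<le> 1 / (1 / 2) ^ Suc i" using i that by (intro frac_le) auto
      then show "1 / norm y \<le> 2 ^ Suc i" by (simp add: power_one_over)
    qed simp
    ultimately have "ennreal (indicator (cball 0 1) y * (1 / norm y) ^ k) \<le> F i y"
      using True by (simp add: F_def ennreal_leI)
    also have "\<dots> \<le> (\<Sum>i. F i y)" using sum_le_suminf[of "\<lambda>i. F i y" "{i}"] by simp
    finally show ?thesis .
  qed simp
  have "(\<integral>\<^sup>+y. ennreal (indicator (cball 0 1) y * (1 / norm y) ^ k) \<partial>perp_lborel \<theta>) \<le> (\<integral>\<^sup>+y. (\<Sum>i. F i y) \<partial>perp_lborel \<theta>)"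
    using AE_perp_lborel_nonzero[OF \<theta> dim] by (intro nn_integral_mono_AE) (auto simp: le)
  also have "\<dots> = (\<Sum>i. \<integral>\<^sup>+y. F i y \<partial>perp_lborel \<theta>)" by (rule nn_integral_suminf) simp
  also have "\<dots> = (\<Sum>i. ennreal (vol * 2 ^ k * (1 / 2) ^ i))"
  proof (rule suminf_cong)
    fix i
    have "(\<integral>\<^sup>+y. F i y \<partial>perp_lborel \<theta>) = ennreal ((2 ^ Suc i) ^ k * (vol * ((1 / 2) ^ i) ^ Suc k))"
      unfolding F_def by (simp add: nn_integral_cmult vol ennreal_mult' del: power_Suc)
    also have "((2::real) ^ Suc i) ^ k * (vol * ((1 / 2) ^ i) ^ Suc k) = vol * 2 ^ k * (1 / 2) ^ i"
    proof -
      have "((2::real) ^ i) ^ k * ((1 / 2) ^ i) ^ k = 1" by (simp flip: power_mult_distrib)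
      then show ?thesis by (simp add: power_mult_distrib mult_ac)
    qed
    finally show "(\<integral>\<^sup>+y. F i y \<partial>perp_lborel \<theta>) = ennreal (vol * 2 ^ k * (1 / 2) ^ i)" .
  qed
  also have "\<dots> < \<top>"
  proof -
    have "summable (\<lambda>i. vol * 2 ^ k * (1 / 2) ^ i)" by (intro summable_mult summable_geometric) simp
    moreover have "0 \<le> vol * 2 ^ k * (1 / 2) ^ i" for i by (simp add: vol_def)
    ultimately have "(\<Sum>i. ennreal (vol * 2 ^ k * (1 / 2) ^ i)) \<noteq> \<top>" by (rule ennreal_suminf_neq_top)
    then show ?thesis by (simp only: less_top)
  qed
  finally show ?thesis by (simp add: k_def)
qed

lemma integrable_gaussian_inverse_power:
  fixes \<theta> :: "'a::euclidean_space"
  assumes \<theta>: "norm \<theta> = 1" and dim: "2 \<le> DIM('a)" and b: "0 < b" and j: "j \<le> DIM('a) - 2"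
  shows "integrable (perp_lborel \<theta>) (\<lambda>y. exp (- b * (norm y)\<^sup>2) * (1 / norm y) ^ j)"
proof (rule integrableI_nonneg)
  let ?k = "DIM('a) - 2"
  have le: "exp (- b * (norm y)\<^sup>2) * (1 / norm y) ^ j \<le> exp (- b * (norm y)\<^sup>2) + indicator (cball 0 1) y * (1 / norm y) ^ ?k" for y :: 'a
  proof (cases "y = 0")
    case True then show ?thesis by (simp add: power_0_left)
  next
    case False
    show ?thesis
    proof (cases "norm y \<le> 1")
      case True
      have "exp (- b * (norm y)\<^sup>2) * (1 / norm y) ^ j \<le> 1 * (1 / norm y) ^ ?k"
        using False True j b by (intro mult_mono power_increasing) auto
      then show ?thesis using True by (simp add: add_increasing)
    next
      case False
      then have "(1 / norm y) ^ j \<le> 1" by (intro power_le_one) (auto simp: divide_le_eq_1)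
      then show ?thesis using False by (simp add: mult_left_le)
    qed
  qed
  have "(\<integral>\<^sup>+y. ennreal (exp (- b * (norm y)\<^sup>2) * (1 / norm y) ^ j) \<partial>perp_lborel \<theta>) \<le>
    (\<integral>\<^sup>+y. ennreal (exp (- b * (norm y)\<^sup>2)) + ennreal (indicator (cball 0 1) y * (1 / norm y) ^ ?k) \<partial>perp_lborel \<theta>)"
    using le by (intro nn_integral_mono) (simp add: ennreal_plus[symmetric] ennreal_leI del: ennreal_plus)
  also have "\<dots> = (\<integral>\<^sup>+y. ennreal (exp (- b * (norm y)\<^sup>2)) \<partial>perp_lborel \<theta>) + (\<integral>\<^sup>+y. ennreal (indicator (cball 0 1) y * (1 / norm y) ^ ?k) \<partial>perp_lborel \<theta>)"
    by (rule nn_integral_add) auto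
  also have "\<dots> < \<infinity>" using integrable_inverse_power_ball[OF \<theta> dim] nn_integral_gaussian_perp[OF \<theta> b] by simp
  finally show "(\<integral>\<^sup>+y. ennreal (exp (- b * (norm y)\<^sup>2) * (1 / norm y) ^ j) \<partial>perp_lborel \<theta>) < \<infinity>" .
qed auto

text \<open>The second term is the first one dilated by 2. Since the difference is O(r^2) at 0, it
  stays integrable against |eta|^(-j) up to j = n in dimension n - 1, while a single Gaussian stops
  at j = n - 2.\<close>

definition radial_weight :: "real \<Rightarrow> real" where
  "radial_weight r = exp (- r\<^sup>2) - exp (- 4 * r\<^sup>2)"

lemma radial_weight_bounds: "0 \<le> radial_weight r" "radial_weight r \<le> exp (- r\<^sup>2)" "radial_weight r \<le> 3 * r\<^sup>2 * exp (- r\<^sup>2)"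
proof -
  have e: "radial_weight r = exp (- r\<^sup>2) * (1 - exp (- 3 * r\<^sup>2))"
    by (simp add: radial_weight_def right_diff_distrib flip: exp_add)
  have "1 - exp (- 3 * r\<^sup>2) \<le> 3 * r\<^sup>2" using exp_ge_add_one_self[of "- 3 * r\<^sup>2"] by simp
  then show "radial_weight r \<le> 3 * r\<^sup>2 * exp (- r\<^sup>2)" unfolding e by (simp add: mult.commute)
  show "0 \<le> radial_weight r" "radial_weight r \<le> exp (- r\<^sup>2)" by (simp_all add: radial_weight_def)
qed

lemma radial_weight_pos: "r \<noteq> 0 \<Longrightarrow> 0 < radial_weight r"
  by (simp add: radial_weight_def)

lemma measurable_radial_weight[measurable]: "radial_weight \<in> borel_measurable borel"
  unfolding radial_weight_def by measurable

lemma integrable_radial_weight: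
  fixes \<theta> :: "'a::euclidean_space"
  assumes \<theta>: "norm \<theta> = 1" and dim: "3 \<le> DIM('a)" and j: "j \<le> DIM('a)"
  shows "integrable (perp_lborel \<theta>) (\<lambda>y. radial_weight (norm y) * (1 / norm y) ^ j)"
proof (cases "j < 2")
  case True
  have "integrable (perp_lborel \<theta>) (\<lambda>y. exp (- 1 * (norm y)\<^sup>2) * (1 / norm y) ^ j)"
    by (rule integrable_gaussian_inverse_power) (use assms True in auto)
  then show ?thesis
    by (rule Bochner_Integration.integrable_bound) (auto simp: abs_mult radial_weight_bounds intro!: mult_right_mono)
next
  case False
  have "integrable (perp_lborel \<theta>) (\<lambda>y. 3 * (exp (- 1 * (norm y)\<^sup>2) * (1 / norm y) ^ (j - 2)))"
    by (intro integrable_mult_right integrable_gaussian_inverse_power) (use assms False in auto)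
  then show ?thesis
  proof (rule Bochner_Integration.integrable_bound)
    have "norm (radial_weight (norm y) * (1 / norm y) ^ j) \<le> norm (3 * (exp (- 1 * (norm y)\<^sup>2) * (1 / norm y) ^ (j - 2)))" for y :: 'a
    proof (cases "y = 0")
      case False
      have "\<bar>radial_weight (norm y) * (1 / norm y) ^ j\<bar> \<le> (3 * (norm y)\<^sup>2 * exp (- (norm y)\<^sup>2)) * (1 / norm y) ^ j"
        using radial_weight_bounds[of "norm y"] by (simp add: abs_mult mult_right_mono)
      also have "\<dots> = 3 * (exp (- (norm y)\<^sup>2) * (((norm y)\<^sup>2 * (1 / norm y)\<^sup>2) * (1 / norm y) ^ (j - 2)))"
      proof -
        have "(1 / norm y) ^ j = (1 / norm y)\<^sup>2 * (1 / norm y) ^ (j - 2)"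
          using power_add[of "1 / norm y" 2 "j - 2"] \<open>\<not> j < 2\<close> by (metis le_add_diff_inverse not_less)
        then show ?thesis by (simp only: mult_ac)
      qed
      also have "(norm y)\<^sup>2 * (1 / norm y)\<^sup>2 = 1" using False by (simp flip: power_mult_distrib)
      finally show ?thesis by simp
    qed (use \<open>\<not> j < 2\<close> in \<open>simp add: radial_weight_def\<close>)
    then show "AE y in perp_lborel \<theta>. norm (radial_weight (norm y) * (1 / norm y) ^ j) \<le> norm (3 * (exp (- 1 * (norm y)\<^sup>2) * (1 / norm y) ^ (j - 2)))"
      by simp
  qed measurable
qed

section \<open>The averaged section volume as an integral over the body\<close>

lemma AE_perp_proj_nonzero:
  fixes \<theta> :: "'a::euclidean_space"
  assumes \<theta>: "norm \<theta> = 1" and dim: "2 \<le> DIM('a)"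
  shows "AE x in lborel. perp_proj \<theta> x \<noteq> 0"
proof (rule AE_I[of _ _ "{x. perp_proj \<theta> x = 0}"])
  have "emeasure lborel {x. perp_proj \<theta> x = 0} = (\<integral>\<^sup>+x. indicator {x. perp_proj \<theta> x = 0} x \<partial>lborel)"
    by (subst nn_integral_indicator) simp_all
  also have "\<dots> = (\<integral>\<^sup>+s. \<integral>\<^sup>+y. indicator {x. perp_proj \<theta> x = 0} (s *\<^sub>R \<theta> + y) \<partial>perp_lborel \<theta> \<partial>lborel)"
    by (rule nn_integral_lborel_perp[OF \<theta>]) measurable
  also have "\<dots> = (\<integral>\<^sup>+(s::real). \<integral>\<^sup>+y. 0 \<partial>perp_lborel \<theta> \<partial>lborel)"
  proof (rule nn_integral_cong, rule nn_integral_cong_AE)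
    fix s :: real
    show "AE y in perp_lborel \<theta>. indicator {x. perp_proj \<theta> x = 0} (s *\<^sub>R \<theta> + y) = (0::ennreal)"
      using AE_perp_lborel[OF \<theta>] AE_perp_lborel_nonzero[OF \<theta> dim]
    proof eventually_elim
      case (elim y)
      have "perp_proj \<theta> (s *\<^sub>R \<theta> + y) = y"
        using elim \<theta> by (simp add: perp_proj_def inner_add_left perp_def norm_eq_1)
      then show ?case using elim by simp
    qed
  qed
  finally show "emeasure lborel {x. perp_proj \<theta> x = 0} = 0" by simp
qed simp_all

lemma nn_integral_real_scale:
  assumes r: "0 < r" and [measurable]: "F \<in> borel_measurable borel"
  shows "(\<integral>\<^sup>+t. F t \<partial>lborel) = (\<integral>\<^sup>+s. ennreal r * F (r * s) \<partial>lborel)"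
  using nn_integral_real_affine[of F r 0] r by (simp add: nn_integral_cmult)

text \<open>Both sides are the density of the image of the Gaussian measure times the uniform measure
  on \<open>K\<close> under \<open>(\<eta>, x) \<mapsto> \<langle>x, \<eta>\<rangle>\<close>.\<close>

lemma AE_gaussian_section_average:
  fixes \<theta> :: "'a::euclidean_space"
  assumes \<theta>: "norm \<theta> = 1" and dim: "2 \<le> DIM('a)" and b: "0 < b"
    and K[measurable]: "K \<in> sets borel" and bK: "bounded K"
  shows "AE t in lborel.
    (\<integral>\<^sup>+\<eta>. ennreal (exp (- b * (norm \<eta>)\<^sup>2) * (1 / norm \<eta>) * section_volume K (sgn \<eta>) (t / norm \<eta>)) \<partial>perp_lborel \<theta>) =
    (\<integral>\<^sup>+x. indicator K x * ennreal (sqrt (pi / b) ^ (DIM('a) - 2) * (1 / norm (perp_proj \<theta> x)) *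
        exp (- b * (t / norm (perp_proj \<theta> x))\<^sup>2)) \<partial>lborel)"
proof -
  interpret P: sigma_finite_measure "perp_lborel \<theta>" using sigma_finite_perp_lborel[OF \<theta> dim] .
  interpret PR: pair_sigma_finite "perp_lborel \<theta>" "lborel :: real measure"
    by (simp add: pair_sigma_finite_def P.sigma_finite_measure_axioms sigma_finite_lborel)
  interpret RP: pair_sigma_finite "lborel :: real measure" "perp_lborel \<theta>"
    by (simp add: pair_sigma_finite_def P.sigma_finite_measure_axioms sigma_finite_lborel)
  interpret PL: pair_sigma_finite "perp_lborel \<theta>" "lborel :: 'a measure"
    by (simp add: pair_sigma_finite_def P.sigma_finite_measure_axioms sigma_finite_lborel)
  define e where "e \<eta> = exp (- b * (norm \<eta>)\<^sup>2)" for \<eta> :: 'a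
  define c where "c = sqrt (pi / b) ^ (DIM('a) - 2)"
  have [measurable]: "e \<in> borel_measurable borel" unfolding e_def by measurable
  have e0: "0 \<le> e \<eta>" for \<eta> by (simp add: e_def)
  have c0: "0 \<le> c" using b by (simp add: c_def)
  define A where "A \<eta> t = section_volume K (sgn \<eta>) (t / norm \<eta>)" for \<eta> t
  have A0: "0 \<le> A \<eta> t" for \<eta> t by (simp add: A_def section_volume_nonneg)
  note msv = measurable_section_volume_sgn[OF K bK dim]
  have Am[measurable]: "(\<lambda>p. A (fst p) (snd p)) \<in> borel_measurable (perp_lborel \<theta> \<Otimes>\<^sub>M lborel)"
    "(\<lambda>p. A (snd p) (fst p)) \<in> borel_measurable (lborel \<Otimes>\<^sub>M perp_lborel \<theta>)"
    unfolding A_def by (rule msv; measurable)+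
  have A1[measurable]: "(\<lambda>t. A \<eta> t) \<in> borel_measurable borel" for \<eta>
    unfolding A_def by (rule msv; measurable)
  have A2[measurable]: "(\<lambda>\<eta>. A \<eta> t) \<in> borel_measurable (perp_lborel \<theta>)" for t
    unfolding A_def by (rule msv; measurable)
  have sv1[measurable]: "(\<lambda>t. section_volume K (sgn \<eta>) t) \<in> borel_measurable borel" for \<eta>
    by (rule msv; measurable)
  define p where "p x = norm (perp_proj \<theta> x)" for x
  have [measurable]: "p \<in> borel_measurable borel" unfolding p_def by measurable
  have p0: "0 \<le> p x" for x by (simp add: p_def)
  define f where "f t = (\<integral>\<^sup>+\<eta>. ennreal (e \<eta> * (1 / norm \<eta>) * A \<eta> t) \<partial>perp_lborel \<theta>)" for t
  define f' where "f' t = (\<integral>\<^sup>+x. indicator K x * ennreal (c * (1 / p x) * exp (- b * (t / p x)\<^sup>2)) \<partial>lborel)" for t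
  have "AE t in lborel. f t = f' t"
  proof (rule sigma_finite_measure.density_unique2)
    show "sigma_finite_measure (lborel :: real measure)" by (rule sigma_finite_lborel)
    show fm: "f \<in> borel_measurable lborel"
      unfolding f_def by (rule P.borel_measurable_nn_integral) (simp add: case_prod_unfold)
    show fm': "f' \<in> borel_measurable lborel" unfolding f'_def by measurable
    fix T :: "real set" assume "T \<in> sets lborel"
    then have [measurable]: "T \<in> sets borel" by simp
    \<comment> \<open>For fixed eta the level t of the pairing with eta is the section at height
      t/|eta| along the unit normal, so substituting t = r s and Fubini along that normal give the
      law of the pairing on K.\<close>
    have 1: "(\<integral>\<^sup>+t. ennreal (e \<eta> * (1 / norm \<eta>) * A \<eta> t) * indicator T t \<partial>lborel) =
      ennreal (e \<eta>) * (\<integral>\<^sup>+x. indicator K x * indicator T (x \<bullet> \<eta>) \<partial>lborel)" if \<eta>: "\<eta> \<noteq> 0" for \<eta>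
    proof -
      define r where "r = norm \<eta>"
      define \<xi> where "\<xi> = sgn \<eta>"
      have r: "0 < r" "\<eta> = r *\<^sub>R \<xi>" and \<xi>: "norm \<xi> = 1" using \<eta> by (auto simp: r_def \<xi>_def sgn_div_norm)
      have "(\<integral>\<^sup>+t. ennreal (e \<eta> * (1 / norm \<eta>) * A \<eta> t) * indicator T t \<partial>lborel) =
        (\<integral>\<^sup>+s. ennreal r * (ennreal (e \<eta> * (1 / r) * section_volume K \<xi> s) * indicator T (r * s)) \<partial>lborel)"
        using r(1) by (subst nn_integral_real_scale[OF r(1)]) (simp_all add: A_def r_def[symmetric] \<xi>_def)
      also have "\<dots> = (\<integral>\<^sup>+s. ennreal (e \<eta>) * (ennreal (section_volume K \<xi> s) * indicator T (r * s)) \<partial>lborel)"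
      proof (rule nn_integral_cong)
        fix s
        have "ennreal r * ennreal (e \<eta> * (1 / r) * section_volume K \<xi> s) = ennreal (e \<eta>) * ennreal (section_volume K \<xi> s)"
          using r e0 section_volume_nonneg[of K \<xi> s] by (simp add: ennreal_mult'[symmetric])
        then show "ennreal r * (ennreal (e \<eta> * (1 / r) * section_volume K \<xi> s) * indicator T (r * s)) =
           ennreal (e \<eta>) * (ennreal (section_volume K \<xi> s) * indicator T (r * s))" by (simp add: mult.assoc[symmetric])
      qed
      also have "\<dots> = ennreal (e \<eta>) * (\<integral>\<^sup>+s. ennreal (section_volume K \<xi> s) * indicator T (r * s) \<partial>lborel)"
        unfolding \<xi>_def by (rule nn_integral_cmult) measurable
      also have "(\<integral>\<^sup>+s. ennreal (section_volume K \<xi> s) * indicator T (r * s) \<partial>lborel) =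
        (\<integral>\<^sup>+s. \<integral>\<^sup>+y. indicator K (s *\<^sub>R \<xi> + y) * indicator T ((s *\<^sub>R \<xi> + y) \<bullet> \<eta>) \<partial>perp_lborel \<xi> \<partial>lborel)"
      proof (rule nn_integral_cong)
        fix s
        have "ennreal (section_volume K \<xi> s) * indicator T (r * s) = (\<integral>\<^sup>+y. indicator K (s *\<^sub>R \<xi> + y) * indicator T (r * s) \<partial>perp_lborel \<xi>)"
          unfolding ennreal_section_volume[OF \<xi> K bK dim] by (rule nn_integral_multc[symmetric]) measurable
        also have "\<dots> = (\<integral>\<^sup>+y. indicator K (s *\<^sub>R \<xi> + y) * indicator T ((s *\<^sub>R \<xi> + y) \<bullet> \<eta>) \<partial>perp_lborel \<xi>)"
          using AE_perp_lborel[OF \<xi>] \<xi>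
          by (intro nn_integral_cong_AE) (auto simp: r(2) inner_add_left perp_def norm_eq_1)
        finally show "ennreal (section_volume K \<xi> s) * indicator T (r * s) = \<dots>" .
      qed
      also have "\<dots> = (\<integral>\<^sup>+x. indicator K x * indicator T (x \<bullet> \<eta>) \<partial>lborel)"
        by (rule nn_integral_lborel_perp[OF \<xi>, symmetric]) measurable
      finally show ?thesis .
    qed
    \<comment> \<open>For fixed x only its projection y to the hyperplane matters, because eta is
      orthogonal to \<open>\<theta>\<close>; the pairing then has the one-dimensional Gaussian law
      scaled by |y|.\<close>
    have 2: "(\<integral>\<^sup>+\<eta>. ennreal (e \<eta>) * (indicator K x * indicator T (x \<bullet> \<eta>)) \<partial>perp_lborel \<theta>) =
      (\<integral>\<^sup>+t. indicator K x * ennreal (c * (1 / p x) * exp (- b * (t / p x)\<^sup>2)) * indicator T t \<partial>lborel)" if nz: "perp_proj \<theta> x \<noteq> 0" for x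
    proof -
      define y where "y = perp_proj \<theta> x"
      have y: "y \<in> perp \<theta>" "y \<noteq> 0" using nz perp_proj_in_perp[OF \<theta>] by (auto simp: y_def)
      have r: "0 < p x" "p x = norm y" using y by (auto simp: p_def y_def)
      have "(\<integral>\<^sup>+\<eta>. ennreal (e \<eta>) * (indicator K x * indicator T (x \<bullet> \<eta>)) \<partial>perp_lborel \<theta>) =
        (\<integral>\<^sup>+\<eta>. indicator K x * (ennreal (exp (- b * (norm \<eta>)\<^sup>2)) * indicator T (\<eta> \<bullet> y)) \<partial>perp_lborel \<theta>)"
      proof (rule nn_integral_cong_AE)
        show "AE \<eta> in perp_lborel \<theta>. ennreal (e \<eta>) * (indicator K x * indicator T (x \<bullet> \<eta>)) =
          indicator K x * (ennreal (exp (- b * (norm \<eta>)\<^sup>2)) * indicator T (\<eta> \<bullet> y))"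
          using AE_perp_lborel[OF \<theta>]
        proof eventually_elim
          case (elim \<eta>)
          have "x \<bullet> \<eta> = \<eta> \<bullet> y" using elim by (simp add: y_def perp_proj_def perp_def inner_diff_right inner_commute)
          then show ?case by (simp add: e_def mult_ac)
        qed
      qed
      also have "\<dots> = indicator K x * (\<integral>\<^sup>+\<eta>. ennreal (exp (- b * (norm \<eta>)\<^sup>2)) * indicator T (\<eta> \<bullet> y) \<partial>perp_lborel \<theta>)"
        by (rule nn_integral_cmult) measurable
      also have "\<dots> = indicator K x * (ennreal c * (\<integral>\<^sup>+s. ennreal (exp (- b * s\<^sup>2)) * indicator T (s * norm y) \<partial>lborel))"
        unfolding c_def by (subst nn_integral_gaussian_marginal[OF \<theta> y b dim]) simp_all
      also have "\<dots> = (\<integral>\<^sup>+s. indicator K x * (ennreal c * (ennreal (exp (- b * s\<^sup>2)) * indicator T (s * norm y))) \<partial>lborel)"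
        by (simp add: nn_integral_cmult)
      also have "\<dots> = (\<integral>\<^sup>+s. ennreal (p x) * (indicator K x * ennreal (c * (1 / p x) * exp (- b * ((p x * s) / p x)\<^sup>2)) * indicator T (p x * s)) \<partial>lborel)"
      proof (rule nn_integral_cong)
        fix s
        have "ennreal (p x) * ennreal (c * (1 / p x) * exp (- b * ((p x * s) / p x)\<^sup>2)) = ennreal c * ennreal (exp (- b * s\<^sup>2))"
          using r(1) c0 by (simp add: ennreal_mult'[symmetric])
        then have "(ennreal c * ennreal (exp (- b * s\<^sup>2))) * (indicator K x * indicator T (p x * s)) =
          (ennreal (p x) * ennreal (c * (1 / p x) * exp (- b * ((p x * s) / p x)\<^sup>2))) * (indicator K x * indicator T (p x * s))" by simp
        moreover have "s * norm y = p x * s" by (simp add: r(2))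
        ultimately show "indicator K x * (ennreal c * (ennreal (exp (- b * s\<^sup>2)) * indicator T (s * norm y))) =
          ennreal (p x) * (indicator K x * ennreal (c * (1 / p x) * exp (- b * ((p x * s) / p x)\<^sup>2)) * indicator T (p x * s))"
          by (simp only: mult_ac)
      qed
      also have "\<dots> = (\<integral>\<^sup>+t. indicator K x * ennreal (c * (1 / p x) * exp (- b * (t / p x)\<^sup>2)) * indicator T t \<partial>lborel)"
        by (rule nn_integral_real_scale[OF r(1), symmetric]) measurable
      finally show ?thesis .
    qed
    have "(\<integral>\<^sup>+t. f t * indicator T t \<partial>lborel) = (\<integral>\<^sup>+t. \<integral>\<^sup>+\<eta>. ennreal (e \<eta> * (1 / norm \<eta>) * A \<eta> t) * indicator T t \<partial>perp_lborel \<theta> \<partial>lborel)"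
      unfolding f_def by (rule nn_integral_cong, subst nn_integral_multc) simp_all
    also have "\<dots> = (\<integral>\<^sup>+\<eta>. \<integral>\<^sup>+t. ennreal (e \<eta> * (1 / norm \<eta>) * A \<eta> t) * indicator T t \<partial>lborel \<partial>perp_lborel \<theta>)"
      by (rule PR.Fubini') (simp add: case_prod_unfold)
    also have "\<dots> = (\<integral>\<^sup>+\<eta>. ennreal (e \<eta>) * (\<integral>\<^sup>+x. indicator K x * indicator T (x \<bullet> \<eta>) \<partial>lborel) \<partial>perp_lborel \<theta>)"
      by (rule nn_integral_cong_AE, rule eventually_mono[OF AE_perp_lborel_nonzero[OF \<theta> dim]], rule 1)
    also have "\<dots> = (\<integral>\<^sup>+\<eta>. \<integral>\<^sup>+x. ennreal (e \<eta>) * (indicator K x * indicator T (x \<bullet> \<eta>)) \<partial>lborel \<partial>perp_lborel \<theta>)"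
      by (simp add: nn_integral_cmult)
    also have "\<dots> = (\<integral>\<^sup>+x. \<integral>\<^sup>+\<eta>. ennreal (e \<eta>) * (indicator K x * indicator T (x \<bullet> \<eta>)) \<partial>perp_lborel \<theta> \<partial>lborel)"
      by (rule PL.Fubini'[symmetric]) measurable
    also have "\<dots> = (\<integral>\<^sup>+x. \<integral>\<^sup>+t. indicator K x * ennreal (c * (1 / p x) * exp (- b * (t / p x)\<^sup>2)) * indicator T t \<partial>lborel \<partial>lborel)"
      by (rule nn_integral_cong_AE, rule eventually_mono[OF AE_perp_proj_nonzero[OF \<theta> dim]], rule 2)
    also have "\<dots> = (\<integral>\<^sup>+t. \<integral>\<^sup>+x. indicator K x * ennreal (c * (1 / p x) * exp (- b * (t / p x)\<^sup>2)) * indicator T t \<partial>lborel \<partial>lborel)"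
      by (rule lborel_pair.Fubini'[symmetric]) measurable
    also have "\<dots> = (\<integral>\<^sup>+t. f' t * indicator T t \<partial>lborel)"
      unfolding f'_def by (simp add: nn_integral_multc)
    finally show "(\<integral>\<^sup>+t. f t * indicator T t \<partial>lborel) = (\<integral>\<^sup>+t. f' t * indicator T t \<partial>lborel)" .
  qed
  then show ?thesis by (simp add: f_def f'_def e_def c_def A_def p_def)
qed

text \<open>For t > 0 the Gaussian suppresses the singularity of 1/r on the axis: with u = t/r the
  left side is u exp(- b u^2)/t, and u exp(- b u^2) is bounded. The case r = 0 is included through
  1/0 = 0.\<close>

lemma gaussian_tail_bound:
  assumes "0 < b" "0 < t" "0 \<le> r"
  shows "1 / r * exp (- b * (t / r)\<^sup>2) \<le> (1 + 1 / b) / (t :: real)"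
proof -
  define u where "u = t / r"
  have u: "0 \<le> u" using assms by (simp add: u_def)
  have "exp (- b * u\<^sup>2) \<le> 1 / (1 + b * u\<^sup>2)"
  proof -
    have "1 + b * u\<^sup>2 \<le> exp (b * u\<^sup>2)" by (rule exp_ge_add_one_self)
    moreover have "0 < 1 + b * u\<^sup>2" using assms by (simp add: add_pos_nonneg)
    ultimately have "1 / exp (b * u\<^sup>2) \<le> 1 / (1 + b * u\<^sup>2)" by (intro frac_le) auto
    then show ?thesis by (simp add: exp_minus inverse_eq_divide)
  qed
  then have "u * exp (- b * u\<^sup>2) \<le> u * (1 / (1 + b * u\<^sup>2))" using u by (rule mult_left_mono)
  also have "\<dots> \<le> 1 + 1 / b"
  proof -
    have "u \<le> 1 + u\<^sup>2" using zero_le_power2[of "u - 1"] u by (simp add: power2_eq_square algebra_simps)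
    also have "\<dots> \<le> (1 + 1 / b) * (1 + b * u\<^sup>2)" using assms by (simp add: algebra_simps)
    finally show ?thesis using assms by (simp add: pos_divide_le_eq add_pos_nonneg)
  qed
  finally have "u * exp (- b * u\<^sup>2) / t \<le> (1 + 1 / b) / t" using assms by (intro divide_right_mono) auto
  moreover have "u / t = 1 / r" using assms by (simp add: u_def)
  ultimately show ?thesis by (metis times_divide_eq_left u_def)
qed

lemma gaussian_section_average:
  fixes \<theta> :: "'a::euclidean_space"
  assumes \<theta>: "norm \<theta> = 1" and dim: "3 \<le> DIM('a)" and b: "0 < b" and K: "star_body K"
  shows integrable_gaussian_section: "integrable (perp_lborel \<theta>) (\<lambda>\<eta>. exp (- b * (norm \<eta>)\<^sup>2) * (1 / norm \<eta>) * section_volume K (sgn \<eta>) (t / norm \<eta>))"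
    and integrable_gaussian_body: "0 < t \<Longrightarrow> integrable lborel (\<lambda>x. indicator K x * (1 / norm (perp_proj \<theta> x) * exp (- b * (t / norm (perp_proj \<theta> x))\<^sup>2)))"
    and AE_gaussian_section_average_real: "AE t in lborel. 0 < t \<longrightarrow>
      (\<integral>\<eta>. exp (- b * (norm \<eta>)\<^sup>2) * (1 / norm \<eta>) * section_volume K (sgn \<eta>) (t / norm \<eta>) \<partial>perp_lborel \<theta>) =
      sqrt (pi / b) ^ (DIM('a) - 2) * (\<integral>x. indicator K x * (1 / norm (perp_proj \<theta> x) * exp (- b * (t / norm (perp_proj \<theta> x))\<^sup>2)) \<partial>lborel)"
proof -
  have dim2: "2 \<le> DIM('a)" using dim by simp
  have K'[measurable]: "K \<in> sets borel" and bK: "bounded K" "compact K"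
    using star_body_borel[OF K] K by (auto simp: star_body_def compact_imp_bounded)
  obtain M where M: "0 < M" "\<And>\<xi> t. norm \<xi> = 1 \<Longrightarrow> section_volume K \<xi> t \<le> M"
    by (rule section_volume_bound[OF K dim2]) (rule that)
  have mL: "(\<lambda>\<eta>. section_volume K (sgn \<eta>) (t / norm \<eta>)) \<in> borel_measurable (perp_lborel \<theta>)" for t
    by (rule measurable_section_volume_sgn[OF K' bK(1) dim2]; measurable)
  show iL: "integrable (perp_lborel \<theta>) (\<lambda>\<eta>. exp (- b * (norm \<eta>)\<^sup>2) * (1 / norm \<eta>) * section_volume K (sgn \<eta>) (t / norm \<eta>))" for t
  proof (rule Bochner_Integration.integrable_bound)
    show "integrable (perp_lborel \<theta>) (\<lambda>y. M * (exp (- b * (norm y)\<^sup>2) * (1 / norm y) ^ 1))"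
      by (intro integrable_mult_right integrable_gaussian_inverse_power[OF \<theta> dim2 b]) (use dim in simp)
    show "AE \<eta> in perp_lborel \<theta>. norm (exp (- b * (norm \<eta>)\<^sup>2) * (1 / norm \<eta>) * section_volume K (sgn \<eta>) (t / norm \<eta>)) \<le>
      norm (M * (exp (- b * (norm \<eta>)\<^sup>2) * (1 / norm \<eta>) ^ 1))"
      using AE_perp_lborel_nonzero[OF \<theta> dim2]
    proof eventually_elim
      case (elim \<eta>)
      then have "\<bar>section_volume K (sgn \<eta>) (t / norm \<eta>)\<bar> \<le> M"
        using M(2)[of "sgn \<eta>"] section_volume_nonneg[of K "sgn \<eta>"] by (simp add: norm_sgn)
      then show ?case using M(1) by (simp add: abs_mult mult.commute divide_right_mono)
    qed
  qed (use mL in measurable)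
  show iR: "integrable lborel (\<lambda>x. indicator K x * (1 / norm (perp_proj \<theta> x) * exp (- b * (t / norm (perp_proj \<theta> x))\<^sup>2)))" if t: "0 < t" for t
  proof (rule Bochner_Integration.integrable_bound)
    show "integrable lborel (\<lambda>x. indicator K x * ((1 + 1 / b) / t))"
      by (intro integrable_mult_left integrable_real_indicator) (use emeasure_bounded_finite[OF bK(1)] in auto)
    show "AE x in lborel. norm (indicator K x * (1 / norm (perp_proj \<theta> x) * exp (- b * (t / norm (perp_proj \<theta> x))\<^sup>2))) \<le> norm (indicator K x * ((1 + 1 / b) / t))"
      using gaussian_tail_bound[OF b t, of "norm (perp_proj \<theta> _)"] b t
      by (intro always_eventually) (auto simp: indicator_def abs_mult)
  qed measurable
  show "AE t in lborel. 0 < t \<longrightarrow>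
      (\<integral>\<eta>. exp (- b * (norm \<eta>)\<^sup>2) * (1 / norm \<eta>) * section_volume K (sgn \<eta>) (t / norm \<eta>) \<partial>perp_lborel \<theta>) =
      sqrt (pi / b) ^ (DIM('a) - 2) * (\<integral>x. indicator K x * (1 / norm (perp_proj \<theta> x) * exp (- b * (t / norm (perp_proj \<theta> x))\<^sup>2)) \<partial>lborel)"
    using AE_gaussian_section_average[OF \<theta> dim2 b K' bK(1)]
  proof eventually_elim
    case (elim t)
    show ?case
    proof
      assume t: "0 < t"
      let ?c = "sqrt (pi / b) ^ (DIM('a) - 2)"
      let ?L = "\<lambda>\<eta>. exp (- b * (norm \<eta>)\<^sup>2) * (1 / norm \<eta>) * section_volume K (sgn \<eta>) (t / norm \<eta>)"
      let ?R = "\<lambda>x. indicator K x * (1 / norm (perp_proj \<theta> x) * exp (- b * (t / norm (perp_proj \<theta> x))\<^sup>2))"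
      have c0: "0 \<le> ?c" using b by simp
      have 1: "(\<integral>\<^sup>+\<eta>. ennreal (?L \<eta>) \<partial>perp_lborel \<theta>) = ennreal (\<integral>\<eta>. ?L \<eta> \<partial>perp_lborel \<theta>)"
        by (rule nn_integral_eq_integral[OF iL]) (simp add: section_volume_nonneg)
      have "(\<integral>\<^sup>+x. indicator K x * ennreal (?c * (1 / norm (perp_proj \<theta> x)) * exp (- b * (t / norm (perp_proj \<theta> x))\<^sup>2)) \<partial>lborel) =
        (\<integral>\<^sup>+x. ennreal (?c * ?R x) \<partial>lborel)"
        by (intro nn_integral_cong) (auto simp: indicator_def mult.assoc)
      also have "\<dots> = ennreal (\<integral>x. ?c * ?R x \<partial>lborel)"
        using c0 by (intro nn_integral_eq_integral integrable_mult_right iR t) auto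
      also have "(\<integral>x. ?c * ?R x \<partial>lborel) = ?c * (\<integral>x. ?R x \<partial>lborel)" by (rule integral_mult_right_zero)
      finally have 2: "ennreal (\<integral>\<eta>. ?L \<eta> \<partial>perp_lborel \<theta>) = ennreal (?c * (\<integral>x. ?R x \<partial>lborel))"
        using 1 elim by simp
      have "0 \<le> (\<integral>\<eta>. ?L \<eta> \<partial>perp_lborel \<theta>)" by (intro integral_nonneg_AE) (simp add: section_volume_nonneg)
      moreover have "0 \<le> ?c * (\<integral>x. ?R x \<partial>lborel)" using c0 by (intro mult_nonneg_nonneg integral_nonneg_AE) auto
      ultimately show "(\<integral>\<eta>. ?L \<eta> \<partial>perp_lborel \<theta>) = ?c * (\<integral>x. ?R x \<partial>lborel)" using 2 by simp
    qed
  qed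
qed

text \<open>What \<open>radial_weight\<close> becomes on the body side, up to the factor
  sqrt(pi)^(n-2): the Gaussian with b = 4 contributes sqrt(pi/4)^(n-2), hence the power of
  1/2.\<close>

definition body_weight :: "nat \<Rightarrow> real \<Rightarrow> real" where
  "body_weight n s = exp (- s\<^sup>2) - (1 / 2) ^ (n - 2) * exp (- 4 * s\<^sup>2)"

lemma AE_radial_weight_average:
  fixes \<theta> :: "'a::euclidean_space"
  assumes \<theta>: "norm \<theta> = 1" and dim: "3 \<le> DIM('a)" and K: "star_body K"
  shows "AE t in lborel. 0 < t \<longrightarrow>
    (\<integral>\<eta>. radial_weight (norm \<eta>) * (1 / norm \<eta>) * section_volume K (sgn \<eta>) (t / norm \<eta>) \<partial>perp_lborel \<theta>) =
    sqrt pi ^ (DIM('a) - 2) * (\<integral>x. indicator K x * (1 / norm (perp_proj \<theta> x) * body_weight DIM('a) (t / norm (perp_proj \<theta> x))) \<partial>lborel)"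
proof -
  have b4: "0 < (4::real)" by simp
  show ?thesis
  using AE_gaussian_section_average_real[OF \<theta> dim zero_less_one K] AE_gaussian_section_average_real[OF \<theta> dim b4 K]
proof eventually_elim
  case (elim t)
  show ?case
  proof
    assume t: "0 < t"
    let ?L = "\<lambda>b \<eta>. exp (- b * (norm \<eta>)\<^sup>2) * (1 / norm \<eta>) * section_volume K (sgn \<eta>) (t / norm \<eta>)"
    let ?R = "\<lambda>b x. indicator K x * (1 / norm (perp_proj \<theta> x) * exp (- b * (t / norm (perp_proj \<theta> x))\<^sup>2))"
    have s4: "sqrt (pi / 4) = sqrt pi * (1 / 2)" by (simp add: real_sqrt_divide)
    have "(\<integral>\<eta>. radial_weight (norm \<eta>) * (1 / norm \<eta>) * section_volume K (sgn \<eta>) (t / norm \<eta>) \<partial>perp_lborel \<theta>)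
      = (\<integral>\<eta>. ?L 1 \<eta> - ?L 4 \<eta> \<partial>perp_lborel \<theta>)"
      by (rule Bochner_Integration.integral_cong) (simp_all add: radial_weight_def left_diff_distrib diff_divide_distrib)
    also have "\<dots> = (\<integral>\<eta>. ?L 1 \<eta> \<partial>perp_lborel \<theta>) - (\<integral>\<eta>. ?L 4 \<eta> \<partial>perp_lborel \<theta>)"
      by (rule Bochner_Integration.integral_diff) (rule integrable_gaussian_section[OF \<theta> dim _ K], simp)+
    also have "\<dots> = sqrt (pi / 1) ^ (DIM('a) - 2) * (\<integral>x. ?R 1 x \<partial>lborel) - sqrt (pi / 4) ^ (DIM('a) - 2) * (\<integral>x. ?R 4 x \<partial>lborel)"
      using elim t by simp
    also have "\<dots> = sqrt pi ^ (DIM('a) - 2) * ((\<integral>x. ?R 1 x \<partial>lborel) - (1 / 2) ^ (DIM('a) - 2) * (\<integral>x. ?R 4 x \<partial>lborel))"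
      unfolding s4 power_mult_distrib by (simp add: algebra_simps)
    also have "(\<integral>x. ?R 1 x \<partial>lborel) - (1 / 2) ^ (DIM('a) - 2) * (\<integral>x. ?R 4 x \<partial>lborel) = (\<integral>x. ?R 1 x - (1 / 2) ^ (DIM('a) - 2) * ?R 4 x \<partial>lborel)"
      using integrable_gaussian_body[OF \<theta> dim _ K t, of 1] integrable_gaussian_body[OF \<theta> dim _ K t, of 4]
      by (subst Bochner_Integration.integral_diff) (simp_all only: zero_less_one zero_less_numeral integral_mult_right_zero integrable_mult_right HOL.simp_thms)
    also have "\<dots> = (\<integral>x. indicator K x * (1 / norm (perp_proj \<theta> x) * body_weight DIM('a) (t / norm (perp_proj \<theta> x))) \<partial>lborel)"
      by (rule Bochner_Integration.integral_cong) (simp_all add: body_weight_def algebra_simps diff_divide_distrib)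
    finally show "(\<integral>\<eta>. radial_weight (norm \<eta>) * (1 / norm \<eta>) * section_volume K (sgn \<eta>) (t / norm \<eta>) \<partial>perp_lborel \<theta>) =
      sqrt pi ^ (DIM('a) - 2) * (\<integral>x. indicator K x * (1 / norm (perp_proj \<theta> x) * body_weight DIM('a) (t / norm (perp_proj \<theta> x))) \<partial>lborel)" .
  qed
qed
qed

section \<open>Comparison of a star body with a ball\<close>

lemma radial_function_lipschitz_at:
  fixes K :: "'a::euclidean_space set"
  assumes K: "star_body K" and sm: "smooth_on_submanifold (radial_function K) (sphere 0 1)" and \<theta>: "norm \<theta> = 1"
  obtains L where "0 \<le> L" "\<And>u. norm u = 1 \<Longrightarrow> \<bar>radial_function K u - radial_function K \<theta>\<bar> \<le> L * norm (u - \<theta>)"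
proof -
  obtain R where R: "0 < R" "K \<subseteq> cball 0 R" using star_body_bounded[OF K] .
  have bd: "\<bar>radial_function K u\<bar> \<le> R" if u: "norm u = 1" for u
  proof -
    have p: "0 < radial_function K u" using K u by (simp add: star_body_def)
    then have "radial_function K u *\<^sub>R u \<in> K"
      using u by (subst star_body_mem_iff[OF K]) (auto simp: sgn_scaleR, auto simp: sgn_div_norm)
    then have "radial_function K u *\<^sub>R u \<in> cball 0 R" using R(2) by blast
    then show ?thesis using u p by simp
  qed
  have "\<theta> \<in> sphere 0 1" using \<theta> by simp
  then obtain U g where U: "open U" "\<theta> \<in> U" "Cinf_on g U" "\<forall>y\<in>U \<inter> sphere 0 1. g y = radial_function K y"
    using sm[unfolded smooth_on_submanifold_def, THEN bspec, of \<theta>] by blast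
  have "Ck_on (Suc 0) g U" using U(3) unfolding Cinf_on_def by blast
  then have "g differentiable at \<theta>" using U(1,2) by (simp add: differentiable_on_eq_differentiable_at)
  then obtain g' where g': "(g has_derivative g') (at \<theta>)" by (auto simp: differentiable_def)
  then obtain B where B: "0 < B" "\<And>x. norm (g' x) \<le> norm x * B"
    using bounded_linear.pos_bounded[OF has_derivative_bounded_linear] by blast
  from g' obtain d1 where d1: "0 < d1" "\<And>y. norm (y - \<theta>) < d1 \<Longrightarrow> norm (g y - g \<theta> - g' (y - \<theta>)) \<le> 1 * norm (y - \<theta>)"
    unfolding has_derivative_at_alt by (meson zero_less_one)
  obtain d2 where d2: "0 < d2" "ball \<theta> d2 \<subseteq> U" using U openE by blast
  define d where "d = min d1 d2"
  have d: "0 < d" using d1 d2 by (simp add: d_def)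
  \<comment> \<open>The first summand is the slope from differentiability at
    \<open>\<theta>\<close>, valid within distance d; beyond d the difference is at most 2R, which
    the second summand covers.\<close>
  define L where "L = (1 + B) + 2 * R / d"
  have L: "0 \<le> L" using B R d by (simp add: L_def)
  have "\<bar>radial_function K u - radial_function K \<theta>\<bar> \<le> L * norm (u - \<theta>)" if u: "norm u = 1" for u
  proof (cases "norm (u - \<theta>) < d")
    case True
    then have "u \<in> U" using d2(2) by (auto simp: d_def dist_norm norm_minus_commute subset_iff)
    then have e: "g u = radial_function K u" "g \<theta> = radial_function K \<theta>" using U(2,4) u \<theta> by auto
    have "\<bar>g u - g \<theta> - g' (u - \<theta>)\<bar> \<le> norm (u - \<theta>)" using d1(2)[of u] True by (simp add: d_def)
    moreover have "\<bar>g' (u - \<theta>)\<bar> \<le> norm (u - \<theta>) * B" using B(2)[of "u - \<theta>"] by simp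
    ultimately have "\<bar>g u - g \<theta>\<bar> \<le> (1 + B) * norm (u - \<theta>)" by (simp add: algebra_simps)
    also have "\<dots> \<le> L * norm (u - \<theta>)" using R d by (intro mult_right_mono) (auto simp: L_def)
    finally show ?thesis by (simp add: e)
  next
    case False
    have "\<bar>radial_function K u - radial_function K \<theta>\<bar> \<le> 2 * R" using bd[OF u] bd[OF \<theta>] by linarith
    also have "\<dots> = 2 * R / d * d" using d by simp
    also have "\<dots> \<le> 2 * R / d * norm (u - \<theta>)" using False R d by (intro mult_left_mono) auto
    also have "\<dots> \<le> L * norm (u - \<theta>)" using B by (intro mult_right_mono) (auto simp: L_def)
    finally show ?thesis .
  qed
  then show ?thesis using that L by blast
qed

lemma radial_function_uminus:
  assumes "origin_symmetric K"
  shows "radial_function K (- u) = radial_function K u"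
proof -
  have "x \<in> K \<longleftrightarrow> - x \<in> K" for x
    using assms unfolding origin_symmetric_def by (metis image_eqI minus_minus imageE)
  then show ?thesis unfolding radial_function_def by (metis scaleR_minus_right)
qed

text \<open>With s the cosine of the angle, the squares are 2 - 2s and 1 - s^2, and 4(1 - s^2) - (2
  - 2s) = (1 - s)(2 + 4s). Nonnegativity of s excludes the opposite pole, where the projection
  vanishes as well.\<close>

lemma norm_diff_unit_le:
  assumes "norm \<theta> = 1" "norm u = 1" "0 \<le> u \<bullet> \<theta>"
  shows "norm (u - \<theta>) \<le> 2 * norm (perp_proj \<theta> u)"
proof (rule power2_le_imp_le)
  define s where "s = u \<bullet> \<theta>"
  have s: "0 \<le> s" "s \<le> 1" using assms norm_cauchy_schwarz[of u \<theta>] by (auto simp: s_def)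
  have n: "u \<bullet> u = 1" "\<theta> \<bullet> \<theta> = 1" "\<theta> \<bullet> u = s" "u \<bullet> \<theta> = s" using assms by (auto simp: s_def norm_eq_1 inner_commute)
  have 1: "(norm (u - \<theta>))\<^sup>2 = 2 - 2 * s"
    by (simp add: power2_norm_eq_inner inner_diff_left inner_diff_right n)
  have 2: "(norm (perp_proj \<theta> u))\<^sup>2 = 1 - s\<^sup>2"
    by (simp only: power2_norm_eq_inner perp_proj_def) (simp add: inner_diff_left inner_diff_right n power2_eq_square)
  have "2 - 2 * s \<le> 4 * (1 - s\<^sup>2)"
  proof -
    have "0 \<le> (1 - s) * (2 + 4 * s)" using s by (intro mult_nonneg_nonneg) auto
    then show ?thesis by (simp add: power2_eq_square algebra_simps)
  qed
  then show "(norm (u - \<theta>))\<^sup>2 \<le> (2 * norm (perp_proj \<theta> u))\<^sup>2" by (simp add: power_mult_distrib 1 2)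
qed simp

text \<open>Where the two indicators differ, |x| lies between the radial functions at
  \<open>\<theta>\<close> and at x/|x|. By the Lipschitz bound, over a point y of the hyperplane
  this leaves only heights within O(|y|) of the two poles. That gains one power of |y| against
  |y|^(1-n), and |y|^(2-n) is locally integrable in dimension n - 1. Symmetry of K supplies the
  estimate at the pole opposite to \<open>\<theta>\<close>.\<close>

lemma integrable_star_body_minus_ball:
  fixes K :: "'a::euclidean_space set"
  assumes K: "star_body K" and sm: "smooth_on_submanifold (radial_function K) (sphere 0 1)"
    and sym: "origin_symmetric K" and \<theta>: "norm \<theta> = 1" and dim: "3 \<le> DIM('a)"
  defines "f \<equiv> \<lambda>x. indicator K x - indicator (cball 0 (radial_function K \<theta>)) x"
  shows "integrable lborel (\<lambda>x. f x * (1 / norm (perp_proj \<theta> x)) ^ (DIM('a) - 1))"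
proof -
  have dim2: "2 \<le> DIM('a)" using dim by simp
  define a where "a = radial_function K \<theta>"
  define n where "n = DIM('a)"
  have n: "3 \<le> n" using dim by (simp add: n_def)
  have a: "0 < a" using K \<theta> by (simp add: a_def star_body_def)
  have [measurable]: "K \<in> sets borel" using star_body_borel[OF K] .
  obtain L where L: "0 \<le> L" "\<And>u. norm u = 1 \<Longrightarrow> \<bar>radial_function K u - a\<bar> \<le> L * norm (u - \<theta>)"
    using radial_function_lipschitz_at[OF K sm \<theta>] unfolding a_def by blast
  obtain c0 where c0: "0 < c0" "\<And>u. norm u = 1 \<Longrightarrow> c0 \<le> radial_function K u"
    using star_body_radial_lower[OF K] by blast
  obtain R0 where R0: "0 < R0" "K \<subseteq> cball 0 R0" using star_body_bounded[OF K] .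
  define R where "R = max R0 a"
  \<comment> \<open>Both bodies contain the ball of radius r0, so points where they differ have norm
    at least r0 and dividing by |x| is harmless.\<close>
  define r0 where "r0 = min c0 a"
  have r0: "0 < r0" using c0 a by (simp add: r0_def)
  \<comment> \<open>The first summand bounds the deviation of |x| from a, the second the gap between
    |x| and the height of x, which is at most |y|.\<close>
  define C where "C = L * (2 / r0) + 1"
  have C: "0 \<le> C" using L r0 by (simp add: C_def)
  define f0 where "f0 x = \<bar>f x\<bar>" for x
  have [measurable]: "f \<in> borel_measurable borel" unfolding f_def by measurable
  have [measurable]: "f0 \<in> borel_measurable borel" unfolding f0_def by measurable
  have f01: "f0 x \<le> 1" for x by (simp add: f0_def f_def indicator_def)
  have supp: "\<bar>\<bar>x \<bullet> \<theta>\<bar> - a\<bar> \<le> C * norm (perp_proj \<theta> x) \<and> norm (perp_proj \<theta> x) \<le> R" if fx: "f0 x \<noteq> 0" for x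
  proof -
    have x0: "x \<noteq> 0" using fx star_body_zero_mem[OF K] a by (auto simp: f0_def f_def a_def[symmetric])
    define u where "u = sgn x"
    have u: "norm u = 1" "x = norm x *\<^sub>R u" using x0 by (auto simp: u_def norm_sgn sgn_div_norm)
    have xor: "(norm x \<le> radial_function K u) \<noteq> (norm x \<le> a)"
      using fx star_body_mem_iff[OF K x0] by (auto simp: f0_def f_def a_def u_def indicator_def split: if_splits)
    then have xr: "r0 \<le> norm x" using c0(2)[OF u(1)] by (auto simp: r0_def)
    have xR: "norm x \<le> R"
    proof -
      have "x \<in> K \<or> x \<in> cball 0 a" using fx by (rule contrapos_np) (simp add: f0_def f_def a_def[symmetric])
      then show ?thesis using R0(2) by (auto simp: R_def le_max_iff_disj)
    qed
    define y where "y = perp_proj \<theta> x"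
    have yu: "norm (perp_proj \<theta> u) = norm y / norm x"
    proof -
      have "y = norm x *\<^sub>R perp_proj \<theta> u" by (subst y_def, subst u(2)) (simp add: perp_proj_def scaleR_diff_right)
      then show ?thesis using x0 by simp
    qed
    have rho: "\<bar>radial_function K u - a\<bar> \<le> L * (2 * norm (perp_proj \<theta> u))"
    proof (cases "0 \<le> u \<bullet> \<theta>")
      case True
      then show ?thesis using L(2)[OF u(1)] norm_diff_unit_le[OF \<theta> u(1)] L(1) by (meson mult_left_mono order_trans)
    next
      case False
      have "perp_proj \<theta> (- u) = - perp_proj \<theta> u" by (simp add: perp_proj_def)
      then show ?thesis using L(2)[of "- u"] norm_diff_unit_le[OF \<theta>, of "- u"] L(1) False u(1) radial_function_uminus[OF sym, of u]
        by (simp add: inner_minus_left) (meson mult_left_mono order_trans)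
    qed
    have "\<bar>norm x - a\<bar> \<le> \<bar>radial_function K u - a\<bar>" using xor by auto
    also have "\<dots> \<le> L * (2 * (norm y / norm x))" using rho yu by simp
    also have "\<dots> \<le> L * (2 * (norm y / r0))"
      using xr r0 L(1) by (intro mult_left_mono divide_left_mono mult_pos_pos) auto
    finally have 1: "\<bar>norm x - a\<bar> \<le> L * (2 / r0) * norm y" by simp
    have xs: "x = (x \<bullet> \<theta>) *\<^sub>R \<theta> + y" by (simp add: y_def perp_proj_def)
    have nx: "(norm x)\<^sup>2 = (x \<bullet> \<theta>)\<^sup>2 + (norm y)\<^sup>2"
      using norm_add_perp[OF \<theta> perp_proj_in_perp[OF \<theta>, of x], of "x \<bullet> \<theta>"] xs by (simp add: y_def)
    have 2: "\<bar>x \<bullet> \<theta>\<bar> \<le> norm x" using Cauchy_Schwarz_ineq2[of x \<theta>] \<theta> by simp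
    have 3: "norm x \<le> \<bar>x \<bullet> \<theta>\<bar> + norm y" using norm_triangle_ineq[of "(x \<bullet> \<theta>) *\<^sub>R \<theta>" y] xs \<theta> by simp
    have 4: "norm y \<le> norm x" by (rule power2_le_imp_le) (simp_all add: nx)
    have "\<bar>\<bar>x \<bullet> \<theta>\<bar> - a\<bar> \<le> L * (2 / r0) * norm y + norm y" using 1 2 3 by linarith
    then show ?thesis using 4 xR by (simp add: C_def y_def distrib_right)
  qed
  interpret P: sigma_finite_measure "perp_lborel \<theta>" using sigma_finite_perp_lborel[OF \<theta> dim2] .
  interpret RP: pair_sigma_finite "perp_lborel \<theta>" "lborel :: real measure"
    by (simp add: pair_sigma_finite_def P.sigma_finite_measure_axioms sigma_finite_lborel)
  have slice: "(\<integral>\<^sup>+s. ennreal (f0 (s *\<^sub>R \<theta> + y)) \<partial>lborel) \<le> ennreal (4 * C * norm y) * indicator (cball 0 R) y" if y: "y \<in> perp \<theta>" for y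
  proof -
    have pr: "perp_proj \<theta> (s *\<^sub>R \<theta> + y) = y" "(s *\<^sub>R \<theta> + y) \<bullet> \<theta> = s" for s
      using y \<theta> by (simp_all add: perp_proj_def inner_add_left perp_def norm_eq_1)
    \<comment> \<open>One interval of length 2C|y| around each of the two poles; together they give
      4C|y|.\<close>
    have "ennreal (f0 (s *\<^sub>R \<theta> + y)) \<le>
      (indicator {a - C * norm y..a + C * norm y} s + indicator {- a - C * norm y..- a + C * norm y} s) * indicator (cball 0 R) y" for s
    proof (cases "f0 (s *\<^sub>R \<theta> + y) = 0")
      case False
      have *: "\<bar>\<bar>s\<bar> - a\<bar> \<le> C * norm y" "norm y \<le> R" using supp[OF False] by (simp_all add: pr)
      have "ennreal (f0 (s *\<^sub>R \<theta> + y)) \<le> 1" using f01 by (simp add: ennreal_le_1)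
      moreover have "s \<in> {a - C * norm y..a + C * norm y} \<or> s \<in> {- a - C * norm y..- a + C * norm y}"
        using *(1) by (auto simp: abs_if split: if_splits)
      then have "1 \<le> (indicator {a - C * norm y..a + C * norm y} s + indicator {- a - C * norm y..- a + C * norm y} s :: ennreal) * indicator (cball 0 R) y"
        using *(2) by (auto simp: indicator_def)
      ultimately show ?thesis by (rule order_trans)
    qed simp
    then have "(\<integral>\<^sup>+s. ennreal (f0 (s *\<^sub>R \<theta> + y)) \<partial>lborel) \<le>
      (\<integral>\<^sup>+s. (indicator {a - C * norm y..a + C * norm y} s + indicator {- a - C * norm y..- a + C * norm y} s) * indicator (cball 0 R) y \<partial>lborel)"
      by (rule nn_integral_mono)
    also have "\<dots> = (ennreal (2 * (C * norm y)) + ennreal (2 * (C * norm y))) * indicator (cball 0 R) y"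
      using C by (subst nn_integral_multc) (simp_all add: nn_integral_add)
    also have "\<dots> = ennreal (4 * C * norm y) * indicator (cball 0 R) y"
      using C by (simp add: ennreal_plus[symmetric] mult.assoc del: ennreal_plus)
    finally show ?thesis .
  qed
  have "(\<integral>\<^sup>+x. ennreal (f0 x * (1 / norm (perp_proj \<theta> x)) ^ (n - 1)) \<partial>lborel) =
    (\<integral>\<^sup>+s. \<integral>\<^sup>+y. ennreal (f0 (s *\<^sub>R \<theta> + y) * (1 / norm (perp_proj \<theta> (s *\<^sub>R \<theta> + y))) ^ (n - 1)) \<partial>perp_lborel \<theta> \<partial>lborel)"
    by (rule nn_integral_lborel_perp[OF \<theta>]) measurable
  also have "\<dots> = (\<integral>\<^sup>+s. \<integral>\<^sup>+y. ennreal ((1 / norm y) ^ (n - 1)) * ennreal (f0 (s *\<^sub>R \<theta> + y)) \<partial>perp_lborel \<theta> \<partial>lborel)"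
  proof (rule nn_integral_cong, rule nn_integral_cong_AE)
    fix s :: real
    show "AE y in perp_lborel \<theta>. ennreal (f0 (s *\<^sub>R \<theta> + y) * (1 / norm (perp_proj \<theta> (s *\<^sub>R \<theta> + y))) ^ (n - 1)) =
      ennreal ((1 / norm y) ^ (n - 1)) * ennreal (f0 (s *\<^sub>R \<theta> + y))"
      using AE_perp_lborel[OF \<theta>]
    proof eventually_elim
      case (elim y)
      have "perp_proj \<theta> (s *\<^sub>R \<theta> + y) = y" using elim \<theta> by (simp add: perp_proj_def inner_add_left perp_def norm_eq_1)
      then show ?case by (simp only: mult.commute[of "f0 _"]) (simp add: ennreal_mult f0_def)
    qed
  qed
  also have "\<dots> = (\<integral>\<^sup>+y. \<integral>\<^sup>+s. ennreal ((1 / norm y) ^ (n - 1)) * ennreal (f0 (s *\<^sub>R \<theta> + y)) \<partial>lborel \<partial>perp_lborel \<theta>)"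
    by (rule RP.Fubini') measurable
  also have "\<dots> = (\<integral>\<^sup>+y. ennreal ((1 / norm y) ^ (n - 1)) * (\<integral>\<^sup>+s. ennreal (f0 (s *\<^sub>R \<theta> + y)) \<partial>lborel) \<partial>perp_lborel \<theta>)"
    by (rule nn_integral_cong, rule nn_integral_cmult) measurable
  also have "\<dots> \<le> (\<integral>\<^sup>+y. ennreal (4 * C * exp (R\<^sup>2) * (exp (- 1 * (norm y)\<^sup>2) * (1 / norm y) ^ (n - 2))) \<partial>perp_lborel \<theta>)"
  proof (rule nn_integral_mono_AE)
    show "AE y in perp_lborel \<theta>. ennreal ((1 / norm y) ^ (n - 1)) * (\<integral>\<^sup>+s. ennreal (f0 (s *\<^sub>R \<theta> + y)) \<partial>lborel) \<le>
      ennreal (4 * C * exp (R\<^sup>2) * (exp (- 1 * (norm y)\<^sup>2) * (1 / norm y) ^ (n - 2)))"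
      using AE_perp_lborel[OF \<theta>] AE_perp_lborel_nonzero[OF \<theta> dim2]
    proof eventually_elim
      case (elim y)
      have "ennreal ((1 / norm y) ^ (n - 1)) * (\<integral>\<^sup>+s. ennreal (f0 (s *\<^sub>R \<theta> + y)) \<partial>lborel) \<le>
        ennreal ((1 / norm y) ^ (n - 1)) * (ennreal (4 * C * norm y) * indicator (cball 0 R) y)"
        by (rule mult_left_mono[OF slice[OF elim(1)]]) simp
      also have "\<dots> \<le> ennreal (4 * C * exp (R\<^sup>2) * (exp (- 1 * (norm y)\<^sup>2) * (1 / norm y) ^ (n - 2)))"
      proof (cases "norm y \<le> R")
        case True
        have "(1 / norm y) ^ (n - 1) = (1 / norm y) ^ (n - 2) * (1 / norm y)"
        proof -
          have "n - 1 = Suc (n - 2)" using n by simp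
          then show ?thesis by (simp only: power_Suc2)
        qed
        then have "(1 / norm y) ^ (n - 1) * (4 * C * norm y) = 4 * C * (1 * (1 / norm y) ^ (n - 2))"
          using elim(2) by simp
        \<comment> \<open>On |y| \<le> R the constant 1 is at most exp(R^2) exp(-|y|^2), which turns
          the compact support into the Gaussian for which integrability is known.\<close>
        also have "\<dots> \<le> 4 * C * ((exp (R\<^sup>2) * exp (- 1 * (norm y)\<^sup>2)) * (1 / norm y) ^ (n - 2))"
          using C True by (intro mult_left_mono mult_right_mono) (auto simp: exp_add[symmetric] power_mono)
        finally show ?thesis using True C by (simp add: ennreal_mult'[symmetric] mult_ac ennreal_leI)
      qed simp
      finally show ?case .
    qed
  qed
  also have "\<dots> < \<infinity>"
  proof -
    have "integrable (perp_lborel \<theta>) (\<lambda>y. 4 * C * exp (R\<^sup>2) * (exp (- 1 * (norm y)\<^sup>2) * (1 / norm y) ^ (n - 2)))"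
      by (intro integrable_mult_right integrable_gaussian_inverse_power[OF \<theta> dim2]) (simp_all add: n_def)
    then show ?thesis using C by (subst nn_integral_eq_integral) auto
  qed
  finally have "(\<integral>\<^sup>+x. ennreal (norm (f x * (1 / norm (perp_proj \<theta> x)) ^ (n - 1))) \<partial>lborel) < \<infinity>"
    by (simp add: f0_def abs_mult power_abs)
  then show ?thesis unfolding n_def by (intro integrableI_bounded) measurable
qed

section \<open>The Taylor remainder of the weight\<close>

definition exp_remainder :: "nat \<Rightarrow> real \<Rightarrow> real" where
  "exp_remainder J x = exp (- x) - (\<Sum>j<J. (- x) ^ j / fact j)"

lemma exp_remainder_bound:
  assumes "0 \<le> x"
  shows "\<bar>exp_remainder J x\<bar> \<le> x ^ J / fact J"
proof -
  obtain t where t: "\<bar>t\<bar> \<le> \<bar>x\<bar>" "exp (- x) = (\<Sum>m<J. (- x) ^ m / fact m * 1) + exp (- t) * (- x) ^ J / fact J \<and> 0 \<le> t"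
  proof (cases "x = 0 \<or> J = 0")
    case True
    then show ?thesis
    proof
      assume "x = 0"
      then show ?thesis using that[of 0] by (cases J) (auto simp: lessThan_Suc_eq_insert_0 sum.reindex zero_notin_Suc_image power_0_left)
    next
      assume "J = 0" then show ?thesis using that[of x] assms by simp
    qed
  next
    case False
    have "\<exists>t. (if x < 0 then x < t \<and> t < 0 else 0 < t \<and> t < x) \<and>
      exp (- x) = (\<Sum>m<J. (- 1) ^ m * exp (- 0) / fact m * (x - 0) ^ m) + (- 1) ^ J * exp (- t) / fact J * (x - 0) ^ J"
      by (rule Taylor[where diff = "\<lambda>m t. (- 1) ^ m * exp (- t)" and a = 0 and b = x])
        (use False assms in \<open>auto intro!: derivative_eq_intros\<close>)
    then obtain t where "0 < t" "t < x"
      "exp (- x) = (\<Sum>m<J. (- 1) ^ m * exp (- 0) / fact m * (x - 0) ^ m) + (- 1) ^ J * exp (- t) / fact J * (x - 0) ^ J"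
      using assms False by (auto split: if_splits)
    then show ?thesis using that[of t] by (simp add: power_minus[of x] mult_ac)
  qed
  have "exp_remainder J x = exp (- t) * (- x) ^ J / fact J" using t(2) by (simp add: exp_remainder_def)
  then have "\<bar>exp_remainder J x\<bar> = exp (- t) * x ^ J / fact J" using assms by (simp add: abs_mult power_abs)
  also have "\<dots> \<le> 1 * x ^ J / fact J" using assms t(2) by (intro divide_right_mono mult_right_mono) auto
  finally show ?thesis by simp
qed

lemma exp_remainder_Suc: "exp_remainder (Suc J) x = exp_remainder J x - (- x) ^ J / fact J"
  by (simp add: exp_remainder_def)

text \<open>The Taylor coefficient of \<open>body_weight\<close> at s^(2j). It vanishes exactly for
  4^j = 2^(n-2), that is, at the critical degree 2j = n - 2.\<close>

definition body_coeff :: "nat \<Rightarrow> nat \<Rightarrow> real" where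
  "body_coeff n j = (- 1) ^ j / fact j * (1 - (1 / 2) ^ (n - 2) * 4 ^ j)"

text \<open>The bound on j removes precisely the even degrees below n - 2, for either parity of
  n.\<close>

definition body_remainder :: "nat \<Rightarrow> real \<Rightarrow> real" where
  "body_remainder n s = body_weight n s - (\<Sum>j<(n - 1) div 2. body_coeff n j * s ^ (2 * j))"

lemma measurable_body_remainder[measurable]: "body_remainder n \<in> borel_measurable borel"
  unfolding body_remainder_def body_weight_def by measurable

lemma body_remainder_eq:
  "body_remainder n s = exp_remainder ((n - 1) div 2) (s\<^sup>2) - (1 / 2) ^ (n - 2) * exp_remainder ((n - 1) div 2) (4 * s\<^sup>2)"
proof -
  have "body_coeff n j * s ^ (2 * j) = (- (s\<^sup>2)) ^ j / fact j - (1 / 2) ^ (n - 2) * ((- (4 * s\<^sup>2)) ^ j / fact j)" for j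
  proof -
    have 1: "(- (s\<^sup>2)) ^ j = (- 1) ^ j * s ^ (2 * j)" by (subst power_minus) (simp add: power_mult)
    have 2: "(- (4 * s\<^sup>2)) ^ j = (- 1) ^ j * 4 ^ j * s ^ (2 * j)" by (subst power_minus) (simp add: power_mult power_mult_distrib)
    show ?thesis unfolding body_coeff_def 1 2 by (simp add: algebra_simps diff_divide_distrib)
  qed
  then have "(\<Sum>j<J. body_coeff n j * s ^ (2 * j)) =
    (\<Sum>j<J. (- (s\<^sup>2)) ^ j / fact j) - (1 / 2) ^ (n - 2) * (\<Sum>j<J. (- (4 * s\<^sup>2)) ^ j / fact j)" for J
    by (simp add: sum_subtractf sum_distrib_left)
  then show ?thesis by (simp add: body_remainder_def body_weight_def exp_remainder_def algebra_simps)
qed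

lemma scaled_exp_remainder_bound:
  fixes s :: real
  shows "\<bar>exp_remainder J (s\<^sup>2) - c * exp_remainder J (4 * s\<^sup>2)\<bar> \<le> (1 + \<bar>c\<bar> * 4 ^ J) * s ^ (2 * J)"
proof -
  have f: "x / fact J \<le> x" if "0 \<le> x" for x :: real
    using that by (intro divide_le_eq[THEN iffD2]) (auto simp: fact_ge_1 mult_le_cancel_left1)
  have "\<bar>exp_remainder J (s\<^sup>2)\<bar> \<le> s ^ (2 * J)"
    using exp_remainder_bound[of "s\<^sup>2" J] f[of "s ^ (2 * J)"] by (simp add: power_mult)
  moreover have "\<bar>exp_remainder J (4 * s\<^sup>2)\<bar> \<le> 4 ^ J * s ^ (2 * J)"
    using exp_remainder_bound[of "4 * s\<^sup>2" J] f[of "4 ^ J * s ^ (2 * J)"] by (simp add: power_mult power_mult_distrib)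
  then have "\<bar>c * exp_remainder J (4 * s\<^sup>2)\<bar> \<le> \<bar>c\<bar> * (4 ^ J * s ^ (2 * J))"
    unfolding abs_mult by (intro mult_left_mono) auto
  ultimately show ?thesis by (simp add: algebra_simps)
qed

text \<open>For n - 2 = 2N the term of degree n - 2 has coefficient zero because 2^(-(n-2)) 4^N = 1.
  The remainder may thus be regarded as one of higher order and is O(s^n). The weaker exponent is
  recorded as well, since it is the one that supplies an integrable majorant.\<close>

lemma body_remainder_even:
  assumes "even n" "2 \<le> n"
  shows "\<exists>C\<ge>0. \<forall>s\<ge>0. \<bar>body_remainder n s\<bar> \<le> C * s ^ (n - 2) \<and> \<bar>body_remainder n s\<bar> \<le> C * s ^ n"
proof -
  obtain N where N: "n = 2 * N + 2" using assms by (metis evenE le_Suc_ex add.commute dvd_add_right_iff dvd_refl)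
  have J: "(n - 1) div 2 = N" "n - 2 = 2 * N" using N by auto
  define c where "c = (1 / 2 :: real) ^ (n - 2)"
  have c4: "c * 4 ^ N = 1" by (simp add: c_def J power_mult power_one_over power2_eq_square)
  have e: "body_remainder n s = exp_remainder (Suc N) (s\<^sup>2) - c * exp_remainder (Suc N) (4 * s\<^sup>2)" for s
  proof -
    have "(- (4 * s\<^sup>2)) ^ N = 4 ^ N * (- (s\<^sup>2)) ^ N" by (metis mult_minus_right power_mult_distrib)
    then have "c * ((- (4 * s\<^sup>2)) ^ N / fact N) = (- (s\<^sup>2)) ^ N / fact N" using c4 by simp
    then show ?thesis unfolding body_remainder_eq J(1) exp_remainder_Suc c_def by (simp add: algebra_simps)
  qed
  define C where "C = 1 + \<bar>c\<bar> * 4 ^ Suc N"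
  have "\<bar>body_remainder n s\<bar> \<le> C * s ^ n" if "0 \<le> s" for s
  proof -
    have "s ^ n = s ^ (2 * Suc N)" by (simp add: N)
    then show ?thesis using scaled_exp_remainder_bound[of "Suc N" s c] unfolding e[of s] C_def by (simp only:)
  qed
  moreover have "\<bar>body_remainder n s\<bar> \<le> C * s ^ (n - 2)" if "0 \<le> s" for s
  proof -
    have "\<bar>body_remainder n s\<bar> \<le> (1 + \<bar>c\<bar> * 4 ^ N) * s ^ (n - 2)"
      using scaled_exp_remainder_bound[of N s c] unfolding body_remainder_eq J(1) J(2) c_def by simp
    also have "\<dots> \<le> C * s ^ (n - 2)" using that by (intro mult_right_mono) (auto simp: C_def intro!: mult_left_mono)
    finally show ?thesis .
  qed
  moreover have "0 \<le> C" by (simp add: C_def)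
  ultimately show ?thesis by blast
qed

text \<open>The exponent n - 1 is the order of the remainder; n - 3 follows by giving back the last
  subtracted term. Against s^(1-n) the first bound serves near 0 and the second at infinity.\<close>

lemma body_remainder_odd:
  assumes "odd n" "3 \<le> n"
  shows "\<exists>C\<ge>0. \<forall>s\<ge>0. \<bar>body_remainder n s\<bar> \<le> C * s ^ (n - 1) \<and> \<bar>body_remainder n s\<bar> \<le> C * s ^ (n - 3)"
proof -
  obtain N where N: "n = 2 * Suc N + 1" using assms by (metis oddE One_nat_def Suc_eq_plus1 add_2_eq_Suc' mult_0_right not0_implies_Suc not_numeral_le_zero numeral_3_eq_3 plus_1_eq_Suc add.commute add_0 Suc_le_mono not_less_eq_eq)
  have J: "(n - 1) div 2 = Suc N" "n - 1 = 2 * Suc N" "n - 3 = 2 * N" using N by auto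
  define c where "c = (1 / 2 :: real) ^ (n - 2)"
  define C where "C = 1 + \<bar>c\<bar> * 4 ^ Suc N + 1 + \<bar>c\<bar> * 4 ^ N + 1 + \<bar>c\<bar> * 4 ^ N"
  have "\<bar>body_remainder n s\<bar> \<le> C * s ^ (n - 1)" if "0 \<le> s" for s
  proof -
    have "\<bar>body_remainder n s\<bar> \<le> (1 + \<bar>c\<bar> * 4 ^ Suc N) * s ^ (n - 1)"
      using scaled_exp_remainder_bound[of "Suc N" s c] unfolding body_remainder_eq J(1) J(2) c_def by simp
    also have "\<dots> \<le> C * s ^ (n - 1)" using that by (intro mult_right_mono) (auto simp: C_def)
    finally show ?thesis .
  qed
  moreover have "\<bar>body_remainder n s\<bar> \<le> C * s ^ (n - 3)" if "0 \<le> s" for s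
  proof -
    have p: "\<bar>x ^ N / fact N\<bar> \<le> \<bar>x\<bar> ^ N" for x :: real
      by (simp add: abs_divide power_abs divide_le_eq fact_ge_1 mult_le_cancel_left1)
    have e: "body_remainder n s = (exp_remainder N (s\<^sup>2) - c * exp_remainder N (4 * s\<^sup>2)) - (- (s\<^sup>2)) ^ N / fact N + c * ((- (4 * s\<^sup>2)) ^ N / fact N)"
      unfolding body_remainder_eq J(1) exp_remainder_Suc c_def by (simp add: algebra_simps)
    have 1: "\<bar>exp_remainder N (s\<^sup>2) - c * exp_remainder N (4 * s\<^sup>2)\<bar> \<le> (1 + \<bar>c\<bar> * 4 ^ N) * s ^ (2 * N)"
      by (rule scaled_exp_remainder_bound)
    have 2: "\<bar>(- (s\<^sup>2)) ^ N / fact N\<bar> \<le> s ^ (2 * N)" using p[of "- (s\<^sup>2)"] by (simp add: power_mult)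
    have 3: "\<bar>c * ((- (4 * s\<^sup>2)) ^ N / fact N)\<bar> \<le> \<bar>c\<bar> * (4 ^ N * s ^ (2 * N))"
      unfolding abs_mult[of c] using p[of "- (4 * s\<^sup>2)"] by (intro mult_left_mono) (auto simp: power_mult power_mult_distrib)
    have "\<bar>body_remainder n s\<bar> \<le> (1 + \<bar>c\<bar> * 4 ^ N) * s ^ (2 * N) + s ^ (2 * N) + \<bar>c\<bar> * (4 ^ N * s ^ (2 * N))"
      unfolding e using 1 2 3 by linarith
    also have "\<dots> = (1 + \<bar>c\<bar> * 4 ^ N + 1 + \<bar>c\<bar> * 4 ^ N) * s ^ (n - 3)" by (simp add: algebra_simps J(3))
    also have "\<dots> \<le> C * s ^ (n - 3)" using that by (intro mult_right_mono) (auto simp: C_def)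
    finally show ?thesis .
  qed
  moreover have "0 \<le> C" by (simp add: C_def)
  ultimately show ?thesis by blast
qed

section \<open>Comparison of Taylor expansions\<close>

text \<open>The averaged identities hold only for almost every t. Asymptotic expansions at 0 can
  still be compared along a sequence, and every interval (0, e) has positive measure.\<close>

lemma AE_imp_sequence:
  fixes Q :: "real \<Rightarrow> bool"
  assumes "AE t in lborel. 0 < t \<longrightarrow> Q t"
  obtains s where "\<And>i. 0 < s i" "\<And>i. Q (s i)" "s \<longlonglongrightarrow> 0"
proof -
  have "\<exists>t. 0 < t \<and> t < e \<and> Q t" if e: "0 < e" for e :: real
  proof (rule ccontr)
    assume no: "\<not> ?thesis"
    have "AE t in lborel. t \<notin> {0<..<e}"
      using assms by eventually_elim (use no in auto)
    then have "emeasure lborel {0<..<e} = 0"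
      by (subst (asm) AE_iff_measurable[of "{0<..<e}"]) auto
    then show False using e by simp
  qed
  then have "\<forall>i. \<exists>t. 0 < t \<and> t < 1 / real (Suc i) \<and> Q t" by simp
  then obtain s where s: "\<And>i. 0 < s i \<and> s i < 1 / real (Suc i) \<and> Q (s i)" by metis
  have "s \<longlonglongrightarrow> 0"
    by (rule tendsto_sandwich[OF _ _ tendsto_const LIMSEQ_Suc[OF lim_1_over_n]])
      (use s in \<open>auto intro!: always_eventually less_imp_le\<close>)
  then show ?thesis using that s by blast
qed

text \<open>Uniqueness of asymptotic expansions along a sequence: the constant term is the limit and
  so vanishes, then one factor \<open>s i\<close> is cancelled.\<close>

lemma polynomial_coeffs_zero:
  fixes c :: "nat \<Rightarrow> real"
  assumes s: "\<And>i. 0 < s i" "s \<longlonglongrightarrow> 0"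
    and b: "\<And>i. \<bar>\<Sum>k<m. c k * s i ^ k\<bar> \<le> C * s i ^ m" and k: "k < m"
  shows "c k = 0"
  using b k
proof (induction m arbitrary: c k)
  case (Suc m)
  have split: "(\<Sum>k<Suc m. c k * x ^ k) = c 0 + x * (\<Sum>k<m. c (Suc k) * x ^ k)" for x
    by (simp add: sum.lessThan_Suc_shift sum_distrib_left mult_ac del: sum.lessThan_Suc)
  have "(\<lambda>i. \<Sum>k<Suc m. c k * s i ^ k) \<longlonglongrightarrow> (\<Sum>k<Suc m. c k * 0 ^ k)"
    by (intro tendsto_intros s)
  moreover have "(\<Sum>k<Suc m. c k * 0 ^ k) = c 0" unfolding split by simp
  moreover have "(\<lambda>i. \<Sum>k<Suc m. c k * s i ^ k) \<longlonglongrightarrow> 0"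
  proof (rule Lim_null_comparison)
    show "\<forall>\<^sub>F i in sequentially. norm (\<Sum>k<Suc m. c k * s i ^ k) \<le> C * s i ^ Suc m"
      using Suc.prems(1) by simp
    have "(\<lambda>i. C * s i ^ Suc m) \<longlonglongrightarrow> C * 0 ^ Suc m" by (intro tendsto_intros s)
    then show "(\<lambda>i. C * s i ^ Suc m) \<longlonglongrightarrow> 0" by simp
  qed
  ultimately have c0: "c 0 = 0" using LIMSEQ_unique by metis
  have "\<bar>\<Sum>k<m. c (Suc k) * s i ^ k\<bar> \<le> C * s i ^ m" for i
  proof -
    have "s i * \<bar>\<Sum>k<m. c (Suc k) * s i ^ k\<bar> \<le> s i * (C * s i ^ m)"
      using Suc.prems(1)[of i] s(1)[of i] unfolding split c0 by (simp add: abs_mult mult_ac)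
    then show ?thesis using s(1)[of i] by (simp only: mult_le_cancel_left_pos)
  qed
  from Suc.IH[OF this] c0 Suc.prems(2) show ?case by (cases k) auto
qed simp

section \<open>Expansion of the averages in powers of t\<close>

definition section_remainder :: "nat \<Rightarrow> 'a::euclidean_space set \<Rightarrow> 'a \<Rightarrow> real \<Rightarrow> real" where
  "section_remainder N K \<xi> t = section_volume K \<xi> t - (\<Sum>k<N. section_deriv0 K \<xi> k / fact k * t ^ k)"

lemma measurable_section_remainder_sgn:
  fixes K :: "'a::euclidean_space set"
  assumes K: "star_body K" "smooth_on_submanifold (radial_function K) (sphere 0 1)" "2 \<le> DIM('a)"
    and f: "f \<in> borel_measurable M" and g: "g \<in> borel_measurable M"
  shows "(\<lambda>x. section_remainder N K (sgn (f x :: 'a)) (g x)) \<in> borel_measurable M"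
proof -
  note [measurable] = f g
  have "K \<in> sets borel" "bounded K" using K(1) star_body_borel by (auto simp: star_body_def compact_imp_bounded)
  note [measurable] = measurable_section_volume_sgn[OF this K(3) f g]
    measurable_compose[OF f measurable_section_deriv0_sgn[OF K]]
  show ?thesis unfolding section_remainder_def by measurable
qed

definition section_average :: "'a::euclidean_space \<Rightarrow> 'a set \<Rightarrow> real \<Rightarrow> real" where
  "section_average \<theta> K t = (\<integral>\<eta>. radial_weight (norm \<eta>) * (1 / norm \<eta>) * section_volume K (sgn \<eta>) (t / norm \<eta>) \<partial>perp_lborel \<theta>)"

text \<open>Inserting t/|eta| into the Taylor polynomial puts k further powers of 1/|eta| in front
  of t^k. At k = n - 2 the weight is |eta|^(1-n), the one under which the Radon transform is finally
  computed.\<close>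

definition average_coeff :: "'a::euclidean_space \<Rightarrow> 'a set \<Rightarrow> nat \<Rightarrow> real" where
  "average_coeff \<theta> K k = (\<integral>\<eta>. radial_weight (norm \<eta>) * (1 / norm \<eta>) ^ Suc k * (section_deriv0 K (sgn \<eta>) k / fact k) \<partial>perp_lborel \<theta>)"

text \<open>The Taylor bound, uniform in the normal, is integrated. Order N needs |eta|^(-(N+1)) to
  be integrable against \<open>radial_weight\<close>, which holds up to exponent n; hence N <
  n.\<close>

lemma section_average_expansion:
  fixes K :: "'a::euclidean_space set"
  assumes \<theta>: "norm \<theta> = 1" and dim: "3 \<le> DIM('a)"
    and K: "star_body K" and sm: "smooth_on_submanifold (radial_function K) (sphere 0 1)" and N: "N < DIM('a)"
  shows integrable_average_coeff: "\<And>k. k < DIM('a) \<Longrightarrow> integrable (perp_lborel \<theta>)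
        (\<lambda>\<eta>. radial_weight (norm \<eta>) * (1 / norm \<eta>) ^ Suc k * (section_deriv0 K (sgn \<eta>) k / fact k))"
    and integrable_section_remainder: "\<And>t. integrable (perp_lborel \<theta>)
        (\<lambda>\<eta>. radial_weight (norm \<eta>) * (1 / norm \<eta>) * section_remainder N K (sgn \<eta>) (t / norm \<eta>))"
    and section_average_remainder: "\<And>t. section_average \<theta> K t - (\<Sum>k<N. average_coeff \<theta> K k * t ^ k) =
        (\<integral>\<eta>. radial_weight (norm \<eta>) * (1 / norm \<eta>) * section_remainder N K (sgn \<eta>) (t / norm \<eta>) \<partial>perp_lborel \<theta>)"
    and section_average_taylor: "\<exists>C. \<forall>t>0. \<bar>section_average \<theta> K t - (\<Sum>k<N. average_coeff \<theta> K k * t ^ k)\<bar> \<le> C * t ^ N"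
proof -
  have dim2: "2 \<le> DIM('a)" using dim by simp
  have nz: "AE \<eta> in perp_lborel \<theta>. \<eta> \<noteq> 0" by (rule AE_perp_lborel_nonzero[OF \<theta> dim2])
  show ic: "integrable (perp_lborel \<theta>) (\<lambda>\<eta>. radial_weight (norm \<eta>) * (1 / norm \<eta>) ^ Suc k * (section_deriv0 K (sgn \<eta>) k / fact k))"
    if k: "k < DIM('a)" for k
  proof -
    obtain D where D: "0 \<le> D" "\<And>\<xi>. norm \<xi> = 1 \<Longrightarrow> \<bar>section_deriv0 K \<xi> k\<bar> \<le> D"
      using section_volume_taylor(2)[OF K sm dim2, of k] by blast
    have i: "integrable (perp_lborel \<theta>) (\<lambda>\<eta>. radial_weight (norm \<eta>) * (1 / norm \<eta>) ^ Suc k * (D / fact k))"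
      by (intro integrable_mult_left integrable_radial_weight[OF \<theta> dim]) (use k in simp)
    note [measurable] = measurable_section_deriv0_sgn[OF K sm dim2]
    show ?thesis
    proof (rule Bochner_Integration.integrable_bound[OF i])
      show "AE \<eta> in perp_lborel \<theta>. norm (radial_weight (norm \<eta>) * (1 / norm \<eta>) ^ Suc k * (section_deriv0 K (sgn \<eta>) k / fact k)) \<le>
        norm (radial_weight (norm \<eta>) * (1 / norm \<eta>) ^ Suc k * (D / fact k))"
        using nz
      proof eventually_elim
        case (elim \<eta>)
        then have "\<bar>section_deriv0 K (sgn \<eta>) k / fact k\<bar> \<le> \<bar>D / fact k\<bar>"
          using D(1) D(2)[of "sgn \<eta>"] by (simp add: norm_sgn abs_divide divide_right_mono)
        then show ?case
          unfolding real_norm_def abs_mult[of "radial_weight (norm \<eta>) * (1 / norm \<eta>) ^ Suc k"] by (rule mult_left_mono) simp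
      qed
    qed measurable
  qed
  have iA: "integrable (perp_lborel \<theta>) (\<lambda>\<eta>. radial_weight (norm \<eta>) * (1 / norm \<eta>) * section_volume K (sgn \<eta>) (t / norm \<eta>))" for t
  proof -
    have b4: "0 < (4::real)" by simp
    from Bochner_Integration.integrable_diff[OF integrable_gaussian_section[OF \<theta> dim zero_less_one K, of t]
        integrable_gaussian_section[OF \<theta> dim b4 K, of t]]
    show ?thesis by (simp add: radial_weight_def left_diff_distrib diff_divide_distrib)
  qed
  have split: "radial_weight (norm \<eta>) * (1 / norm \<eta>) * section_remainder N K (sgn \<eta>) (t / norm \<eta>) =
    radial_weight (norm \<eta>) * (1 / norm \<eta>) * section_volume K (sgn \<eta>) (t / norm \<eta>) -
    (\<Sum>k<N. radial_weight (norm \<eta>) * (1 / norm \<eta>) ^ Suc k * (section_deriv0 K (sgn \<eta>) k / fact k) * t ^ k)" for \<eta> t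
    by (simp add: section_remainder_def right_diff_distrib sum_distrib_left power_divide mult_ac)
  show ir: "integrable (perp_lborel \<theta>) (\<lambda>\<eta>. radial_weight (norm \<eta>) * (1 / norm \<eta>) * section_remainder N K (sgn \<eta>) (t / norm \<eta>))" for t
    unfolding split by (intro Bochner_Integration.integrable_diff iA Bochner_Integration.integrable_sum integrable_mult_left ic) (use N in simp)
  show rem: "section_average \<theta> K t - (\<Sum>k<N. average_coeff \<theta> K k * t ^ k) =
        (\<integral>\<eta>. radial_weight (norm \<eta>) * (1 / norm \<eta>) * section_remainder N K (sgn \<eta>) (t / norm \<eta>) \<partial>perp_lborel \<theta>)" for t
  proof -
    have s: "integrable (perp_lborel \<theta>) (\<lambda>\<eta>. radial_weight (norm \<eta>) * (1 / norm \<eta>) ^ Suc k * (section_deriv0 K (sgn \<eta>) k / fact k) * t ^ k)" if "k \<in> {..<N}" for k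
      by (intro integrable_mult_left ic) (use that N in simp)
    show ?thesis
      unfolding split section_average_def average_coeff_def
      by (subst Bochner_Integration.integral_diff[OF iA Bochner_Integration.integrable_sum[OF s]], assumption,
          subst Bochner_Integration.integral_sum[OF s], assumption) (simp only: integral_mult_left_zero)
  qed
  show "\<exists>C. \<forall>t>0. \<bar>section_average \<theta> K t - (\<Sum>k<N. average_coeff \<theta> K k * t ^ k)\<bar> \<le> C * t ^ N"
  proof -
    obtain C where C: "0 \<le> C" "\<And>\<xi> t. norm \<xi> = 1 \<Longrightarrow> \<bar>section_remainder N K \<xi> t\<bar> \<le> C * \<bar>t\<bar> ^ N"
      using section_volume_taylor(1)[OF K sm dim2, of N] unfolding section_remainder_def by blast
    define Z where "Z = (\<integral>\<eta>. radial_weight (norm \<eta>) * (1 / norm \<eta>) ^ Suc N \<partial>perp_lborel \<theta>)"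
    have "\<bar>section_average \<theta> K t - (\<Sum>k<N. average_coeff \<theta> K k * t ^ k)\<bar> \<le> Z * C * t ^ N" if t: "0 < t" for t
    proof -
      have i: "integrable (perp_lborel \<theta>) (\<lambda>\<eta>. radial_weight (norm \<eta>) * (1 / norm \<eta>) ^ Suc N * (C * t ^ N))"
        by (intro integrable_mult_left integrable_radial_weight[OF \<theta> dim]) (use N in simp)
      have "norm (section_average \<theta> K t - (\<Sum>k<N. average_coeff \<theta> K k * t ^ k)) \<le>
        (\<integral>\<eta>. norm (radial_weight (norm \<eta>) * (1 / norm \<eta>) * section_remainder N K (sgn \<eta>) (t / norm \<eta>)) \<partial>perp_lborel \<theta>)"
        unfolding rem by (rule integral_norm_bound)
      also have "\<dots> \<le> (\<integral>\<eta>. radial_weight (norm \<eta>) * (1 / norm \<eta>) ^ Suc N * (C * t ^ N) \<partial>perp_lborel \<theta>)"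
      proof (rule integral_mono_AE[OF integrable_norm[OF ir] i])
        show "AE \<eta> in perp_lborel \<theta>. norm (radial_weight (norm \<eta>) * (1 / norm \<eta>) * section_remainder N K (sgn \<eta>) (t / norm \<eta>)) \<le>
          radial_weight (norm \<eta>) * (1 / norm \<eta>) ^ Suc N * (C * t ^ N)"
          using nz
        proof eventually_elim
          case (elim \<eta>)
          have "\<bar>section_remainder N K (sgn \<eta>) (t / norm \<eta>)\<bar> \<le> C * (t / norm \<eta>) ^ N"
            using C(2)[of "sgn \<eta>" "t / norm \<eta>"] elim t by (simp add: norm_sgn)
          then have "radial_weight (norm \<eta>) * (1 / norm \<eta>) * \<bar>section_remainder N K (sgn \<eta>) (t / norm \<eta>)\<bar> \<le>
            radial_weight (norm \<eta>) * (1 / norm \<eta>) * (C * (t / norm \<eta>) ^ N)"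
            using radial_weight_bounds(1)[of "norm \<eta>"] by (intro mult_left_mono) auto
          then show ?case using radial_weight_bounds(1)[of "norm \<eta>"] by (simp add: abs_mult power_divide mult_ac)
        qed
      qed
      also have "\<dots> = Z * (C * t ^ N)" unfolding Z_def by (rule integral_mult_left_zero)
      finally show ?thesis by (simp add: mult.assoc)
    qed
    then show ?thesis by blast
  qed
qed

lemma average_coeff_top:
  "average_coeff \<theta> K k = (\<integral>\<eta>. radial_weight (norm \<eta>) * (1 / norm \<eta>) ^ Suc k * section_deriv0 K (sgn \<eta>) k \<partial>perp_lborel \<theta>) / fact k"
  unfolding average_coeff_def by (simp only: times_divide_eq_right integral_divide_zero)

definition ball_difference :: "'a::euclidean_space \<Rightarrow> 'a set \<Rightarrow> 'a \<Rightarrow> real" where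
  "ball_difference \<theta> K x = indicator K x - indicator (cball 0 (radial_function K \<theta>)) x"

text \<open>For odd n the exponent n - 2 lies between the two available ones: n - 1 is used for s
  \<le> 1 and n - 3 for s > 1.\<close>

lemma body_remainder_bound:
  assumes "3 \<le> n"
  shows "\<exists>C\<ge>0. \<forall>s\<ge>0. \<bar>body_remainder n s\<bar> \<le> C * s ^ (n - 2)"
proof (cases "even n")
  case True
  then show ?thesis using body_remainder_even[of n] assms by auto
next
  case False
  then obtain C where C: "0 \<le> C" "\<And>s. 0 \<le> s \<Longrightarrow> \<bar>body_remainder n s\<bar> \<le> C * s ^ (n - 1)" "\<And>s. 0 \<le> s \<Longrightarrow> \<bar>body_remainder n s\<bar> \<le> C * s ^ (n - 3)"
    using body_remainder_odd[OF _ assms] by blast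
  have "\<bar>body_remainder n s\<bar> \<le> C * s ^ (n - 2)" if s: "0 \<le> s" for s
  proof (cases "s \<le> 1")
    case True
    have "C * s ^ (n - 1) \<le> C * s ^ (n - 2)" using C(1) s True by (intro mult_left_mono power_decreasing) auto
    then show ?thesis using C(2)[OF s] by linarith
  next
    case False
    have "C * s ^ (n - 3) \<le> C * s ^ (n - 2)" using C(1) False by (intro mult_left_mono power_increasing) auto
    then show ?thesis using C(3)[OF s] by linarith
  qed
  then show ?thesis using C(1) by blast
qed

text \<open>Integrability of f and of f p^(1-n) gives that of f p^(-i) for all intermediate i, so
  every Taylor term of the weight may be integrated separately. In use f is the difference of two
  indicators and p the distance to the axis.\<close>

lemma body_average_expansion:
  fixes f :: "'a::euclidean_space \<Rightarrow> real" and p :: "'a \<Rightarrow> real"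
  assumes n: "3 \<le> n" and f: "integrable lborel f" and fp: "integrable lborel (\<lambda>x. f x * (1 / p x) ^ (n - 1))"
    and p[measurable]: "p \<in> borel_measurable borel" and p0: "\<And>x. 0 \<le> p x"
  defines "r \<equiv> \<lambda>j. body_coeff n j * (\<integral>x. f x * (1 / p x) ^ (2 * j + 1) \<partial>lborel)"
  shows integrable_body_remainder: "\<And>t. 0 \<le> t \<Longrightarrow> integrable lborel (\<lambda>x. f x * (1 / p x * body_remainder n (t / p x)))"
    and body_average_remainder: "\<And>t. 0 \<le> t \<Longrightarrow> (\<integral>x. f x * (1 / p x * body_weight n (t / p x)) \<partial>lborel) - (\<Sum>j<(n - 1) div 2. r j * t ^ (2 * j)) =
       (\<integral>x. f x * (1 / p x * body_remainder n (t / p x)) \<partial>lborel)"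
    and body_average_bound: "\<exists>C. \<forall>t>0. \<bar>\<integral>x. f x * (1 / p x * body_remainder n (t / p x)) \<partial>lborel\<bar> \<le> C * t ^ (n - 2)"
proof -
  have [measurable]: "f \<in> borel_measurable borel" using f by auto
  have ii: "integrable lborel (\<lambda>x. f x * (1 / p x) ^ i)" if i: "i \<le> n - 1" for i
  proof (rule Bochner_Integration.integrable_bound)
    show "integrable lborel (\<lambda>x. \<bar>f x\<bar> + \<bar>f x * (1 / p x) ^ (n - 1)\<bar>)" using f fp by simp
    have "\<bar>f x * (1 / p x) ^ i\<bar> \<le> \<bar>f x\<bar> + \<bar>f x * (1 / p x) ^ (n - 1)\<bar>" for x
    proof (cases "1 \<le> 1 / p x")
      case True
      then have "(1 / p x) ^ i \<le> (1 / p x) ^ (n - 1)" using i by (rule power_increasing[rotated])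
      then have "\<bar>f x\<bar> * (1 / p x) ^ i \<le> \<bar>f x\<bar> * (1 / p x) ^ (n - 1)" by (intro mult_left_mono) auto
      then show ?thesis using p0[of x] by (simp add: abs_mult)
    next
      case False
      then have "(1 / p x) ^ i \<le> 1" using p0[of x] by (intro power_le_one) auto
      then have "\<bar>f x\<bar> * (1 / p x) ^ i \<le> \<bar>f x\<bar> * 1" by (intro mult_left_mono) auto
      then show ?thesis using p0[of x] by (simp add: abs_mult add_increasing2)
    qed
    then show "AE x in lborel. norm (f x * (1 / p x) ^ i) \<le> norm (\<bar>f x\<bar> + \<bar>f x * (1 / p x) ^ (n - 1)\<bar>)" by simp
  qed measurable
  obtain C where C: "0 \<le> C" "\<And>s. 0 \<le> s \<Longrightarrow> \<bar>body_remainder n s\<bar> \<le> C * s ^ (n - 2)"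
    using body_remainder_bound[OF n] by blast
  have qb: "\<bar>f x * (1 / p x * body_remainder n (t / p x))\<bar> \<le> \<bar>f x * (1 / p x) ^ (n - 1)\<bar> * (C * t ^ (n - 2))" if t: "0 \<le> t" for t x
  proof -
    have "n - 1 = Suc (n - 2)" using n by simp
    then have e: "(1 / p x) ^ (n - 1) = (1 / p x) * (1 / p x) ^ (n - 2)" by (simp only: power_Suc)
    have "\<bar>f x\<bar> * (1 / p x) * \<bar>body_remainder n (t / p x)\<bar> \<le> \<bar>f x\<bar> * (1 / p x) * (C * (t / p x) ^ (n - 2))"
      using C(2)[of "t / p x"] t p0[of x] by (intro mult_left_mono) auto
    then show ?thesis unfolding e using p0[of x] by (simp add: abs_mult power_divide mult_ac)
  qed
  show iq: "integrable lborel (\<lambda>x. f x * (1 / p x * body_remainder n (t / p x)))" if t: "0 \<le> t" for t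
    by (rule Bochner_Integration.integrable_bound[OF integrable_mult_left[OF integrable_abs[OF fp], of "C * t ^ (n - 2)"]])
      (use qb[OF t] C(1) t in \<open>auto simp: abs_mult\<close>)
  show "(\<integral>x. f x * (1 / p x * body_weight n (t / p x)) \<partial>lborel) - (\<Sum>j<(n - 1) div 2. r j * t ^ (2 * j)) =
       (\<integral>x. f x * (1 / p x * body_remainder n (t / p x)) \<partial>lborel)" if t: "0 \<le> t" for t
  proof -
    have s: "integrable lborel (\<lambda>x. (f x * (1 / p x) ^ (2 * j + 1)) * (body_coeff n j * t ^ (2 * j)))" if "j \<in> {..<(n - 1) div 2}" for j
      by (intro integrable_mult_left ii) (use that in auto)
    have e: "f x * (1 / p x * body_weight n (t / p x)) = f x * (1 / p x * body_remainder n (t / p x)) +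
      (\<Sum>j<(n - 1) div 2. (f x * (1 / p x) ^ (2 * j + 1)) * (body_coeff n j * t ^ (2 * j)))" for x
      by (simp add: body_remainder_def right_diff_distrib diff_divide_distrib sum_distrib_left sum_divide_distrib power_divide mult_ac)
    have "(\<integral>x. f x * (1 / p x * body_weight n (t / p x)) \<partial>lborel) = (\<integral>x. f x * (1 / p x * body_remainder n (t / p x)) \<partial>lborel) +
      (\<Sum>j<(n - 1) div 2. (\<integral>x. (f x * (1 / p x) ^ (2 * j + 1)) * (body_coeff n j * t ^ (2 * j)) \<partial>lborel))"
      unfolding e by (subst Bochner_Integration.integral_add[OF iq[OF t] Bochner_Integration.integrable_sum[OF s]], assumption,
          subst Bochner_Integration.integral_sum[OF s], assumption, rule refl)
    then show ?thesis by (simp only: integral_mult_left_zero r_def) (simp add: mult_ac)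
  qed
  have "\<bar>\<integral>x. f x * (1 / p x * body_remainder n (t / p x)) \<partial>lborel\<bar> \<le> (\<integral>x. \<bar>f x * (1 / p x) ^ (n - 1)\<bar> \<partial>lborel) * C * t ^ (n - 2)" if t: "0 < t" for t
  proof -
    have "norm (\<integral>x. f x * (1 / p x * body_remainder n (t / p x)) \<partial>lborel) \<le> (\<integral>x. \<bar>f x * (1 / p x) ^ (n - 1)\<bar> * (C * t ^ (n - 2)) \<partial>lborel)"
      by (rule Bochner_Integration.integral_norm_bound_integral[OF iq integrable_mult_left[OF integrable_abs[OF fp]]])
        (use qb t in auto)
    also have "\<dots> = (\<integral>x. \<bar>f x * (1 / p x) ^ (n - 1)\<bar> \<partial>lborel) * (C * t ^ (n - 2))" by (rule integral_mult_left_zero)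
    finally show ?thesis by (simp add: mult.assoc)
  qed
  then show "\<exists>C. \<forall>t>0. \<bar>\<integral>x. f x * (1 / p x * body_remainder n (t / p x)) \<partial>lborel\<bar> \<le> C * t ^ (n - 2)" by blast
qed

section \<open>Comparison of the expansions for a body and for its ball\<close>

lemma star_body_cball:
  assumes a: "0 < a"
  shows "norm u = 1 \<Longrightarrow> radial_function (cball (0::'a::euclidean_space) a) u = a"
    and "star_body (cball (0::'a) a)" and "smooth_on_submanifold (radial_function (cball (0::'a) a)) (sphere 0 1)"
proof -
  show r: "radial_function (cball (0::'a) a) u = a" if u: "norm u = 1" for u
  proof -
    have "{l. 0 < l \<and> l *\<^sub>R u \<in> cball 0 a} = {0<..a}" using u by auto
    then show ?thesis using a by (simp add: radial_function_def)
  qed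
  have "continuous_on (sphere 0 1) (radial_function (cball (0::'a) a))"
    by (rule continuous_on_eq[of _ "\<lambda>_. a"]) (auto simp: r)
  moreover have "closed_segment 0 x \<subseteq> cball 0 a" if "x \<in> cball (0::'a) a" for x
    by (rule closed_segment_subset) (use that a in auto)
  ultimately show "star_body (cball (0::'a) a)" using a by (auto simp: star_body_def r)
  have "Ck_on k (\<lambda>x::'a. c) UNIV" for k c
    by (induction k arbitrary: c) auto
  then show "smooth_on_submanifold (radial_function (cball (0::'a) a)) (sphere 0 1)"
    unfolding smooth_on_submanifold_def Cinf_on_def
    by (intro ballI exI[of _ UNIV] exI[of _ "\<lambda>_. a"]) (auto simp: r)
qed

text \<open>Both sides of the averaged identity, taken for K minus the ball, are a polynomial of
  degree below n - 2 plus O(t^(n-2)). Uniqueness of such expansions matches the polynomials, and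
  what is left is the identity of the remainders.\<close>

lemma AE_section_remainder_ball:
  fixes K :: "'a::euclidean_space set"
  assumes K: "star_body K" and sm: "smooth_on_submanifold (radial_function K) (sphere 0 1)"
    and sym: "origin_symmetric K" and \<theta>: "norm \<theta> = 1" and dim: "3 \<le> DIM('a)"
  defines "B \<equiv> cball 0 (radial_function K \<theta>)"
  shows "AE t in lborel. 0 < t \<longrightarrow>
    (section_average \<theta> K t - (\<Sum>k<DIM('a) - 2. average_coeff \<theta> K k * t ^ k)) -
    (section_average \<theta> B t - (\<Sum>k<DIM('a) - 2. average_coeff \<theta> B k * t ^ k)) =
    sqrt pi ^ (DIM('a) - 2) * (\<integral>x. ball_difference \<theta> K x *
      (1 / norm (perp_proj \<theta> x) * body_remainder DIM('a) (t / norm (perp_proj \<theta> x))) \<partial>lborel)"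
proof -
  define n where "n = DIM('a)"
  have n: "3 \<le> n" using dim by (simp add: n_def)
  define a where "a = radial_function K \<theta>"
  have a: "0 < a" using K \<theta> by (simp add: a_def star_body_def)
  have B: "star_body B" "smooth_on_submanifold (radial_function B) (sphere 0 1)"
    unfolding B_def a_def[symmetric] using star_body_cball[OF a] by auto
  define f where "f = ball_difference \<theta> K"
  define p where "p x = norm (perp_proj \<theta> x)" for x
  define c where "c = sqrt pi ^ (n - 2)"
  have [measurable]: "p \<in> borel_measurable borel" unfolding p_def by measurable
  have p0: "0 \<le> p x" for x by (simp add: p_def)
  have ind: "integrable lborel (indicator X :: 'a \<Rightarrow> real)" if "star_body X" for X
    using that star_body_borel[OF that] emeasure_bounded_finite[of X]
    by (intro integrable_real_indicator) (auto simp: star_body_def compact_imp_bounded)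
  have fi: "integrable lborel f"
    unfolding f_def ball_difference_def
    by (intro Bochner_Integration.integrable_diff ind K B(1)[unfolded B_def])
  have fp: "integrable lborel (\<lambda>x. f x * (1 / p x) ^ (n - 1))"
    using integrable_star_body_minus_ball[OF K sm sym \<theta> dim] by (simp add: f_def ball_difference_def[abs_def] p_def n_def)
  define r where "r j = body_coeff n j * (\<integral>x. f x * (1 / p x) ^ (2 * j + 1) \<partial>lborel)" for j
  define J where "J = (n - 1) div 2"
  define L where "L t = section_average \<theta> K t - section_average \<theta> B t" for t
  define lc where "lc k = average_coeff \<theta> K k - average_coeff \<theta> B k" for k
  define W where "W t = (\<integral>x. f x * (1 / p x * body_weight n (t / p x)) \<partial>lborel)" for t
  define Q where "Q t = (\<integral>x. f x * (1 / p x * body_remainder n (t / p x)) \<partial>lborel)" for t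
  have WQ: "W t - (\<Sum>j<J. r j * t ^ (2 * j)) = Q t" if "0 < t" for t
    unfolding W_def Q_def r_def J_def using body_average_remainder[OF n fi fp _ p0, of t] that by simp
  obtain C1 where C1: "\<And>t. 0 < t \<Longrightarrow> \<bar>Q t\<bar> \<le> C1 * t ^ (n - 2)"
    unfolding Q_def using body_average_bound[OF n fi fp _ p0] by auto
  have N: "n - 2 < DIM('a)" using dim by (simp add: n_def)
  obtain CK where CK: "\<And>t. 0 < t \<Longrightarrow> \<bar>section_average \<theta> K t - (\<Sum>k<n - 2. average_coeff \<theta> K k * t ^ k)\<bar> \<le> CK * t ^ (n - 2)"
    using section_average_taylor[OF \<theta> dim K sm N] by blast
  obtain CB where CB: "\<And>t. 0 < t \<Longrightarrow> \<bar>section_average \<theta> B t - (\<Sum>k<n - 2. average_coeff \<theta> B k * t ^ k)\<bar> \<le> CB * t ^ (n - 2)"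
    using section_average_taylor[OF \<theta> dim B N] by blast
  have Lb: "\<bar>L t - (\<Sum>k<n - 2. lc k * t ^ k)\<bar> \<le> (CK + CB) * t ^ (n - 2)" if "0 < t" for t
    using CK[OF that] CB[OF that] unfolding L_def lc_def left_diff_distrib sum_subtractf distrib_right by linarith
  have AE1: "AE t in lborel. 0 < t \<longrightarrow> L t = c * W t"
    using AE_radial_weight_average[OF \<theta> dim K] AE_radial_weight_average[OF \<theta> dim B(1)]
  proof eventually_elim
    case (elim t)
    show ?case
    proof
      assume t: "0 < t"
      have i: "integrable lborel (\<lambda>x. indicator X x * (1 / p x * body_weight n (t / p x)))" if X: "star_body X" for X
      proof -
        have b4: "0 < (4::real)" by simp
        have "integrable lborel (\<lambda>x. indicator X x * (1 / p x * exp (- 1 * (t / p x)\<^sup>2)) - (1 / 2) ^ (n - 2) * (indicator X x * (1 / p x * exp (- 4 * (t / p x)\<^sup>2))))"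
          unfolding p_def by (intro Bochner_Integration.integrable_diff integrable_mult_right
            integrable_gaussian_body[OF \<theta> dim zero_less_one X t] integrable_gaussian_body[OF \<theta> dim b4 X t])
        then show ?thesis by (simp add: body_weight_def algebra_simps diff_divide_distrib)
      qed
      have "L t = c * (\<integral>x. indicator K x * (1 / p x * body_weight n (t / p x)) \<partial>lborel) - c * (\<integral>x. indicator B x * (1 / p x * body_weight n (t / p x)) \<partial>lborel)"
        using elim t by (simp add: L_def section_average_def c_def p_def n_def)
      also have "\<dots> = c * (\<integral>x. indicator K x * (1 / p x * body_weight n (t / p x)) - indicator B x * (1 / p x * body_weight n (t / p x)) \<partial>lborel)"
        using i[OF K] i[OF B(1)] by (simp only: Bochner_Integration.integral_diff right_diff_distrib)
      also have "\<dots> = c * W t" by (simp only: W_def f_def ball_difference_def B_def left_diff_distrib)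
      finally show "L t = c * W t" .
    qed
  qed
  \<comment> \<open>The body side has only even powers; they are placed at k = 2j so that the two
    polynomials can be subtracted coefficient by coefficient.\<close>
  define d where "d k = lc k - c * (if even k then r (k div 2) else 0)" for k
  have even_sum: "(\<Sum>j<J. r j * t ^ (2 * j)) = (\<Sum>k<n - 2. (if even k then r (k div 2) else 0) * t ^ k)" for t
  proof -
    have "(\<Sum>k<n - 2. (if even k then r (k div 2) else 0) * t ^ k) = (\<Sum>k\<in>{k. k < n - 2 \<and> even k}. r (k div 2) * t ^ k)"
      by (rule sum.mono_neutral_cong_right) auto
    also have "\<dots> = (\<Sum>j<J. r j * t ^ (2 * j))"
      by (rule sum.reindex_bij_witness[where i = "\<lambda>j. 2 * j" and j = "\<lambda>k. k div 2"]) (use n in \<open>auto simp: J_def\<close>)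
    finally show ?thesis by simp
  qed
  have poly: "\<bar>\<Sum>k<n - 2. d k * t ^ k\<bar> \<le> (CK + CB + \<bar>c\<bar> * C1) * t ^ (n - 2)" if t: "0 < t" and e: "L t = c * W t" for t
  proof -
    have "(\<Sum>k<n - 2. d k * t ^ k) = (\<Sum>k<n - 2. lc k * t ^ k) - c * (\<Sum>j<J. r j * t ^ (2 * j))"
      unfolding even_sum d_def by (simp add: left_diff_distrib sum_subtractf sum_distrib_left mult.assoc)
    also have "\<dots> = - (L t - (\<Sum>k<n - 2. lc k * t ^ k)) + c * Q t" using e WQ[OF t] by (simp add: algebra_simps)
    finally have "\<bar>\<Sum>k<n - 2. d k * t ^ k\<bar> \<le> \<bar>L t - (\<Sum>k<n - 2. lc k * t ^ k)\<bar> + \<bar>c\<bar> * \<bar>Q t\<bar>"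
      by (simp add: abs_mult[symmetric]) 
    also have "\<dots> \<le> (CK + CB) * t ^ (n - 2) + \<bar>c\<bar> * (C1 * t ^ (n - 2))"
      using Lb[OF t] C1[OF t] by (intro add_mono mult_left_mono) auto
    finally show ?thesis by (simp add: algebra_simps)
  qed
  \<comment> \<open>A single sequence of good values of t settles all coefficients, after which the
    polynomials agree for every t.\<close>
  obtain s where s: "\<And>i. 0 < s i" "\<And>i. L (s i) = c * W (s i)" "s \<longlonglongrightarrow> 0"
    using AE_imp_sequence[OF AE1] by blast
  have d0: "d k = 0" if "k < n - 2" for k
    by (rule polynomial_coeffs_zero[OF s(1,3) poly[OF s(1,2)] that])
  have "AE t in lborel. 0 < t \<longrightarrow> L t - (\<Sum>k<n - 2. lc k * t ^ k) = c * Q t"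
    using AE1
  proof eventually_elim
    case (elim t)
    show ?case
    proof
      assume t: "0 < t"
      have "(\<Sum>k<n - 2. d k * t ^ k) = 0" by (simp add: d0)
      then have "(\<Sum>k<n - 2. lc k * t ^ k) = c * (\<Sum>j<J. r j * t ^ (2 * j))"
        unfolding even_sum d_def by (simp add: left_diff_distrib sum_subtractf sum_distrib_left mult.assoc)
      then show "L t - (\<Sum>k<n - 2. lc k * t ^ k) = c * Q t" using elim t WQ[OF t] by (simp add: algebra_simps)
    qed
  qed
  then show ?thesis
    by (simp add: L_def lc_def Q_def f_def c_def p_def n_def left_diff_distrib sum_subtractf algebra_simps)
qed

lemma ball_difference_integrable:
  fixes K :: "'a::euclidean_space set"
  assumes K: "star_body K" and sm: "smooth_on_submanifold (radial_function K) (sphere 0 1)"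
    and sym: "origin_symmetric K" and \<theta>: "norm \<theta> = 1" and dim: "3 \<le> DIM('a)"
  shows "integrable lborel (\<lambda>x. ball_difference \<theta> K x * (1 / norm (perp_proj \<theta> x)) ^ (DIM('a) - 1))"
  using integrable_star_body_minus_ball[OF assms] by (simp add: ball_difference_def)

text \<open>Divide the identity of remainders by t^(n-2) and let t tend to 0. The section side tends
  to the difference of the coefficients of order n - 2. The body side tends to 0 by dominated
  convergence: the bound O(s^(n-2)) on \<open>body_remainder\<close> gives the majorant f p^(1-n),
  and the bound O(s^n) gives pointwise convergence, thanks to the vanishing critical
  coefficient.\<close>

lemma average_coeff_eq_ball:
  fixes K :: "'a::euclidean_space set"
  assumes K: "star_body K" and sm: "smooth_on_submanifold (radial_function K) (sphere 0 1)"
    and sym: "origin_symmetric K" and \<theta>: "norm \<theta> = 1" and dim: "3 \<le> DIM('a)" and ev: "even DIM('a)"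
  defines "B \<equiv> cball 0 (radial_function K \<theta>)"
  shows "average_coeff \<theta> K (DIM('a) - 2) = average_coeff \<theta> B (DIM('a) - 2)"
proof -
  define n where "n = DIM('a)"
  have n: "3 \<le> n" "even n" using dim ev by (simp_all add: n_def)
  have a: "0 < radial_function K \<theta>" using K \<theta> by (simp add: star_body_def)
  have B: "star_body B" "smooth_on_submanifold (radial_function B) (sphere 0 1)"
    unfolding B_def using star_body_cball[OF a] by auto
  define f where "f = ball_difference \<theta> K"
  define p where "p x = norm (perp_proj \<theta> x)" for x
  define c where "c = sqrt pi ^ (n - 2)"
  have [measurable]: "p \<in> borel_measurable borel" unfolding p_def by measurable
  have p0: "0 \<le> p x" for x by (simp add: p_def)
  have [measurable]: "K \<in> sets borel" using star_body_borel[OF K] .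
  have [measurable]: "f \<in> borel_measurable borel" unfolding f_def ball_difference_def by measurable
  have fp: "integrable lborel (\<lambda>x. f x * (1 / p x) ^ (n - 1))"
    using ball_difference_integrable[OF K sm sym \<theta> dim] by (simp add: f_def p_def n_def)
  define Q where "Q t = (\<integral>x. f x * (1 / p x * body_remainder n (t / p x)) \<partial>lborel)" for t
  define lc where "lc k = average_coeff \<theta> K k - average_coeff \<theta> B k" for k
  have AEx: "AE t in lborel. 0 < t \<longrightarrow> (section_average \<theta> K t - (\<Sum>k<n - 2. average_coeff \<theta> K k * t ^ k)) -
    (section_average \<theta> B t - (\<Sum>k<n - 2. average_coeff \<theta> B k * t ^ k)) = c * Q t"
    using AE_section_remainder_ball[OF K sm sym \<theta> dim] unfolding Q_def f_def p_def c_def n_def B_def .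
  obtain s where s0: "\<And>i. 0 < s i"
    and e: "\<And>i. (section_average \<theta> K (s i) - (\<Sum>k<n - 2. average_coeff \<theta> K k * s i ^ k)) -
    (section_average \<theta> B (s i) - (\<Sum>k<n - 2. average_coeff \<theta> B k * s i ^ k)) = c * Q (s i)"
    and s1: "s \<longlonglongrightarrow> 0"
    by (rule AE_imp_sequence[OF AEx]) (rule that)
  note s = s0 s1
  \<comment> \<open>One order more than in the identity of remainders, so that the coefficient of
    t^(n-2) is split off with an error O(t^(n-1)).\<close>
  have N: "n - 1 < DIM('a)" using dim by (simp add: n_def)
  obtain CK where CK: "\<And>t. 0 < t \<Longrightarrow> \<bar>section_average \<theta> K t - (\<Sum>k<n - 1. average_coeff \<theta> K k * t ^ k)\<bar> \<le> CK * t ^ (n - 1)"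
    using section_average_taylor[OF \<theta> dim K sm N] by blast
  obtain CB where CB: "\<And>t. 0 < t \<Longrightarrow> \<bar>section_average \<theta> B t - (\<Sum>k<n - 1. average_coeff \<theta> B k * t ^ k)\<bar> \<le> CB * t ^ (n - 1)"
    using section_average_taylor[OF \<theta> dim B N] by blast
  have n1: "n - 1 = Suc (n - 2)" using n by simp
  have b: "\<bar>c * (Q (s i) / s i ^ (n - 2)) - lc (n - 2)\<bar> \<le> (CK + CB) * s i" for i
  proof -
    have "\<bar>c * Q (s i) - lc (n - 2) * s i ^ (n - 2)\<bar> \<le> (CK + CB) * s i ^ (n - 1)"
      using CK[OF s(1)[of i]] CB[OF s(1)[of i]] e[of i] unfolding n1 lc_def sum.lessThan_Suc left_diff_distrib distrib_right by linarith
    then have "\<bar>c * Q (s i) - lc (n - 2) * s i ^ (n - 2)\<bar> / s i ^ (n - 2) \<le> (CK + CB) * s i ^ (n - 1) / s i ^ (n - 2)"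
      using s(1)[of i] by (intro divide_right_mono) auto
    moreover have "(CK + CB) * s i ^ (n - 1) / s i ^ (n - 2) = (CK + CB) * s i" using s(1)[of i] unfolding n1 by simp
    moreover have "\<bar>c * Q (s i) - lc (n - 2) * s i ^ (n - 2)\<bar> / s i ^ (n - 2) = \<bar>c * (Q (s i) / s i ^ (n - 2)) - lc (n - 2)\<bar>"
    proof -
      have "c * (Q (s i) / s i ^ (n - 2)) - lc (n - 2) = (c * Q (s i) - lc (n - 2) * s i ^ (n - 2)) / s i ^ (n - 2)"
        using s(1)[of i] by (simp add: diff_divide_distrib)
      then show ?thesis using s(1)[of i] by (simp add: abs_divide)
    qed
    ultimately show ?thesis by simp
  qed
  obtain C where C: "0 \<le> C" "\<And>x. 0 \<le> x \<Longrightarrow> \<bar>body_remainder n x\<bar> \<le> C * x ^ (n - 2)" "\<And>x. 0 \<le> x \<Longrightarrow> \<bar>body_remainder n x\<bar> \<le> C * x ^ n"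
    using body_remainder_even[of n] n by auto
  define F where "F i x = f x * (1 / p x * body_remainder n (s i / p x)) / s i ^ (n - 2)" for i x
  have "(\<lambda>i. \<integral>x. F i x \<partial>lborel) \<longlonglongrightarrow> (\<integral>x. 0 \<partial>(lborel :: 'a measure))"
  proof (rule integral_dominated_convergence)
    show "integrable lborel (\<lambda>x. \<bar>f x * (1 / p x) ^ (n - 1)\<bar> * C)" using fp by simp
    show "F i \<in> borel_measurable lborel" for i unfolding F_def by measurable
    show "AE x in lborel. norm (F i x) \<le> \<bar>f x * (1 / p x) ^ (n - 1)\<bar> * C" for i
    proof (rule AE_I2)
      fix x
      have "\<bar>F i x\<bar> = \<bar>f x\<bar> * (1 / p x) * \<bar>body_remainder n (s i / p x)\<bar> / s i ^ (n - 2)"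
        using p0[of x] s(1)[of i] by (simp add: F_def abs_mult)
      also have "\<dots> \<le> \<bar>f x\<bar> * (1 / p x) * (C * (s i / p x) ^ (n - 2)) / s i ^ (n - 2)"
        using C(2)[of "s i / p x"] p0[of x] s(1)[of i] by (intro divide_right_mono mult_left_mono) auto
      also have "\<dots> = \<bar>f x * (1 / p x) ^ (n - 1)\<bar> * C"
        using s(1)[of i] p0[of x] unfolding n1 by (simp add: abs_mult power_divide)
      finally show "norm (F i x) \<le> \<bar>f x * (1 / p x) ^ (n - 1)\<bar> * C" by simp
    qed
    show "AE x in lborel. (\<lambda>i. F i x) \<longlonglongrightarrow> 0"
    proof (rule AE_I2, rule Lim_null_comparison)
      fix x
      have n2: "n = Suc (Suc (n - 2))" using n by simp
      have "norm (F i x) \<le> \<bar>f x\<bar> * (1 / p x) * (C * (1 / p x) ^ n) * (s i)\<^sup>2" for i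
      proof -
        have "\<bar>F i x\<bar> = \<bar>f x\<bar> * (1 / p x) * \<bar>body_remainder n (s i / p x)\<bar> / s i ^ (n - 2)"
          using p0[of x] s(1)[of i] by (simp add: F_def abs_mult)
        also have "\<dots> \<le> \<bar>f x\<bar> * (1 / p x) * (C * (s i / p x) ^ n) / s i ^ (n - 2)"
          using C(3)[of "s i / p x"] p0[of x] s(1)[of i] by (intro divide_right_mono mult_left_mono) auto
        also have "\<dots> = \<bar>f x\<bar> * (1 / p x) * (C * (1 / p x) ^ n) * (s i ^ n / s i ^ (n - 2))"
          by (simp add: power_divide)
        also have "s i ^ n / s i ^ (n - 2) = (s i)\<^sup>2"
          using s(1)[of i] n by (simp add: power_diff[symmetric] less_imp_neq[OF s(1)[of i], symmetric] flip: power_diff)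
        finally show ?thesis by simp
      qed
      then show "\<forall>\<^sub>F i in sequentially. norm (F i x) \<le> \<bar>f x\<bar> * (1 / p x) * (C * (1 / p x) ^ n) * (s i)\<^sup>2" by simp
      have "(\<lambda>i. \<bar>f x\<bar> * (1 / p x) * (C * (1 / p x) ^ n) * (s i)\<^sup>2) \<longlonglongrightarrow> \<bar>f x\<bar> * (1 / p x) * (C * (1 / p x) ^ n) * 0\<^sup>2"
        by (intro tendsto_mult tendsto_const tendsto_power s)
      then show "(\<lambda>i. \<bar>f x\<bar> * (1 / p x) * (C * (1 / p x) ^ n) * (s i)\<^sup>2) \<longlonglongrightarrow> 0" by simp
    qed
  qed simp
  moreover have "(\<integral>x. F i x \<partial>lborel) = Q (s i) / s i ^ (n - 2)" for i
    unfolding F_def Q_def by (rule integral_divide_zero)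
  ultimately have "(\<lambda>i. Q (s i) / s i ^ (n - 2)) \<longlonglongrightarrow> 0" by simp
  then have "(\<lambda>i. c * (Q (s i) / s i ^ (n - 2))) \<longlonglongrightarrow> c * 0" by (intro tendsto_intros)
  moreover have "(\<lambda>i. c * (Q (s i) / s i ^ (n - 2)) - lc (n - 2)) \<longlonglongrightarrow> 0"
  proof (rule Lim_null_comparison)
    show "\<forall>\<^sub>F i in sequentially. norm (c * (Q (s i) / s i ^ (n - 2)) - lc (n - 2)) \<le> (CK + CB) * s i" using b by simp
    show "(\<lambda>i. (CK + CB) * s i) \<longlonglongrightarrow> 0" using tendsto_mult_right_zero[OF s(2)] by simp
  qed
  then have "(\<lambda>i. c * (Q (s i) / s i ^ (n - 2))) \<longlonglongrightarrow> lc (n - 2)" by (rule LIM_zero_cancel)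
  ultimately have "lc (n - 2) = 0" using LIMSEQ_unique by fastforce
  then show ?thesis by (simp add: lc_def n_def)
qed

section \<open>Regularised moments\<close>

text \<open>The Mellin transform at the exponent 2 - n. Applied to a Taylor remainder it is the
  regularised moment of order 1 - n.\<close>

definition mellin :: "nat \<Rightarrow> (real \<Rightarrow> real) \<Rightarrow> real" where
  "mellin n F = (\<integral>s. indicator {0<..} s * ((1 / s) ^ (n - 1) * F s) \<partial>lborel)"

abbreviation mellin_bound :: "real \<Rightarrow> real" where
  "mellin_bound s \<equiv> indicator {0<..} s * (inverse (1 + s))\<^sup>2"

lemma integrable_mellin_bound: "integrable lborel mellin_bound"
proof (rule integrableI_nonneg)
  have "(\<integral>\<^sup>+s. ennreal ((inverse (1 + s))\<^sup>2) * indicator {0..} s \<partial>lborel) = ennreal (0 - (- inverse (1 + 0)))"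
  proof (rule nn_integral_FTC_atLeast[where F = "\<lambda>s. - inverse (1 + s)"])
    show "((\<lambda>s. - inverse (1 + s)) has_real_derivative (inverse (1 + s))\<^sup>2) (at s)" if "0 \<le> s" for s :: real
      using that by (auto intro!: derivative_eq_intros simp: power2_eq_square)
    show "((\<lambda>s::real. - inverse (1 + s)) \<longlongrightarrow> 0) at_top"
    proof -
      have "((\<lambda>s::real. inverse (1 + s)) \<longlongrightarrow> 0) at_top"
        by (intro tendsto_inverse_0_at_top filterlim_tendsto_add_at_top[OF tendsto_const] filterlim_ident)
      from tendsto_minus[OF this] show ?thesis by simp
    qed
  qed auto
  moreover have "(\<integral>\<^sup>+s. ennreal (mellin_bound s) \<partial>lborel) \<le> (\<integral>\<^sup>+s. ennreal ((inverse (1 + s))\<^sup>2) * indicator {0..} s \<partial>lborel)"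
    by (intro nn_integral_mono) (auto simp: indicator_def)
  ultimately have "(\<integral>\<^sup>+s. ennreal (mellin_bound s) \<partial>lborel) \<le> 1" by simp
  also have "\<dots> < \<infinity>" by simp
  finally show "(\<integral>\<^sup>+s. ennreal (mellin_bound s) \<partial>lborel) < \<infinity>" .
qed auto

text \<open>The two hypotheses bound the integrand by A near 0 and by A/s^2 at infinity. The factor
  4 comes from min(1, s^(-2)) \<le> 4 (1 + s)^(-2).\<close>

lemma mellin_bound_intro:
  fixes s x A :: real
  assumes n: "3 \<le> n" and s: "0 < s" and b: "\<bar>x\<bar> \<le> A * s ^ (n - 1)" "\<bar>x\<bar> \<le> A * s ^ (n - 3)" and A: "0 \<le> A"
  shows "\<bar>(1 / s) ^ (n - 1) * x\<bar> \<le> 4 * A * (inverse (1 + s))\<^sup>2"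
proof -
  have n1: "n - 1 = Suc (Suc (n - 3))" using n by simp
  have pw: "(1 / s) ^ k * s ^ k = 1" for k using s by (subst power_mult_distrib[symmetric]) simp
  have sn: "(1 / s) ^ (n - 1) * s ^ (n - 1) = 1" by (rule pw)
  have sn3: "(1 / s) ^ (n - 1) * s ^ (n - 3) = (1 / s)\<^sup>2"
  proof -
    have "(1 / s) ^ (n - 3) * s ^ (n - 3) = 1" by (rule pw)
    then show ?thesis unfolding n1 power_Suc power2_eq_square by (metis mult.assoc mult.right_neutral)
  qed
  have e: "\<bar>(1 / s) ^ (n - 1) * x\<bar> = (1 / s) ^ (n - 1) * \<bar>x\<bar>" using s by (simp add: abs_mult)
  have 1: "\<bar>(1 / s) ^ (n - 1) * x\<bar> \<le> A"
  proof -
    have "(1 / s) ^ (n - 1) * \<bar>x\<bar> \<le> (1 / s) ^ (n - 1) * (A * s ^ (n - 1))" using b(1) s by (intro mult_left_mono) auto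
    also have "\<dots> = A * ((1 / s) ^ (n - 1) * s ^ (n - 1))" by (simp only: mult_ac)
    finally show ?thesis unfolding e sn by simp
  qed
  have 2: "\<bar>(1 / s) ^ (n - 1) * x\<bar> \<le> A * (1 / s)\<^sup>2"
  proof -
    have "(1 / s) ^ (n - 1) * \<bar>x\<bar> \<le> (1 / s) ^ (n - 1) * (A * s ^ (n - 3))" using b(2) s by (intro mult_left_mono) auto
    also have "\<dots> = A * ((1 / s) ^ (n - 1) * s ^ (n - 3))" by (simp only: mult_ac)
    finally show ?thesis unfolding e sn3 .
  qed
  show ?thesis
  proof (cases "s \<le> 1")
    case True
    have "1 / 2 \<le> inverse (1 + s)" using True s by (simp add: field_simps)
    then have "(1 / 2)\<^sup>2 \<le> (inverse (1 + s))\<^sup>2" by (rule power_mono) simp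
    then have "A * 1 \<le> A * (4 * (inverse (1 + s))\<^sup>2)" using A by (intro mult_left_mono) (auto simp: power2_eq_square)
    then show ?thesis using 1 by simp
  next
    case False
    have "1 / s \<le> 2 * inverse (1 + s)" using False by (simp add: field_simps)
    then have "(1 / s)\<^sup>2 \<le> (2 * inverse (1 + s))\<^sup>2" using s by (intro power_mono) auto
    then have "A * (1 / s)\<^sup>2 \<le> A * (4 * (inverse (1 + s))\<^sup>2)" using A by (intro mult_left_mono) (auto simp: power_mult_distrib)
    then show ?thesis using 2 by simp
  qed
qed

lemma integrable_mellin:
  fixes F :: "real \<Rightarrow> real"
  assumes [measurable]: "F \<in> borel_measurable borel"
    and b: "\<And>s. 0 < s \<Longrightarrow> \<bar>(1 / s) ^ (n - 1) * F s\<bar> \<le> C * (inverse (1 + s))\<^sup>2"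
  shows "integrable lborel (\<lambda>s. indicator {0<..} s * ((1 / s) ^ (n - 1) * F s))"
proof (rule Bochner_Integration.integrable_bound)
  show "integrable lborel (\<lambda>s. C * mellin_bound s)" by (rule integrable_mult_right[OF integrable_mellin_bound])
  show "AE s in lborel. norm (indicator {0<..} s * ((1 / s) ^ (n - 1) * F s)) \<le> norm (C * mellin_bound s)"
    using b by (intro AE_I2) (force simp: indicator_def intro: order_trans)
qed measurable

text \<open>The substitution t = p s gives the moment of X(t/p)/p as p^(1-n) times the moment of X;
  the majorant uniform in x justifies Fubini. The measure is general because the result is used both
  on a hyperplane with p = |eta| and on the whole space with p the distance to the axis.\<close>

lemma scaled_mellin_Fubini:
  fixes M :: "'b measure"
  assumes sf: "sigma_finite_measure M" and n: "1 \<le> n"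
    and W[measurable]: "W \<in> borel_measurable M" and p[measurable]: "p \<in> borel_measurable M"
    and X: "(\<lambda>z. X (fst z) (snd z)) \<in> borel_measurable (M \<Otimes>\<^sub>M borel)"
    and p0: "AE x in M. 0 < p x" and int: "integrable M (\<lambda>x. W x * (1 / p x) ^ (n - 1))"
    and b: "AE x in M. \<forall>s>0. \<bar>(1 / s) ^ (n - 1) * X x s\<bar> \<le> C * (inverse (1 + s))\<^sup>2"
  shows mellin_average: "mellin n (\<lambda>t. \<integral>x. W x * (1 / p x * X x (t / p x)) \<partial>M) = (\<integral>x. W x * (1 / p x) ^ (n - 1) * mellin n (X x) \<partial>M)"
    and integrable_mellin_average: "integrable M (\<lambda>x. W x * (1 / p x) ^ (n - 1) * mellin n (X x))"
proof -
  interpret pair_sigma_finite M "lborel :: real measure"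
    using sf by (simp add: pair_sigma_finite_def sigma_finite_lborel)
  define G where "G x s = indicator {0<..} s * ((1 / s) ^ (n - 1) * X x s)" for x and s :: real
  define F where "F x t = indicator {0<..} t * ((1 / t) ^ (n - 1) * (W x * (1 / p x * X x (t / p x))))" for x and t :: real
  have Xm: "(\<lambda>z. X (fst z) (snd z / p (fst z))) \<in> borel_measurable (M \<Otimes>\<^sub>M lborel)"
    by (rule measurable_compose[of "\<lambda>z. (fst z, snd z / p (fst z))" _ "M \<Otimes>\<^sub>M borel" "\<lambda>z. X (fst z) (snd z)", simplified, OF _ X]) measurable
  note [measurable] = Xm
  have Fm: "(\<lambda>(x, t). F x t) \<in> borel_measurable (M \<Otimes>\<^sub>M lborel)"
    unfolding F_def case_prod_unfold by measurable
  have Gx: "(\<lambda>s. G x s) \<in> borel_measurable borel" if "x \<in> space M" for x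
  proof -
    have "(\<lambda>s. X x s) \<in> borel_measurable borel"
      using measurable_compose[OF measurable_Pair1'[OF that] X] by simp
    then show ?thesis unfolding G_def by measurable
  qed
  have scale: "F x (0 + p x * s) = (1 / p x) * (W x * (1 / p x) ^ (n - 1)) * G x s" if "0 < p x" for x s
    using that by (auto simp: F_def G_def indicator_def zero_less_mult_iff power_divide power_mult_distrib)
  have iG: "AE x in M. integrable lborel (G x) \<and> (\<integral>s. \<bar>G x s\<bar> \<partial>lborel) \<le> C * (\<integral>s. mellin_bound s \<partial>lborel)"
    using b AE_space
  proof eventually_elim
    case (elim x)
    have le: "\<bar>G x s\<bar> \<le> C * mellin_bound s" for s using elim by (auto simp: G_def indicator_def)
    have i: "integrable lborel (\<lambda>s. C * mellin_bound s)" by (rule integrable_mult_right[OF integrable_mellin_bound])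
    have iG: "integrable lborel (G x)"
    proof (rule Bochner_Integration.integrable_bound[OF i])
      show "AE s in lborel. norm (G x s) \<le> norm (C * mellin_bound s)"
      proof (rule AE_I2)
        fix s show "norm (G x s) \<le> norm (C * mellin_bound s)" using le[of s] by (simp only: real_norm_def)
      qed
    qed (use Gx[OF elim(2)] in simp)
    have "(\<integral>s. \<bar>G x s\<bar> \<partial>lborel) \<le> (\<integral>s. C * mellin_bound s \<partial>lborel)"
      by (rule integral_mono[OF integrable_abs[OF iG] i]) (rule le)
    also have "\<dots> = C * (\<integral>s. mellin_bound s \<partial>lborel)" by (rule integral_mult_right_zero)
    finally show ?case using iG by simp
  qed
  have F1: "AE x in M. integrable lborel (F x) \<and> (\<integral>t. F x t \<partial>lborel) = W x * (1 / p x) ^ (n - 1) * (\<integral>s. G x s \<partial>lborel)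
      \<and> (\<integral>t. norm (F x t) \<partial>lborel) = \<bar>W x * (1 / p x) ^ (n - 1)\<bar> * (\<integral>s. \<bar>G x s\<bar> \<partial>lborel)"
    using iG p0
  proof eventually_elim
    case (elim x)
    have nz: "p x \<noteq> 0" using elim by simp
    have "integrable lborel (\<lambda>s. F x (0 + p x * s))"
      unfolding scale[OF elim(2)] using elim(1) by simp
    then have "integrable lborel (F x)" using lborel_integrable_real_affine_iff[OF nz, of "F x" 0] by simp
    moreover have "(\<integral>t. F x t \<partial>lborel) = \<bar>p x\<bar> *\<^sub>R (\<integral>s. F x (0 + p x * s) \<partial>lborel)"
      by (rule lborel_integral_real_affine[OF nz])
    then have "(\<integral>t. F x t \<partial>lborel) = W x * (1 / p x) ^ (n - 1) * (\<integral>s. G x s \<partial>lborel)"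
      unfolding scale[OF elim(2)] integral_mult_right_zero using elim(2) by simp
    moreover have "(\<integral>t. norm (F x t) \<partial>lborel) = \<bar>p x\<bar> *\<^sub>R (\<integral>s. norm (F x (0 + p x * s)) \<partial>lborel)"
      by (rule lborel_integral_real_affine[OF nz])
    then have "(\<integral>t. norm (F x t) \<partial>lborel) = \<bar>W x * (1 / p x) ^ (n - 1)\<bar> * (\<integral>s. \<bar>G x s\<bar> \<partial>lborel)"
      unfolding scale[OF elim(2)] norm_mult real_norm_def integral_mult_right_zero using elim(2) by (simp add: abs_mult)
    ultimately show ?case by blast
  qed
  have intF: "integrable (M \<Otimes>\<^sub>M lborel) (\<lambda>(x, t). F x t)"
  proof (rule Fubini_integrable[OF Fm])
    show "integrable M (\<lambda>x. \<integral>y. norm (case (x, y) of (x, t) \<Rightarrow> F x t) \<partial>lborel)"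
    proof (rule Bochner_Integration.integrable_bound)
      show "integrable M (\<lambda>x. (W x * (1 / p x) ^ (n - 1)) * (C * (\<integral>s. mellin_bound s \<partial>lborel)))"
        by (rule integrable_mult_left[OF int])
      show "(\<lambda>x. \<integral>y. norm (case (x, y) of (x, t) \<Rightarrow> F x t) \<partial>lborel) \<in> borel_measurable M"
        using Fm by measurable
      show "AE x in M. norm (\<integral>y. norm (case (x, y) of (x, t) \<Rightarrow> F x t) \<partial>lborel) \<le> norm ((W x * (1 / p x) ^ (n - 1)) * (C * (\<integral>s. mellin_bound s \<partial>lborel)))"
        using F1 iG
      proof eventually_elim
        case (elim x)
        have 0: "0 \<le> (\<integral>s. \<bar>G x s\<bar> \<partial>lborel)" by (rule integral_nonneg_AE) simp
        have "\<bar>W x * (1 / p x) ^ (n - 1)\<bar> * (\<integral>s. \<bar>G x s\<bar> \<partial>lborel) \<le> \<bar>W x * (1 / p x) ^ (n - 1)\<bar> * \<bar>C * (\<integral>s. mellin_bound s \<partial>lborel)\<bar>"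
          using elim(2) by (intro mult_left_mono) auto
        then show ?case using elim 0 by (simp only: prod.case real_norm_def abs_mult abs_abs abs_of_nonneg[OF 0])
      qed
    qed
    show "AE x in M. integrable lborel (\<lambda>y. case (x, y) of (x, t) \<Rightarrow> F x t)"
      using F1 by eventually_elim simp
  qed
  have Gm: "(\<integral>s. G x s \<partial>lborel) = mellin n (X x)" for x by (simp add: mellin_def G_def)
  have mF: "(\<lambda>x. \<integral>t. F x t \<partial>lborel) \<in> borel_measurable M" using Fm by (simp add: borel_measurable_lebesgue_integral)
  have mG: "(\<lambda>x. W x * (1 / p x) ^ (n - 1) * mellin n (X x)) \<in> borel_measurable M"
  proof -
    have "(\<lambda>(x, s). G x s) \<in> borel_measurable (M \<Otimes>\<^sub>M lborel)"
    proof -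
      have [measurable]: "(\<lambda>z. X (fst z) (snd z)) \<in> borel_measurable (M \<Otimes>\<^sub>M lborel)"
        using X by (simp add: measurable_cong_sets[OF sets_pair_measure_cong[OF refl sets_lborel] refl])
      show ?thesis unfolding G_def case_prod_unfold by measurable
    qed
    then have "(\<lambda>x. \<integral>s. G x s \<partial>lborel) \<in> borel_measurable M" by (simp add: borel_measurable_lebesgue_integral)
    then show ?thesis unfolding Gm by measurable
  qed
  have "mellin n (\<lambda>t. \<integral>x. W x * (1 / p x * X x (t / p x)) \<partial>M) = (\<integral>t. (\<integral>x. F x t \<partial>M) \<partial>lborel)"
    unfolding mellin_def F_def integral_mult_right_zero ..
  also have "\<dots> = (\<integral>x. (\<integral>t. F x t \<partial>lborel) \<partial>M)" by (rule Fubini_integral[OF intF])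
  also have "\<dots> = (\<integral>x. W x * (1 / p x) ^ (n - 1) * mellin n (X x) \<partial>M)"
    by (rule integral_cong_AE[OF mF mG]) (use F1 in \<open>eventually_elim, simp add: Gm\<close>)
  finally show "mellin n (\<lambda>t. \<integral>x. W x * (1 / p x * X x (t / p x)) \<partial>M) = (\<integral>x. W x * (1 / p x) ^ (n - 1) * mellin n (X x) \<partial>M)" .
  have "integrable M (\<lambda>x. \<integral>t. F x t \<partial>lborel)" using integrable_fst'[OF intF] by simp
  then show "integrable M (\<lambda>x. W x * (1 / p x) ^ (n - 1) * mellin n (X x))"
    by (rule integrable_cong_AE_imp[OF _ mG]) (use F1 in \<open>eventually_elim, simp add: Gm\<close>)
qed

lemma body_remainder_mellin_bound:
  assumes "odd n" "3 \<le> n"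
  shows "\<exists>C. \<forall>s>0. \<bar>(1 / s) ^ (n - 1) * body_remainder n s\<bar> \<le> C * (inverse (1 + s))\<^sup>2"
proof -
  obtain C where "0 \<le> C" "\<And>s. 0 \<le> s \<Longrightarrow> \<bar>body_remainder n s\<bar> \<le> C * s ^ (n - 1)" "\<And>s. 0 \<le> s \<Longrightarrow> \<bar>body_remainder n s\<bar> \<le> C * s ^ (n - 3)"
    using body_remainder_odd[OF assms] by blast
  then show ?thesis by (intro exI[of _ "4 * C"] allI impI mellin_bound_intro[OF assms(2)]) auto
qed

text \<open>The two Gaussians in \<^const>\<open>body_weight\<close> are rescalings of each other, and the moment of order
  \<open>1 - n\<close> is exactly the one for which the substitution cancels their coefficients.\<close>

lemma mellin_body_remainder:
  assumes "odd n" "3 \<le> n"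
  shows "mellin n (body_remainder n) = 0"
proof -
  define J where "J = (n - 1) div 2"
  have J: "n - 1 = 2 * J" "n - 3 = 2 * (J - 1)" "J = Suc (J - 1)" 
  proof -
    obtain N where "n = 2 * N + 1" using assms(1) by (rule oddE)
    then show "n - 1 = 2 * J" "n - 3 = 2 * (J - 1)" "J = Suc (J - 1)" using assms(2) by (auto simp: J_def)
  qed
  define r where "r c s = indicator {0<..} s * ((1 / s) ^ (n - 1) * exp_remainder J (c * s\<^sup>2))" for c s :: real
  have i1: "integrable lborel (r 1)"
    unfolding r_def
  proof (rule integrable_mellin)
    show "(\<lambda>s. exp_remainder J (1 * s\<^sup>2)) \<in> borel_measurable borel" unfolding exp_remainder_def by measurable
    fix s :: real assume s: "0 < s"
    have 1: "\<bar>exp_remainder J (s\<^sup>2)\<bar> \<le> s ^ (2 * J)" using scaled_exp_remainder_bound[of J s 0] by simp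
    \<comment> \<open>Giving back one Taylor term lowers the exponent from n - 1 to n - 3, as
      required at infinity, at the cost of a factor 2.\<close>
    have 2: "\<bar>exp_remainder J (s\<^sup>2)\<bar> \<le> 2 * s ^ (2 * (J - 1))"
    proof -
      have "\<bar>(- (s\<^sup>2)) ^ (J - 1) / fact (J - 1)\<bar> \<le> s ^ (2 * (J - 1))"
        by (simp add: abs_divide power_abs power_mult divide_le_eq fact_ge_1 mult_le_cancel_left1)
      moreover have "\<bar>exp_remainder (J - 1) (s\<^sup>2)\<bar> \<le> s ^ (2 * (J - 1))" using scaled_exp_remainder_bound[of "J - 1" s 0] by simp
      moreover have "exp_remainder J (s\<^sup>2) = exp_remainder (J - 1) (s\<^sup>2) - (- (s\<^sup>2)) ^ (J - 1) / fact (J - 1)"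
        by (subst J(3)) (rule exp_remainder_Suc)
      ultimately show ?thesis by linarith
    qed
    have "\<bar>(1 / s) ^ (n - 1) * exp_remainder J (s\<^sup>2)\<bar> \<le> 4 * 2 * (inverse (1 + s))\<^sup>2"
    proof (rule mellin_bound_intro[OF assms(2) s])
      have "0 \<le> s ^ (2 * J)" using s by simp
      then show "\<bar>exp_remainder J (s\<^sup>2)\<bar> \<le> 2 * s ^ (n - 1)" using 1 unfolding J(1) by linarith
      show "\<bar>exp_remainder J (s\<^sup>2)\<bar> \<le> 2 * s ^ (n - 3)" using 2 unfolding J(2) .
    qed simp
    then show "\<bar>(1 / s) ^ (n - 1) * exp_remainder J (1 * s\<^sup>2)\<bar> \<le> 8 * (inverse (1 + s))\<^sup>2" by simp
  qed
  \<comment> \<open>The power of 1/s scales by 2^(-(n-1)); together with the Jacobian 2 of the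
    substitution this is 2^(-(n-2)), the very constant in \<open>body_weight\<close>.\<close>
  have sc: "r 1 (0 + 2 * s) = (1 / 2) ^ (n - 1) * r 4 s" for s
    by (simp add: r_def indicator_def power_mult_distrib power_divide)
  have nn: "(1 / 2 :: real) ^ (n - 2) = 2 * (1 / 2) ^ (n - 1)"
  proof -
    have "n - 1 = Suc (n - 2)" using assms by simp
    then show ?thesis by simp
  qed
  have "integrable lborel (\<lambda>s. (1 / 2) ^ (n - 1) * r 4 s)"
    unfolding sc[symmetric] using i1 lborel_integrable_real_affine_iff[of 2 "r 1" 0] by simp
  then have i4: "integrable lborel (r 4)" by simp
  have "(\<integral>s. r 1 s \<partial>lborel) = \<bar>2\<bar> *\<^sub>R (\<integral>s. r 1 (0 + 2 * s) \<partial>lborel)" by (rule lborel_integral_real_affine) simp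
  also have "\<dots> = (1 / 2) ^ (n - 2) * (\<integral>s. r 4 s \<partial>lborel)" unfolding sc integral_mult_right_zero nn by simp
  finally have "(\<integral>s. r 1 s \<partial>lborel) = (1 / 2) ^ (n - 2) * (\<integral>s. r 4 s \<partial>lborel)" .
  moreover have "mellin n (body_remainder n) = (\<integral>s. r 1 s - (1 / 2) ^ (n - 2) * r 4 s \<partial>lborel)"
    unfolding mellin_def by (rule Bochner_Integration.integral_cong) (simp_all add: body_remainder_eq r_def J_def algebra_simps)
  moreover have "\<dots> = (\<integral>s. r 1 s \<partial>lborel) - (1 / 2) ^ (n - 2) * (\<integral>s. r 4 s \<partial>lborel)"
    using i1 i4 by (simp only: Bochner_Integration.integral_diff integrable_mult_right integral_mult_right_zero)
  ultimately show ?thesis by simp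
qed

section \<open>Symmetry of the sections and their regularised moments\<close>

lemma section_volume_minus:
  fixes K :: "'a::euclidean_space set"
  assumes K: "star_body K" and sym: "origin_symmetric K" and \<xi>: "norm \<xi> = 1" and dim: "2 \<le> DIM('a)"
  shows "section_volume K \<xi> (- t) = section_volume K \<xi> t"
proof -
  have K'[measurable]: "K \<in> sets borel" and bK: "bounded K"
    using star_body_borel[OF K] K by (auto simp: star_body_def compact_imp_bounded)
  have neg: "x \<in> K \<longleftrightarrow> - x \<in> K" for x
    using sym unfolding origin_symmetric_def by (metis image_eqI minus_minus imageE)
  \<comment> \<open>T fixes \<open>\<xi>\<close> and acts as -1 on its hyperplane. It sends the
    section at height - t to the reflected point set, which symmetry of K identifies with the
    section at height t.\<close>
  define T where "T x = (2 * (x \<bullet> \<xi>)) *\<^sub>R \<xi> - x" for x :: 'a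
  have n: "\<xi> \<bullet> \<xi> = 1" using \<xi> by (simp add: norm_eq_1)
  have "linear T" by (rule linearI) (auto simp: T_def inner_add_left algebra_simps)
  moreover have "T x \<bullet> T y = x \<bullet> y" for x y
    by (simp add: T_def inner_diff_left inner_diff_right n inner_commute)
  ultimately have T: "orthogonal_transformation T" by (simp add: orthogonal_transformation_def)
  have T\<xi>: "T \<xi> = \<xi>" by (simp add: T_def n scaleR_2)
  have "ennreal (section_volume K \<xi> (- t)) = (\<integral>\<^sup>+y. indicator K (- t *\<^sub>R \<xi> + T y) \<partial>perp_lborel \<xi>)"
    unfolding ennreal_section_volume[OF \<xi> K' bK dim]
    by (rule nn_integral_perp_rotate[OF \<xi> _ T T\<xi>, of "\<lambda>y. indicator K (- t *\<^sub>R \<xi> + y)", symmetric]) measurable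
  also have "\<dots> = (\<integral>\<^sup>+y. indicator K (t *\<^sub>R \<xi> + y) \<partial>perp_lborel \<xi>)"
  proof (rule nn_integral_cong_AE)
    show "AE y in perp_lborel \<xi>. (indicator K (- t *\<^sub>R \<xi> + T y) :: ennreal) = indicator K (t *\<^sub>R \<xi> + y)"
      using AE_perp_lborel[OF \<xi>]
    proof eventually_elim
      case (elim y)
      have "- t *\<^sub>R \<xi> + T y = - (t *\<^sub>R \<xi> + y)" using elim by (simp add: T_def perp_def)
      then show ?case using neg[of "t *\<^sub>R \<xi> + y"] by (simp add: indicator_def)
    qed
  qed
  also have "\<dots> = ennreal (section_volume K \<xi> t)" by (rule ennreal_section_volume[OF \<xi> K' bK dim, symmetric])
  finally show ?thesis by (simp add: section_volume_nonneg)
qed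

text \<open>The Taylor expansions at t and - t are subtracted: odd terms double, even ones cancel,
  and the difference of the volumes is 0. Uniqueness of expansions then forces the odd coefficients
  to vanish.\<close>

lemma section_deriv0_odd:
  fixes K :: "'a::euclidean_space set"
  assumes K: "star_body K" and sm: "smooth_on_submanifold (radial_function K) (sphere 0 1)"
    and sym: "origin_symmetric K" and \<xi>: "norm \<xi> = 1" and dim: "2 \<le> DIM('a)" and k: "odd k"
  shows "section_deriv0 K \<xi> k = 0"
proof -
  obtain C where C: "0 \<le> C" "\<And>t. \<bar>section_volume K \<xi> t - (\<Sum>j<Suc k. section_deriv0 K \<xi> j / fact j * t ^ j)\<bar> \<le> C * \<bar>t\<bar> ^ Suc k"
    using section_volume_taylor(1)[OF K sm dim, of "Suc k"] \<xi> by blast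
  define d where "d j = section_deriv0 K \<xi> j / fact j * (1 - (- 1) ^ j)" for j
  have "d k = 0"
  proof (rule polynomial_coeffs_zero)
    show "0 < 1 / real (Suc i)" for i by simp
    show "(\<lambda>i. 1 / real (Suc i)) \<longlonglongrightarrow> 0" using LIMSEQ_Suc[OF lim_1_over_n] .
    have bd: "\<bar>\<Sum>j<Suc k. d j * t ^ j\<bar> \<le> 2 * C * t ^ Suc k" if t: "0 < t" for t
    proof -
      have "(- t) ^ j = (- 1) ^ j * t ^ j" for j by (rule power_minus)
      then have "(\<Sum>j<Suc k. d j * t ^ j) = (\<Sum>j<Suc k. section_deriv0 K \<xi> j / fact j * t ^ j) - (\<Sum>j<Suc k. section_deriv0 K \<xi> j / fact j * (- t) ^ j)"
        unfolding d_def sum_subtractf[symmetric] by (intro sum.cong) (simp_all add: algebra_simps diff_divide_distrib)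
      moreover have "\<bar>- t\<bar> = t" "\<bar>t\<bar> = t" using t by auto
      ultimately show ?thesis
        using C(2)[of t] C(2)[of "- t"] section_volume_minus[OF K sym \<xi> dim, of t] by simp
    qed
    show "\<bar>\<Sum>j<Suc k. d j * (1 / real (Suc i)) ^ j\<bar> \<le> 2 * C * (1 / real (Suc i)) ^ Suc k" for i
      by (rule bd) simp
  qed simp
  then show ?thesis using k by (simp add: d_def)
qed

lemma origin_symmetric_cball: "origin_symmetric (cball (0::'a::euclidean_space) a)"
proof -
  have "x \<in> uminus ` cball 0 a" if "x \<in> cball 0 a" for x :: 'a
    using that by (intro image_eqI[of _ _ "- x"]) auto
  then show ?thesis by (auto simp: origin_symmetric_def)
qed

text \<open>For odd n the derivative of order n - 2 vanishes, so the remainder of order n - 2 is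
  also the one of order n - 1 and is O(s^(n-1)). Giving back the term of degree n - 3 yields the
  bound at infinity.\<close>

lemma section_remainder_mellin_bound:
  fixes K :: "'a::euclidean_space set"
  assumes K: "star_body K" and sm: "smooth_on_submanifold (radial_function K) (sphere 0 1)"
    and sym: "origin_symmetric K" and dim: "3 \<le> DIM('a)" and od: "odd DIM('a)"
  shows "\<exists>C. \<forall>\<xi> s. norm \<xi> = 1 \<longrightarrow> 0 < s \<longrightarrow>
    \<bar>(1 / s) ^ (DIM('a) - 1) * section_remainder (DIM('a) - 2) K \<xi> s\<bar> \<le> C * (inverse (1 + s))\<^sup>2"
proof -
  define n where "n = DIM('a)"
  have dim2: "2 \<le> DIM('a)" using dim by simp
  have n: "3 \<le> n" using dim by (simp add: n_def)
  have n1: "n - 1 = Suc (n - 2)" "n - 2 = Suc (n - 3)" using n by auto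
  have od2: "odd (n - 2)" using od n by (simp add: n_def)
  obtain C1 where C1: "0 \<le> C1" "\<And>\<xi> t. norm \<xi> = 1 \<Longrightarrow> \<bar>section_remainder (n - 1) K \<xi> t\<bar> \<le> C1 * \<bar>t\<bar> ^ (n - 1)"
    using section_volume_taylor(1)[OF K sm dim2, of "n - 1"] unfolding section_remainder_def by blast
  obtain C2 where C2: "0 \<le> C2" "\<And>\<xi> t. norm \<xi> = 1 \<Longrightarrow> \<bar>section_remainder (n - 3) K \<xi> t\<bar> \<le> C2 * \<bar>t\<bar> ^ (n - 3)"
    using section_volume_taylor(1)[OF K sm dim2, of "n - 3"] unfolding section_remainder_def by blast
  obtain D where D: "0 \<le> D" "\<And>\<xi>. norm \<xi> = 1 \<Longrightarrow> \<bar>section_deriv0 K \<xi> (n - 3)\<bar> \<le> D"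
    using section_volume_taylor(2)[OF K sm dim2, of "n - 3"] by blast
  have "\<bar>(1 / s) ^ (n - 1) * section_remainder (n - 2) K \<xi> s\<bar> \<le> 4 * (C1 + C2 + D) * (inverse (1 + s))\<^sup>2"
    if \<xi>: "norm \<xi> = 1" and s: "0 < s" for \<xi> s
  proof (rule mellin_bound_intro[OF n s])
    have "section_remainder (n - 2) K \<xi> s = section_remainder (n - 1) K \<xi> s"
      unfolding n1(1) section_remainder_def using section_deriv0_odd[OF K sm sym \<xi> dim2 od2] by simp
    then have "\<bar>section_remainder (n - 2) K \<xi> s\<bar> \<le> C1 * s ^ (n - 1)" using C1(2)[OF \<xi>, of s] s by simp
    also have "\<dots> \<le> (C1 + C2 + D) * s ^ (n - 1)" using C2 D s by (intro mult_right_mono) auto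
    finally show "\<bar>section_remainder (n - 2) K \<xi> s\<bar> \<le> (C1 + C2 + D) * s ^ (n - 1)" .
    have "section_remainder (n - 2) K \<xi> s = section_remainder (n - 3) K \<xi> s - section_deriv0 K \<xi> (n - 3) / fact (n - 3) * s ^ (n - 3)"
      unfolding n1(2) section_remainder_def by simp
    moreover have "\<bar>section_deriv0 K \<xi> (n - 3) / fact (n - 3) * s ^ (n - 3)\<bar> \<le> D * s ^ (n - 3)"
    proof -
      have "\<bar>section_deriv0 K \<xi> (n - 3)\<bar> / fact (n - 3) \<le> D / 1"
        using D(1) D(2)[OF \<xi>] by (intro frac_le) (auto simp: fact_ge_1)
      then have "\<bar>section_deriv0 K \<xi> (n - 3)\<bar> / fact (n - 3) * s ^ (n - 3) \<le> D * s ^ (n - 3)"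
        using s by (intro mult_right_mono) auto
      then show ?thesis using s by (simp add: abs_mult)
    qed
    moreover have "\<bar>section_remainder (n - 3) K \<xi> s\<bar> \<le> C2 * s ^ (n - 3)" using C2(2)[OF \<xi>, of s] s by simp
    ultimately have "\<bar>section_remainder (n - 2) K \<xi> s\<bar> \<le> C2 * s ^ (n - 3) + D * s ^ (n - 3)" by linarith
    also have "\<dots> \<le> (C1 + C2 + D) * s ^ (n - 3)" using C1 s by (simp add: algebra_simps)
    finally show "\<bar>section_remainder (n - 2) K \<xi> s\<bar> \<le> (C1 + C2 + D) * s ^ (n - 3)" .
  qed (use C1 C2 D in simp)
  then show ?thesis unfolding n_def by blast
qed

lemma measurable_mellin_section_remainder:
  fixes K :: "'a::euclidean_space set"
  assumes K: "star_body K" "smooth_on_submanifold (radial_function K) (sphere 0 1)" "2 \<le> DIM('a)"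
  shows "(\<lambda>\<eta>. mellin n (section_remainder N K (sgn \<eta>))) \<in> borel_measurable borel"
proof -
  have [measurable]: "(\<lambda>z. section_remainder N K (sgn (fst z)) (snd z)) \<in> borel_measurable (borel \<Otimes>\<^sub>M lborel)"
    by (rule measurable_section_remainder_sgn[OF K]; measurable)
  show ?thesis unfolding mellin_def
    by (rule sigma_finite_measure.borel_measurable_lebesgue_integral[OF sigma_finite_lborel]) (simp only: case_prod_unfold, measurable)
qed

text \<open>Moments are taken on both sides of the identity of remainders. On the section side this
  leaves the regularised moments of the sections weighted by |eta|^(1-n); on the body side the
  factor \<open>mellin n (body_remainder n)\<close> appears, which is 0.\<close>

lemma mellin_average_eq_ball:
  fixes K :: "'a::euclidean_space set"
  assumes K: "star_body K" and sm: "smooth_on_submanifold (radial_function K) (sphere 0 1)"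
    and sym: "origin_symmetric K" and \<theta>: "norm \<theta> = 1" and dim: "3 \<le> DIM('a)" and od: "odd DIM('a)"
  defines "B \<equiv> cball 0 (radial_function K \<theta>)"
  shows "(\<integral>\<eta>. radial_weight (norm \<eta>) * (1 / norm \<eta>) ^ (DIM('a) - 1) * mellin DIM('a) (section_remainder (DIM('a) - 2) K (sgn \<eta>)) \<partial>perp_lborel \<theta>) =
    (\<integral>\<eta>. radial_weight (norm \<eta>) * (1 / norm \<eta>) ^ (DIM('a) - 1) * mellin DIM('a) (section_remainder (DIM('a) - 2) B (sgn \<eta>)) \<partial>perp_lborel \<theta>)"
proof -
  define n where "n = DIM('a)"
  have dim2: "2 \<le> DIM('a)" using dim by simp
  have n: "3 \<le> n" "odd n" "1 \<le> n" using dim od by (simp_all add: n_def)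
  have a: "0 < radial_function K \<theta>" using K \<theta> by (simp add: star_body_def)
  have B: "star_body B" "smooth_on_submanifold (radial_function B) (sphere 0 1)" "origin_symmetric B"
    unfolding B_def using star_body_cball[OF a] origin_symmetric_cball by auto
  define X where "X Y \<eta> s = section_remainder (n - 2) Y (sgn \<eta>) s" for Y and \<eta> :: 'a and s
  interpret P: sigma_finite_measure "perp_lborel \<theta>" using sigma_finite_perp_lborel[OF \<theta> dim2] .
  have nz: "AE \<eta> in perp_lborel \<theta>. \<eta> \<noteq> 0" by (rule AE_perp_lborel_nonzero[OF \<theta> dim2])
  have pos: "AE \<eta> in perp_lborel \<theta>. 0 < norm \<eta>" using nz by eventually_elim simp
  have Xm: "(\<lambda>z. X Y (fst z) (snd z)) \<in> borel_measurable (perp_lborel \<theta> \<Otimes>\<^sub>M borel)"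
    if Y: "star_body Y" "smooth_on_submanifold (radial_function Y) (sphere 0 1)" for Y
    unfolding X_def by (rule measurable_section_remainder_sgn[OF Y dim2]; measurable)
  have X1: "(\<lambda>s. X Y \<eta> s) \<in> borel_measurable borel"
    if Y: "star_body Y" "smooth_on_submanifold (radial_function Y) (sphere 0 1)" for Y \<eta>
    unfolding X_def by (rule measurable_section_remainder_sgn[OF Y dim2]; measurable)
  have W: "integrable (perp_lborel \<theta>) (\<lambda>\<eta>. radial_weight (norm \<eta>) * (1 / norm \<eta>) ^ (n - 1))"
    by (rule integrable_radial_weight[OF \<theta> dim]) (simp add: n_def)
  obtain CK where CK: "\<And>\<xi> s. norm \<xi> = 1 \<Longrightarrow> 0 < s \<Longrightarrow> \<bar>(1 / s) ^ (n - 1) * section_remainder (n - 2) K \<xi> s\<bar> \<le> CK * (inverse (1 + s))\<^sup>2"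
    using section_remainder_mellin_bound[OF K sm sym dim od] unfolding n_def by blast
  obtain CB where CB: "\<And>\<xi> s. norm \<xi> = 1 \<Longrightarrow> 0 < s \<Longrightarrow> \<bar>(1 / s) ^ (n - 1) * section_remainder (n - 2) B \<xi> s\<bar> \<le> CB * (inverse (1 + s))\<^sup>2"
    using section_remainder_mellin_bound[OF B dim od] unfolding n_def by blast
  have bK: "\<bar>(1 / s) ^ (n - 1) * X K \<eta> s\<bar> \<le> CK * (inverse (1 + s))\<^sup>2" if "\<eta> \<noteq> 0" "0 < s" for \<eta> s
    unfolding X_def using that by (intro CK) (auto simp: norm_sgn)
  have bB: "\<bar>(1 / s) ^ (n - 1) * X B \<eta> s\<bar> \<le> CB * (inverse (1 + s))\<^sup>2" if "\<eta> \<noteq> 0" "0 < s" for \<eta> s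
    unfolding X_def using that by (intro CB) (auto simp: norm_sgn)
  have rw: "(\<lambda>\<eta>. radial_weight (norm \<eta>)) \<in> borel_measurable (perp_lborel \<theta>)" "norm \<in> borel_measurable (perp_lborel \<theta>)" by measurable
  have iK: "integrable (perp_lborel \<theta>) (\<lambda>\<eta>. radial_weight (norm \<eta>) * (1 / norm \<eta>) ^ (n - 1) * mellin n (X K \<eta>))"
    by (rule integrable_mellin_average[OF P.sigma_finite_measure_axioms n(3) rw Xm[OF K sm] pos W, of CK])
      (rule eventually_mono[OF nz], use bK in blast)
  have iB: "integrable (perp_lborel \<theta>) (\<lambda>\<eta>. radial_weight (norm \<eta>) * (1 / norm \<eta>) ^ (n - 1) * mellin n (X B \<eta>))"
    by (rule integrable_mellin_average[OF P.sigma_finite_measure_axioms n(3) rw Xm[OF B(1,2)] pos W, of CB])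
      (rule eventually_mono[OF nz], use bB in blast)
  \<comment> \<open>Only the difference between K and the ball is tied to the body side, so its
    average \<open>AD\<close> is what is compared with Q. The separate moments are recovered
    afterwards by linearity.\<close>
  define D where "D \<eta> s = X K \<eta> s - X B \<eta> s" for \<eta> s
  have Dm: "(\<lambda>z. D (fst z) (snd z)) \<in> borel_measurable (perp_lborel \<theta> \<Otimes>\<^sub>M borel)"
    unfolding D_def using Xm[OF K sm] Xm[OF B(1,2)] by (rule borel_measurable_diff)
  have bD: "\<bar>(1 / s) ^ (n - 1) * D \<eta> s\<bar> \<le> (CK + CB) * (inverse (1 + s))\<^sup>2" if "\<eta> \<noteq> 0" "0 < s" for \<eta> s
    using bK[OF that] bB[OF that] unfolding D_def right_diff_distrib distrib_right by linarith
  have mD: "mellin n (D \<eta>) = mellin n (X K \<eta>) - mellin n (X B \<eta>)" if "\<eta> \<noteq> 0" for \<eta>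
  proof -
    have "integrable lborel (\<lambda>s. indicator {0<..} s * ((1 / s) ^ (n - 1) * X K \<eta> s))"
      "integrable lborel (\<lambda>s. indicator {0<..} s * ((1 / s) ^ (n - 1) * X B \<eta> s))"
      by (rule integrable_mellin[OF X1[OF K sm] bK[OF that]], assumption, rule integrable_mellin[OF X1[OF B(1,2)] bB[OF that]], assumption)
    then show ?thesis unfolding mellin_def D_def by (simp add: right_diff_distrib)
  qed
  define AD where "AD t = (\<integral>\<eta>. radial_weight (norm \<eta>) * (1 / norm \<eta> * D \<eta> (t / norm \<eta>)) \<partial>perp_lborel \<theta>)" for t
  have 1: "mellin n AD = (\<integral>\<eta>. radial_weight (norm \<eta>) * (1 / norm \<eta>) ^ (n - 1) * mellin n (D \<eta>) \<partial>perp_lborel \<theta>)"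
    unfolding AD_def
    by (rule mellin_average[OF P.sigma_finite_measure_axioms n(3) rw Dm pos W, of "CK + CB"])
      (rule eventually_mono[OF nz], use bD in blast)
  define f where "f = ball_difference \<theta> K"
  define p where "p x = norm (perp_proj \<theta> x)" for x
  define c where "c = sqrt pi ^ (n - 2)"
  have [measurable]: "p \<in> borel_measurable borel" unfolding p_def by measurable
  have [measurable]: "K \<in> sets borel" using star_body_borel[OF K] .
  have [measurable]: "f \<in> borel_measurable borel" unfolding f_def ball_difference_def by measurable
  have fp: "integrable lborel (\<lambda>x. f x * (1 / p x) ^ (n - 1))"
    using ball_difference_integrable[OF K sm sym \<theta> dim] by (simp add: f_def p_def n_def)
  have p0: "AE x in lborel. 0 < p x"
    using AE_perp_proj_nonzero[OF \<theta> dim2] by eventually_elim (simp add: p_def)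
  define Q where "Q t = (\<integral>x. f x * (1 / p x * body_remainder n (t / p x)) \<partial>lborel)" for t
  obtain CQ where CQ: "\<And>s. 0 < s \<Longrightarrow> \<bar>(1 / s) ^ (n - 1) * body_remainder n s\<bar> \<le> CQ * (inverse (1 + s))\<^sup>2"
    using body_remainder_mellin_bound[OF n(2,1)] by blast
  have "mellin n Q = (\<integral>x. f x * (1 / p x) ^ (n - 1) * mellin n (body_remainder n) \<partial>lborel)"
    unfolding Q_def
    by (rule mellin_average[OF sigma_finite_lborel n(3) _ _ _ p0 fp, of "\<lambda>_. body_remainder n" CQ]) (use CQ in \<open>simp_all\<close>)
  then have mQ: "mellin n Q = 0" by (simp add: mellin_body_remainder[OF n(2,1)])
  have AE: "AE t in lborel. 0 < t \<longrightarrow> AD t = c * Q t"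
    using AE_section_remainder_ball[OF K sm sym \<theta> dim]
  proof eventually_elim
    case (elim t)
    show ?case
    proof
      assume t: "0 < t"
      have N: "n - 2 < DIM('a)" using dim by (simp add: n_def)
      have "AD t = (\<integral>\<eta>. radial_weight (norm \<eta>) * (1 / norm \<eta>) * section_remainder (n - 2) K (sgn \<eta>) (t / norm \<eta>) -
         radial_weight (norm \<eta>) * (1 / norm \<eta>) * section_remainder (n - 2) B (sgn \<eta>) (t / norm \<eta>) \<partial>perp_lborel \<theta>)"
        unfolding AD_def D_def X_def by (rule Bochner_Integration.integral_cong) (simp_all add: right_diff_distrib diff_divide_distrib)
      also have "\<dots> = (\<integral>\<eta>. radial_weight (norm \<eta>) * (1 / norm \<eta>) * section_remainder (n - 2) K (sgn \<eta>) (t / norm \<eta>) \<partial>perp_lborel \<theta>) -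
         (\<integral>\<eta>. radial_weight (norm \<eta>) * (1 / norm \<eta>) * section_remainder (n - 2) B (sgn \<eta>) (t / norm \<eta>) \<partial>perp_lborel \<theta>)"
        by (rule Bochner_Integration.integral_diff[OF integrable_section_remainder[OF \<theta> dim K sm N] integrable_section_remainder[OF \<theta> dim B(1,2) N]])
      also have "\<dots> = c * Q t"
        unfolding section_average_remainder[OF \<theta> dim K sm N, symmetric] section_average_remainder[OF \<theta> dim B(1,2) N, symmetric]
        using elim t unfolding n_def B_def Q_def f_def p_def c_def by blast
      finally show "AD t = c * Q t" .
    qed
  qed
  have "mellin n AD = c * mellin n Q"
  proof -
    have ADm: "AD \<in> borel_measurable borel"
    proof -
      have "(\<lambda>z. D (snd z) (fst z / norm (snd z))) \<in> borel_measurable (lborel \<Otimes>\<^sub>M perp_lborel \<theta>)"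
        by (rule measurable_compose[of "\<lambda>z. (snd z, fst z / norm (snd z))" _ "perp_lborel \<theta> \<Otimes>\<^sub>M borel" "\<lambda>z. D (fst z) (snd z)", simplified, OF _ Dm]) measurable
      note [measurable] = this
      have "(\<lambda>t. AD t) \<in> borel_measurable lborel"
        unfolding AD_def by (rule P.borel_measurable_lebesgue_integral) (simp only: case_prod_unfold, measurable)
      then show ?thesis by simp
    qed
    have Qm: "Q \<in> borel_measurable borel"
    proof -
      have "(\<lambda>t. Q t) \<in> borel_measurable lborel"
        unfolding Q_def by (rule sigma_finite_measure.borel_measurable_lebesgue_integral[OF sigma_finite_lborel]) (simp only: case_prod_unfold, measurable)
      then show ?thesis by simp
    qed
    note [measurable] = ADm Qm
    have "mellin n AD = (\<integral>t. c * (indicator {0<..} t * ((1 / t) ^ (n - 1) * Q t)) \<partial>lborel)"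
      unfolding mellin_def
    proof (rule integral_cong_AE)
      show "AE t in lborel. indicator {0<..} t * ((1 / t) ^ (n - 1) * AD t) = c * (indicator {0<..} t * ((1 / t) ^ (n - 1) * Q t))"
        using AE by eventually_elim (auto simp: indicator_def)
    qed measurable
    also have "\<dots> = c * mellin n Q" unfolding mellin_def by (rule integral_mult_right_zero)
    finally show ?thesis .
  qed
  then have "(\<integral>\<eta>. radial_weight (norm \<eta>) * (1 / norm \<eta>) ^ (n - 1) * mellin n (D \<eta>) \<partial>perp_lborel \<theta>) = 0"
    using 1 mQ by simp
  moreover have "(\<integral>\<eta>. radial_weight (norm \<eta>) * (1 / norm \<eta>) ^ (n - 1) * mellin n (D \<eta>) \<partial>perp_lborel \<theta>) =
    (\<integral>\<eta>. radial_weight (norm \<eta>) * (1 / norm \<eta>) ^ (n - 1) * mellin n (X K \<eta>) -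
      radial_weight (norm \<eta>) * (1 / norm \<eta>) ^ (n - 1) * mellin n (X B \<eta>) \<partial>perp_lborel \<theta>)"
  proof (rule integral_cong_AE)
    show "AE \<eta> in perp_lborel \<theta>. radial_weight (norm \<eta>) * (1 / norm \<eta>) ^ (n - 1) * mellin n (D \<eta>) =
      radial_weight (norm \<eta>) * (1 / norm \<eta>) ^ (n - 1) * mellin n (X K \<eta>) -
      radial_weight (norm \<eta>) * (1 / norm \<eta>) ^ (n - 1) * mellin n (X B \<eta>)"
      using nz by eventually_elim (simp add: mD right_diff_distrib)
    show "(\<lambda>\<eta>. radial_weight (norm \<eta>) * (1 / norm \<eta>) ^ (n - 1) * mellin n (D \<eta>)) \<in> borel_measurable (perp_lborel \<theta>)"
      by (rule borel_measurable_integrable, rule integrable_mellin_average[OF P.sigma_finite_measure_axioms n(3) rw Dm pos W, of "CK + CB"])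
        (rule eventually_mono[OF nz], use bD in blast)
  qed (use iK iB in measurable)
  ultimately show ?thesis
    unfolding Bochner_Integration.integral_diff[OF iK iB] by (simp add: X_def[abs_def] n_def)
qed

section \<open>From weighted integrals to the Radon transform\<close>

lemma radial_weight_mass:
  fixes \<theta> :: "'a::euclidean_space"
  assumes \<theta>: "norm \<theta> = 1" and dim: "3 \<le> DIM('a)"
  obtains z where "0 < z" "(\<integral>\<^sup>+y. ennreal (radial_weight (norm y) * (1 / norm y) ^ (DIM('a) - 1)) \<partial>perp_lborel \<theta>) = ennreal z"
    "(\<integral>y. radial_weight (norm y) * (1 / norm y) ^ (DIM('a) - 1) \<partial>perp_lborel \<theta>) = z"
proof -
  let ?v = "\<lambda>y::'a. radial_weight (norm y) * (1 / norm y) ^ (DIM('a) - 1)"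
  have dim2: "2 \<le> DIM('a)" using dim by simp
  have i: "integrable (perp_lborel \<theta>) ?v" by (rule integrable_radial_weight[OF \<theta> dim]) simp
  define z where "z = (\<integral>y. ?v y \<partial>perp_lborel \<theta>)"
  have v0: "0 \<le> ?v y" for y using radial_weight_bounds(1) by simp
  have e: "(\<integral>\<^sup>+y. ennreal (?v y) \<partial>perp_lborel \<theta>) = ennreal z"
    unfolding z_def by (rule nn_integral_eq_integral[OF i AE_I2[OF v0]])
  have "z \<noteq> 0"
  proof
    assume "z = 0"
    then have "AE y in perp_lborel \<theta>. ?v y = 0"
      using integral_nonneg_eq_0_iff_AE[OF i AE_I2[OF v0]] unfolding z_def by blast
    with AE_perp_lborel_nonzero[OF \<theta> dim2] have "AE y in perp_lborel \<theta>. False"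
    proof eventually_elim
      case (elim y)
      have "0 < ?v y" using elim(1) by (intro mult_pos_pos radial_weight_pos zero_less_power) auto
      then show ?case using elim(2) by (simp only: less_irrefl)
    qed
    then have "emeasure (perp_lborel \<theta>) UNIV = 0" by (simp add: AE_iff_measurable[OF _ refl])
    then have "emeasure (perp_lborel \<theta>) (cball 0 1) = 0"
      using emeasure_mono[of "cball 0 1" UNIV "perp_lborel \<theta>"] by simp
    then show False
      using emeasure_perp_lborel_cball[OF \<theta> _ dim2, of 1] unit_ball_vol_pos[of "real (DIM('a) - 1)"]
      by (simp del: unit_ball_vol_pos)
  qed
  moreover have "0 \<le> z" unfolding z_def by (rule integral_nonneg_AE[OF AE_I2[OF v0]])
  ultimately show ?thesis using that e z_def by simp
qed

text \<open>Here G is the same quantity for the ball, constant on the sphere by symmetry. Equality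
  of the weighted integrals is then enough to evaluate the Radon transform of F, because the radial
  weight of finite mass z drops out of the quotient.\<close>

lemma spherical_radon_eq_const:
  fixes \<theta> :: "'a::euclidean_space"
  assumes \<theta>: "norm \<theta> = 1" and dim: "3 \<le> DIM('a)"
    and F: "F \<in> borel_measurable (restrict_space borel (sphere 0 1))"
    and eq: "(\<integral>\<eta>. radial_weight (norm \<eta>) * (1 / norm \<eta>) ^ (DIM('a) - 1) * F (sgn \<eta>) \<partial>perp_lborel \<theta>) =
      (\<integral>\<eta>. radial_weight (norm \<eta>) * (1 / norm \<eta>) ^ (DIM('a) - 1) * G (sgn \<eta>) \<partial>perp_lborel \<theta>)"
    and G: "\<And>\<xi>. norm \<xi> = 1 \<Longrightarrow> G \<xi> = \<kappa>"
  shows "spherical_radon F \<theta> = subsphere_mass TYPE('a) * \<kappa>"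
proof -
  have dim2: "2 \<le> DIM('a)" using dim by simp
  obtain z where z: "0 < z" "(\<integral>\<^sup>+y. ennreal (radial_weight (norm y) * (1 / norm y) ^ (DIM('a) - 1)) \<partial>perp_lborel \<theta>) = ennreal z"
    "(\<integral>y. radial_weight (norm y) * (1 / norm y) ^ (DIM('a) - 1) \<partial>perp_lborel \<theta>) = z"
    using radial_weight_mass[OF \<theta> dim] by blast
  \<comment> \<open>The absolute value keeps v nonnegative at negative arguments too; on norms it
    changes nothing.\<close>
  define v where "v r = radial_weight r * (1 / \<bar>r\<bar>) ^ (DIM('a) - 1)" for r
  have v: "v \<in> borel_measurable borel" "\<And>r. 0 \<le> v r" unfolding v_def using radial_weight_bounds(1) by auto
  have vn: "v (norm y) = radial_weight (norm y) * (1 / norm y) ^ (DIM('a) - 1)" for y :: 'a by (simp add: v_def)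
  have ae: "AE \<eta> in perp_lborel \<theta>. radial_weight (norm \<eta>) * (1 / norm \<eta>) ^ (DIM('a) - 1) * G (sgn \<eta>) = radial_weight (norm \<eta>) * (1 / norm \<eta>) ^ (DIM('a) - 1) * \<kappa>"
    using AE_perp_lborel_nonzero[OF \<theta> dim2] by eventually_elim (simp add: G norm_sgn)
  have "spherical_radon F \<theta> = subsphere_mass TYPE('a) / z * (\<integral>y. v (norm y) * F (sgn y) \<partial>perp_lborel \<theta>)"
    by (rule spherical_radon_eq_weighted[OF \<theta> dim2 v _ z(1) F]) (simp only: vn z(2))
  also have "(\<integral>y. v (norm y) * F (sgn y) \<partial>perp_lborel \<theta>) = (\<integral>\<eta>. radial_weight (norm \<eta>) * (1 / norm \<eta>) ^ (DIM('a) - 1) * G (sgn \<eta>) \<partial>perp_lborel \<theta>)"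
    using eq by (simp add: vn)
  also have "\<dots> = (\<integral>\<eta>. radial_weight (norm \<eta>) * (1 / norm \<eta>) ^ (DIM('a) - 1) * \<kappa> \<partial>perp_lborel \<theta>)"
  proof (rule integral_cong_AE[OF _ _ ae])
    \<comment> \<open>G is controlled on the sphere only. At eta = 0, where \<open>sgn\<close>
      leaves the sphere, \<open>radial_weight 0 = 0\<close> removes its value.\<close>
    have "(\<lambda>\<eta>. if \<eta> = 0 then 0 else radial_weight (norm \<eta>) * (1 / norm \<eta>) ^ (DIM('a) - 1) * \<kappa>) \<in> borel_measurable borel" by measurable
    moreover have "(\<lambda>\<eta>. radial_weight (norm \<eta>) * (1 / norm \<eta>) ^ (DIM('a) - 1) * G (sgn \<eta>)) = (\<lambda>\<eta>. if \<eta> = 0 then 0 else radial_weight (norm \<eta>) * (1 / norm \<eta>) ^ (DIM('a) - 1) * \<kappa>)"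
      by (auto simp: fun_eq_iff G norm_sgn radial_weight_def)
    ultimately show "(\<lambda>\<eta>. radial_weight (norm \<eta>) * (1 / norm \<eta>) ^ (DIM('a) - 1) * G (sgn \<eta>)) \<in> borel_measurable (perp_lborel \<theta>)" by simp
  qed measurable
  also have "\<dots> = z * \<kappa>" unfolding z(3)[symmetric] by (rule integral_mult_left_zero)
  finally show ?thesis using z(1) by simp
qed

section \<open>The ball\<close>

lemma section_volume_cball:
  fixes \<xi> :: "'a::euclidean_space"
  assumes \<xi>: "norm \<xi> = 1" and a: "0 < a" and dim: "2 \<le> DIM('a)"
  shows "section_volume (cball 0 a) \<xi> t =
    (if \<bar>t\<bar> \<le> a then unit_ball_vol (real (DIM('a) - 1)) * sqrt (a\<^sup>2 - t\<^sup>2) ^ (DIM('a) - 1) else 0)"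
proof -
  have B: "cball (0::'a) a \<in> sets borel" by simp
  have mem: "t *\<^sub>R \<xi> + y \<in> cball 0 a \<longleftrightarrow> (norm y)\<^sup>2 \<le> a\<^sup>2 - t\<^sup>2" if "y \<in> perp \<xi>" for y
  proof -
    have "t *\<^sub>R \<xi> + y \<in> cball 0 a \<longleftrightarrow> (norm (t *\<^sub>R \<xi> + y))\<^sup>2 \<le> a\<^sup>2"
      using a by (simp add: abs_le_square_iff[symmetric])
    also have "\<dots> \<longleftrightarrow> (norm y)\<^sup>2 \<le> a\<^sup>2 - t\<^sup>2" unfolding norm_add_perp[OF \<xi> that] by linarith
    finally show ?thesis .
  qed
  show ?thesis
  proof (cases "\<bar>t\<bar> \<le> a")
    case True
    then have ts: "t\<^sup>2 \<le> a\<^sup>2" using a by (simp add: abs_le_square_iff[symmetric])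
    have "emeasure (perp_lborel \<xi>) {y. t *\<^sub>R \<xi> + y \<in> cball 0 a} = emeasure (perp_lborel \<xi>) (cball 0 (sqrt (a\<^sup>2 - t\<^sup>2)))"
    proof (rule emeasure_eq_AE)
      show "AE y in perp_lborel \<xi>. (y \<in> {y. t *\<^sub>R \<xi> + y \<in> cball 0 a}) = (y \<in> cball 0 (sqrt (a\<^sup>2 - t\<^sup>2)))"
        using AE_perp_lborel[OF \<xi>]
      proof eventually_elim
        case (elim y)
        have "norm y \<le> sqrt (a\<^sup>2 - t\<^sup>2) \<longleftrightarrow> (norm y)\<^sup>2 \<le> a\<^sup>2 - t\<^sup>2"
          using ts by (metis diff_ge_0_iff_ge norm_ge_zero real_le_rsqrt real_sqrt_ge_zero real_sqrt_le_iff real_sqrt_pow2 power_mono)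
        then show ?case using mem[OF elim] by simp
      qed
    qed measurable
    also have "\<dots> = ennreal (unit_ball_vol (real (DIM('a) - 1)) * sqrt (a\<^sup>2 - t\<^sup>2) ^ (DIM('a) - 1))"
      using ts by (intro emeasure_perp_lborel_cball[OF \<xi> _ dim]) simp
    finally show ?thesis using True ts by (simp add: section_volume_eq[OF \<xi> B] measure_def)
  next
    case False
    then have "a\<^sup>2 < t\<^sup>2" using a by (metis abs_le_square_iff abs_of_pos not_le)
    have "emeasure (perp_lborel \<xi>) {y. t *\<^sub>R \<xi> + y \<in> cball 0 a} = emeasure (perp_lborel \<xi>) {}"
    proof (rule emeasure_eq_AE)
      show "AE y in perp_lborel \<xi>. (y \<in> {y. t *\<^sub>R \<xi> + y \<in> cball 0 a}) = (y \<in> {})"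
        using AE_perp_lborel[OF \<xi>]
      proof eventually_elim
        case (elim y)
        have "\<not> (norm y)\<^sup>2 \<le> a\<^sup>2 - t\<^sup>2" using \<open>a\<^sup>2 < t\<^sup>2\<close> zero_le_power2[of "norm y"] by linarith
        then show ?case using mem[OF elim] by simp
      qed
    qed measurable
    then show ?thesis using False by (simp add: section_volume_eq[OF \<xi> B] measure_def)
  qed
qed

text \<open>The tail of the binomial series is dominated by its majorant at 1/2, whose absolute
  convergence follows from convergence at 3/4. For even dimension the exponent is a half-integer and
  the series is infinite.\<close>

lemma binomial_series_remainder:
  fixes \<alpha> :: real
  shows "\<exists>C\<ge>0. \<forall>x. 0 \<le> x \<longrightarrow> x \<le> 1 / 2 \<longrightarrow> \<bar>(1 - x) powr \<alpha> - (\<Sum>j<J. (\<alpha> gchoose j) * (- x) ^ j)\<bar> \<le> C * x ^ J"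
proof -
  let ?c = "\<lambda>j. \<alpha> gchoose j"
  have "summable (\<lambda>j. ?c j * (3 / 4) ^ j)" using gen_binomial_real[of "3 / 4" \<alpha>] sums_summable by force
  then have "summable (\<lambda>j. norm (?c j * (1 / 2) ^ j))" by (rule powser_insidea) simp
  then have s: "summable (\<lambda>j. norm (?c (j + J) * (1 / 2) ^ (j + J)))" by (rule summable_ignore_initial_segment)
  have "norm (?c (j + J) * (1 / 2) ^ (j + J)) * 2 ^ J = \<bar>?c (j + J)\<bar> * (1 / 2) ^ j" for j
    by (simp add: abs_mult power_add power_one_over)
  then have s': "summable (\<lambda>j. \<bar>?c (j + J)\<bar> * (1 / 2) ^ j)" using summable_mult2[OF s, of "2 ^ J"] by simp
  define C where "C = (\<Sum>j. \<bar>?c (j + J)\<bar> * (1 / 2) ^ j)"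
  have "\<bar>(1 - x) powr \<alpha> - (\<Sum>j<J. ?c j * (- x) ^ j)\<bar> \<le> C * x ^ J" if x: "0 \<le> x" "x \<le> 1 / 2" for x
  proof -
    have sm: "(\<lambda>j. ?c j * (- x) ^ j) sums (1 - x) powr \<alpha>" using gen_binomial_real[of "- x" \<alpha>] x by simp
    have "(1 - x) powr \<alpha> - (\<Sum>j<J. ?c j * (- x) ^ j) = (\<Sum>j. ?c (j + J) * (- x) ^ (j + J))"
      using suminf_minus_initial_segment[OF sums_summable[OF sm], of J] sums_unique[OF sm] by simp
    also have "norm \<dots> \<le> (\<Sum>j. \<bar>?c (j + J)\<bar> * (1 / 2) ^ j * x ^ J)"
    proof (rule norm_suminf_le)
      show "norm (?c (j + J) * (- x) ^ (j + J)) \<le> \<bar>?c (j + J)\<bar> * (1 / 2) ^ j * x ^ J" for j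
      proof -
        have "x ^ j \<le> (1 / 2) ^ j" using x by (intro power_mono) auto
        then have "\<bar>?c (j + J)\<bar> * (x ^ j * x ^ J) \<le> \<bar>?c (j + J)\<bar> * ((1 / 2) ^ j * x ^ J)"
          using x by (intro mult_left_mono mult_right_mono) auto
        then show ?thesis using x by (simp add: abs_mult power_abs power_add mult.assoc)
      qed
      show "summable (\<lambda>j. \<bar>?c (j + J)\<bar> * (1 / 2) ^ j * x ^ J)" by (rule summable_mult2[OF s'])
    qed
    also have "\<dots> = C * x ^ J" unfolding C_def by (rule suminf_mult2[OF s', symmetric])
    finally show ?thesis by simp
  qed
  moreover have "0 \<le> C" unfolding C_def by (rule suminf_nonneg[OF s']) simp
  ultimately show ?thesis by blast
qed

text \<open>Nothing is differentiated: the volume is a constant times (1 - (t/a)^2)^(m/2), its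
  binomial expansion is a Taylor expansion at 0, and uniqueness identifies the coefficients.\<close>

lemma section_deriv0_cball:
  fixes \<xi> :: "'a::euclidean_space"
  assumes \<xi>: "norm \<xi> = 1" and a: "0 < a" and dim: "2 \<le> DIM('a)" and k: "k < DIM('a) - 1" "even k"
  shows "section_deriv0 (cball 0 a) \<xi> k / fact k =
    unit_ball_vol (real (DIM('a) - 1)) * a ^ (DIM('a) - 1) * ((real (DIM('a) - 1) / 2) gchoose (k div 2)) * (- 1) ^ (k div 2) / a ^ k"
proof -
  define m where "m = DIM('a) - 1"
  \<comment> \<open>The number of even k below m. In particular 2J is at least m, so the binomial
    error is O(t^m).\<close>
  define J where "J = Suc m div 2"
  define \<alpha> where "\<alpha> = real m / 2"
  define vol where "vol = unit_ball_vol (real m)"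
  have m: "1 \<le> m" using dim by (simp add: m_def)
  have vol: "0 \<le> vol" by (simp add: vol_def)
  obtain C1 where C1: "0 \<le> C1" "\<And>t. \<bar>section_volume (cball 0 a) \<xi> t - (\<Sum>k<m. section_deriv0 (cball 0 a) \<xi> k / fact k * t ^ k)\<bar> \<le> C1 * \<bar>t\<bar> ^ m"
    using section_volume_taylor(1)[OF star_body_cball(2,3)[OF a] dim, of m] \<xi> by blast
  obtain C2 where C2: "0 \<le> C2" "\<And>x. 0 \<le> x \<Longrightarrow> x \<le> 1 / 2 \<Longrightarrow> \<bar>(1 - x) powr \<alpha> - (\<Sum>j<J. (\<alpha> gchoose j) * (- x) ^ j)\<bar> \<le> C2 * x ^ J"
    using binomial_series_remainder[of \<alpha> J] by blast
  define g where "g k = (if even k then vol * a ^ m * (\<alpha> gchoose (k div 2)) * (- 1) ^ (k div 2) / a ^ k else 0)" for k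
  define d where "d k = section_deriv0 (cball 0 a) \<xi> k / fact k - g k" for k
  \<comment> \<open>All terms stay below a/2, so (t/a)^2 remains in the range of the binomial
    bound.\<close>
  define s where "s i = a / 2 * (1 / real (Suc i))" for i
  have s0: "0 < s i" for i using a by (simp add: s_def)
  have sl: "s \<longlonglongrightarrow> 0" unfolding s_def by (rule tendsto_mult_right_zero) (rule LIMSEQ_Suc[OF lim_1_over_n])
  have sa: "s i \<le> a / 2" for i
  proof -
    have "a / 2 * (1 / real (Suc i)) \<le> a / 2 * 1" using a by (intro mult_left_mono) auto
    then show ?thesis by (simp add: s_def)
  qed
  have gs: "(\<Sum>k<m. g k * t ^ k) = vol * a ^ m * (\<Sum>j<J. (\<alpha> gchoose j) * (- ((t / a)\<^sup>2)) ^ j)" for t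
  proof -
    have "(\<Sum>k<m. g k * t ^ k) = (\<Sum>k\<in>{k. k < m \<and> even k}. g k * t ^ k)"
      by (rule sum.mono_neutral_right) (auto simp: g_def)
    also have "\<dots> = (\<Sum>j<J. g (2 * j) * t ^ (2 * j))"
      by (rule sum.reindex_bij_witness[where i = "\<lambda>j. 2 * j" and j = "\<lambda>k. k div 2"]) (use m in \<open>auto simp: J_def\<close>)
    also have "\<dots> = (\<Sum>j<J. vol * a ^ m * ((\<alpha> gchoose j) * (- ((t / a)\<^sup>2)) ^ j))"
    proof (rule sum.cong)
      fix j
      have "(- ((t / a)\<^sup>2)) ^ j = (- 1) ^ j * (t ^ (2 * j) / a ^ (2 * j))"
        by (subst power_minus) (simp add: power_divide power_mult)
      then show "g (2 * j) * t ^ (2 * j) = vol * a ^ m * ((\<alpha> gchoose j) * (- ((t / a)\<^sup>2)) ^ j)" by (simp add: g_def)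
    qed simp
    finally show ?thesis by (simp add: sum_distrib_left)
  qed
  have main: "\<bar>section_volume (cball 0 a) \<xi> t - (\<Sum>k<m. g k * t ^ k)\<bar> \<le> vol * a ^ m * C2 * (1 / a) ^ m * t ^ m" if t: "0 < t" "t \<le> a / 2" for t
  proof -
    define x where "x = (t / a)\<^sup>2"
    have ta: "0 < t / a" "t / a \<le> 1 / 2" using t a by (auto simp: field_simps)
    have x: "0 \<le> x" "x \<le> 1 / 2"
    proof -
      have "x \<le> (1 / 2)\<^sup>2" unfolding x_def using ta by (intro power_mono) auto
      also have "\<dots> \<le> (1 / 2 :: real)" by (simp add: power2_eq_square)
      finally show "x \<le> 1 / 2" .
      show "0 \<le> x" by (simp add: x_def)
    qed
    have "sqrt (a\<^sup>2 - t\<^sup>2) = a * sqrt (1 - x)"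
    proof -
      have "a\<^sup>2 - t\<^sup>2 = a\<^sup>2 * (1 - x)" using a by (simp add: x_def power_divide right_diff_distrib)
      then show ?thesis using a by (simp add: real_sqrt_mult)
    qed
    moreover have "sqrt (1 - x) ^ m = (1 - x) powr \<alpha>"
      using x by (simp add: \<alpha>_def powr_half_sqrt[symmetric] powr_power)
    ultimately have "section_volume (cball 0 a) \<xi> t = vol * a ^ m * (1 - x) powr \<alpha>"
      using section_volume_cball[OF \<xi> a dim, of t] t a by (simp add: vol_def m_def power_mult_distrib)
    then have "\<bar>section_volume (cball 0 a) \<xi> t - (\<Sum>k<m. g k * t ^ k)\<bar> = vol * a ^ m * \<bar>(1 - x) powr \<alpha> - (\<Sum>j<J. (\<alpha> gchoose j) * (- x) ^ j)\<bar>"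
      using vol a by (simp add: gs x_def[symmetric] right_diff_distrib[symmetric] abs_mult)
    also have "\<dots> \<le> vol * a ^ m * (C2 * x ^ J)" using C2(2)[OF x] vol a by (intro mult_left_mono) auto
    also have "\<dots> \<le> vol * a ^ m * (C2 * (t / a) ^ m)"
    proof -
      have "x ^ J = (t / a) ^ (2 * J)" by (simp add: x_def power_mult)
      also have "\<dots> \<le> (t / a) ^ m" 
      proof (rule power_decreasing)
        show "t / a \<le> 1" using ta(2) by linarith
      qed (use ta(1) in \<open>auto simp: J_def\<close>)
      finally show ?thesis using vol a C2(1) by (intro mult_left_mono) auto
    qed
    also have "(t / a) ^ m = (1 / a) ^ m * t ^ m" by (simp add: power_divide)
    finally show ?thesis by (simp only: mult_ac)
  qed
  have "d k = 0"
  proof (rule polynomial_coeffs_zero[OF s0 sl])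
    show "k < m" using k by (simp add: m_def)
    show "\<bar>\<Sum>k<m. d k * s i ^ k\<bar> \<le> (C1 + vol * a ^ m * C2 * (1 / a) ^ m) * s i ^ m" for i
    proof -
      have "(\<Sum>k<m. d k * s i ^ k) = (\<Sum>k<m. section_deriv0 (cball 0 a) \<xi> k / fact k * s i ^ k) - (\<Sum>k<m. g k * s i ^ k)"
        by (simp add: d_def left_diff_distrib sum_subtractf)
      moreover have "\<bar>section_volume (cball 0 a) \<xi> (s i) - (\<Sum>k<m. section_deriv0 (cball 0 a) \<xi> k / fact k * s i ^ k)\<bar> \<le> C1 * s i ^ m"
        using C1(2)[of "s i"] s0[of i] by simp
      ultimately show ?thesis using main[OF s0 sa, of i] unfolding distrib_right by linarith
    qed
  qed
  then show ?thesis using k by (simp add: d_def g_def vol_def \<alpha>_def m_def)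
qed

lemma Gamma_half_plus_nat: "Gamma (real M + 1 / 2) = fact (2 * M) * sqrt pi / (4 ^ M * fact M)"
proof (induction M)
  case (Suc M)
  have h: "real M + 1 / 2 \<notin> \<int>\<^sub>\<le>\<^sub>0" by (auto dest: nonpos_Ints_nonpos)
  have "real (Suc M) + 1 / 2 = real M + 1 / 2 + 1" by simp
  then have "Gamma (real (Suc M) + 1 / 2) = (real M + 1 / 2) * Gamma (real M + 1 / 2)"
    by (simp only: Gamma_plus1[OF h])
  also have "\<dots> = (4 * (real M + 1) * ((real M + 1 / 2) * fact (2 * M) * sqrt pi)) / (4 * (real M + 1) * (4 ^ M * fact M))"
    unfolding Suc.IH by (subst mult_divide_mult_cancel_left) auto
  also have "4 * (real M + 1) * ((real M + 1 / 2) * fact (2 * M) * sqrt pi) = fact (2 * Suc M) * sqrt pi"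
    by (simp add: algebra_simps)
  also have "4 * (real M + 1) * (4 ^ M * fact M) = 4 ^ Suc M * fact (Suc M)" by (simp add: algebra_simps)
  finally show ?case .
qed (simp add: Gamma_one_half_real)

text \<open>With x = (n - 1)/2 = M + 1/2, the value Gamma(x + 1) in the ball volume cancels the one
  in the generalised binomial coefficient. The remaining Gamma(x) is explicit at a
  half-integer.\<close>

lemma even_constant:
  assumes "n = 2 * M + 2"
  shows "2 * pi powr ((real n - 1) / 2) / Gamma ((real n - 1) / 2) *
    (fact (2 * M) * unit_ball_vol (real (n - 1)) * ((real (n - 1) / 2) gchoose M)) = 2 ^ n * pi ^ (n - 2)"
proof -
  define x where "x = real M + 1 / 2"
  have n: "(real n - 1) / 2 = x" "real (n - 1) / 2 = x" "real (n - 1) / 2 + 1 = x + 1" using assms by (auto simp: x_def field_simps)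
  have p: "x + 1 \<notin> \<int>\<^sub>\<le>\<^sub>0" "x \<notin> \<int>\<^sub>\<le>\<^sub>0" by (auto dest!: nonpos_Ints_nonpos simp: x_def)
  have x0: "0 < x" by (simp add: x_def add_nonneg_pos)
  have G0: "0 < Gamma x" "0 < Gamma (x + 1)" using x0 by (auto intro: Gamma_real_pos)
  have e: "x - real M + 1 = 1 / 2 + 1" by (simp add: x_def)
  have h: "(1 / 2 :: real) \<notin> \<int>\<^sub>\<le>\<^sub>0" by (auto dest: nonpos_Ints_nonpos)
  have G32: "Gamma (1 / 2 + 1 :: real) = sqrt pi / 2" using Gamma_plus1[OF h] Gamma_one_half_real by simp
  have gc: "x gchoose M = Gamma (x + 1) / (fact M * (sqrt pi / 2))"
    unfolding gbinomial_Gamma[OF p(1), of M] e G32 ..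
  have ub: "unit_ball_vol (real (n - 1)) = pi powr x / Gamma (x + 1)" unfolding unit_ball_vol_def n(2) ..
  have pp: "pi powr x * pi powr x = pi ^ (2 * M) * pi"
  proof -
    have "pi powr x * pi powr x = pi powr real (2 * M + 1)" by (simp add: x_def add.commute flip: powr_add)
    also have "\<dots> = pi ^ (2 * M + 1)" by (rule powr_realpow) simp
    finally show ?thesis by simp
  qed
  have "2 * pi powr x / Gamma x * (fact (2 * M) * (pi powr x / Gamma (x + 1)) * (Gamma (x + 1) / (fact M * (sqrt pi / 2)))) =
    4 * (pi powr x * pi powr x) * fact (2 * M) / (Gamma x * fact M * sqrt pi)"
    using G0 by (simp add: field_simps)
  also have "\<dots> = 4 * (pi ^ (2 * M) * pi) * fact (2 * M) / (fact (2 * M) * sqrt pi / (4 ^ M * fact M) * fact M * sqrt pi)"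
    by (simp only: pp Gamma_half_plus_nat[of M, folded x_def])
  also have "\<dots> = 4 * 4 ^ M * pi ^ (2 * M) * (pi / (sqrt pi * sqrt pi))" by simp
  also have "\<dots> = 2 ^ n * pi ^ (n - 2)" by (simp add: assms power_add power_mult)
  finally show ?thesis unfolding n(1,2) ub gc .
qed

text \<open>Integration by parts gives \<open>(2 N - 1) I\<^sub>N = 2 N I\<^sub>N\<^sub>-\<^sub>1\<close> for
  \<open>I\<^sub>N = 1 + \<integral> (1 - (1 - t\<^sup>-\<^sup>2)\<^sup>N) dt\<close> over \<open>t \<ge> 1\<close>.\<close>

lemma ball_moment_antiderivative:
  "\<exists>G. (\<forall>t>0. (G has_real_derivative 1 - (1 - 1 / t\<^sup>2) ^ N) (at t)) \<and> (G \<longlongrightarrow> 0) at_top \<and>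
    1 - G 1 = 4 ^ N * (fact N)\<^sup>2 / fact (2 * N)"
proof (induction N)
  case 0
  show ?case by (rule exI[of _ "\<lambda>_. 0"]) simp
next
  case (Suc N)
  then obtain G where G: "\<And>t. 0 < t \<Longrightarrow> (G has_real_derivative 1 - (1 - 1 / t\<^sup>2) ^ N) (at t)"
    "(G \<longlongrightarrow> 0) at_top" "1 - G 1 = 4 ^ N * (fact N)\<^sup>2 / fact (2 * N)" by blast
  define u where "u t = 1 - (1 - 1 / t\<^sup>2) ^ Suc N" for t :: real
  define c where "c = real (2 * N + 1)"
  have c: "0 < c" by (simp add: c_def)
  \<comment> \<open>The antiderivative for exponent N + 1 produced by integration by parts, where c
    = 2(N + 1) - 1; the boundary function t u(t) equals 1 at t = 1.\<close>
  define H where "H t = ((c + 1) * G t - t * u t) / c" for t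
  have du: "((\<lambda>t. t * u t) has_real_derivative u t - (c + 1) * (u t - (1 - (1 - 1 / t\<^sup>2) ^ N))) (at t)" if t: "0 < t" for t
  proof -
    define w where "w = 1 - 1 / t\<^sup>2"
    have "((\<lambda>t. 1 - 1 / t\<^sup>2) has_real_derivative 2 / t ^ 3) (at t)"
      using t by (auto intro!: derivative_eq_intros simp: field_simps power2_eq_square power3_eq_cube)
    then have "((\<lambda>t. (1 - 1 / t\<^sup>2) ^ Suc N) has_real_derivative real (Suc N) * (2 / t ^ 3 * w ^ (Suc N - Suc 0))) (at t)"
      unfolding w_def by (rule DERIV_power)
    then have "(u has_real_derivative 0 - real (Suc N) * (2 / t ^ 3 * w ^ N)) (at t)"
      unfolding u_def[abs_def] by (intro DERIV_diff DERIV_const) simp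
    from DERIV_mult[OF DERIV_ident this]
    have "((\<lambda>t. t * u t) has_real_derivative 1 * u t + - (real (Suc N) * (2 / t ^ 3 * w ^ N)) * t) (at t)" by simp
    moreover have "- (real (Suc N) * (2 / t ^ 3 * w ^ N)) * t = - ((c + 1) * (1 / t\<^sup>2 * w ^ N))"
      using t by (simp add: c_def power3_eq_cube power2_eq_square field_simps)
    moreover have "1 / t\<^sup>2 * w ^ N = u t - (1 - w ^ N)"
      by (simp add: u_def w_def[symmetric]) (simp add: w_def algebra_simps)
    ultimately have "((\<lambda>t. t * u t) has_real_derivative 1 * u t + - ((c + 1) * (u t - (1 - w ^ N)))) (at t)"
      by (simp only:)
    then show ?thesis by (simp only: w_def mult_1 add_uminus_conv_diff)
  qed
  have dH: "(H has_real_derivative u t) (at t)" if t: "0 < t" for t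
  proof -
    have "(H has_real_derivative ((c + 1) * (1 - (1 - 1 / t\<^sup>2) ^ N) - (u t - (c + 1) * (u t - (1 - (1 - 1 / t\<^sup>2) ^ N)))) / c) (at t)"
      unfolding H_def by (intro DERIV_cdivide DERIV_diff DERIV_cmult G(1) du t)
    moreover have "((c + 1) * (1 - (1 - 1 / t\<^sup>2) ^ N) - (u t - (c + 1) * (u t - (1 - (1 - 1 / t\<^sup>2) ^ N)))) / c = u t"
      using c by (simp add: field_simps)
    ultimately show ?thesis by simp
  qed
  \<comment> \<open>The boundary term at infinity: Bernoulli's inequality bounds u by (N +
    1)/t^2.\<close>
  have "((\<lambda>t. t * u t) \<longlongrightarrow> 0) at_top"
  proof (rule Lim_null_comparison)
    show "\<forall>\<^sub>F t in at_top. norm (t * u t) \<le> real (Suc N) * inverse t"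
      using eventually_ge_at_top[of 1]
    proof eventually_elim
      case (elim t)
      have i: "0 \<le> 1 / t\<^sup>2" "1 / t\<^sup>2 \<le> 1" using elim by (auto simp: one_le_power)
      have "1 + real (Suc N) * (- (1 / t\<^sup>2)) \<le> (1 + - (1 / t\<^sup>2)) ^ Suc N" using i by (intro Bernoulli_inequality) simp
      then have "u t \<le> real (Suc N) * (1 / t\<^sup>2)" by (simp add: u_def)
      moreover have "0 \<le> u t" unfolding u_def using i power_le_one[of "1 - 1 / t\<^sup>2" "Suc N"] by simp
      then have "\<bar>t * u t\<bar> = t * u t" using elim by simp
      ultimately have "\<bar>t * u t\<bar> \<le> t * (real (Suc N) * (1 / t\<^sup>2))" using elim by (simp only: mult_left_mono)
      also have "\<dots> = real (Suc N) * inverse t" using elim by (simp add: power2_eq_square field_simps)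
      finally show ?case by simp
    qed
    show "((\<lambda>t. real (Suc N) * inverse t) \<longlongrightarrow> 0) at_top"
      by (intro tendsto_mult_right_zero tendsto_inverse_0_at_top filterlim_ident)
  qed
  then have "(H \<longlongrightarrow> ((c + 1) * 0 - 0) / c) at_top" unfolding H_def using c by (intro tendsto_intros G(2)) auto
  then have lH: "(H \<longlongrightarrow> 0) at_top" by simp
  have "H 1 = ((c + 1) * G 1 - 1) / c" by (simp add: H_def u_def)
  then have "1 - H 1 = (c + 1) / c * (1 - G 1)" using c by (simp add: field_simps)
  also have "\<dots> = 4 ^ Suc N * (fact (Suc N))\<^sup>2 / fact (2 * Suc N)"
  proof -
    have 1: "(fact (2 * Suc N) :: real) = (c + 1) * (c * fact (2 * N))" by (simp add: c_def algebra_simps)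
    have 2: "4 ^ Suc N * (fact (Suc N))\<^sup>2 = (c + 1) * ((c + 1) * (4 ^ N * (fact N)\<^sup>2))"
      by (simp add: c_def power2_eq_square algebra_simps)
    show ?thesis unfolding G(3) 1 2 using c by (subst mult_divide_mult_cancel_left) auto
  qed
  finally have "1 - H 1 = 4 ^ Suc N * (fact (Suc N))\<^sup>2 / fact (2 * Suc N)" .
  then show ?case using dH lH unfolding u_def by blast
qed

lemma ball_moment:
  fixes N :: nat
  defines "u \<equiv> \<lambda>t::real. indicator {1..} t * (1 - (1 - 1 / t\<^sup>2) ^ N) :: real"
  shows "integrable lborel u" and "1 + (\<integral>t. u t \<partial>lborel) = 4 ^ N * (fact N)\<^sup>2 / fact (2 * N)"
proof -
  obtain G where G: "\<And>t. 0 < t \<Longrightarrow> (G has_real_derivative 1 - (1 - 1 / t\<^sup>2) ^ N) (at t)"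
    "(G \<longlongrightarrow> 0) at_top" "1 - G 1 = 4 ^ N * (fact N)\<^sup>2 / fact (2 * N)"
    using ball_moment_antiderivative[of N] by blast
  have nn: "0 \<le> 1 - (1 - 1 / t\<^sup>2) ^ N" if "1 \<le> t" for t :: real
    using power_le_one[of "1 - 1 / t\<^sup>2" N] that by (simp add: one_le_power)
  have nn': "0 \<le> indicator {1..} t * (1 - (1 - 1 / t\<^sup>2) ^ N)" for t :: real
    using nn[of t] by (simp add: indicator_def)
  have e: "(\<integral>\<^sup>+t. ennreal (1 - (1 - 1 / t\<^sup>2) ^ N) * indicator {1..} t \<partial>lborel) = ennreal (0 - G 1)"
    by (rule nn_integral_FTC_atLeast) (use G nn in auto)
  have "(\<integral>\<^sup>+t. ennreal (indicator {1..} t * (1 - (1 - 1 / t\<^sup>2) ^ N)) \<partial>lborel) = ennreal (0 - G 1)"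
    unfolding e[symmetric] by (intro nn_integral_cong) (auto simp: indicator_def)
  moreover have "G 1 \<le> 0"
  proof (rule tendsto_lowerbound[OF G(2)])
    show "\<forall>\<^sub>F t in at_top. G 1 \<le> G t"
      using eventually_ge_at_top[of 1]
    proof eventually_elim
      case (elim t)
      show ?case by (rule DERIV_nonneg_imp_nondecreasing[OF elim]) (use G(1) nn in \<open>meson less_le_trans zero_less_one\<close>)
    qed
  qed simp
  ultimately have "has_bochner_integral lborel (\<lambda>t. indicator {1..} t * (1 - (1 - 1 / t\<^sup>2) ^ N)) (0 - G 1)"
    by (intro has_bochner_integral_nn_integral) (auto simp: nn')
  then show "integrable lborel u" "1 + (\<integral>t. u t \<partial>lborel) = 4 ^ N * (fact N)\<^sup>2 / fact (2 * N)"
    using G(3) unfolding u_def by (auto simp: has_bochner_integral_iff)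
qed

text \<open>After t = a s the Taylor polynomial is (1 - s^2)^N without its top term. For s < 1 the
  remainder is therefore the top term itself and contributes 1 after division by (-1)^N s^(2N). For
  s > 1 the section is empty and minus the polynomial remains, which gives 1 - (1 - s^(-2))^N, the
  integrand of \<open>ball_moment\<close>.\<close>

lemma mellin_section_remainder_cball:
  fixes \<xi> :: "'a::euclidean_space"
  assumes \<xi>: "norm \<xi> = 1" and a: "0 < a" and N: "DIM('a) = 2 * N + 1" "1 \<le> N"
  shows "mellin DIM('a) (section_remainder (DIM('a) - 2) (cball 0 a) \<xi>) =
    unit_ball_vol (real (2 * N)) * (- 1) ^ N * (4 ^ N * (fact N)\<^sup>2 / fact (2 * N)) * a"
proof -
  have dim: "2 \<le> DIM('a)" using N by simp
  define vol where "vol = unit_ball_vol (real (2 * N))"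
  have m: "DIM('a) - 1 = 2 * N" using N by simp
  have taylor: "(\<Sum>k<DIM('a) - 2. section_deriv0 (cball 0 a) \<xi> k / fact k * (a * s) ^ k) = vol * a ^ (2 * N) * ((1 - s\<^sup>2) ^ N - (- (s\<^sup>2)) ^ N)" for s
  proof -
    have "(\<Sum>k<DIM('a) - 2. section_deriv0 (cball 0 a) \<xi> k / fact k * (a * s) ^ k) = (\<Sum>k\<in>{k. k < DIM('a) - 2 \<and> even k}. section_deriv0 (cball 0 a) \<xi> k / fact k * (a * s) ^ k)"
    proof (rule sum.mono_neutral_right)
      show "\<forall>k\<in>{..<DIM('a) - 2} - {k. k < DIM('a) - 2 \<and> even k}. section_deriv0 (cball 0 a) \<xi> k / fact k * (a * s) ^ k = 0"
        using section_deriv0_odd[OF star_body_cball(2,3)[OF a] origin_symmetric_cball \<xi> dim] by auto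
    qed auto
    also have "\<dots> = (\<Sum>j<N. section_deriv0 (cball 0 a) \<xi> (2 * j) / fact (2 * j) * (a * s) ^ (2 * j))"
      by (rule sum.reindex_bij_witness[where i = "\<lambda>j. 2 * j" and j = "\<lambda>k. k div 2"]) (use N in auto)
    also have "\<dots> = (\<Sum>j<N. vol * a ^ (2 * N) * (real (N choose j) * (- (s\<^sup>2)) ^ j))"
    proof (rule sum.cong)
      fix j assume "j \<in> {..<N}"
      then have j: "2 * j < DIM('a) - 1" "even (2 * j)" using N by auto
      have "real (2 * N) / 2 = real N" by simp
      then have "section_deriv0 (cball 0 a) \<xi> (2 * j) / fact (2 * j) = vol * a ^ (2 * N) * real (N choose j) * (- 1) ^ j / a ^ (2 * j)"
        unfolding section_deriv0_cball[OF \<xi> a dim j] m vol_def by (simp add: binomial_gbinomial)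
      moreover have "(- (s\<^sup>2)) ^ j = (- 1) ^ j * s ^ (2 * j)" by (subst power_minus) (simp add: power_mult)
      ultimately show "section_deriv0 (cball 0 a) \<xi> (2 * j) / fact (2 * j) * (a * s) ^ (2 * j) = vol * a ^ (2 * N) * (real (N choose j) * (- (s\<^sup>2)) ^ j)"
        using a by (simp add: power_mult_distrib)
    qed simp
    also have "\<dots> = vol * a ^ (2 * N) * (\<Sum>j<N. real (N choose j) * (- (s\<^sup>2)) ^ j)" by (simp add: sum_distrib_left)
    also have "(\<Sum>j<N. real (N choose j) * (- (s\<^sup>2)) ^ j) = (1 - s\<^sup>2) ^ N - (- (s\<^sup>2)) ^ N"
      using binomial_ring[of "- (s\<^sup>2)" 1 N] by (simp add: lessThan_Suc_atMost[symmetric])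
    finally show ?thesis .
  qed
  define F where "F t = indicator {0<..} t * ((1 / t) ^ (2 * N) * section_remainder (DIM('a) - 2) (cball 0 a) \<xi> t)" for t
  have Fs: "F (0 + a * s) = vol * (- 1) ^ N * (indicator {0<..<1} s + indicator {1..} s * (1 - (1 - 1 / s\<^sup>2) ^ N))" for s
  proof (cases "0 < s")
    case False
    then show ?thesis using a by (simp add: F_def indicator_def zero_less_mult_iff)
  next
    case True
    have sN: "(- (s\<^sup>2)) ^ N = (- 1) ^ N * s ^ (2 * N)" by (subst power_minus) (simp add: power_mult)
    have inv: "(1 / (a * s)) ^ (2 * N) * (vol * a ^ (2 * N) * y) = vol * (y / s ^ (2 * N))" for y
      using a True by (simp add: power_divide power_mult_distrib)
    have vol_eq: "section_volume (cball 0 a) \<xi> (a * s) = vol * a ^ (2 * N) * (if s \<le> 1 then (1 - s\<^sup>2) ^ N else 0)"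
    proof -
      have "sqrt (a\<^sup>2 - (a * s)\<^sup>2) ^ (2 * N) = a ^ (2 * N) * (1 - s\<^sup>2) ^ N" if "s \<le> 1"
      proof -
        have "a\<^sup>2 - (a * s)\<^sup>2 = a\<^sup>2 * (1 - s\<^sup>2)" by (simp add: power_mult_distrib right_diff_distrib)
        moreover have "0 \<le> 1 - s\<^sup>2" using that True by (simp add: power_le_one)
        ultimately show ?thesis using a by (simp add: power_mult power_mult_distrib)
      qed
      then show ?thesis using section_volume_cball[OF \<xi> a dim, of "a * s", unfolded m] a True by (simp add: vol_def abs_mult)
    qed
    have rem: "section_remainder (DIM('a) - 2) (cball 0 a) \<xi> (a * s) = vol * a ^ (2 * N) * ((if s \<le> 1 then (1 - s\<^sup>2) ^ N else 0) - (1 - s\<^sup>2) ^ N + (- (s\<^sup>2)) ^ N)"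
      unfolding section_remainder_def vol_eq taylor by (simp only: right_diff_distrib distrib_left)
    have F: "F (0 + a * s) = vol * (((if s \<le> 1 then (1 - s\<^sup>2) ^ N else 0) - (1 - s\<^sup>2) ^ N + (- (s\<^sup>2)) ^ N) / s ^ (2 * N))"
      unfolding F_def add_0 rem inv using a True by simp
    consider "s < 1" | "s = 1" | "1 < s" by linarith
    then show ?thesis
    proof cases
      case 1 then show ?thesis unfolding F sN using True by (simp add: indicator_def)
    next
      \<comment> \<open>At s = 1 both regimes agree because 0^N = 0 for N \<ge> 1.\<close>
      case 2 then show ?thesis unfolding F sN using N(2) by (simp add: indicator_def power_0_left)
    next
      case 3
      have "1 - s\<^sup>2 = - (s\<^sup>2) * (1 - 1 / s\<^sup>2)" using True by (simp add: right_diff_distrib)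
      then have "(1 - s\<^sup>2) ^ N = (- 1) ^ N * s ^ (2 * N) * (1 - 1 / s\<^sup>2) ^ N" by (simp only: power_mult_distrib sN)
      then show ?thesis unfolding F sN using 3 True by (simp add: indicator_def diff_divide_distrib right_diff_distrib)
    qed
  qed
  have "mellin DIM('a) (section_remainder (DIM('a) - 2) (cball 0 a) \<xi>) = (\<integral>t. F t \<partial>lborel)"
    unfolding mellin_def F_def m by simp
  also have "\<dots> = \<bar>a\<bar> *\<^sub>R (\<integral>s. F (0 + a * s) \<partial>lborel)" using a by (intro lborel_integral_real_affine) simp
  also have "(\<integral>s. F (0 + a * s) \<partial>lborel) = vol * (- 1) ^ N * (\<integral>s. indicator {0<..<1} s + indicator {1..} s * (1 - (1 - 1 / s\<^sup>2) ^ N) \<partial>lborel)"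
    unfolding Fs by (rule integral_mult_right_zero)
  also have "(\<integral>s. indicator {0<..<1} s + indicator {1..} s * (1 - (1 - 1 / (s::real)\<^sup>2) ^ N) \<partial>lborel) =
    (\<integral>s. indicator {0<..<1::real} s \<partial>lborel) + (\<integral>s. indicator {1..} s * (1 - (1 - 1 / s\<^sup>2) ^ N) \<partial>lborel)"
  proof (rule Bochner_Integration.integral_add)
    show "integrable lborel (\<lambda>s::real. indicator {0<..<1} s :: real)" by (rule integrable_real_indicator) simp_all
  qed (rule ball_moment(1))
  also have "\<dots> = 4 ^ N * (fact N)\<^sup>2 / fact (2 * N)" unfolding ball_moment(2)[symmetric] by simp
  finally show ?thesis using a by (simp add: vol_def)
qed

text \<open>With n - 1 = 2N the sphere contributes 2 pi^N/(N-1)! and the ball pi^N/N!; the rest is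
  (2N)! = 2N (n-2)!.\<close>

lemma odd_constant:
  assumes n: "n = 2 * N + 1" "1 \<le> N"
  shows "2 * pi powr ((real n - 1) / 2) / Gamma ((real n - 1) / 2) *
    (unit_ball_vol (real (2 * N)) * (4 ^ N * (fact N)\<^sup>2 / fact (2 * N))) = (2 * pi) ^ (n - 1) / fact (n - 2)"
proof -
  obtain L where L: "N = Suc L" using n(2) by (cases N) auto
  have "(real n - 1) / 2 = real N" using n by simp
  moreover have "pi powr real N = pi ^ N" by (rule powr_realpow) simp
  moreover have "Gamma (real N) = fact L" using Gamma_fact[of L, where 'a = real] by (simp add: L add.commute)
  ultimately have "2 * pi powr ((real n - 1) / 2) / Gamma ((real n - 1) / 2) * (unit_ball_vol (real (2 * N)) * (4 ^ N * (fact N)\<^sup>2 / fact (2 * N))) =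
    2 * pi ^ N / fact L * (pi ^ N / fact N * (4 ^ N * (fact N)\<^sup>2 / fact (2 * N)))"
    by (simp only: unit_ball_vol_even)
  also have "\<dots> = 2 * real N * (4 ^ N * (pi ^ N * pi ^ N)) / fact (2 * N)"
  proof -
    have cl: "2 * P / A * (P / B * (Q * B\<^sup>2 / R)) = 2 * (B / A) * (Q * (P * P)) / R" if "B \<noteq> 0" for A B P Q R :: real
      using that unfolding power2_eq_square by simp
    have q: "(fact N :: real) / fact L = real N" unfolding L by simp
    show ?thesis unfolding q[symmetric] by (rule cl) simp
  qed
  also have "\<dots> = (2 * pi) ^ (n - 1) / fact (n - 2)"
  proof -
    have 1: "4 ^ N * (pi ^ N * pi ^ N) = (2 * pi) ^ (n - 1)"
      using n(1) by (simp add: power_mult_distrib power_mult power2_eq_square)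
    have 2: "(fact (2 * N) :: real) = 2 * real N * fact (n - 2)" using n by (simp add: L)
    show ?thesis unfolding 1 2 using n(2) by simp
  qed
  finally show ?thesis .
qed

section \<open>The two inversion formulas\<close>

theorem spherical_radon_section_deriv0:
  fixes K :: "'a::euclidean_space set"
  assumes K: "star_body K" and sm: "smooth_on_submanifold (radial_function K) (sphere 0 1)"
    and sym: "origin_symmetric K" and \<theta>: "norm \<theta> = 1" and n: "DIM('a) = n" "3 \<le> n" "even n"
  shows "spherical_radon (\<lambda>\<xi>. section_deriv0 K \<xi> (n - 2)) \<theta> = (- 1) ^ ((n - 2) div 2) * 2 ^ n * pi ^ (n - 2) * radial_function K \<theta>"
proof -
  define a where "a = radial_function K \<theta>"
  have a: "0 < a" using K \<theta> by (simp add: a_def star_body_def)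
  define M where "M = (n - 2) div 2"
  have M: "n = 2 * M + 2" "n - 2 = 2 * M" using n by (auto simp: M_def)
  have dim: "3 \<le> DIM('a)" "2 \<le> DIM('a)" "even DIM('a)" using n by auto
  define b where "b = unit_ball_vol (real (n - 1)) * ((real (n - 1) / 2) gchoose M)"
  have \<kappa>: "section_deriv0 (cball 0 a) \<xi> (n - 2) = (- 1) ^ M * (fact (2 * M) * b) * a" if \<xi>: "norm \<xi> = 1" for \<xi> :: 'a
  proof -
    have k: "2 * M < DIM('a) - 1" "even (2 * M)" using n M by auto
    have 1: "a ^ (n - 1) / a ^ (2 * M) = a" using a by (simp add: M(1))
    have 2: "2 * M div 2 = M" by simp
    have "section_deriv0 (cball 0 a) \<xi> (2 * M) / fact (2 * M) = b * (- 1) ^ M * (a ^ (n - 1) / a ^ (2 * M))"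
      unfolding section_deriv0_cball[OF \<xi> a dim(2) k] n(1) b_def 2 times_divide_eq_right by (simp only: mult_ac)
    then have "section_deriv0 (cball 0 a) \<xi> (2 * M) / fact (2 * M) = b * (- 1) ^ M * a" unfolding 1 .
    then show ?thesis unfolding M(2) by (simp add: field_simps)
  qed
  have Suc: "Suc (n - 2) = n - 1" using n by simp
  have "spherical_radon (\<lambda>\<xi>. section_deriv0 K \<xi> (n - 2)) \<theta> = subsphere_mass TYPE('a) * ((- 1) ^ M * (fact (2 * M) * b) * a)"
  proof (rule spherical_radon_eq_const[OF \<theta> dim(1), where G = "\<lambda>\<xi>. section_deriv0 (cball 0 a) \<xi> (n - 2)"])
    show "(\<lambda>\<xi>. section_deriv0 K \<xi> (n - 2)) \<in> borel_measurable (restrict_space borel (sphere 0 1))"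
      by (rule measurable_section_deriv0[OF K sm dim(2)])
    \<comment> \<open>This is the equality of the coefficients of order n - 2, freed from their
      common factor 1/(n-2)!.\<close>
    show "(\<integral>\<eta>. radial_weight (norm \<eta>) * (1 / norm \<eta>) ^ (DIM('a) - 1) * section_deriv0 K (sgn \<eta>) (n - 2) \<partial>perp_lborel \<theta>) =
      (\<integral>\<eta>. radial_weight (norm \<eta>) * (1 / norm \<eta>) ^ (DIM('a) - 1) * section_deriv0 (cball 0 a) (sgn \<eta>) (n - 2) \<partial>perp_lborel \<theta>)"
      using average_coeff_eq_ball[OF K sm sym \<theta> dim(1,3)] unfolding average_coeff_top n(1) Suc a_def by simp
  qed (rule \<kappa>)
  also have "\<dots> = (- 1) ^ M * (2 ^ n * pi ^ (n - 2)) * a"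
    using even_constant[OF M(1)] by (simp add: subsphere_mass_def n(1) b_def mult_ac)
  finally show ?thesis by (simp add: a_def M_def mult.assoc)
qed

text \<open>F is prescribed only at unit vectors, because the regularised integral is identified
  with \<open>mellin\<close> only for unit normals. Its value at 0 is multiplied by
  \<open>radial_weight 0 = 0\<close>.\<close>

theorem spherical_radon_mellin:
  fixes K :: "'a::euclidean_space set"
  assumes K: "star_body K" and sm: "smooth_on_submanifold (radial_function K) (sphere 0 1)"
    and sym: "origin_symmetric K" and \<theta>: "norm \<theta> = 1" and n: "DIM('a) = n" "3 \<le> n" "odd n"
    and F: "\<And>\<xi>. norm \<xi> = 1 \<Longrightarrow> F \<xi> = mellin n (section_remainder (n - 2) K \<xi>)"
  shows "spherical_radon F \<theta> = (- 1) ^ ((n - 1) div 2) * (2 * pi) ^ (n - 1) / fact (n - 2) * radial_function K \<theta>"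
proof -
  define a where "a = radial_function K \<theta>"
  have a: "0 < a" using K \<theta> by (simp add: a_def star_body_def)
  define N where "N = (n - 1) div 2"
  have N: "n = 2 * N + 1" "1 \<le> N"
  proof -
    obtain j where "n = 2 * j + 1" using n(3) by (rule oddE)
    then show "n = 2 * N + 1" "1 \<le> N" using n(2) by (auto simp: N_def)
  qed
  have dim: "3 \<le> DIM('a)" "2 \<le> DIM('a)" "odd DIM('a)" using n by auto
  define b where "b = unit_ball_vol (real (2 * N)) * (4 ^ N * (fact N)\<^sup>2 / fact (2 * N))"
  have \<kappa>: "mellin n (section_remainder (n - 2) (cball 0 a) \<xi>) = (- 1) ^ N * b * a" if \<xi>: "norm \<xi> = 1" for \<xi> :: 'a
    using mellin_section_remainder_cball[OF \<xi> a _ N(2)] N(1) n(1) by (simp add: b_def mult_ac)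
  have "spherical_radon F \<theta> = subsphere_mass TYPE('a) * ((- 1) ^ N * b * a)"
  proof (rule spherical_radon_eq_const[OF \<theta> dim(1), where G = "\<lambda>\<xi>. mellin n (section_remainder (n - 2) (cball 0 a) \<xi>)"])
    have "(\<lambda>\<xi>. mellin n (section_remainder (n - 2) K (sgn \<xi>))) \<in> borel_measurable (restrict_space borel (sphere 0 1))"
      by (rule measurable_restrict_space1[OF measurable_mellin_section_remainder[OF K sm dim(2)]])
    then show "F \<in> borel_measurable (restrict_space borel (sphere 0 1))"
      by (rule measurable_cong[THEN iffD1, rotated]) (auto simp: space_restrict_space F sgn_div_norm)
    have "(\<lambda>\<eta>. radial_weight (norm \<eta>) * (1 / norm \<eta>) ^ (DIM('a) - 1) * F (sgn \<eta>)) =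
      (\<lambda>\<eta>. radial_weight (norm \<eta>) * (1 / norm \<eta>) ^ (DIM('a) - 1) * mellin n (section_remainder (n - 2) K (sgn \<eta>)))"
    proof
      fix \<eta> :: 'a
      show "radial_weight (norm \<eta>) * (1 / norm \<eta>) ^ (DIM('a) - 1) * F (sgn \<eta>) =
        radial_weight (norm \<eta>) * (1 / norm \<eta>) ^ (DIM('a) - 1) * mellin n (section_remainder (n - 2) K (sgn \<eta>))"
      proof (cases "\<eta> = 0")
        case True then show ?thesis by (simp add: radial_weight_def)
      next
        case False then show ?thesis by (subst F) (simp_all add: norm_sgn)
      qed
    qed
    then show "(\<integral>\<eta>. radial_weight (norm \<eta>) * (1 / norm \<eta>) ^ (DIM('a) - 1) * F (sgn \<eta>) \<partial>perp_lborel \<theta>) =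
      (\<integral>\<eta>. radial_weight (norm \<eta>) * (1 / norm \<eta>) ^ (DIM('a) - 1) * mellin n (section_remainder (n - 2) (cball 0 a) (sgn \<eta>)) \<partial>perp_lborel \<theta>)"
      using mellin_average_eq_ball[OF K sm sym \<theta> dim(1,3)] by (simp only: n(1) a_def)
  qed (rule \<kappa>)
  also have "\<dots> = (- 1) ^ N * ((2 * pi) ^ (n - 1) / fact (n - 2)) * a"
  proof -
    have "subsphere_mass TYPE('a) * b = (2 * pi) ^ (n - 1) / fact (n - 2)"
      unfolding subsphere_mass_def n(1) b_def by (rule odd_constant[OF N])
    then show ?thesis by (metis mult.assoc mult.left_commute)
  qed
  finally show ?thesis by (simp add: a_def N_def)
qed

text \<open>By symmetry of K the derivatives of odd order vanish, so the sum over all k < n - 2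
  reduces to the even orders up to n - 3 in the theorem.\<close>

lemma regularised_integral_eq_mellin:
  fixes K :: "'a::euclidean_space set"
  assumes K: "star_body K" and sm: "smooth_on_submanifold (radial_function K) (sphere 0 1)"
    and sym: "origin_symmetric K" and \<xi>: "norm \<xi> = 1" and dim: "2 \<le> DIM('a)" and n: "3 \<le> n" "odd n"
  shows "(LINT t:{0<..}|lborel. t powi (1 - int n) * (section_volume K \<xi> t -
      (\<Sum>k=0..(n - 3) div 2. section_deriv0 K \<xi> (2 * k) * (t ^ (2 * k) / fact (2 * k))))) =
    mellin n (section_remainder (n - 2) K \<xi>)"
proof -
  have s: "(\<Sum>k<n - 2. section_deriv0 K \<xi> k / fact k * t ^ k) = (\<Sum>k=0..(n - 3) div 2. section_deriv0 K \<xi> (2 * k) * (t ^ (2 * k) / fact (2 * k)))" for t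
  proof -
    obtain j where j: "n = 2 * j + 1" using n(2) by (rule oddE)
    have "(\<Sum>k<n - 2. section_deriv0 K \<xi> k / fact k * t ^ k) = (\<Sum>k\<in>{k. k < n - 2 \<and> even k}. section_deriv0 K \<xi> k / fact k * t ^ k)"
    proof (rule sum.mono_neutral_right)
      show "\<forall>k\<in>{..<n - 2} - {k. k < n - 2 \<and> even k}. section_deriv0 K \<xi> k / fact k * t ^ k = 0"
        using section_deriv0_odd[OF K sm sym \<xi> dim] by auto
    qed auto
    also have "\<dots> = (\<Sum>k=0..(n - 3) div 2. section_deriv0 K \<xi> (2 * k) * (t ^ (2 * k) / fact (2 * k)))"
      by (rule sum.reindex_bij_witness[where i = "\<lambda>j. 2 * j" and j = "\<lambda>k. k div 2"]) (use n j in auto)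
    finally show ?thesis .
  qed
  have p: "t powi (1 - int n) = (1 / t) ^ (n - 1)" if "0 < t" for t :: real
  proof -
    have "1 - int n = - int (n - 1)" using n by simp
    then show ?thesis using that by (simp only: power_int_minus power_int_of_nat) (simp add: power_one_over inverse_eq_divide)
  qed
  show ?thesis
    unfolding set_lebesgue_integral_def mellin_def section_remainder_def s
    by (rule Bochner_Integration.integral_cong) (auto simp: p indicator_def)
qed

theorem mainTheorem1:
  fixes K :: "(real ^ 'n) set" and n :: nat
  assumes "n = CARD('n)" and "n \<ge> 3"
    and "star_body K" and "origin_symmetric K"
    and "smooth_on_submanifold (radial_function K) (sphere 0 1)"
  shows "(even n \<longrightarrow>
      (\<forall>\<theta>\<in>sphere 0 1.
        (-1) ^ ((n - 2) div 2) * 2 ^ n * pi ^ (n - 2) * radial_function K \<theta> =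
        spherical_radon (\<lambda>\<xi>. (deriv ^^ (n - 2)) (section_volume K \<xi>) 0) \<theta>)) \<and>
    (odd n \<longrightarrow>
      (\<forall>\<theta>\<in>sphere 0 1.
        (-1) ^ ((n - 1) div 2) * (2 * pi) ^ (n - 1) / fact (n - 2) * radial_function K \<theta> =
        spherical_radon
          (\<lambda>\<xi>. LINT t:{0<..}|lborel.
             t powi (1 - int n) *
             (section_volume K \<xi> t -
              (\<Sum>k=0..(n - 3) div 2.
                 (deriv ^^ (2 * k)) (section_volume K \<xi>) 0 * (t ^ (2 * k) / fact (2 * k))))) \<theta>))"
proof (intro conjI impI ballI)
  have dim: "DIM(real ^ 'n) = n" "2 \<le> DIM(real ^ 'n)" using assms(1,2) by auto
  fix \<theta> :: "real ^ 'n" assume "\<theta> \<in> sphere 0 1"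
  then have \<theta>: "norm \<theta> = 1" by simp
  show "(-1) ^ ((n - 2) div 2) * 2 ^ n * pi ^ (n - 2) * radial_function K \<theta> =
    spherical_radon (\<lambda>\<xi>. (deriv ^^ (n - 2)) (section_volume K \<xi>) 0) \<theta>" if "even n"
    by (rule spherical_radon_section_deriv0[OF assms(3,5,4) \<theta> dim(1) assms(2) that, symmetric])
  show "(-1) ^ ((n - 1) div 2) * (2 * pi) ^ (n - 1) / fact (n - 2) * radial_function K \<theta> =
    spherical_radon
      (\<lambda>\<xi>. LINT t:{0<..}|lborel.
         t powi (1 - int n) *
         (section_volume K \<xi> t -
          (\<Sum>k=0..(n - 3) div 2.
             (deriv ^^ (2 * k)) (section_volume K \<xi>) 0 * (t ^ (2 * k) / fact (2 * k))))) \<theta>" if "odd n"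
    by (rule spherical_radon_mellin[OF assms(3,5,4) \<theta> dim(1) assms(2) that, symmetric])
      (rule regularised_integral_eq_mellin[OF assms(3,5,4) _ dim(2) assms(2) that])
qed

end
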